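(* Let $f$ have rank $r$, and let $p=n^{-1+\kappa}$ for some $\kappa\in(0,\frac12)$ such that $1/\kappa$ is not an integer. Let $t=\lfloor \frac{\ln(1/p)}{\ln(np)}\rfloor$ and let $\hat F$ be the nearest neighbor estimate built from the distance estimates $$\hat d(u,v)=\tfrac{1}{p'}\,(\tilde N_{u,t}-\tilde N_{v,t})^T (M''+M'_{\mathrm{ind}})(\tilde N_{u,t+1}-\tilde N_{v,t+1}),\qquad (u,v)\in[n]^2,$$ with threshold $\eta=\Theta(n^{-\frac12(\kappa-\rho)})$, for any $\rho\in(0,\kappa)$. Let $C_f=|\lambda_1|/|\lambda_r|$. Then with probability $1-o(1)$, $$\max_{u,v\in[n]}|\hat F(u,v)-F(u,v)| = O\Big(r\,C_f^{1/\kappa}\,n^{-\frac14(\kappa-\rho)}\Big).$$ Furthermore, $$\mathrm{MSE}(\hat F)=O\Big(r^2\,C_f^{2/\kappa}\,n^{-\frac12(\kappa-\rho)}\Big).$$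
   Context: Asymptotics are as $n\to\infty$ with $f,\kappa,\rho$ fixed. Model. $\theta_1,\dots,\theta_n$ are i.i.d. uniform on $[0,1]$. $f:[0,1]^2\to[0,1]$ is a fixed (independent of $n$) symmetric Lipschitz function, and $F(u,v)=f(\theta_u,\theta_v)$ for $u,v\in[n]$. Given the latent variables, $\{Z(u,v)\}_{(u,v)\in[n]^2}$ are independent, $[0,1]$-valued, with $\mathbb E[Z(u,v)]=F(u,v)$. Each ordered pair $(u,v)\in[n]^2$ belongs to the observed set $\mathcal E$ independently with probability $p$ (independently of all else). $M(u,v)=Z(u,v)$ if $(u,v)\in\mathcal E$ and $M(u,v)=0$ otherwise. Rank. $f$ has rank $r$ if $f(x,y)=\sum_{k=1}^r\lambda_k q_k(x)q_k(y)$ for all $x,y\in[0,1]$, where $\lambda_k\in\mathbb R$, $|\lambda_1|\ge\dots\ge|\lambda_r|>0$, the $q_k$ are orthonormal in $L^2[0,1]$, and $\sup_{y\in[0,1]}|q_k(y)|\le B$ for all $k$, for some constant $B$. Sample splitting. Each element of $\mathcal E$ is placed independently in $\mathcal E'$ with probability $1/4$, in $\mathcal E''$ with probability $1/4$, and in $\mathcal E'''$ with probability $1/2$. Put $p'=\frac{p}{4-p}$. Conditioned on $\mathcal E'$, $\mathcal E'_{\mathrm{ind}}\subseteq\mathcal E'$ includes each element of $\mathcal E'$ independently with probability $p'$. $M',M'_{\mathrm{ind}},M'',M'''$ are the $n\times n$ matrices equal to $M$ on $\mathcal E',\mathcal E'_{\mathrm{ind}},\mathcal E'',\mathcal E'''$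 respectively and $0$ elsewhere. Neighborhood vectors. Consider the directed graph $([n],\mathcal E')$. $\mathcal S_{u,s}$ is the set of vertices $i$ whose shortest path from $u$ has length $s$. $\mathcal T_u$ is a breadth-first tree rooted at $u$, chosen uniformly at random among the valid ones. $N_{u,s}\in[0,1]^n$ is given by $N_{u,s}(i)=\prod_{(a,b)\in\mathrm{path}_{\mathcal T_u}(u,i)}M'(a,b)$ if $i\in\mathcal S_{u,s}$, and $0$ otherwise, where the product is over the edges of the tree path from $u$ to $i$. $\tilde N_{u,s}=N_{u,s}/|\mathcal S_{u,s}|$ (and $0$ if $\mathcal S_{u,s}=\emptyset$). Nearest neighbor estimate. Given $\hat d$ and threshold $\eta$, let $\mathcal E'''_{uv}=\{(a,b)\in\mathcal E''' : \hat d(u,a)<\eta,\ \hat d(v,b)<\eta\}$ and $\hat F(u,v)=\frac{1}{|\mathcal E'''_{uv}|}\sum_{(a,b)\in\mathcal E'''_{uv}}M'''(a,b)$ (with an arbitrary value in $[0,1]$ if $\mathcal E'''_{uv}=\emptyset$). $\mathrm{MSE}(\hat F)=\frac1{n^2}\mathbb E\big[\sum_{u,v}(\hat F(u,v)-F(u,v))^2\big]$, with expectation over all the randomness. *)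

theory Defs
  imports
    "HOL-Probability.Probability"
    "HOL-Library.Landau_Symbols"
begin

section \<open>Spectral decomposition of the latent function\<close>

text \<open>\<open>lam\<close> and \<open>q\<close> are indexed by \<open>{1..r}\<close>.  The eigenpairs are parameters rather than
  existentially quantified because the condition number \<open>\<bar>lam 1\<bar> / \<bar>lam r\<bar>\<close> occurs in the bounds.\<close>

definition rank_decomposition ::
  "(real \<Rightarrow> real \<Rightarrow> real) \<Rightarrow> nat \<Rightarrow> (nat \<Rightarrow> real) \<Rightarrow> (nat \<Rightarrow> real \<Rightarrow> real) \<Rightarrow> bool" where
  "rank_decomposition f r lam q \<longleftrightarrow>
     r \<ge> 1 \<and>
     (\<forall>x\<in>{0..1}. \<forall>y\<in>{0..1}. f x y = (\<Sum>k=1..r. lam k * q k x * q k y)) \<and>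
     (\<forall>j\<in>{1..r}. \<forall>k\<in>{1..r}. j \<le> k \<longrightarrow> \<bar>lam k\<bar> \<le> \<bar>lam j\<bar>) \<and>
     \<bar>lam r\<bar> > 0 \<and>
     (\<forall>k\<in>{1..r}. q k \<in> borel_measurable (lebesgue_on {0..1})) \<and>
     (\<forall>j\<in>{1..r}. \<forall>k\<in>{1..r}.
        integral\<^sup>L (lebesgue_on {0..1}) (\<lambda>x. q j x * q k x) = (if j = k then 1 else 0)) \<and>
     (\<exists>B. \<forall>k\<in>{1..r}. \<forall>y\<in>{0..1}. \<bar>q k y\<bar> \<le> B)"


section \<open>Observation and sample splitting\<close>

text \<open>The mark of an ordered pair records whether it is observed and in which part of the split it
  lies: \<open>Part1\<close> is \<open>\<E>'\<close>, \<open>Part2\<close> is \<open>\<E>''\<close>, \<open>Part3\<close> is \<open>\<E>'''\<close>.  The flag of \<open>Part1\<close> records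
  membership in the subsample \<open>\<E>'\<^sub>i\<^sub>n\<^sub>d\<close>.\<close>

datatype mark = Unobserved | Part1 bool | Part2 | Part3

definition subsample_prob :: "real \<Rightarrow> real" where
  "subsample_prob p = p / (4 - p)"

definition mark_pmf :: "real \<Rightarrow> mark pmf" where
  "mark_pmf p =
     bind_pmf (bernoulli_pmf p) (\<lambda>observed.
       if \<not> observed then return_pmf Unobserved
       else bind_pmf (pmf_of_list [(1::nat, 1/4), (2, 1/4), (3, 1/2)]) (\<lambda>part.
         if part = 1 then map_pmf Part1 (bernoulli_pmf (subsample_prob p))
         else return_pmf (if part = 2 then Part2 else Part3)))"

text \<open>In the sequel \<open>\<mu>\<close> is a realised mark assignment and \<open>z\<close> a realisation of \<open>Z\<close>;
  both matter only on \<open>{1..n} \<times> {1..n}\<close>.\<close>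

definition edges_obs :: "nat \<Rightarrow> (nat \<times> nat \<Rightarrow> mark) \<Rightarrow> (nat \<times> nat) set" where
  "edges_obs n \<mu> = {e \<in> {1..n} \<times> {1..n}. \<mu> e \<noteq> Unobserved}"

definition edges1 :: "nat \<Rightarrow> (nat \<times> nat \<Rightarrow> mark) \<Rightarrow> (nat \<times> nat) set" where
  "edges1 n \<mu> = {e \<in> {1..n} \<times> {1..n}. \<exists>b. \<mu> e = Part1 b}"

definition edges1_ind :: "nat \<Rightarrow> (nat \<times> nat \<Rightarrow> mark) \<Rightarrow> (nat \<times> nat) set" where
  "edges1_ind n \<mu> = {e \<in> {1..n} \<times> {1..n}. \<mu> e = Part1 True}"

definition edges2 :: "nat \<Rightarrow> (nat \<times> nat \<Rightarrow> mark) \<Rightarrow> (nat \<times> nat) set" where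
  "edges2 n \<mu> = {e \<in> {1..n} \<times> {1..n}. \<mu> e = Part2}"

definition edges3 :: "nat \<Rightarrow> (nat \<times> nat \<Rightarrow> mark) \<Rightarrow> (nat \<times> nat) set" where
  "edges3 n \<mu> = {e \<in> {1..n} \<times> {1..n}. \<mu> e = Part3}"

definition restrict_matrix ::
  "(nat \<times> nat) set \<Rightarrow> (nat \<Rightarrow> nat \<Rightarrow> real) \<Rightarrow> nat \<Rightarrow> nat \<Rightarrow> real" where
  "restrict_matrix E A = (\<lambda>a b. if (a, b) \<in> E then A a b else 0)"

definition data_matrix ::
  "nat \<Rightarrow> (nat \<times> nat \<Rightarrow> mark) \<Rightarrow> (nat \<times> nat \<Rightarrow> real) \<Rightarrow> nat \<Rightarrow> nat \<Rightarrow> real" where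
  "data_matrix n \<mu> z = restrict_matrix (edges_obs n \<mu>) (\<lambda>a b. z (a, b))"


section \<open>Breadth-first trees and neighborhood vectors\<close>

definition sphere_at :: "(nat \<times> nat) set \<Rightarrow> nat \<Rightarrow> nat \<Rightarrow> nat set" where
  "sphere_at E u s = {i. (u, i) \<in> E ^^ s \<and> (\<forall>m<s. (u, i) \<notin> E ^^ m)}"

definition walk_betw :: "(nat \<times> nat) set \<Rightarrow> nat \<Rightarrow> nat \<Rightarrow> nat list \<Rightarrow> bool" where
  "walk_betw E u i xs \<longleftrightarrow>
     xs \<noteq> [] \<and> hd xs = u \<and> last xs = i \<and> successively (\<lambda>a b. (a, b) \<in> E) xs"

text \<open>A breadth-first tree, given by its set of edges, is an arborescence rooted at \<open>u\<close> that spans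
  the vertices reachable from \<open>u\<close> and preserves the distances from \<open>u\<close>.\<close>

definition bfs_trees :: "(nat \<times> nat) set \<Rightarrow> nat \<Rightarrow> (nat \<times> nat) set set" where
  "bfs_trees E u = {T. T \<subseteq> E \<and> (\<forall>(a, b)\<in>T. (u, a) \<in> E\<^sup>*) \<and>
     (\<forall>i. (u, i) \<in> E\<^sup>* \<longrightarrow> (\<exists>!xs. walk_betw T u i xs)) \<and>
     (\<forall>s i. i \<in> sphere_at E u s \<longrightarrow> i \<in> sphere_at T u s)}"

definition tree_path :: "(nat \<times> nat) set \<Rightarrow> nat \<Rightarrow> nat \<Rightarrow> (nat \<times> nat) list" where
  "tree_path T u i = (let xs = (THE xs. walk_betw T u i xs) in zip xs (tl xs))"

definition nbr_vec ::
  "(nat \<times> nat) set \<Rightarrow> (nat \<Rightarrow> nat \<Rightarrow> real) \<Rightarrow> (nat \<times> nat) set \<Rightarrow> nat \<Rightarrow> nat \<Rightarrow> nat \<Rightarrow> real" where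
  "nbr_vec E A T u s i =
     (if i \<in> sphere_at E u s then \<Prod>(a, b)\<leftarrow>tree_path T u i. A a b else 0)"

text \<open>For an empty sphere this is \<open>0\<close>, since \<open>x / 0 = 0\<close>.\<close>

definition nbr_vec_normalized ::
  "(nat \<times> nat) set \<Rightarrow> (nat \<Rightarrow> nat \<Rightarrow> real) \<Rightarrow> (nat \<times> nat) set \<Rightarrow> nat \<Rightarrow> nat \<Rightarrow> nat \<Rightarrow> real" where
  "nbr_vec_normalized E A T u s i = nbr_vec E A T u s i / real (card (sphere_at E u s))"


section \<open>Distance estimate and nearest neighbor estimate\<close>

text \<open>\<open>T u\<close> is the realised breadth-first tree rooted at \<open>u\<close>.\<close>

definition dist_estimate ::
  "nat \<Rightarrow> real \<Rightarrow> nat \<Rightarrow> (nat \<times> nat \<Rightarrow> mark) \<Rightarrow> (nat \<times> nat \<Rightarrow> real) \<Rightarrow> (nat \<Rightarrow> (nat \<times> nat) set)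
     \<Rightarrow> nat \<Rightarrow> nat \<Rightarrow> real" where
  "dist_estimate n p t \<mu> z T u v =
     (let M = data_matrix n \<mu> z;
          M1 = restrict_matrix (edges1 n \<mu>) M;
          M1_ind = restrict_matrix (edges1_ind n \<mu>) M;
          M2 = restrict_matrix (edges2 n \<mu>) M;
          N = (\<lambda>w s. nbr_vec_normalized (edges1 n \<mu>) M1 (T w) w s)
      in 1 / subsample_prob p *
         (\<Sum>a=1..n. \<Sum>b=1..n.
            (N u t a - N v t a) * (M2 a b + M1_ind a b) * (N u (t + 1) b - N v (t + 1) b)))"

text \<open>\<open>c u v\<close> is the arbitrary value used when there are no nearby observed pairs.\<close>

definition nn_estimate ::
  "nat \<Rightarrow> (nat \<times> nat \<Rightarrow> mark) \<Rightarrow> (nat \<times> nat \<Rightarrow> real) \<Rightarrow> (nat \<Rightarrow> nat \<Rightarrow> real) \<Rightarrow> real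
     \<Rightarrow> (nat \<Rightarrow> nat \<Rightarrow> real) \<Rightarrow> nat \<Rightarrow> nat \<Rightarrow> real" where
  "nn_estimate n \<mu> z d \<eta> c u v =
     (let M3 = restrict_matrix (edges3 n \<mu>) (data_matrix n \<mu> z);
          near = {(a, b) \<in> edges3 n \<mu>. d u a < \<eta> \<and> d v b < \<eta>}
      in if near = {} then c u v else 1 / real (card near) * (\<Sum>(a, b)\<in>near. M3 a b))"


section \<open>The probabilistic model\<close>

definition cond_indep_vars ::
  "'w measure \<Rightarrow> 'w measure \<Rightarrow> 'i set \<Rightarrow> ('i \<Rightarrow> 'w \<Rightarrow> real) \<Rightarrow> bool" where
  "cond_indep_vars P G I X \<longleftrightarrow>
     (\<forall>A. (\<forall>i\<in>I. A i \<in> sets borel) \<longrightarrow>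
        (AE w in P. real_cond_exp P G (\<lambda>w. \<Prod>i\<in>I. indicator (A i) (X i w)) w =
                    (\<Prod>i\<in>I. real_cond_exp P G (\<lambda>w. indicator (A i) (X i w)) w)))"

text \<open>The vertex set is \<open>{1..n}\<close>.  \<open>latent_algebra\<close> is generated by the latent variables, and
  \<open>sample_algebra\<close> by all randomness other than the choice of the trees.\<close>

definition latent_algebra :: "'w measure \<Rightarrow> nat \<Rightarrow> (nat \<Rightarrow> 'w \<Rightarrow> real) \<Rightarrow> 'w measure" where
  "latent_algebra P n \<theta> =
     vimage_algebra (space P) (\<lambda>w. \<lambda>i\<in>{1..n}. \<theta> i w) (Pi\<^sub>M {1..n} (\<lambda>_. borel))"

definition sample_algebra ::
  "'w measure \<Rightarrow> nat \<Rightarrow> (nat \<Rightarrow> 'w \<Rightarrow> real) \<Rightarrow> (nat \<times> nat \<Rightarrow> 'w \<Rightarrow> real) \<Rightarrow> (nat \<times> nat \<Rightarrow> 'w \<Rightarrow> mark)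
     \<Rightarrow> 'w measure" where
  "sample_algebra P n \<theta> Z mrk =
     vimage_algebra (space P)
       (\<lambda>w. (\<lambda>i\<in>{1..n}. \<theta> i w, \<lambda>e\<in>{1..n}\<times>{1..n}. Z e w, \<lambda>e\<in>{1..n}\<times>{1..n}. mrk e w))
       (Pi\<^sub>M {1..n} (\<lambda>_. borel) \<Otimes>\<^sub>M Pi\<^sub>M ({1..n}\<times>{1..n}) (\<lambda>_. borel) \<Otimes>\<^sub>M
        Pi\<^sub>M ({1..n}\<times>{1..n}) (\<lambda>_. count_space UNIV))"

locale latent_model = prob_space P for P :: "'w measure" +
  fixes n :: nat
    and f :: "real \<Rightarrow> real \<Rightarrow> real"
    and p :: real
    and \<theta> :: "nat \<Rightarrow> 'w \<Rightarrow> real"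
    and Z :: "nat \<times> nat \<Rightarrow> 'w \<Rightarrow> real"
    and mrk :: "nat \<times> nat \<Rightarrow> 'w \<Rightarrow> mark"
    and T :: "nat \<Rightarrow> 'w \<Rightarrow> (nat \<times> nat) set"
  assumes theta_range: "i \<in> {1..n} \<Longrightarrow> w \<in> space P \<Longrightarrow> \<theta> i w \<in> {0..1}"
    and theta_indep: "indep_vars (\<lambda>_. borel) \<theta> {1..n}"
    and theta_uniform: "i \<in> {1..n} \<Longrightarrow> distr P borel (\<theta> i) = uniform_measure lborel {0..1}"
    and Z_measurable: "e \<in> {1..n} \<times> {1..n} \<Longrightarrow> Z e \<in> borel_measurable P"
    and Z_range: "e \<in> {1..n} \<times> {1..n} \<Longrightarrow> w \<in> space P \<Longrightarrow> Z e w \<in> {0..1}"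
    and Z_cond_indep: "cond_indep_vars P (latent_algebra P n \<theta>) ({1..n} \<times> {1..n}) Z"
    and Z_cond_mean: "u \<in> {1..n} \<Longrightarrow> v \<in> {1..n} \<Longrightarrow>
      AE w in P. real_cond_exp P (latent_algebra P n \<theta>) (Z (u, v)) w = f (\<theta> u w) (\<theta> v w)"
    and mark_indep: "indep_vars (\<lambda>_. count_space UNIV) mrk ({1..n} \<times> {1..n})"
    and mark_distr: "e \<in> {1..n} \<times> {1..n} \<Longrightarrow>
      distr P (count_space UNIV) (mrk e) = measure_pmf (mark_pmf p)"
    and mark_indep_data: "indep_set
      (sets (vimage_algebra (space P) (\<lambda>w. (\<lambda>i\<in>{1..n}. \<theta> i w, \<lambda>e\<in>{1..n}\<times>{1..n}. Z e w))
        (Pi\<^sub>M {1..n} (\<lambda>_. borel) \<Otimes>\<^sub>M Pi\<^sub>M ({1..n}\<times>{1..n}) (\<lambda>_. borel))))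
      (sets (vimage_algebra (space P) (\<lambda>w. \<lambda>e\<in>{1..n}\<times>{1..n}. mrk e w)
        (Pi\<^sub>M ({1..n}\<times>{1..n}) (\<lambda>_. count_space UNIV))))"
    and tree_measurable: "u \<in> {1..n} \<Longrightarrow> T u \<in> P \<rightarrow>\<^sub>M count_space (Pow ({1..n} \<times> {1..n}))"
    \<comment> \<open>given everything else, the trees are independent and uniform on the breadth-first trees\<close>
    and tree_cond_distr: "AE w in P.
      real_cond_exp P (sample_algebra P n \<theta> Z mrk)
        (indicator {w \<in> space P. \<forall>u\<in>{1..n}. T u w = \<tau> u}) w =
      (\<Prod>u=1..n. pmf (pmf_of_set (bfs_trees (edges1 n (\<lambda>e. mrk e w)) u)) (\<tau> u))"

definition mean_squared_error ::
  "'w measure \<Rightarrow> nat \<Rightarrow> (nat \<Rightarrow> nat \<Rightarrow> 'w \<Rightarrow> real) \<Rightarrow> (nat \<Rightarrow> nat \<Rightarrow> 'w \<Rightarrow> real) \<Rightarrow> real" where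
  "mean_squared_error P n Fhat F =
     1 / (real n)\<^sup>2 * (\<integral>w. (\<Sum>u=1..n. \<Sum>v=1..n. (Fhat u v w - F u v w)\<^sup>2) \<partial>P)"

end

theory Submission
  imports Defs "HOL-Real_Asymp.Real_Asymp"
begin

text \<open>Growing the breadth-first trees level by level, the normalized neighborhood vector of \<open>u\<close> at
  distance \<open>s\<close> has inner product close to \<open>\<lambda>\<^sub>k\<^sup>s q\<^sub>k(\<theta>\<^sub>u)\<close> with the \<open>k\<close>-th eigenfunction: one level multiplies by
  \<open>F\<close> up to a martingale error, controlled by an exponential moment bound given the earlier levels.
  The choice of \<open>t\<close> keeps level \<open>t\<close> sparse (\<open>\<kappa> (t + 1) \<le> 1\<close>) but makes levels \<open>t\<close> and \<open>t + 1\<close> together large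
  enough for the bilinear form in the fresh sample to concentrate (\<open>\<kappa> (2 t + 1) \<ge> 1\<close>). Hence the
  distance estimate is uniformly within \<open>\<eta> / 2\<close> of \<open>\<Sum>\<^sub>k \<lambda>\<^sub>k\<^sup>2\<^sup>t\<^sup>+\<^sup>2 (q\<^sub>k(\<theta>\<^sub>u) - q\<^sub>k(\<theta>\<^sub>v))\<^sup>2\<close>. Pairs that
  pass the threshold therefore have mean within \<open>O(\<surd>\<eta>)\<close> of \<open>F(u, v)\<close>, and there are enough of them for the
  averaged noise to be negligible. The exceptional event has probability \<open>O(n\<^sup>2 exp(-n\<^sup>\<rho>\<^sup>/\<^sup>4))\<close>, which
  gives both claims.\<close>

text \<open>The obstacle is dependence: the law of a tree involves the whole graph, products along a
  tree reuse entries of \<open>Z\<close>, and \<open>M'_ind\<close> returns to entries that the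
  vectors already contain. Three devices deal with it. The chord bound
  \<open>exp (y * Z) \<le> 1 + Z * (exp y - 1)\<close> on the unit interval makes an exponential
  moment affine in each fresh entry, so only conditional means of \<open>Z\<close> are used, and
  entries are replaced by means one at a time. A uniform breadth-first tree amounts to independent
  uniform parents; so the data are integrated with graph and trees fixed, and then the graph is
  explored with the data fixed. Finally p' = p/(4-p) solves p' (1 - p/4) = p/4: given the first
  sample, an entry is present in \<open>M'' + M'_ind\<close> with probability p' both on and off
  that sample. On the sample its value is already revealed, which costs only an out-degree divided
  by the size of a sphere. One quantity L = n^(rho/4) ties the exponents together: each single
  failure has probability at most a constant times exp(-L).\<close>

section \<open>Distance spheres of a directed graph\<close>

lemma sphere_at_0 [simp]: "sphere_at E u 0 = {u}"
  by (auto simp: sphere_at_def)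

lemma sphere_at_relpow: "i \<in> sphere_at E u s \<Longrightarrow> (u, i) \<in> E ^^ s"
  by (simp add: sphere_at_def)

lemma sphere_at_unique: "i \<in> sphere_at E u s \<Longrightarrow> i \<in> sphere_at E u s' \<Longrightarrow> s = s'"
  unfolding sphere_at_def by (metis (mono_tags, lifting) linorder_neqE_nat mem_Collect_eq)

lemma relpow_sphere_at:
  assumes "(u, i) \<in> E ^^ m" shows "\<exists>s\<le>m. i \<in> sphere_at E u s"
proof -
  let ?s = "LEAST s. (u, i) \<in> E ^^ s"
  have "(u, i) \<in> E ^^ ?s" "?s \<le> m" using assms by (auto intro: LeastI Least_le)
  moreover have "(u, i) \<notin> E ^^ k" if "k < ?s" for k using not_less_Least[OF that] .
  ultimately show ?thesis unfolding sphere_at_def by blast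
qed

lemma reachable_iff_sphere_at: "(u, i) \<in> E\<^sup>* \<longleftrightarrow> (\<exists>s. i \<in> sphere_at E u s)"
proof
  assume "(u, i) \<in> E\<^sup>*"
  then obtain m where "(u, i) \<in> E ^^ m" by (auto simp: rtrancl_power)
  then show "\<exists>s. i \<in> sphere_at E u s" using relpow_sphere_at by blast
qed (auto simp: rtrancl_power sphere_at_def)

lemma relpow_subset:
  fixes G :: "('a \<times> 'a) set"
  assumes "G \<subseteq> E" shows "G ^^ m \<subseteq> E ^^ m"
proof -
  have "(a, b) \<in> E ^^ m" if "(a, b) \<in> G ^^ m" for a b using that
    by (induction m arbitrary: b) (use assms in \<open>auto simp: relcomp.simps\<close>)
  then show ?thesis by auto
qed

text \<open>On a shortest walk to \<open>i\<close> the last edge leaves a vertex at distance exactly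
  \<open>s\<close>, since a shorter walk to that vertex would shorten the one to \<open>i\<close>.
  Spheres are mostly handled through this recursion.\<close>

lemma sphere_at_Suc:
  "sphere_at E u (Suc s) = E `` sphere_at E u s - (\<Union>j\<le>s. sphere_at E u j)"
proof (intro set_eqI iffI)
  fix i assume i: "i \<in> sphere_at E u (Suc s)"
  then obtain a where a: "(u, a) \<in> E ^^ s" "(a, i) \<in> E"
    by (auto simp: sphere_at_def)
  have "(u, a) \<notin> E ^^ m" if "m < s" for m
  proof
    assume "(u, a) \<in> E ^^ m"
    with a(2) have "(u, i) \<in> E ^^ Suc m" by auto
    with i that show False unfolding sphere_at_def by blast
  qed
  with a(1) have "a \<in> sphere_at E u s" unfolding sphere_at_def by blast
  moreover have "i \<notin> sphere_at E u j" if "j \<le> s" for j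
    using sphere_at_unique[OF i, of j] that by auto
  ultimately show "i \<in> E `` sphere_at E u s - (\<Union>j\<le>s. sphere_at E u j)"
    using a(2) by blast
next
  fix i assume i: "i \<in> E `` sphere_at E u s - (\<Union>j\<le>s. sphere_at E u j)"
  then obtain a where a: "a \<in> sphere_at E u s" "(a, i) \<in> E" by blast
  then have "(u, i) \<in> E ^^ Suc s" using sphere_at_relpow[OF a(1)] by auto
  moreover have "(u, i) \<notin> E ^^ m" if m: "m < Suc s" for m
  proof
    assume "(u, i) \<in> E ^^ m"
    then obtain j where "j \<le> m" "i \<in> sphere_at E u j" using relpow_sphere_at by metis
    with i m show False by auto
  qed
  ultimately show "i \<in> sphere_at E u (Suc s)" unfolding sphere_at_def by blast
qed

lemma sphere_at_SucE:
  assumes "i \<in> sphere_at E u (Suc s)"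
  obtains a where "a \<in> sphere_at E u s" "(a, i) \<in> E"
  using assms unfolding sphere_at_Suc by blast

lemma sphere_at_subset: "E \<subseteq> W \<times> W \<Longrightarrow> u \<in> W \<Longrightarrow> sphere_at E u s \<subseteq> W"
  by (cases s) (auto simp: sphere_at_Suc)

text \<open>The spheres up to radius \<open>s\<close> only depend on the edges leaving the ball of radius \<open>s - 1\<close>.\<close>

lemma sphere_at_local:
  assumes "E \<inter> (\<Union>j<s. sphere_at E u j) \<times> UNIV = E' \<inter> (\<Union>j<s. sphere_at E u j) \<times> UNIV"
  shows "j \<le> s \<Longrightarrow> sphere_at E' u j = sphere_at E u j"
proof (induction j rule: less_induct)
  case (less j)
  show ?case
  proof (cases j)
    case (Suc k)
    have eq: "sphere_at E' u m = sphere_at E u m" if "m \<le> k" for m using less Suc that by simp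
    have "E `` sphere_at E u k = E' `` sphere_at E u k"
    proof (rule set_eqI)
      fix i
      have "(a, i) \<in> E \<longleftrightarrow> (a, i) \<in> E'" if "a \<in> sphere_at E u k" for a
      proof -
        have "(a, i) \<in> (\<Union>j<s. sphere_at E u j) \<times> UNIV" using that less.prems Suc by auto
        then show ?thesis using assms by blast
      qed
      then show "i \<in> E `` sphere_at E u k \<longleftrightarrow> i \<in> E' `` sphere_at E u k" by blast
    qed
    then show ?thesis unfolding Suc sphere_at_Suc using eq by auto
  qed simp
qed

section \<open>Breadth-first trees as independent choices of parents\<close>

definition targets :: "(nat \<times> nat) set \<Rightarrow> nat \<Rightarrow> nat set" where
  "targets E u = {i. i \<noteq> u \<and> (u, i) \<in> E\<^sup>*}"

definition parents :: "(nat \<times> nat) set \<Rightarrow> nat \<Rightarrow> nat \<Rightarrow> nat set" where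
  "parents E u i = {a. (a, i) \<in> E \<and> (\<exists>s. a \<in> sphere_at E u s \<and> i \<in> sphere_at E u (Suc s))}"

definition tree_of :: "nat set \<Rightarrow> (nat \<Rightarrow> nat) \<Rightarrow> (nat \<times> nat) set" where
  "tree_of R \<pi> = {(\<pi> i, i) | i. i \<in> R}"

lemma targets_iff: "i \<in> targets E u \<longleftrightarrow> (\<exists>s. i \<in> sphere_at E u (Suc s))"
proof
  assume "i \<in> targets E u"
  then obtain s where s: "i \<in> sphere_at E u s" "i \<noteq> u"
    by (auto simp: targets_def reachable_iff_sphere_at)
  then show "\<exists>s. i \<in> sphere_at E u (Suc s)" by (cases s) auto
next
  assume "\<exists>s. i \<in> sphere_at E u (Suc s)"
  then obtain s where s: "i \<in> sphere_at E u (Suc s)" by blast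
  moreover have "i \<noteq> u" using sphere_at_unique[OF s, of 0] by auto
  ultimately show "i \<in> targets E u" by (auto simp: targets_def reachable_iff_sphere_at)
qed

text \<open>The level in the definition is determined by \<open>i\<close>, because distinct spheres
  are disjoint.\<close>

lemma parents_eq:
  "i \<in> sphere_at E u (Suc s) \<Longrightarrow> parents E u i = {a \<in> sphere_at E u s. (a, i) \<in> E}"
  unfolding parents_def using sphere_at_unique by fastforce

lemma parents_nonempty: "i \<in> targets E u \<Longrightarrow> parents E u i \<noteq> {}"
  unfolding targets_iff using parents_eq sphere_at_SucE by (metis (mono_tags, lifting) emptyE mem_Collect_eq)

lemma walk_betw_snoc:
  "walk_betw G u i xs \<longleftrightarrow>
     (xs = [u] \<and> i = u) \<or> (\<exists>ys a. xs = ys @ [i] \<and> walk_betw G u a ys \<and> (a, i) \<in> G)"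
proof (cases xs rule: rev_cases)
  case (snoc ys y)
  then show ?thesis
    by (cases "ys = []") (auto simp: walk_betw_def successively_append_iff)
qed (simp add: walk_betw_def)

lemma walk_betw_exists: "(u, i) \<in> G ^^ s \<Longrightarrow> \<exists>xs. walk_betw G u i xs"
proof (induction s arbitrary: i)
  case 0
  then show ?case by (auto simp: walk_betw_def intro!: exI[of _ "[u]"])
next
  case (Suc s)
  then obtain a where "(u, a) \<in> G ^^ s" "(a, i) \<in> G" by auto
  with Suc.IH[of a] show ?case using walk_betw_snoc[of G u i] by blast
qed

context
  fixes E :: "(nat \<times> nat) set" and u :: nat and \<pi> :: "nat \<Rightarrow> nat" and G :: "(nat \<times> nat) set"
  assumes \<pi>: "\<And>i. i \<in> targets E u \<Longrightarrow> \<pi> i \<in> parents E u i"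
    and G: "G = tree_of (targets E u) \<pi>"
begin

lemma tree_edge: "(a, i) \<in> G \<longleftrightarrow> i \<in> targets E u \<and> a = \<pi> i"
  by (auto simp: G tree_of_def)

text \<open>Each vertex other than the root has \<open>(\<pi> i, i)\<close> as its only incoming
  tree edge, and the root has none, so a walk from the root can be read backwards in one way
  only.\<close>

lemma tree_walk_unique: "i \<in> sphere_at E u s \<Longrightarrow> \<exists>!xs. walk_betw G u i xs"
proof (induction s arbitrary: i)
  case 0
  then have i: "i = u" by simp
  have "walk_betw G u i xs \<longleftrightarrow> xs = [u]" for xs
    by (subst walk_betw_snoc) (auto simp: i tree_edge targets_def)
  then show ?case by simp
next
  case (Suc s)
  have it: "i \<in> targets E u" using Suc.prems targets_iff by blast
  then have "i \<noteq> u" by (simp add: targets_def)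
  then have *: "walk_betw G u i xs \<longleftrightarrow> (\<exists>ys. xs = ys @ [i] \<and> walk_betw G u (\<pi> i) ys)" for xs
    by (subst walk_betw_snoc) (auto simp: tree_edge it)
  have "\<pi> i \<in> sphere_at E u s" using \<pi>[OF it] parents_eq[OF Suc.prems] by simp
  from Suc.IH[OF this] show ?case unfolding * by auto
qed

text \<open>Following parents reaches the root from level \<open>s\<close> in \<open>s\<close>
  steps, and distances in the tree cannot be smaller because it is a subgraph.\<close>

lemma tree_sphere: "i \<in> sphere_at E u s \<Longrightarrow> i \<in> sphere_at G u s"
proof -
  have GE: "G \<subseteq> E" using \<pi> by (auto simp: G tree_of_def parents_def)
  have "(u, i) \<in> G ^^ s" if "i \<in> sphere_at E u s" using that
  proof (induction s arbitrary: i)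
    case (Suc s)
    have it: "i \<in> targets E u" using Suc.prems targets_iff by blast
    then have "(\<pi> i, i) \<in> G" by (simp add: tree_edge)
    moreover have "\<pi> i \<in> sphere_at E u s" using \<pi>[OF it] parents_eq[OF Suc.prems] by simp
    ultimately show ?case using Suc.IH by auto
  qed simp
  then show "i \<in> sphere_at E u s \<Longrightarrow> i \<in> sphere_at G u s"
    using relpow_subset[OF GE] unfolding sphere_at_def by blast
qed

lemma tree_of_bfs: "G \<in> bfs_trees E u"
  unfolding bfs_trees_def mem_Collect_eq
proof (intro conjI allI impI ballI)
  show "G \<subseteq> E" using \<pi> by (auto simp: G tree_of_def parents_def)
next
  fix e assume "e \<in> G"
  then show "case e of (a, b) \<Rightarrow> (u, a) \<in> E\<^sup>*"
    using \<pi>[of "snd e"] by (cases e) (auto simp: tree_edge parents_def reachable_iff_sphere_at)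
next
  fix i assume "(u, i) \<in> E\<^sup>*"
  then obtain s where "i \<in> sphere_at E u s" unfolding reachable_iff_sphere_at by blast
  then show "\<exists>!xs. walk_betw G u i xs" by (rule tree_walk_unique)
qed (rule tree_sphere)

text \<open>The tree path to \<open>i\<close> is the tree path to its parent followed by one edge.
  This turns products along paths into a recursion over levels, in which each vertex of the new
  level uses one new entry of \<open>A\<close>.\<close>

lemma nbr_vec_Suc:
  assumes i: "i \<in> sphere_at E u (Suc s)"
  shows "nbr_vec E A G u (Suc s) i = nbr_vec E A G u s (\<pi> i) * A (\<pi> i) i"
proof -
  have it: "i \<in> targets E u" using i targets_iff by blast
  then have iu: "i \<noteq> u" by (simp add: targets_def)
  have ps: "\<pi> i \<in> sphere_at E u s" using \<pi>[OF it] parents_eq[OF i] by simp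
  from tree_walk_unique[OF ps] obtain ys where ys: "walk_betw G u (\<pi> i) ys"
    "\<And>zs. walk_betw G u (\<pi> i) zs \<Longrightarrow> zs = ys" by blast
  then have ys_the: "(THE xs. walk_betw G u (\<pi> i) xs) = ys" by (rule the_equality)
  have "(\<pi> i, i) \<in> G" using it tree_edge by blast
  then have "walk_betw G u i (ys @ [i])"
    using walk_betw_snoc[of G u i "ys @ [i]"] ys(1) by blast
  with tree_walk_unique[OF i] have the: "(THE xs. walk_betw G u i xs) = ys @ [i]"
    by (rule the1_equality)
  have "ys \<noteq> []" "last ys = \<pi> i" using ys(1) by (auto simp: walk_betw_def)
  moreover have "zip (ys @ [i]) (tl (ys @ [i])) = zip ys (tl ys) @ [(last ys, i)]" if "ys \<noteq> []" for ys
    using that by (induction ys rule: induct_list012) auto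
  ultimately have "tree_path G u i = tree_path G u (\<pi> i) @ [(\<pi> i, i)]"
    unfolding tree_path_def Let_def the ys_the by simp
  then show ?thesis using i ps by (simp add: nbr_vec_def)
qed

end

lemma nbr_vec_0:
  assumes "G \<in> bfs_trees E u"
  shows "nbr_vec E A G u 0 i = (if i = u then 1 else 0)"
proof -
  have "\<exists>!xs. walk_betw G u u xs" using assms by (auto simp: bfs_trees_def)
  moreover have "walk_betw G u u [u]" by (simp add: walk_betw_def)
  ultimately have "(THE xs. walk_betw G u u xs) = [u]" by (rule the1_equality)
  then show ?thesis by (simp add: nbr_vec_def tree_path_def)
qed

text \<open>Two tree edges into \<open>i\<close> would give two tree walks to \<open>i\<close>, as
  their tails are reachable. The parent is reached in \<open>s\<close> steps, and it cannot be
  closer to \<open>u\<close> than that, since \<open>i\<close> is at distance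
  \<open>Suc s\<close>.\<close>

lemma bfs_tree_parent:
  assumes G: "G \<in> bfs_trees E u" and i: "i \<in> targets E u"
  shows "\<exists>!a. (a, i) \<in> G" and "\<And>a. (a, i) \<in> G \<Longrightarrow> a \<in> parents E u i"
proof -
  have GE: "G \<subseteq> E" using G by (auto simp: bfs_trees_def)
  from i obtain s where s: "i \<in> sphere_at E u (Suc s)" unfolding targets_iff by blast
  then have "i \<in> sphere_at G u (Suc s)" using G by (auto simp: bfs_trees_def)
  then obtain a where a: "a \<in> sphere_at G u s" "(a, i) \<in> G" by (rule sphere_at_SucE)
  have uniq: "b = a" if b: "(b, i) \<in> G" for b
  proof -
    have "(u, b) \<in> E\<^sup>*" using G b by (auto simp: bfs_trees_def)
    then obtain xs where xs: "walk_betw G u b xs" using G by (auto simp: bfs_trees_def)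
    obtain ys where ys: "walk_betw G u a ys" using walk_betw_exists[OF sphere_at_relpow[OF a(1)]] by blast
    have "walk_betw G u i (xs @ [i])" "walk_betw G u i (ys @ [i])"
      using walk_betw_snoc[of G u i "xs @ [i]"] walk_betw_snoc[of G u i "ys @ [i]"] xs ys a(2) b by blast+
    moreover have "\<exists>!xs. walk_betw G u i xs" using G i by (auto simp: bfs_trees_def targets_def)
    ultimately have "xs = ys" by blast
    then show ?thesis using xs ys by (auto simp: walk_betw_def)
  qed
  show "\<exists>!a. (a, i) \<in> G" using a uniq by blast
  fix b assume "(b, i) \<in> G"
  then have ba: "b = a" by (rule uniq)
  have "(u, a) \<in> E ^^ s" using relpow_subset[OF GE] sphere_at_relpow[OF a(1)] by blast
  then obtain m where m: "m \<le> s" "a \<in> sphere_at E u m" using relpow_sphere_at by blast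
  have aE: "(a, i) \<in> E" using a GE by auto
  then have "(u, i) \<in> E ^^ Suc m" using sphere_at_relpow[OF m(2)] by auto
  then obtain k where "k \<le> Suc m" "i \<in> sphere_at E u k" using relpow_sphere_at by blast
  with sphere_at_unique[OF s] m(1) have "m = s" by fastforce
  then show "b \<in> parents E u i" using m s aE ba by (auto simp: parents_def)
qed

lemma bfs_tree_root: "G \<in> bfs_trees E u \<Longrightarrow> (a, u) \<notin> G"
proof
  assume G: "G \<in> bfs_trees E u" and a: "(a, u) \<in> G"
  have "(u, a) \<in> E\<^sup>*" using G a by (auto simp: bfs_trees_def)
  then obtain xs where xs: "walk_betw G u a xs" using G by (auto simp: bfs_trees_def)
  have "walk_betw G u u (xs @ [u])" "walk_betw G u u [u]"
    using walk_betw_snoc[of G u u "xs @ [u]"] xs a by (blast, simp add: walk_betw_def)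
  moreover have "\<exists>!xs. walk_betw G u u xs" using G by (auto simp: bfs_trees_def)
  ultimately have "xs @ [u] = [u]" by blast
  then show False using xs by (auto simp: walk_betw_def)
qed

text \<open>The constraints on the parents of different vertices do not interact: any choice of
  parents one level closer gives a breadth-first tree, and every such tree arises in this way. The
  default value \<open>0\<close> off \<open>targets\<close> makes the parent map recoverable from
  the tree, as \<open>inj_on_tree_of\<close> requires.\<close>

lemma bfs_trees_eq:
  "bfs_trees E u = tree_of (targets E u) ` PiE_dflt (targets E u) 0 (parents E u)"
proof (intro equalityI subsetI)
  fix G assume G: "G \<in> bfs_trees E u"
  define \<pi> where "\<pi> i = (if i \<in> targets E u then THE a. (a, i) \<in> G else 0)" for i
  have \<pi>: "(\<pi> i, i) \<in> G" if "i \<in> targets E u" for i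
    using theI'[OF bfs_tree_parent(1)[OF G that]] that by (simp add: \<pi>_def)
  have "i \<in> targets E u \<and> a = \<pi> i" if ai: "(a, i) \<in> G" for a i
  proof -
    have "(u, a) \<in> E\<^sup>*" "(a, i) \<in> E" using G ai by (auto simp: bfs_trees_def)
    then have "(u, i) \<in> E\<^sup>*" by auto
    moreover have "i \<noteq> u" using bfs_tree_root[OF G] ai by blast
    ultimately have "i \<in> targets E u" by (simp add: targets_def)
    then show ?thesis using bfs_tree_parent(1)[OF G] \<pi> ai by blast
  qed
  then have "G = tree_of (targets E u) \<pi>" using \<pi> by (auto simp: tree_of_def)
  moreover have "\<pi> \<in> PiE_dflt (targets E u) 0 (parents E u)"
    using bfs_tree_parent(2)[OF G _ \<pi>] by (auto simp: PiE_dflt_def \<pi>_def)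
  ultimately show "G \<in> tree_of (targets E u) ` PiE_dflt (targets E u) 0 (parents E u)" by blast
next
  fix G assume "G \<in> tree_of (targets E u) ` PiE_dflt (targets E u) 0 (parents E u)"
  then show "G \<in> bfs_trees E u" by (auto simp: PiE_dflt_def intro!: tree_of_bfs)
qed

lemma inj_on_tree_of: "inj_on (tree_of R) (PiE_dflt R d B)"
proof (rule inj_onI, rule ext)
  fix \<pi> \<pi>' i assume *: "\<pi> \<in> PiE_dflt R d B" "\<pi>' \<in> PiE_dflt R d B" "tree_of R \<pi> = tree_of R \<pi>'"
  show "\<pi> i = \<pi>' i"
  proof (cases "i \<in> R")
    case True
    then have "(\<pi> i, i) \<in> tree_of R \<pi>'" using *(3) by (auto simp: tree_of_def)
    then show ?thesis by (auto simp: tree_of_def)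
  qed (use * in \<open>auto simp: PiE_dflt_def\<close>)
qed

lemma targets_subset: "E \<subseteq> W \<times> W \<Longrightarrow> u \<in> W \<Longrightarrow> targets E u \<subseteq> W"
  using sphere_at_subset[of E W u] by (auto simp: targets_iff subset_iff)

lemma parents_subset: "E \<subseteq> W \<times> W \<Longrightarrow> parents E u i \<subseteq> W"
  by (auto simp: parents_def)

lemma bfs_trees_nonempty: "E \<subseteq> W \<times> W \<Longrightarrow> bfs_trees E u \<noteq> {}"
  unfolding bfs_trees_eq using parents_nonempty by simp

lemma finite_bfs_trees: "finite E \<Longrightarrow> finite (bfs_trees E u)"
  by (rule finite_subset[of _ "Pow E"]) (auto simp: bfs_trees_def)

text \<open>The uniform law on a product set is the product of the uniform laws, and
  \<open>tree_of\<close> is injective there. So uniformity of the tree becomes independence of the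
  parents.\<close>

lemma pmf_of_set_bfs_trees:
  assumes "E \<subseteq> W \<times> W" "finite W" "u \<in> W"
  shows "pmf_of_set (bfs_trees E u) =
    map_pmf (tree_of (targets E u)) (Pi_pmf (targets E u) 0 (\<lambda>i. pmf_of_set (parents E u i)))"
proof -
  have fin: "finite (targets E u)" "\<And>i. finite (parents E u i)"
    using targets_subset[OF assms(1,3)] parents_subset[OF assms(1)] assms(2) finite_subset by metis+
  have "Pi_pmf (targets E u) 0 (\<lambda>i. pmf_of_set (parents E u i)) = pmf_of_set (PiE_dflt (targets E u) 0 (parents E u))"
    using fin parents_nonempty by (intro Pi_pmf_of_set) auto
  moreover have "finite (PiE_dflt (targets E u) 0 (parents E u))"
    "PiE_dflt (targets E u) 0 (parents E u) \<noteq> {}"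
    using fin parents_nonempty by auto
  ultimately show ?thesis
    by (simp add: map_pmf_of_set_inj inj_on_tree_of bfs_trees_eq)
qed

section \<open>Expectations under finitely supported product laws\<close>

abbreviation pexp :: "'a pmf \<Rightarrow> ('a \<Rightarrow> real) \<Rightarrow> real" where
  "pexp M h \<equiv> measure_pmf.expectation M h"

lemma pexp_sum: "finite (set_pmf M) \<Longrightarrow> pexp M h = (\<Sum>a\<in>set_pmf M. pmf M a * h a)"
  by (subst integral_measure_pmf[of "set_pmf M"]) auto

lemma pexp_bind:
  assumes "finite (set_pmf M)" "\<And>x. x \<in> set_pmf M \<Longrightarrow> finite (set_pmf (K x))"
  shows "pexp (bind_pmf M K) h = pexp M (\<lambda>x. pexp (K x) h)"
  using assms by (subst pmf_expectation_bind[of "set_pmf M"]) (auto simp: pexp_sum)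

lemma pexp_mono:
  assumes "finite (set_pmf M)" "\<And>x. x \<in> set_pmf M \<Longrightarrow> g x \<le> h x"
  shows "pexp M g \<le> pexp M h"
  using assms by (auto simp: pexp_sum intro!: sum_mono mult_left_mono)

lemma pexp_cong: "(\<And>x. x \<in> set_pmf M \<Longrightarrow> g x = h x) \<Longrightarrow> pexp M g = pexp M h"
  by (intro integral_cong_AE) (auto simp: AE_measure_pmf_iff)

lemma pexp_swap_sum:
  assumes "finite (set_pmf M)" shows "pexp M (\<lambda>x. \<Sum>i\<in>A. h i x) = (\<Sum>i\<in>A. pexp M (h i))"
  using assms by (simp add: integrable_measure_pmf_finite)

lemma pexp_pair:
  assumes "finite (set_pmf M)" "finite (set_pmf N)"
  shows "pexp (pair_pmf M N) h = pexp M (\<lambda>x. pexp N (\<lambda>y. h (x, y)))"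
  unfolding pair_pmf_def using assms by (subst pexp_bind) (auto intro!: pexp_cong simp: pexp_bind)

lemma finite_set_Pi_pmf:
  "finite A \<Longrightarrow> (\<And>i. i \<in> A \<Longrightarrow> finite (set_pmf (M i))) \<Longrightarrow> finite (set_pmf (Pi_pmf A d M))"
  by (subst set_Pi_pmf) auto

lemma Pi_pmf_map_index:
  assumes "finite A"
  shows "Pi_pmf A d (\<lambda>i. map_pmf (g i) (M i)) = map_pmf (\<lambda>y i. if i \<in> A then g i (y i) else d) (Pi_pmf A d' M)"
  unfolding map_pmf_def[of "g _"] by (subst Pi_pmf_bind[OF assms, of _ _ _ d']) (simp add: map_pmf_def assms)

text \<open>This separates the random graph from the random choices of parents, which
  \<open>explore_pmf\<close> draws together, vertex by vertex.\<close>

lemma Pi_pmf_pair: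
  assumes "finite A"
  shows "Pi_pmf A (d, d') (\<lambda>i. pair_pmf (M i) (N i)) =
    map_pmf (\<lambda>(x, y) i. (x i, y i)) (pair_pmf (Pi_pmf A d M) (Pi_pmf A d' N))"
proof (rule pmf_eqI)
  fix h :: "'a \<Rightarrow> 'b \<times> 'c"
  let ?f = "\<lambda>(x, y) i. (x i, y i)"
  have inj: "inj (?f :: ('a \<Rightarrow> 'b) \<times> ('a \<Rightarrow> 'c) \<Rightarrow> _)" by (auto simp: inj_def fun_eq_iff)
  have h: "h = ?f (fst \<circ> h, snd \<circ> h)" by (auto simp: fun_eq_iff)
  have "pmf (map_pmf ?f (pair_pmf (Pi_pmf A d M) (Pi_pmf A d' N))) h = pmf (Pi_pmf A d M) (fst \<circ> h) * pmf (Pi_pmf A d' N) (snd \<circ> h)"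
    by (subst h, subst pmf_map_inj'[OF inj]) (simp add: pmf_pair)
  also have "\<dots> = pmf (Pi_pmf A (d, d') (\<lambda>i. pair_pmf (M i) (N i))) h"
  proof (cases "\<forall>x. x \<notin> A \<longrightarrow> h x = (d, d')")
    case True
    then show ?thesis
      by (subst (1 2 3) pmf_Pi') (auto simp: assms prod.distrib[symmetric] intro!: prod.cong, metis pmf_pair prod.collapse)
  next
    case False
    then show ?thesis by (auto simp: pmf_Pi[OF assms] prod_eq_iff)
  qed
  finally show "pmf (Pi_pmf A (d, d') (\<lambda>i. pair_pmf (M i) (N i))) h = pmf (map_pmf ?f (pair_pmf (Pi_pmf A d M) (Pi_pmf A d' N))) h" ..
qed

text \<open>Conditionally on the coordinates in \<open>A\<close>, the remaining ones are still independent.\<close>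

lemma Pi_pmf_split_bound:
  fixes H :: "('a \<Rightarrow> 'b) \<Rightarrow> real" and g h :: "'a \<Rightarrow> ('a \<Rightarrow> 'b) \<Rightarrow> 'b \<Rightarrow> real"
  assumes fin: "finite A" "finite B" "A \<inter> B = {}" "\<And>i. finite (set_pmf (M i))"
    and H: "\<And>y. 0 \<le> H y"
    and g: "\<And>i y x. i \<in> B \<Longrightarrow> 0 \<le> g i y x" and h: "\<And>i y x. i \<in> B \<Longrightarrow> 0 \<le> h i y x"
    and gh: "\<And>i y. i \<in> B \<Longrightarrow> y \<in> set_pmf (Pi_pmf A d M) \<Longrightarrow> H y \<noteq> 0 \<Longrightarrow> pexp (M i) (g i y) \<le> k * pexp (M i) (h i y)"
  defines "r \<equiv> (\<lambda>D i. if i \<in> A then D i else d)"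
  shows "pexp (Pi_pmf (A \<union> B) d M) (\<lambda>D. H (r D) * (\<Prod>i\<in>B. g i (r D) (D i)))
    \<le> k ^ card B * pexp (Pi_pmf (A \<union> B) d M) (\<lambda>D. H (r D) * (\<Prod>i\<in>B. h i (r D) (D i)))"
proof -
  \<comment> \<open>Integrate the coordinates in \<open>B\<close> first. Since \<open>r D\<close>
    keeps the coordinates in \<open>A\<close> and resets the others to \<open>d\<close>, both
    \<open>H\<close> and the second argument of \<open>g\<close> are frozen meanwhile, and the
    product factorizes over \<open>B\<close>.\<close>
  have eq: "pexp (Pi_pmf (A \<union> B) d M) (\<lambda>D. H (r D) * (\<Prod>i\<in>B. g i (r D) (D i)))
      = pexp (Pi_pmf A d M) (\<lambda>y. H y * (\<Prod>i\<in>B. pexp (M i) (g i y)))"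
    if g: "\<And>i y x. i \<in> B \<Longrightarrow> 0 \<le> g i y x" for g :: "'a \<Rightarrow> ('a \<Rightarrow> 'b) \<Rightarrow> 'b \<Rightarrow> real"
  proof -
    have fs: "finite (set_pmf (Pi_pmf A d M))" "finite (set_pmf (Pi_pmf B d M))"
      using fin by (auto intro!: finite_set_Pi_pmf)
    have "pexp (Pi_pmf (A \<union> B) d M) (\<lambda>D. H (r D) * (\<Prod>i\<in>B. g i (r D) (D i)))
        = pexp (Pi_pmf A d M) (\<lambda>y. pexp (Pi_pmf B d M) (\<lambda>x. H y * (\<Prod>i\<in>B. g i y (x i))))"
      unfolding Pi_pmf_union[OF fin(1-3)] integral_map_pmf pexp_pair[OF fs]
    proof (intro pexp_cong)
      fix y x assume y: "y \<in> set_pmf (Pi_pmf A d M)" and x: "x \<in> set_pmf (Pi_pmf B d M)"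
      have r: "r (\<lambda>i. if i \<in> A then y i else x i) = y"
        using set_Pi_pmf_subset[OF fin(1), of d M] y by (auto simp: r_def fun_eq_iff)
      show "H (r (case (y, x) of (f, g) \<Rightarrow> \<lambda>x. if x \<in> A then f x else g x)) *
            (\<Prod>i\<in>B. g i (r (case (y, x) of (f, g) \<Rightarrow> \<lambda>x. if x \<in> A then f x else g x))
                     ((case (y, x) of (f, g) \<Rightarrow> \<lambda>x. if x \<in> A then f x else g x) i)) =
            H y * (\<Prod>i\<in>B. g i y (x i))"
        unfolding prod.case r using fin(3) by (auto intro!: prod.cong)
    qed
    also have "\<dots> = pexp (Pi_pmf A d M) (\<lambda>y. H y * (\<Prod>i\<in>B. pexp (M i) (g i y)))"
      by (intro pexp_cong, simp, intro disjI2 expectation_prod_Pi_pmf)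
         (auto simp: fin g integrable_measure_pmf_finite)
    finally show ?thesis .
  qed
  have "pexp (Pi_pmf A d M) (\<lambda>y. H y * (\<Prod>i\<in>B. pexp (M i) (g i y)))
      \<le> pexp (Pi_pmf A d M) (\<lambda>y. k ^ card B * (H y * (\<Prod>i\<in>B. pexp (M i) (h i y))))"
  proof (rule pexp_mono)
    fix y assume y: "y \<in> set_pmf (Pi_pmf A d M)"
    show "H y * (\<Prod>i\<in>B. pexp (M i) (g i y)) \<le> k ^ card B * (H y * (\<Prod>i\<in>B. pexp (M i) (h i y)))"
    proof (cases "H y = 0")
      case False
      have "(\<Prod>i\<in>B. pexp (M i) (g i y)) \<le> (\<Prod>i\<in>B. k * pexp (M i) (h i y))"
        using gh[OF _ y False] g by (intro prod_mono) auto
      then show ?thesis using H[of y] by (simp add: prod.distrib mult_left_mono mult.left_commute)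
    qed simp
  qed (use fin in \<open>auto intro!: finite_set_Pi_pmf\<close>)
  then show ?thesis using eq[of g] eq[of h] g h by simp
qed

section \<open>Random subsets with independent memberships\<close>

definition rset :: "'a set \<Rightarrow> real \<Rightarrow> 'a set pmf" where
  "rset W w = map_pmf (\<lambda>b. {a \<in> W. b a}) (Pi_pmf W False (\<lambda>_. bernoulli_pmf w))"

lemma set_rset: "set_pmf (rset W w) \<subseteq> Pow W"
  by (auto simp: rset_def)

lemma finite_set_rset [simp]: "finite W \<Longrightarrow> finite (set_pmf (rset W w))"
  using set_rset[of W w] finite_subset by blast

lemma pmf_rset:
  assumes "finite W" "X \<subseteq> W"
  shows "pmf (rset W w) X = (\<Prod>a\<in>W. pmf (bernoulli_pmf w) (a \<in> X))"
proof -
  have "(\<lambda>b. {a \<in> W. b a}) -` {X} = Pi W (\<lambda>a. {a \<in> X})"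
    using assms(2) by (auto simp: Pi_def)
  then show ?thesis unfolding rset_def
    by (simp add: pmf_map measure_Pi_pmf_Pi[OF assms(1)] measure_pmf_single)
qed

lemma pmf_rset_card:
  assumes "finite W" "X \<subseteq> W" "0 \<le> w" "w \<le> 1"
  shows "pmf (rset W w) X = w ^ card X * (1 - w) ^ (card W - card X)"
proof -
  have "(\<Prod>a\<in>W. pmf (bernoulli_pmf w) (a \<in> X)) = (\<Prod>a\<in>X. w) * (\<Prod>a\<in>W - X. 1 - w)"
    using assms by (subst prod.subset_diff[OF assms(2,1)]) (auto simp: mult.commute intro!: arg_cong2[where f = times] prod.cong)
  then show ?thesis using assms by (simp add: pmf_rset card_Diff_subset finite_subset)
qed

lemma rset_Un:
  assumes "finite A" "finite B" "A \<inter> B = {}"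
  shows "rset (A \<union> B) w = map_pmf (\<lambda>(X, Y). X \<union> Y) (pair_pmf (rset A w) (rset B w))"
proof -
  have "rset (A \<union> B) w = map_pmf (\<lambda>(b, c). {a \<in> A. b a} \<union> {a \<in> B. c a})
      (pair_pmf (Pi_pmf A False (\<lambda>_. bernoulli_pmf w)) (Pi_pmf B False (\<lambda>_. bernoulli_pmf w)))"
    unfolding rset_def Pi_pmf_union[OF assms] pmf.map_comp
    using assms(3) by (intro map_pmf_cong refl) (auto split: if_splits)
  also have "\<dots> = map_pmf (\<lambda>(X, Y). X \<union> Y) (pair_pmf (rset A w) (rset B w))"
    unfolding rset_def by (simp add: map_pair[symmetric] pmf.map_comp o_def case_prod_unfold)
  finally show ?thesis .
qed

text \<open>A random edge set is drawn column by column: in-neighbourhoods of distinct vertices are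
  independent. Sorting edges by their heads is what keeps the vertices of a new level independent of
  each other.\<close>

lemma rset_Times:
  assumes "finite W" "finite J"
  shows "rset (W \<times> J) w = map_pmf (\<lambda>c. {(a, i). i \<in> J \<and> a \<in> c i}) (Pi_pmf J {} (\<lambda>_. rset W w))"
    (is "_ = map_pmf ?g ?M")
proof (rule pmf_eqI)
  fix E
  show "pmf (rset (W \<times> J) w) E = pmf (map_pmf ?g ?M) E"
  proof (cases "E \<subseteq> W \<times> J")
    case True
    have "?g -` {E} = Pi J (\<lambda>i. {{a. (a, i) \<in> E}})"
      using True by (fastforce simp: Pi_def)
    then have "pmf (map_pmf ?g ?M) E = (\<Prod>i\<in>J. pmf (rset W w) {a. (a, i) \<in> E})"
      by (simp add: pmf_map measure_Pi_pmf_Pi[OF assms(2)] measure_pmf_single)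
    also have "\<dots> = (\<Prod>i\<in>J. \<Prod>a\<in>W. pmf (bernoulli_pmf w) ((a, i) \<in> E))"
      using True assms(1) by (intro prod.cong refl) (subst pmf_rset; auto)
    also have "\<dots> = (\<Prod>a\<in>W. \<Prod>i\<in>J. pmf (bernoulli_pmf w) ((a, i) \<in> E))" by (rule prod.swap)
    also have "\<dots> = pmf (rset (W \<times> J) w) E"
      using True assms by (simp add: pmf_rset prod.cartesian_product)
    finally show ?thesis ..
  next
    case False
    have "E \<notin> set_pmf (rset (W \<times> J) w)" using set_rset[of "W \<times> J" w] False by blast
    moreover have "E \<notin> set_pmf (map_pmf ?g ?M)"
    proof
      assume "E \<in> set_pmf (map_pmf ?g ?M)"
      then obtain c where "c \<in> set_pmf ?M" "E = ?g c" by auto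
      then show False using False set_rset[of W w] by (auto simp: set_Pi_pmf[OF assms(2)] PiE_dflt_def)
    qed
    ultimately show ?thesis unfolding set_pmf_iff by simp
  qed
qed

text \<open>In the exploration \<open>C\<close> is the in-neighbourhood of a vertex not yet reached,
  \<open>B\<close> the union of the earlier levels and \<open>S\<close> the current one. Knowing
  that no edge comes from \<open>B\<close> says nothing about edges from the disjoint set
  \<open>S\<close>.\<close>

lemma pexp_rset_avoid:
  assumes "finite W" "S \<subseteq> W" "B \<subseteq> W" "S \<inter> B = {}"
  shows "pexp (rset W w) (\<lambda>C. (if C \<inter> B = {} then 1 else 0) * g (C \<inter> S)) =
    pexp (rset W w) (\<lambda>C. if C \<inter> B = {} then 1 else 0) * pexp (rset S w) g"
proof -
  have fin: "finite S" "finite (W - S)" using assms finite_subset by auto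
  have W: "W = S \<union> (W - S)" using assms by auto
  have *: "pexp (rset W w) (\<lambda>C. (if C \<inter> B = {} then 1 else 0) * g (C \<inter> S)) =
    pexp (rset (W - S) w) (\<lambda>C. if C \<inter> B = {} then 1 else 0) * pexp (rset S w) g" for g
  proof -
    have "pexp (rset W w) (\<lambda>C. (if C \<inter> B = {} then 1 else 0) * g (C \<inter> S)) =
      pexp (rset S w) (\<lambda>X. pexp (rset (W - S) w) (\<lambda>Y. (if Y \<inter> B = {} then 1 else 0) * g X))"
    proof -
      have "rset W w = map_pmf (\<lambda>(X, Y). X \<union> Y) (pair_pmf (rset S w) (rset (W - S) w))"
        using rset_Un[OF fin] W by auto
      then have "pexp (rset W w) (\<lambda>C. (if C \<inter> B = {} then 1 else 0) * g (C \<inter> S)) =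
        pexp (rset S w) (\<lambda>X. pexp (rset (W - S) w) (\<lambda>Y. (if (X \<union> Y) \<inter> B = {} then 1 else 0) * g ((X \<union> Y) \<inter> S)))"
        using fin by (simp add: pexp_pair)
      also have "\<dots> = pexp (rset S w) (\<lambda>X. pexp (rset (W - S) w) (\<lambda>Y. (if Y \<inter> B = {} then 1 else 0) * g X))"
      proof (intro pexp_cong)
        fix X Y assume "X \<in> set_pmf (rset S w)" "Y \<in> set_pmf (rset (W - S) w)"
        then have "X \<subseteq> S" "Y \<subseteq> W - S" using set_rset by blast+
        then have "(X \<union> Y) \<inter> B = Y \<inter> B" "(X \<union> Y) \<inter> S = X" using assms(4) by auto
        then show "(if (X \<union> Y) \<inter> B = {} then 1 else 0) * g ((X \<union> Y) \<inter> S) = (if Y \<inter> B = {} then 1 else 0) * g X" by simp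
      qed
      finally show ?thesis .
    qed
    then show ?thesis by (simp add: mult.commute)
  qed
  \<comment> \<open>For constant \<open>g\<close> the identity shows that the first factor is the
    probability that the whole set \<open>C\<close> avoids \<open>B\<close>.\<close>
  from *[of "\<lambda>_. 1"] * [of g] show ?thesis by simp
qed

text \<open>A uniformly random element of a random subset of \<open>S\<close> is uniform on \<open>S\<close>.\<close>

lemma pexp_rset_average:
  fixes h :: "'a \<Rightarrow> real"
  assumes fin: "finite S" and w: "0 \<le> w" "w \<le> 1"
  shows "pexp (rset S w) (\<lambda>X. if X = {} then \<alpha> else (\<Sum>a\<in>X. h a) / card X) =
    (1 - w) ^ card S * \<alpha> + (1 - (1 - w) ^ card S) * ((\<Sum>a\<in>S. h a) / card S)"
proof -
  \<comment> \<open>\<open>c a\<close> is the probability that \<open>a\<close> is the element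
    picked from \<open>X\<close>. It does not depend on \<open>a\<close>: transposing two points of
    \<open>S\<close> preserves cardinalities, and the law of \<open>X\<close> depends on nothing
    else.\<close>
  define c where "c a = pexp (rset S w) (\<lambda>X. if a \<in> X then 1 / card X else 0)" for a
  have c_eq: "c a = (\<Sum>X\<in>Pow S. w ^ card X * (1 - w) ^ (card S - card X) * (if a \<in> X then 1 / card X else 0))" for a
    unfolding c_def
    using set_rset[of S w] fin w
    by (subst integral_measure_pmf[of "Pow S"]) (auto simp: pmf_rset_card intro!: sum.cong)
  have c_const: "c a = c b" if ab: "a \<in> S" "b \<in> S" for a b
    unfolding c_eq
  proof (rule sum.reindex_bij_witness[of _ "image (Transposition.transpose a b)" "image (Transposition.transpose a b)"])
    fix X assume "X \<in> Pow S"
    then show "Transposition.transpose a b ` X \<in> Pow S"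
      using ab by (auto simp: Transposition.transpose_def)
    have "card (Transposition.transpose a b ` X) = card X" by (intro card_image) (metis inj_onI transpose_involutory)
    moreover have "b \<in> Transposition.transpose a b ` X \<longleftrightarrow> a \<in> X"
      by (metis image_eqI in_transpose_image_iff transpose_apply_second)
    ultimately show "w ^ card (Transposition.transpose a b ` X) * (1 - w) ^ (card S - card (Transposition.transpose a b ` X)) *
         (if b \<in> Transposition.transpose a b ` X then 1 / card (Transposition.transpose a b ` X) else 0) =
         w ^ card X * (1 - w) ^ (card S - card X) * (if a \<in> X then 1 / card X else 0)" by simp
  qed (auto simp: image_comp ab Transposition.transpose_def split: if_splits)
  have expand: "pexp (rset S w) (\<lambda>X. if X = {} then \<alpha> else (\<Sum>a\<in>X. h a) / card X) =
      (1 - w) ^ card S * \<alpha> + (\<Sum>a\<in>S. h a * c a)" for \<alpha> and h :: "'a \<Rightarrow> real"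
  proof -
    have "pexp (rset S w) (\<lambda>X. if X = {} then \<alpha> else (\<Sum>a\<in>X. h a) / card X) =
      pexp (rset S w) (\<lambda>X. (if X = {} then 1 else 0) * \<alpha> + (\<Sum>a\<in>S. h a * (if a \<in> X then 1 / card X else 0)))"
    proof (rule pexp_cong)
      fix X assume "X \<in> set_pmf (rset S w)"
      then have X: "X \<subseteq> S" using set_rset by blast
      have "(\<Sum>a\<in>S. h a * (if a \<in> X then 1 / card X else 0)) = (\<Sum>a\<in>X. h a * (1 / card X))"
        by (rule sum.mono_neutral_cong_right) (use X fin in auto)
      then show "(if X = {} then \<alpha> else (\<Sum>a\<in>X. h a) / card X) =
         (if X = {} then 1 else 0) * \<alpha> + (\<Sum>a\<in>S. h a * (if a \<in> X then 1 / card X else 0))"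
        by (auto simp: sum_divide_distrib)
    qed
    also have "\<dots> = pexp (rset S w) (\<lambda>X. if X = {} then 1 else 0) * \<alpha> + (\<Sum>a\<in>S. h a * c a)"
      using fin by (simp add: integrable_measure_pmf_finite pexp_swap_sum c_def)
    also have "pexp (rset S w) (\<lambda>X. if X = {} then 1 else 0) = pmf (rset S w) {}"
      by (subst integral_measure_pmf[of "{{}}"]) (auto split: if_splits)
    finally show ?thesis using fin w by (simp add: pmf_rset_card)
  qed
  show ?thesis
  proof (cases "S = {}")
    case True
    then show ?thesis using expand[of \<alpha> h] by simp
  next
    case False
    then obtain a where a: "a \<in> S" by blast
    have "pexp (rset S w) (\<lambda>X. if X = {} then 0 else (\<Sum>a\<in>X. 1) / card X) = (\<Sum>a\<in>S. c a)"
      using expand[of 0 "\<lambda>_. 1"] by simp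
    \<comment> \<open>Averaging the constant 1, with value 1 also at the empty set, gives 1. Hence
      the \<open>c a\<close> add up to the probability that \<open>X\<close> is nonempty, which
      determines their common value.\<close>
    moreover have "pexp (rset S w) (\<lambda>X. if X = {} then 1 else (\<Sum>a\<in>X. 1) / card X) = 1"
    proof -
      have "pexp (rset S w) (\<lambda>X. if X = {} then 1 else (\<Sum>a\<in>X. 1) / card X) = pexp (rset S w) (\<lambda>_. 1)"
      proof (rule pexp_cong)
        fix X assume "X \<in> set_pmf (rset S w)"
        then have "finite X" using set_rset[of S w] fin by (meson PowD finite_subset subsetD)
        then show "(if X = {} then 1 else (\<Sum>a\<in>X. 1) / card X) = (1 :: real)" by simp
      qed
      then show ?thesis by simp
    qed
    ultimately have "(\<Sum>a\<in>S. c a) = 1 - (1 - w) ^ card S"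
      using expand[of 1 "\<lambda>_. 1"] by simp
    moreover have "(\<Sum>b\<in>S. c b) = card S * c a"
      using c_const[OF _ a] by simp
    ultimately have "c b = (1 - (1 - w) ^ card S) / card S" if "b \<in> S" for b
      using c_const[OF that a] False fin by (simp add: field_simps)
    then have "(\<Sum>a\<in>S. h a * c a) = (\<Sum>a\<in>S. h a) * ((1 - (1 - w) ^ card S) / card S)"
      by (simp add: sum_distrib_right sum_divide_distrib)
    then show ?thesis unfolding expand by simp
  qed
qed

section \<open>Exploring the random graph with parents drawn in advance\<close>

text \<open>A random choice function on subsets of \<open>W\<close>. The set from which a vertex
  picks its parent depends on the whole graph, so an answer is prepared for every possible set; the
  value at the empty set is a dummy.\<close>

definition choice_pmf :: "nat set \<Rightarrow> (nat set \<Rightarrow> nat) pmf" where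
  "choice_pmf W = Pi_pmf (Pow W) 0 (\<lambda>A. if A = {} then return_pmf 0 else pmf_of_set A)"

text \<open>The datum of a vertex holds its in-neighbours, not its out-neighbours, and its choice
  function. Thus everything that decides how a vertex enters the next level sits in its own
  independent coordinate.\<close>

definition explore_pmf :: "nat set \<Rightarrow> real \<Rightarrow> (nat \<Rightarrow> nat set \<times> (nat set \<Rightarrow> nat)) pmf" where
  "explore_pmf W w = Pi_pmf W ({}, \<lambda>_. 0) (\<lambda>_. pair_pmf (rset W w) (choice_pmf W))"

definition graph :: "nat set \<Rightarrow> (nat \<Rightarrow> nat set \<times> (nat set \<Rightarrow> nat)) \<Rightarrow> (nat \<times> nat) set" where
  "graph W D = {(a, i). i \<in> W \<and> a \<in> fst (D i)}"

definition chosen_parent :: "nat set \<Rightarrow> (nat \<Rightarrow> nat set \<times> (nat set \<Rightarrow> nat)) \<Rightarrow> nat \<Rightarrow> nat \<Rightarrow> nat" where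
  "chosen_parent W D u i = snd (D i) (parents (graph W D) u i)"

definition chosen_tree :: "nat set \<Rightarrow> (nat \<Rightarrow> nat set \<times> (nat set \<Rightarrow> nat)) \<Rightarrow> nat \<Rightarrow> (nat \<times> nat) set" where
  "chosen_tree W D u = tree_of (targets (graph W D) u) (chosen_parent W D u)"

definition tree_parent :: "(nat \<times> nat) set \<Rightarrow> nat \<Rightarrow> nat" where
  "tree_parent G i = (THE a. (a, i) \<in> G)"

lemma tree_parent_tree_of: "i \<in> R \<Longrightarrow> tree_parent (tree_of R \<pi>) i = \<pi> i"
  unfolding tree_parent_def by (rule the_equality) (auto simp: tree_of_def)

lemma finite_set_choice [simp]: "finite W \<Longrightarrow> finite (set_pmf (choice_pmf W))"
  unfolding choice_pmf_def by (rule finite_set_Pi_pmf) (auto simp: finite_subset set_pmf_of_set)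

lemma finite_set_explore [simp]: "finite W \<Longrightarrow> finite (set_pmf (explore_pmf W w))"
  unfolding explore_pmf_def by (rule finite_set_Pi_pmf) auto

lemma map_choice_pmf:
  assumes "finite W" "A \<subseteq> W" "A \<noteq> {}"
  shows "map_pmf (\<lambda>k. k A) (choice_pmf W) = pmf_of_set A"
  unfolding choice_pmf_def using assms by (subst Pi_pmf_component) auto

lemma choice_in:
  assumes "finite W" "k \<in> set_pmf (choice_pmf W)" "A \<subseteq> W" "A \<noteq> {}"
  shows "k A \<in> A"
proof -
  have "k A \<in> set_pmf (map_pmf (\<lambda>k. k A) (choice_pmf W))" using assms by auto
  then show ?thesis using assms finite_subset[of A W] by (simp add: map_choice_pmf)
qed

lemma pexp_choice:
  assumes "finite W" "A \<subseteq> W" "A \<noteq> {}"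
  shows "pexp (choice_pmf W) (\<lambda>k. h (k A)) = (\<Sum>a\<in>A. h a) / card A"
proof -
  have "pexp (choice_pmf W) (\<lambda>k. h (k A)) = pexp (map_pmf (\<lambda>k. k A) (choice_pmf W)) h" by simp
  also have "\<dots> = (\<Sum>a\<in>A. h a) / card A"
    unfolding map_choice_pmf[OF assms] using assms finite_subset by (subst integral_pmf_of_set) auto
  finally show ?thesis .
qed

text \<open>Drawing all potential parents in advance turns the breadth-first tree into a function of
  independent data, one item per vertex.\<close>

lemma explore_law:
  assumes W: "finite W" "u \<in> W"
  shows "bind_pmf (rset (W \<times> W) w) (\<lambda>E. map_pmf (Pair E) (pmf_of_set (bfs_trees E u))) =
    map_pmf (\<lambda>D. (graph W D, chosen_tree W D u)) (explore_pmf W w)"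
proof -
  let ?g = "\<lambda>c. {(a, i). i \<in> W \<and> a \<in> c i}"
  let ?C = "Pi_pmf W {} (\<lambda>_. rset W w)" and ?K = "Pi_pmf W (\<lambda>_. 0) (\<lambda>_. choice_pmf W)"
  let ?t = "\<lambda>E K. tree_of (targets E u) (\<lambda>i. K i (parents E u i))"
  \<comment> \<open>With the graph fixed, the choice function of \<open>i\<close> is evaluated only
    at the set \<open>parents E u i\<close>, where it is uniform. So the prepared choices induce the
    uniform tree.\<close>
  have tree: "map_pmf (?t E) ?K = pmf_of_set (bfs_trees E u)" if E: "E \<subseteq> W \<times> W" for E
  proof -
    let ?R = "targets E u"
    have R: "?R \<subseteq> W" "finite ?R" using targets_subset[OF E W(2)] W finite_subset by auto
    have "Pi_pmf ?R 0 (\<lambda>i. pmf_of_set (parents E u i)) = Pi_pmf ?R 0 (\<lambda>i. map_pmf (\<lambda>k. k (parents E u i)) (choice_pmf W))"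
      using parents_subset[OF E] parents_nonempty by (intro Pi_pmf_cong refl) (simp add: map_choice_pmf W)
    also have "\<dots> = map_pmf (\<lambda>y i. if i \<in> ?R then y i (parents E u i) else 0) (Pi_pmf ?R (\<lambda>_. 0) (\<lambda>_. choice_pmf W))"
      by (rule Pi_pmf_map_index[OF R(2)])
    also have "Pi_pmf ?R (\<lambda>_. 0) (\<lambda>_. choice_pmf W) = map_pmf (\<lambda>y i. if i \<in> ?R then y i else (\<lambda>_. 0)) ?K"
      by (rule Pi_pmf_subset[OF W(1) R(1)])
    finally have "pmf_of_set (bfs_trees E u) = map_pmf (tree_of ?R \<circ> ((\<lambda>y i. if i \<in> ?R then y i (parents E u i) else 0) \<circ>
        (\<lambda>y i. if i \<in> ?R then y i else (\<lambda>_. 0)))) ?K"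
      unfolding pmf_of_set_bfs_trees[OF E W] by (simp only: pmf.map_comp)
    also have "\<dots> = map_pmf (?t E) ?K"
      by (intro map_pmf_cong refl) (auto simp: tree_of_def)
    finally show ?thesis ..
  qed
  have "map_pmf (\<lambda>D. (graph W D, chosen_tree W D u)) (explore_pmf W w)
      = map_pmf (\<lambda>(c, K). (?g c, ?t (?g c) K)) (pair_pmf ?C ?K)"
    unfolding explore_pmf_def Pi_pmf_pair[OF W(1)] pmf.map_comp
    by (intro map_pmf_cong refl) (simp add: graph_def chosen_tree_def chosen_parent_def[abs_def] case_prod_unfold)
  also have "\<dots> = bind_pmf ?C (\<lambda>c. map_pmf (Pair (?g c)) (map_pmf (?t (?g c)) ?K))"
    unfolding pair_pmf_def map_bind_pmf map_return_pmf prod.case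
    by (simp add: map_pmf_def bind_assoc_pmf bind_return_pmf)
  also have "\<dots> = bind_pmf ?C (\<lambda>c. map_pmf (Pair (?g c)) (pmf_of_set (bfs_trees (?g c) u)))"
  proof (intro bind_pmf_cong refl arg_cong[where f = "map_pmf _"] tree)
    fix c assume "c \<in> set_pmf ?C"
    then show "?g c \<subseteq> W \<times> W" using set_rset[of W w] by (fastforce simp: set_Pi_pmf[OF W(1)] PiE_dflt_def)
  qed
  also have "\<dots> = bind_pmf (rset (W \<times> W) w) (\<lambda>E. map_pmf (Pair E) (pmf_of_set (bfs_trees E u)))"
    unfolding rset_Times[OF W(1) W(1)] by (simp add: bind_map_pmf)
  finally show ?thesis ..
qed

section \<open>Exponential moment of one level of the exploration\<close>

lemma exp_quadratic_bound:
  fixes y :: real assumes "y \<le> 1" shows "exp y \<le> 1 + y + y\<^sup>2"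
proof (cases "0 \<le> y")
  case True
  then show ?thesis using exp_bound[of y] assms by simp
next
  case False
  define x where "x = - y"
  then have x: "0 \<le> x" using False by simp
  have pos: "0 < 1 + x + x\<^sup>2 / 2" using x by (simp add: add_pos_nonneg)
  \<comment> \<open>With \<open>x = - y\<close> the claim reads
    \<open>1 \<le> (1 - x + x\<^sup>2) * exp x\<close>, and the quadratic Taylor bound of
    \<open>exp x\<close> is already enough for it.\<close>
  have "1 \<le> (1 - x + x\<^sup>2) * (1 + x + x\<^sup>2 / 2)"
  proof -
    have "(1 - x + x\<^sup>2) * (1 + x + x\<^sup>2 / 2) = 1 + x^2/2 + x^3/2 + x^4/2"
      by (simp add: field_simps power2_eq_square power3_eq_cube power4_eq_xxxx)
    then show ?thesis using x by simp
  qed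
  also have "\<dots> \<le> (1 - x + x\<^sup>2) * exp x"
  proof (rule mult_left_mono)
    show "1 + x + x\<^sup>2 / 2 \<le> exp x" by (rule exp_lower_Taylor_quadratic[OF x])
    show "0 \<le> 1 - x + x\<^sup>2"
      using zero_le_power2[of "x - 1/2"] by (simp add: power2_eq_square algebra_simps)
  qed
  finally have "1 * exp (- x) \<le> ((1 - x + x\<^sup>2) * exp x) * exp (- x)" by (intro mult_right_mono) auto
  then show ?thesis by (simp add: mult.assoc exp_add[symmetric] x_def)
qed

text \<open>One unexplored vertex, on the event that it has no edge from \<open>B\<close>. It is hit
  by \<open>S\<close> with probability \<open>\<phi>\<close> and its parent is then uniform on
  \<open>S\<close>, so the linear term of the exponent has mean \<open>y * (\<phi> * m)\<close>,
  which the prefactor cancels. What remains is \<open>\<phi> * y\<^sup>2\<close> and not merely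
  \<open>y\<^sup>2\<close>: this is how the sparsity of a level enters the variance.\<close>

lemma vertex_mgf:
  fixes F N :: "nat \<Rightarrow> real"
  assumes W: "finite W" "S \<subseteq> W" "B \<subseteq> W" "S \<inter> B = {}" and w: "0 \<le> w" "w \<le> 1"
    and F: "\<And>a. F a \<in> {0..1}" and N: "\<And>a. N a \<in> {0..1}" and y: "\<bar>y\<bar> \<le> 1"
  defines "\<phi> \<equiv> 1 - (1 - w) ^ card S" and "m \<equiv> (\<Sum>a\<in>S. N a * F a) / card S"
  shows "pexp (pair_pmf (rset W w) (choice_pmf W)) (\<lambda>(C, k). (if C \<inter> B = {} then 1 else 0) *
      (exp (- (y * (\<phi> * m))) * (if C \<inter> S = {} then 1 else 1 + F (k (C \<inter> S)) * (exp (y * N (k (C \<inter> S))) - 1))))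
    \<le> exp (\<phi> * y\<^sup>2) * pexp (pair_pmf (rset W w) (choice_pmf W)) (\<lambda>(C, k). if C \<inter> B = {} then 1 else 0)"
proof -
  have finS: "finite S" using W(1,2) by (rule finite_subset[rotated])
  have phi: "0 \<le> \<phi>" using w by (simp add: \<phi>_def power_le_one)
  define h where "h a = 1 + F a * (exp (y * N a) - 1)" for a
  define G where "G X = exp (- (y * (\<phi> * m))) * (if X = {} then 1 else (\<Sum>a\<in>X. h a) / card X)" for X
  have "pexp (pair_pmf (rset W w) (choice_pmf W)) (\<lambda>(C, k). (if C \<inter> B = {} then 1 else 0) *
      (exp (- (y * (\<phi> * m))) * (if C \<inter> S = {} then 1 else 1 + F (k (C \<inter> S)) * (exp (y * N (k (C \<inter> S))) - 1))))
    = pexp (rset W w) (\<lambda>C. (if C \<inter> B = {} then 1 else 0) * G (C \<inter> S))"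
    unfolding pexp_pair[OF finite_set_rset[OF W(1)] finite_set_choice[OF W(1)]] prod.case
  proof (intro pexp_cong)
    fix C
    have "pexp (choice_pmf W) (\<lambda>k. h (k (C \<inter> S))) = (\<Sum>a\<in>C \<inter> S. h a) / card (C \<inter> S)" if "C \<inter> S \<noteq> {}"
      using that W by (intro pexp_choice) auto
    then show "pexp (choice_pmf W) (\<lambda>k. (if C \<inter> B = {} then 1 else 0) * (exp (- (y * (\<phi> * m))) *
        (if C \<inter> S = {} then 1 else 1 + F (k (C \<inter> S)) * (exp (y * N (k (C \<inter> S))) - 1)))) =
        (if C \<inter> B = {} then 1 else 0) * G (C \<inter> S)"
      by (auto simp: G_def h_def)
  qed
  also have "\<dots> = pexp (rset W w) (\<lambda>C. if C \<inter> B = {} then 1 else 0) * pexp (rset S w) G"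
    by (rule pexp_rset_avoid[OF W])
  also have "pexp (rset S w) G = exp (- (y * (\<phi> * m))) * ((1 - w) ^ card S * 1 + \<phi> * ((\<Sum>a\<in>S. h a) / card S))"
    unfolding G_def \<phi>_def using pexp_rset_average[OF finS w, of 1 h] by simp
  also have "(1 - w) ^ card S * 1 + \<phi> * ((\<Sum>a\<in>S. h a) / card S) \<le> exp (\<phi> * (y * m) + \<phi> * y\<^sup>2)"
  proof -
    have "(\<Sum>a\<in>S. h a) \<le> (\<Sum>a\<in>S. 1 + y * (N a * F a) + y\<^sup>2)"
    proof (rule sum_mono)
      fix a
      have yN: "\<bar>y * N a\<bar> \<le> \<bar>y\<bar>" using N[of a] by (simp add: abs_mult mult_left_le)
      then have "y * N a \<le> 1" using y by linarith
      then have "exp (y * N a) - 1 \<le> y * N a + (y * N a)\<^sup>2" using exp_quadratic_bound[of "y * N a"] by simp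
      then have "F a * (exp (y * N a) - 1) \<le> F a * (y * N a + (y * N a)\<^sup>2)" using F[of a] by (intro mult_left_mono) auto
      moreover have "F a * (y * N a)\<^sup>2 \<le> 1 * y\<^sup>2"
        using F[of a] yN by (intro mult_mono) (auto simp: abs_le_square_iff)
      ultimately show "h a \<le> 1 + y * (N a * F a) + y\<^sup>2" unfolding h_def by (simp add: algebra_simps)
    qed
    then have "(\<Sum>a\<in>S. h a) \<le> card S * (1 + y\<^sup>2) + y * (\<Sum>a\<in>S. N a * F a)"
      by (simp add: sum.distrib sum_distrib_left algebra_simps)
    then have avg: "(\<Sum>a\<in>S. h a) / card S \<le> 1 + y\<^sup>2 + y * m" if "S \<noteq> {}"
      using that finS by (simp add: m_def field_simps card_gt_0_iff)
    have "\<phi> * ((\<Sum>a\<in>S. h a) / card S) \<le> \<phi> * (1 + y\<^sup>2 + y * m)"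
    \<comment> \<open>For an empty level \<open>\<phi> = 0\<close>, so both sides vanish.\<close>
    proof (cases "S = {}")
      case False
      from mult_left_mono[OF avg[OF this] phi] show ?thesis .
    qed (simp add: \<phi>_def)
    then have "(1 - w) ^ card S * 1 + \<phi> * ((\<Sum>a\<in>S. h a) / card S) \<le> 1 + (\<phi> * (y * m) + \<phi> * y\<^sup>2)"
      by (simp add: \<phi>_def algebra_simps)
    then show ?thesis using exp_ge_add_one_self[of "\<phi> * (y * m) + \<phi> * y\<^sup>2"] by linarith
  qed
  finally have "pexp (pair_pmf (rset W w) (choice_pmf W)) (\<lambda>(C, k). (if C \<inter> B = {} then 1 else 0) *
      (exp (- (y * (\<phi> * m))) * (if C \<inter> S = {} then 1 else 1 + F (k (C \<inter> S)) * (exp (y * N (k (C \<inter> S))) - 1))))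
     \<le> pexp (rset W w) (\<lambda>C. if C \<inter> B = {} then 1 else 0) * (exp (- (y * (\<phi> * m))) * exp (\<phi> * (y * m) + \<phi> * y\<^sup>2))"
    by (simp add: mult_left_mono)
  also have "exp (- (y * (\<phi> * m))) * exp (\<phi> * (y * m) + \<phi> * y\<^sup>2) = exp (\<phi> * y\<^sup>2)"
    by (simp add: exp_add[symmetric] mult_ac)
  finally show ?thesis
    by (simp add: pexp_pair[OF finite_set_rset[OF W(1)] finite_set_choice[OF W(1)]] mult.commute)
qed

lemma prod_list_unit: "(\<And>x. x \<in> set xs \<Longrightarrow> x \<in> {0..1::real}) \<Longrightarrow> prod_list xs \<in> {0..1}"
  by (induction xs) (auto intro: mult_le_one)

lemma nbr_vec_unit:
  assumes "\<And>a b. A a b \<in> {0..1}" shows "nbr_vec E A G u s i \<in> {0..1}"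
proof -
  have "(\<Prod>(a, b)\<leftarrow>tree_path G u i. A a b) \<in> {0..1}"
    using assms by (intro prod_list_unit) auto
  then show ?thesis by (simp add: nbr_vec_def)
qed

definition valid_exploration :: "nat set \<Rightarrow> (nat \<Rightarrow> nat set \<times> (nat set \<Rightarrow> nat)) \<Rightarrow> bool" where
  "valid_exploration W D \<longleftrightarrow> (\<forall>i\<in>W. fst (D i) \<subseteq> W \<and> (\<forall>A. A \<subseteq> W \<longrightarrow> A \<noteq> {} \<longrightarrow> snd (D i) A \<in> A))"

lemma set_explore_valid:
  assumes "finite W" "D \<in> set_pmf (explore_pmf W w)" shows "valid_exploration W D"
proof -
  have *: "D i \<in> set_pmf (rset W w) \<times> set_pmf (choice_pmf W)" if "i \<in> W" for i
    using assms that by (auto simp: explore_pmf_def set_Pi_pmf PiE_dflt_def)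
  show ?thesis unfolding valid_exploration_def
  proof (intro ballI conjI allI impI)
    fix i assume i: "i \<in> W"
    show "fst (D i) \<subseteq> W" using *[OF i] set_rset[of W w] by (auto simp: mem_Times_iff)
    fix A assume "A \<subseteq> W" "A \<noteq> {}"
    then show "snd (D i) A \<in> A" using *[OF i] choice_in[OF assms(1)] by (auto simp: mem_Times_iff)
  qed
qed

text \<open>The exponential of a level deviation after every entry of \<open>Z\<close> on a tree
  edge into level \<open>Suc s\<close> has been bounded by the chord of \<open>exp\<close> and
  replaced by its conditional mean \<open>F\<close>. Each vertex outside the ball carries a
  compensator for its expected contribution; each vertex that is reached carries in addition one
  factor affine in \<open>F\<close>.\<close>

definition level_weight ::
  "nat set \<Rightarrow> real \<Rightarrow> nat \<Rightarrow> nat \<Rightarrow> (nat \<Rightarrow> nat \<Rightarrow> real) \<Rightarrow> (nat \<Rightarrow> nat \<Rightarrow> real) \<Rightarrow> (nat \<Rightarrow> real)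
    \<Rightarrow> (nat \<times> nat) set \<Rightarrow> (nat \<times> nat) set \<Rightarrow> real" where
  "level_weight W w u s F z y E G =
    (\<Prod>i\<in>W - (\<Union>j\<le>s. sphere_at E u j).
      exp (- (y i * ((1 - (1 - w) ^ card (sphere_at E u s)) *
        ((\<Sum>a\<in>sphere_at E u s. nbr_vec E z G u s a * F a i) / card (sphere_at E u s))))) *
      (if i \<in> sphere_at E u (Suc s)
       then 1 + F (tree_parent G i) i * (exp (y i * nbr_vec E z G u s (tree_parent G i)) - 1) else 1))"

text \<open>All that an unexplored vertex feels of the past: which vertices belong to earlier levels
  and which form the current one. The possible histories are finite in number, and each exploration
  has exactly one.\<close>

definition hist :: "nat set \<Rightarrow> nat \<Rightarrow> nat \<Rightarrow> nat set \<Rightarrow> nat set \<Rightarrow> (nat \<Rightarrow> nat set \<times> (nat set \<Rightarrow> nat)) \<Rightarrow> bool" where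
  "hist W u s B S D \<longleftrightarrow> (\<Union>j<s. sphere_at (graph W D) u j) = B \<and> sphere_at (graph W D) u s = S"

text \<open>The data revealed by a history. The other vertices get the default value of
  \<open>explore_pmf\<close>, in the form in which \<open>Pi_pmf_split_bound\<close> freezes
  coordinates.\<close>

definition cutd :: "nat set \<Rightarrow> nat set \<Rightarrow> (nat \<Rightarrow> nat set \<times> (nat set \<Rightarrow> nat)) \<Rightarrow> nat \<Rightarrow> nat set \<times> (nat set \<Rightarrow> nat)" where
  "cutd B S D = (\<lambda>i. if i \<in> B \<union> S then D i else ({}, \<lambda>_. 0))"

context
  fixes W :: "nat set" and u s :: nat and B S :: "nat set" and D :: "nat \<Rightarrow> nat set \<times> (nat set \<Rightarrow> nat)"
  assumes W: "finite W" "u \<in> W" and BS: "B \<subseteq> W" "S \<subseteq> W"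
    and D: "valid_exploration W D"
begin

lemma graph_subset: "graph W D \<subseteq> W \<times> W"
  using D by (auto simp: graph_def valid_exploration_def)

lemma graph_cut_subset: "graph W (cutd B S D) \<subseteq> W \<times> W"
  using D by (auto simp: graph_def valid_exploration_def cutd_def split: if_splits)

lemma graph_cut_iff: "(a, i) \<in> graph W (cutd B S D) \<longleftrightarrow> (a, i) \<in> graph W D \<and> i \<in> B \<union> S"
  by (auto simp: graph_def cutd_def)

text \<open>An edge leaving \<open>B\<close> ends at distance at most \<open>s\<close>, hence in
  \<open>B \<union> S\<close>; so cutting the data of the other vertices removes no such
  edge.\<close>

lemma hist_agree:
  assumes "hist W u s B S D"
  shows "graph W D \<inter> B \<times> UNIV = graph W (cutd B S D) \<inter> B \<times> UNIV"
proof -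
  have "i \<in> B \<union> S" if ai: "(a, i) \<in> graph W D" "a \<in> B" for a i
  proof -
    from ai(2) assms obtain j where j: "j < s" "a \<in> sphere_at (graph W D) u j" unfolding hist_def by blast
    then have "(u, i) \<in> graph W D ^^ Suc j" using ai(1) sphere_at_relpow by fastforce
    then obtain k where "k \<le> Suc j" "i \<in> sphere_at (graph W D) u k" using relpow_sphere_at by blast
    moreover have "k < s \<or> k = s" using \<open>k \<le> Suc j\<close> j(1) by linarith
    ultimately show ?thesis using assms unfolding hist_def by blast
  qed
  then show ?thesis by (auto simp: graph_cut_iff)
qed

lemma hist_spheres: "hist W u s B S D \<Longrightarrow> j \<le> s \<Longrightarrow> sphere_at (graph W (cutd B S D)) u j = sphere_at (graph W D) u j"
proof -
  assume h: "hist W u s B S D" and j: "j \<le> s"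
  have "(\<Union>j<s. sphere_at (graph W D) u j) = B" using h by (simp add: hist_def)
  with hist_agree[OF h] j show ?thesis by (intro sphere_at_local) auto
qed

text \<open>The history is an event about the data of the explored vertices, intersected with one
  event for each unexplored vertex, namely that it has no edge from \<open>B\<close>. This product
  form keeps the unexplored vertices independent given the history.\<close>

lemma hist_iff: "hist W u s B S D \<longleftrightarrow> hist W u s B S (cutd B S D) \<and> (\<forall>i\<in>W - (B \<union> S). fst (D i) \<inter> B = {})"
proof (intro iffI conjI ballI)
  assume h: "hist W u s B S D"
  show "hist W u s B S (cutd B S D)" using h hist_spheres[OF h] unfolding hist_def by auto
  fix i assume i: "i \<in> W - (B \<union> S)"
  show "fst (D i) \<inter> B = {}"
  proof (rule ccontr)
    assume "fst (D i) \<inter> B \<noteq> {}"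
    then obtain a where "a \<in> fst (D i)" "a \<in> B" by blast
    then have "(a, i) \<in> graph W D \<inter> B \<times> UNIV" using i by (auto simp: graph_def)
    then have "(a, i) \<in> graph W (cutd B S D)" using hist_agree[OF h] by blast
    then show False using i by (simp add: graph_cut_iff)
  qed
next
  assume h: "hist W u s B S (cutd B S D) \<and> (\<forall>i\<in>W - (B \<union> S). fst (D i) \<inter> B = {})"
  have "i \<in> B \<union> S" if "(a, i) \<in> graph W D" "a \<in> B" for a i
    using that h by (fastforce simp: graph_def)
  then have "graph W (cutd B S D) \<inter> B \<times> UNIV = graph W D \<inter> B \<times> UNIV"
    by (auto simp: graph_cut_iff)
  then have "sphere_at (graph W D) u j = sphere_at (graph W (cutd B S D)) u j" if "j \<le> s" for j
    using that h by (intro sphere_at_local) (auto simp: hist_def)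
  then show "hist W u s B S D" using h unfolding hist_def by auto
qed

lemma chosen_parent_valid: "i \<in> targets (graph W D) u \<Longrightarrow> chosen_parent W D u i \<in> parents (graph W D) u i"
  unfolding chosen_parent_def
  using D parents_subset[OF graph_subset] parents_nonempty targets_subset[OF graph_subset W(2)]
  by (simp add: valid_exploration_def subset_iff)

lemma chosen_parent_cut_valid: "i \<in> targets (graph W (cutd B S D)) u \<Longrightarrow> chosen_parent W (cutd B S D) u i \<in> parents (graph W (cutd B S D)) u i"
proof -
  assume i: "i \<in> targets (graph W (cutd B S D)) u"
  then have ne: "parents (graph W (cutd B S D)) u i \<noteq> {}" by (rule parents_nonempty)
  then have "i \<in> B \<union> S" unfolding parents_def by (auto simp: graph_cut_iff)
  moreover have "i \<in> W" using i targets_subset[OF graph_cut_subset W(2)] by blast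
  ultimately show ?thesis unfolding chosen_parent_def
    using D parents_subset[OF graph_cut_subset] ne by (simp add: valid_exploration_def cutd_def)
qed

text \<open>Up to level \<open>s\<close> the parents, and with them the path products, are read off
  from data in \<open>B \<union> S\<close>; the unexplored vertices have no influence on
  them.\<close>

lemma hist_nbr_vec:
  assumes h: "hist W u s B S D"
  shows "j \<le> s \<Longrightarrow> a \<in> sphere_at (graph W D) u j \<Longrightarrow>
    nbr_vec (graph W (cutd B S D)) z (chosen_tree W (cutd B S D) u) u j a = nbr_vec (graph W D) z (chosen_tree W D u) u j a"
proof (induction j arbitrary: a)
  case 0
  have "chosen_tree W D u \<in> bfs_trees (graph W D) u" "chosen_tree W (cutd B S D) u \<in> bfs_trees (graph W (cutd B S D)) u"
    using tree_of_bfs[OF chosen_parent_valid] tree_of_bfs[OF chosen_parent_cut_valid]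
    by (simp_all add: chosen_tree_def)
  then show ?case by (simp add: nbr_vec_0)
next
  case (Suc j)
  have a: "a \<in> sphere_at (graph W D) u (Suc j)" "a \<in> sphere_at (graph W (cutd B S D)) u (Suc j)"
    using Suc.prems hist_spheres[OF h] by auto
  have sj: "sphere_at (graph W (cutd B S D)) u j = sphere_at (graph W D) u j" using Suc.prems hist_spheres[OF h] by simp
  have sub: "sphere_at (graph W D) u j \<subseteq> B" using h Suc.prems unfolding hist_def by auto
  have aBS: "a \<in> B \<union> S"
  proof (cases "Suc j = s")
    case True then show ?thesis using a(1) h unfolding hist_def by blast
  next
    case False
    then have "Suc j < s" using Suc.prems by simp
    then show ?thesis using a(1) h unfolding hist_def by blast
  qed
  have "parents (graph W (cutd B S D)) u a = parents (graph W D) u a"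
    unfolding parents_eq[OF a(1)] parents_eq[OF a(2)] sj using aBS by (auto simp: graph_cut_iff)
  then have pa: "chosen_parent W (cutd B S D) u a = chosen_parent W D u a"
    using aBS by (simp add: chosen_parent_def cutd_def)
  have "chosen_parent W D u a \<in> sphere_at (graph W D) u j"
    using chosen_parent_valid[of a] a(1) parents_eq[OF a(1)] by (auto simp: targets_iff)
  from Suc.IH[OF _ this] Suc.prems(1)
  show ?case
    using nbr_vec_Suc[OF chosen_parent_valid chosen_tree_def a(1)]
      nbr_vec_Suc[OF chosen_parent_cut_valid chosen_tree_def a(2)] pa by simp
qed

text \<open>The edges from \<open>B\<close> being excluded, the way an unexplored vertex enters the
  next level is decided by its own datum and the set \<open>S\<close>.\<close>

lemma hist_level:
  assumes h: "hist W u s B S D" and i: "i \<in> W - (B \<union> S)"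
  shows "i \<in> sphere_at (graph W D) u (Suc s) \<longleftrightarrow> fst (D i) \<inter> S \<noteq> {}"
    and "i \<in> sphere_at (graph W D) u (Suc s) \<Longrightarrow> tree_parent (chosen_tree W D u) i = snd (D i) (fst (D i) \<inter> S)"
proof -
  have ball: "(\<Union>j\<le>s. sphere_at (graph W D) u j) = B \<union> S"
    using h unfolding hist_def by (auto simp: le_less)
  have "i \<in> sphere_at (graph W D) u (Suc s) \<longleftrightarrow> i \<in> graph W D `` S"
    unfolding sphere_at_Suc ball using i h unfolding hist_def by blast
  also have "\<dots> \<longleftrightarrow> fst (D i) \<inter> S \<noteq> {}" using i by (auto simp: graph_def)
  finally show "i \<in> sphere_at (graph W D) u (Suc s) \<longleftrightarrow> fst (D i) \<inter> S \<noteq> {}" .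
  assume l: "i \<in> sphere_at (graph W D) u (Suc s)"
  then have it: "i \<in> targets (graph W D) u" by (auto simp: targets_iff)
  have "parents (graph W D) u i = fst (D i) \<inter> S"
    unfolding parents_eq[OF l] using h i unfolding hist_def by (auto simp: graph_def)
  then show "tree_parent (chosen_tree W D u) i = snd (D i) (fst (D i) \<inter> S)"
    unfolding chosen_tree_def tree_parent_tree_of[OF it] by (simp add: chosen_parent_def)
qed

end


text \<open>Decompose over histories. Given one whose level \<open>s\<close> has at most
  \<open>m\<close> vertices, the unexplored vertices are independent, and by
  \<open>vertex_mgf\<close> each contributes a factor of at most
  \<open>exp (w * m * b\<^sup>2)\<close>. The truncation at \<open>m\<close> stands in for a bound
  on the level size, which is available only with high probability.\<close>

lemma level_mgf:
  fixes F z :: "nat \<Rightarrow> nat \<Rightarrow> real" and w b m :: real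
  assumes W: "finite W" "u \<in> W" and w: "0 \<le> w" "w \<le> 1"
    and F: "\<And>a i. F a i \<in> {0..1}" and z: "\<And>a i. z a i \<in> {0..1}"
    and y: "\<And>i. \<bar>y i\<bar> \<le> b" and b: "b \<le> 1"
  shows "pexp (rset (W \<times> W) w) (\<lambda>E. pexp (pmf_of_set (bfs_trees E u)) (\<lambda>G.
      if real (card (sphere_at E u s)) \<le> m then level_weight W w u s F z y E G else 0))
    \<le> exp (card W * (w * m) * b\<^sup>2)"
proof (cases "0 \<le> m")
  case False
  then have "pexp (rset (W \<times> W) w) (\<lambda>E. pexp (pmf_of_set (bfs_trees E u)) (\<lambda>G.
      if real (card (sphere_at E u s)) \<le> m then level_weight W w u s F z y E G else 0)) = 0"
    by (simp add: not_le order.strict_trans2)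
  then show ?thesis by simp
next
  case m: True
  let ?Q = "explore_pmf W w"
  \<comment> \<open>The bound for a single vertex. Its hitting probability is at most
    \<open>w * m\<close> by Bernoulli's inequality.\<close>
  define K where "K = exp (w * m * b\<^sup>2)"
  have K1: "1 \<le> K" using w m by (simp add: K_def)
  define \<Psi> where "\<Psi> D = (if real (card (sphere_at (graph W D) u s)) \<le> m
      then level_weight W w u s F z y (graph W D) (chosen_tree W D u) else 0)" for D
  have finQ: "finite (set_pmf ?Q)" using W by simp
  have ind: "pexp ?Q (\<lambda>D. if hist W u s B S D then \<Psi> D else 0) \<le> K ^ card W * pexp ?Q (\<lambda>D. if hist W u s B S D then 1 else 0)"
    if BS: "B \<subseteq> W" "S \<subseteq> W" for B S
  \<comment> \<open>Otherwise the left side is 0: a level larger than \<open>m\<close> is truncated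
    away, and overlapping sets \<open>B\<close> and \<open>S\<close> never form a history.\<close>
  proof (cases "real (card S) \<le> m \<and> S \<inter> B = {}")
    case False
    have "\<not> hist W u s B S D" if "S \<inter> B \<noteq> {}" for D
    proof
      assume "hist W u s B S D"
      with that obtain a j where "j < s" "a \<in> sphere_at (graph W D) u s" "a \<in> sphere_at (graph W D) u j"
        unfolding hist_def by blast
      then show False using sphere_at_unique[of a "graph W D" u s j] by auto
    qed
    then have "(if hist W u s B S D then \<Psi> D else 0) = 0" for D
      using False unfolding \<Psi>_def hist_def by auto
    then show ?thesis using K1 by (simp add: Bochner_Integration.integral_nonneg)
  next
    case True
    define U where "U = W - (B \<union> S)"
    have WU: "W = (B \<union> S) \<union> U" "(B \<union> S) \<inter> U = {}" "finite (B \<union> S)" "finite U"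
      using BS W(1) finite_subset by (auto simp: U_def)
    define \<phi> where "\<phi> = 1 - (1 - w) ^ card S"
    have phi: "0 \<le> \<phi>" "\<phi> \<le> w * m"
    proof -
      show "0 \<le> \<phi>" using w by (simp add: \<phi>_def power_le_one)
      have "1 + real (card S) * (- w) \<le> (1 + - w) ^ card S" by (rule Bernoulli_inequality) (use w in auto)
      then have "\<phi> \<le> card S * w" by (simp add: \<phi>_def)
      also have "\<dots> \<le> m * w" using True w by (intro mult_right_mono) auto
      finally show "\<phi> \<le> w * m" by (simp add: mult.commute)
    qed
    define N where "N D = nbr_vec (graph W D) z (chosen_tree W D u) u s" for D
    define h where "h = (\<lambda>(i :: nat) (D :: nat \<Rightarrow> nat set \<times> (nat set \<Rightarrow> nat)) (C :: nat set, k :: nat set \<Rightarrow> nat).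
      if C \<inter> B = {} then 1 else 0 :: real)"
    define g where "g = (\<lambda>i D (C, k). (if C \<inter> B = {} then 1 else 0) *
      (exp (- (y i * (\<phi> * ((\<Sum>a\<in>S. N D a * F a i) / card S)))) *
       (if C \<inter> S = {} then 1 else 1 + F (k (C \<inter> S)) i * (exp (y i * N D (k (C \<inter> S))) - 1))))"
    define H where "H D = (if hist W u s B S D then 1 else 0 :: real)" for D
    have N01: "N D a \<in> {0..1}" for D a unfolding N_def by (rule nbr_vec_unit[OF z])
    have factor: "0 \<le> 1 + F a i * (exp (x) - 1)" if "- 1 \<le> x" for a i x
    proof -
      have "F a i * (1 - exp x) \<le> F a i * 1" using F[of a i] by (intro mult_left_mono) auto
      also have "\<dots> \<le> 1" using F[of a i] by simp
      finally have "F a i * (1 - exp x) \<le> 1" .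
      then show ?thesis by (simp add: right_diff_distrib)
    qed
    have yN: "- 1 \<le> y i * N D a" for i D a
    proof -
      have "\<bar>y i * N D a\<bar> \<le> \<bar>y i\<bar>" using N01[of D a] by (simp add: abs_mult mult_left_le)
      then show ?thesis using y[of i] b by linarith
    qed
    have split: "(if hist W u s B S D then \<Psi> D else 0) = H (cutd B S D) * (\<Prod>i\<in>U. g i (cutd B S D) (D i))"
      "(if hist W u s B S D then 1 else 0) = H (cutd B S D) * (\<Prod>i\<in>U. h i (cutd B S D) (D i))"
      if "D \<in> set_pmf ?Q" for D
    proof -
      have val: "valid_exploration W D" by (rule set_explore_valid[OF W(1) that])
      have hi: "hist W u s B S D \<longleftrightarrow> hist W u s B S (cutd B S D) \<and> (\<forall>i\<in>U. fst (D i) \<inter> B = {})"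
        unfolding U_def by (rule hist_iff[OF W BS val])
      have hprod: "(\<Prod>i\<in>U. h i (cutd B S D) (D i)) = (if \<forall>i\<in>U. fst (D i) \<inter> B = {} then 1 else 0)"
        using WU(4) by (auto simp: h_def case_prod_unfold intro!: prod.neutral)
      then show "(if hist W u s B S D then 1 else 0) = H (cutd B S D) * (\<Prod>i\<in>U. h i (cutd B S D) (D i))"
        unfolding H_def hi by auto
      show "(if hist W u s B S D then \<Psi> D else 0) = H (cutd B S D) * (\<Prod>i\<in>U. g i (cutd B S D) (D i))"
      proof (cases "hist W u s B S D")
        case False
        then consider "H (cutd B S D) = 0" | i where "i \<in> U" "fst (D i) \<inter> B \<noteq> {}"
          unfolding hi H_def by auto
        then show ?thesis
        proof cases
          case 2
          then have "(\<Prod>i\<in>U. g i (cutd B S D) (D i)) = 0"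
            using WU(4) by (intro prod_zero) (auto simp: g_def case_prod_unfold)
          then show ?thesis using False by simp
        qed (use False in simp)
      next
        case h: True
        have Ssp: "sphere_at (graph W D) u s = S" using h by (simp add: hist_def)
        have ball: "(\<Union>j\<le>s. sphere_at (graph W D) u j) = B \<union> S"
          using h unfolding hist_def by (auto simp: le_less)
        have Neq: "nbr_vec (graph W D) z (chosen_tree W D u) u s a = N (cutd B S D) a" if "a \<in> S" for a
          unfolding N_def using hist_nbr_vec[OF W BS val h, of s a z] that Ssp by simp
        have "\<Psi> D = level_weight W w u s F z y (graph W D) (chosen_tree W D u)"
          using True by (simp add: \<Psi>_def Ssp)
        also have "\<dots> = (\<Prod>i\<in>U. g i (cutd B S D) (D i))"
          unfolding level_weight_def ball U_def[symmetric] Ssp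
        proof (rule prod.cong[OF refl])
          fix i assume i: "i \<in> U"
          then have iU: "i \<in> W - (B \<union> S)" by (simp add: U_def)
          have sum_eq: "(\<Sum>a\<in>S. nbr_vec (graph W D) z (chosen_tree W D u) u s a * F a i) = (\<Sum>a\<in>S. N (cutd B S D) a * F a i)"
            using Neq by (intro sum.cong) auto
          have lev: "i \<in> sphere_at (graph W D) u (Suc s) \<longleftrightarrow> fst (D i) \<inter> S \<noteq> {}"
            by (rule hist_level(1)[OF W BS val h iU])
          have B0: "fst (D i) \<inter> B = {}" using h i unfolding hi by blast
          show "exp (- (y i * ((1 - (1 - w) ^ card S) * ((\<Sum>a\<in>S. nbr_vec (graph W D) z (chosen_tree W D u) u s a * F a i) / card S)))) *
            (if i \<in> sphere_at (graph W D) u (Suc s)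
             then 1 + F (tree_parent (chosen_tree W D u) i) i * (exp (y i * nbr_vec (graph W D) z (chosen_tree W D u) u s (tree_parent (chosen_tree W D u) i)) - 1) else 1)
            = g i (cutd B S D) (D i)"
          proof (cases "fst (D i) \<inter> S = {}")
            case True
            then show ?thesis using B0 lev by (simp add: g_def case_prod_unfold sum_eq \<phi>_def)
          next
            case False
            then have l: "i \<in> sphere_at (graph W D) u (Suc s)" using lev by simp
            have par: "tree_parent (chosen_tree W D u) i = snd (D i) (fst (D i) \<inter> S)"
              by (rule hist_level(2)[OF W BS val h iU l])
            have "snd (D i) (fst (D i) \<inter> S) \<in> fst (D i) \<inter> S"
            proof -
              have "fst (D i) \<inter> S \<subseteq> W" "i \<in> W" using BS iU by auto
              then show ?thesis using val False unfolding valid_exploration_def by blast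
            qed
            then have "nbr_vec (graph W D) z (chosen_tree W D u) u s (snd (D i) (fst (D i) \<inter> S)) = N (cutd B S D) (snd (D i) (fst (D i) \<inter> S))"
              by (intro Neq) auto
            then show ?thesis using B0 False l by (simp add: g_def case_prod_unfold sum_eq \<phi>_def par)
          qed
        qed
        finally show ?thesis using h hi by (simp add: H_def)
      qed
    qed
    have cutd_eq: "(\<lambda>i. if i \<in> B \<union> S then D i else ({}, \<lambda>_. 0)) = cutd B S D" for D :: "nat \<Rightarrow> nat set \<times> (nat set \<Rightarrow> nat)"
      by (simp add: cutd_def)
    have "pexp ?Q (\<lambda>D. if hist W u s B S D then \<Psi> D else 0) = pexp ?Q (\<lambda>D. H (cutd B S D) * (\<Prod>i\<in>U. g i (cutd B S D) (D i)))"
      by (rule pexp_cong[OF split(1)])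
    also have "\<dots> \<le> K ^ card U * pexp ?Q (\<lambda>D. H (cutd B S D) * (\<Prod>i\<in>U. h i (cutd B S D) (D i)))"
    proof -
      have "pexp (Pi_pmf (B \<union> S \<union> U) ({}, \<lambda>_. 0) (\<lambda>_. pair_pmf (rset W w) (choice_pmf W)))
          (\<lambda>D. H (\<lambda>i. if i \<in> B \<union> S then D i else ({}, \<lambda>_. 0)) * (\<Prod>i\<in>U. g i (\<lambda>i. if i \<in> B \<union> S then D i else ({}, \<lambda>_. 0)) (D i)))
        \<le> K ^ card U * pexp (Pi_pmf (B \<union> S \<union> U) ({}, \<lambda>_. 0) (\<lambda>_. pair_pmf (rset W w) (choice_pmf W)))
          (\<lambda>D. H (\<lambda>i. if i \<in> B \<union> S then D i else ({}, \<lambda>_. 0)) * (\<Prod>i\<in>U. h i (\<lambda>i. if i \<in> B \<union> S then D i else ({}, \<lambda>_. 0)) (D i)))"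
      proof (rule Pi_pmf_split_bound)
        show "finite (B \<union> S)" "finite U" "(B \<union> S) \<inter> U = {}" using WU by auto
        show "finite (set_pmf (pair_pmf (rset W w) (choice_pmf W)))" using W by simp
        show "0 \<le> H D" for D by (simp add: H_def)
        show "0 \<le> h i D x" for i D x by (simp add: h_def case_prod_unfold)
        show "0 \<le> g i D x" for i D x
          unfolding g_def case_prod_unfold using factor[OF yN] by auto
        fix i and D :: "nat \<Rightarrow> nat set \<times> (nat set \<Rightarrow> nat)"
        have y1: "\<bar>y i\<bar> \<le> 1" using y[of i] b by linarith
        have disj: "S \<inter> B = {}" using True by simp
        have "pexp (pair_pmf (rset W w) (choice_pmf W)) (g i D) \<le> exp (\<phi> * (y i)\<^sup>2) * pexp (pair_pmf (rset W w) (choice_pmf W)) (h i D)"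
          unfolding g_def h_def \<phi>_def
          by (rule vertex_mgf[OF W(1) BS(2,1) disj w F N01 y1])
        also have "\<dots> \<le> K * pexp (pair_pmf (rset W w) (choice_pmf W)) (h i D)"
        proof (rule mult_right_mono)
          have "(y i)\<^sup>2 \<le> b\<^sup>2" using y[of i] by (simp add: abs_le_square_iff[symmetric])
          then have "\<phi> * (y i)\<^sup>2 \<le> (w * m) * b\<^sup>2" using phi by (intro mult_mono) auto
          then show "exp (\<phi> * (y i)\<^sup>2) \<le> K" by (simp add: K_def)
          show "0 \<le> pexp (pair_pmf (rset W w) (choice_pmf W)) (h i D)"
            by (rule Bochner_Integration.integral_nonneg) (simp add: h_def case_prod_unfold)
        qed
        finally show "pexp (pair_pmf (rset W w) (choice_pmf W)) (g i D) \<le> K * pexp (pair_pmf (rset W w) (choice_pmf W)) (h i D)" .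
      qed
      then show ?thesis unfolding cutd_eq WU(1)[symmetric] explore_pmf_def .
    qed
    also have "pexp ?Q (\<lambda>D. H (cutd B S D) * (\<Prod>i\<in>U. h i (cutd B S D) (D i))) = pexp ?Q (\<lambda>D. if hist W u s B S D then 1 else 0)"
      by (rule pexp_cong[OF split(2)[symmetric]])
    also have "K ^ card U * \<dots> \<le> K ^ card W * \<dots>"
      using K1 card_mono[OF W(1), of U] by (intro mult_right_mono power_increasing Bochner_Integration.integral_nonneg) (auto simp: U_def)
    finally show ?thesis .
  qed
  have finE: "finite (set_pmf (pmf_of_set (bfs_trees E u)))" if "E \<in> set_pmf (rset (W \<times> W) w)" for E
  proof -
    have "E \<subseteq> W \<times> W" using that set_rset by blast
    then show ?thesis using bfs_trees_nonempty[of E W u] finite_bfs_trees[of E u] W(1) finite_subset[of E "W \<times> W"] by simp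
  qed
  \<comment> \<open>Exactly one pair of sets is the history of a given exploration, so inserting the
    sum over all pairs changes nothing.\<close>
  have decomp: "pexp ?Q \<Psi> = pexp ?Q (\<lambda>D. \<Sum>p\<in>Pow W \<times> Pow W. if hist W u s (fst p) (snd p) D then \<Psi> D else 0)"
    and total: "pexp ?Q (\<lambda>D. \<Sum>p\<in>Pow W \<times> Pow W. if hist W u s (fst p) (snd p) D then 1 else 0) = pexp ?Q (\<lambda>_. 1)"
  proof -
    have *: "(\<Sum>p\<in>Pow W \<times> Pow W. if hist W u s (fst p) (snd p) D then x else 0) = x" if D: "D \<in> set_pmf ?Q" for D and x :: real
    proof -
      have sub: "sphere_at (graph W D) u j \<subseteq> W" for j
        using set_explore_valid[OF W(1) D] W(2) by (intro sphere_at_subset) (auto simp: graph_def valid_exploration_def)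
      let ?p = "((\<Union>j<s. sphere_at (graph W D) u j), sphere_at (graph W D) u s)"
      have "(\<Sum>p\<in>Pow W \<times> Pow W. if hist W u s (fst p) (snd p) D then x else 0) = (\<Sum>p\<in>Pow W \<times> Pow W. if p = ?p then x else 0)"
        by (rule sum.cong) (auto simp: hist_def)
      also have "\<dots> = x" using sub W(1) by (simp add: sum.delta UN_subset_iff)
      finally show ?thesis .
    qed
    show "pexp ?Q \<Psi> = pexp ?Q (\<lambda>D. \<Sum>p\<in>Pow W \<times> Pow W. if hist W u s (fst p) (snd p) D then \<Psi> D else 0)"
      "pexp ?Q (\<lambda>D. \<Sum>p\<in>Pow W \<times> Pow W. if hist W u s (fst p) (snd p) D then 1 else 0) = pexp ?Q (\<lambda>_. 1)"
      by (intro pexp_cong; simp add: *)+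
  qed
  have "pexp (rset (W \<times> W) w) (\<lambda>E. pexp (pmf_of_set (bfs_trees E u)) (\<lambda>G.
      if real (card (sphere_at E u s)) \<le> m then level_weight W w u s F z y E G else 0))
    = pexp (bind_pmf (rset (W \<times> W) w) (\<lambda>E. map_pmf (Pair E) (pmf_of_set (bfs_trees E u))))
       (\<lambda>(E, G). if real (card (sphere_at E u s)) \<le> m then level_weight W w u s F z y E G else 0)"
    using W finE by (subst pexp_bind) auto
  also have "\<dots> = pexp ?Q \<Psi>"
    unfolding explore_law[OF W] by (simp add: \<Psi>_def[abs_def])
  also have "\<dots> = (\<Sum>p\<in>Pow W \<times> Pow W. pexp ?Q (\<lambda>D. if hist W u s (fst p) (snd p) D then \<Psi> D else 0))"
    unfolding decomp by (rule pexp_swap_sum[OF finQ])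
  also have "\<dots> \<le> (\<Sum>p\<in>Pow W \<times> Pow W. K ^ card W * pexp ?Q (\<lambda>D. if hist W u s (fst p) (snd p) D then 1 else 0))"
    by (intro sum_mono ind) auto
  also have "\<dots> = K ^ card W * pexp ?Q (\<lambda>D. \<Sum>p\<in>Pow W \<times> Pow W. if hist W u s (fst p) (snd p) D then 1 else 0)"
    unfolding sum_distrib_left[symmetric] pexp_swap_sum[OF finQ] ..
  also have "\<dots> = K ^ card W" unfolding total by simp
  also have "\<dots> = exp (card W * (w * m) * b\<^sup>2)"
    by (simp add: K_def exp_of_nat_mult[symmetric] mult.assoc)
  finally show ?thesis .
qed

section \<open>Replacing entries of \<open>Z\<close> by their conditional means\<close>

text \<open>The function \<open>f\<close> is controlled on the unit square only, so measurability in
  the latent variables is obtained from a Borel function \<open>f'\<close> that agrees with it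
  there.\<close>

locale sample_model = latent_model P n f p \<theta> Z mrk T
  for P :: "'w measure" and n :: nat and f :: "real \<Rightarrow> real \<Rightarrow> real" and p :: real
    and \<theta> :: "nat \<Rightarrow> 'w \<Rightarrow> real" and Z :: "nat \<times> nat \<Rightarrow> 'w \<Rightarrow> real"
    and mrk :: "nat \<times> nat \<Rightarrow> 'w \<Rightarrow> mark" and T :: "nat \<Rightarrow> 'w \<Rightarrow> (nat \<times> nat) set" +
  fixes f' :: "real \<times> real \<Rightarrow> real"
  assumes n_pos: "1 \<le> n"
    and p_pos: "0 < p" and p_le_1: "p \<le> 1"
    and f_range: "x \<in> {0..1} \<Longrightarrow> y \<in> {0..1} \<Longrightarrow> f x y \<in> {0..1}"
    and f'_measurable [measurable]: "f' \<in> borel_measurable borel"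
    and f'_eq: "x \<in> {0..1} \<Longrightarrow> y \<in> {0..1} \<Longrightarrow> f' (x, y) = f x y"
begin

abbreviation "V \<equiv> {1..n}"

definition mean :: "nat \<times> nat \<Rightarrow> 'w \<Rightarrow> real" where
  "mean e w = f (\<theta> (fst e) w) (\<theta> (snd e) w)"

definition rect :: "(nat \<times> nat) set \<Rightarrow> (nat \<Rightarrow> real set) \<Rightarrow> (nat \<times> nat \<Rightarrow> real set) \<Rightarrow> 'w set" where
  "rect S a b = {w \<in> space P. (\<forall>i\<in>V. \<theta> i w \<in> a i) \<and> (\<forall>e\<in>S. Z e w \<in> b e)}"

text \<open>What is known from all latent variables and the entries of \<open>Z\<close> indexed by
  \<open>S\<close>. It is generated by rectangles because these are stable under intersection and
  directly accessible to the conditional independence assumption.\<close>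

definition info :: "(nat \<times> nat) set \<Rightarrow> 'w measure" where
  "info S = sigma (space P) {rect S a b | a b. range a \<subseteq> sets borel \<and> range b \<subseteq> sets borel}"

lemma theta_measurable: "i \<in> V \<Longrightarrow> \<theta> i \<in> borel_measurable P"
  using theta_indep by (auto simp: indep_vars_def)

lemma mark_measurable: "e \<in> V \<times> V \<Longrightarrow> mrk e \<in> P \<rightarrow>\<^sub>M count_space UNIV"
  using mark_indep by (auto simp: indep_vars_def)

lemma rect_sets:
  assumes "S \<subseteq> V \<times> V" "range a \<subseteq> sets borel" "range b \<subseteq> sets borel"
  shows "rect S a b \<in> sets P"
proof -
  have fin: "finite S" using assms(1) finite_subset by blast
  have a: "a i \<in> sets borel" and b: "b e \<in> sets borel" for i e using assms by auto
  have "{w \<in> space P. \<forall>i\<in>V. \<theta> i w \<in> a i} \<in> sets P"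
    by (intro sets.sets_Collect_finite_All' sets.sets_Collect_finite_All measurable_sets_Collect[OF theta_measurable])
       (use a n_pos in auto)
  moreover have "{w \<in> space P. \<forall>e\<in>S. Z e w \<in> b e} \<in> sets P"
    by (intro sets.sets_Collect_finite_All measurable_sets_Collect[OF Z_measurable]) (use b assms fin in auto)
  ultimately have "{w \<in> space P. \<forall>i\<in>V. \<theta> i w \<in> a i} \<inter> {w \<in> space P. \<forall>e\<in>S. Z e w \<in> b e} \<in> sets P" by blast
  then show ?thesis unfolding rect_def by (simp add: Int_def conj_ac cong: conj_cong)
qed

lemma space_info [simp]: "space (info S) = space P"
  unfolding info_def by (rule space_measure_of) (auto simp: rect_def)

lemma sets_info: "sets (info S) = sigma_sets (space P) {rect S a b | a b. range a \<subseteq> sets borel \<and> range b \<subseteq> sets borel}"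
  unfolding info_def by (rule sets_measure_of) (auto simp: rect_def)

lemma subalgebra_info:
  assumes "S \<subseteq> V \<times> V" shows "subalgebra P (info S)"
proof -
  have "sigma_sets (space P) {rect S a b | a b. range a \<subseteq> sets borel \<and> range b \<subseteq> sets borel} \<subseteq> sets P"
    using rect_sets[OF assms] by (intro sets.sigma_sets_subset) blast
  then show ?thesis unfolding subalgebra_def sets_info by simp
qed

lemma theta_info: "i \<in> V \<Longrightarrow> \<theta> i \<in> borel_measurable (info S)"
proof (rule measurableI)
  fix A :: "real set" assume "i \<in> V" "A \<in> sets borel"
  then have "\<theta> i -` A \<inter> space (info S) = rect S ((\<lambda>_. UNIV)(i := A)) (\<lambda>_. UNIV)"
    by (auto simp: rect_def)
  moreover have "range ((\<lambda>_. UNIV)(i := A)) \<subseteq> sets borel" "range (\<lambda>_. UNIV) \<subseteq> sets (borel :: real measure)"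
    using \<open>A \<in> sets borel\<close> by auto
  ultimately show "\<theta> i -` A \<inter> space (info S) \<in> sets (info S)"
    unfolding sets_info by (intro sigma_sets.Basic) blast
qed simp

lemma Z_info: "e \<in> S \<Longrightarrow> Z e \<in> borel_measurable (info S)"
proof (rule measurableI)
  fix A :: "real set" assume "e \<in> S" "A \<in> sets borel"
  then have "Z e -` A \<inter> space (info S) = rect S (\<lambda>_. UNIV) ((\<lambda>_. UNIV)(e := A))"
    by (auto simp: rect_def)
  moreover have "range ((\<lambda>_. UNIV)(e := A)) \<subseteq> sets borel" "range (\<lambda>_. UNIV) \<subseteq> sets (borel :: real measure)"
    using \<open>A \<in> sets borel\<close> by auto
  ultimately show "Z e -` A \<inter> space (info S) \<in> sets (info S)"
    unfolding sets_info by (intro sigma_sets.Basic) blast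
qed simp

lemma sets_info_mono:
  assumes "S \<subseteq> S'" shows "sets (info S) \<subseteq> sets (info S')"
proof -
  have "rect S a b \<in> sets (info S')" if "range a \<subseteq> sets borel" "range b \<subseteq> sets borel" for a b
  proof -
    have "rect S a b = rect S' a (\<lambda>e. if e \<in> S then b e else UNIV)"
      using assms by (auto simp: rect_def)
    moreover have "range (\<lambda>e. if e \<in> S then b e else UNIV) \<subseteq> sets borel" using that by auto
    ultimately show ?thesis unfolding sets_info using that(1) by (intro sigma_sets.Basic) blast
  qed
  then have "sigma_sets (space (info S')) {rect S a b | a b. range a \<subseteq> sets borel \<and> range b \<subseteq> sets borel} \<subseteq> sets (info S')"
    by (intro sets.sigma_sets_subset) auto
  then show ?thesis by (simp add: sets_info[of S])
qed

lemma measurable_info_mono: "S \<subseteq> S' \<Longrightarrow> g \<in> borel_measurable (info S) \<Longrightarrow> g \<in> borel_measurable (info S')"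
  using sets_info_mono[of S S'] unfolding measurable_def by auto

lemma measurable_info: "S \<subseteq> V \<times> V \<Longrightarrow> g \<in> borel_measurable (info S) \<Longrightarrow> g \<in> borel_measurable P"
  using measurable_from_subalg[OF subalgebra_info] .

lemma mean_eq: "e \<in> V \<times> V \<Longrightarrow> w \<in> space P \<Longrightarrow> mean e w = f' (\<theta> (fst e) w, \<theta> (snd e) w)"
  unfolding mean_def by (rule f'_eq[symmetric]) (rule theta_range; auto)+

lemma mean_range: "e \<in> V \<times> V \<Longrightarrow> w \<in> space P \<Longrightarrow> mean e w \<in> {0..1}"
  unfolding mean_def by (rule f_range) (rule theta_range; auto)+

lemma mean_measurable_gen:
  assumes "e \<in> V \<times> V" "\<And>i. i \<in> V \<Longrightarrow> \<theta> i \<in> borel_measurable M" "space M = space P"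
  shows "mean e \<in> borel_measurable M"
proof -
  have [measurable]: "\<theta> (fst e) \<in> borel_measurable M" "\<theta> (snd e) \<in> borel_measurable M"
    using assms by auto
  have "(\<lambda>w. f' (\<theta> (fst e) w, \<theta> (snd e) w)) \<in> borel_measurable M"
    by (rule measurable_compose[OF _ f'_measurable]) (simp add: borel_prod[symmetric])
  then show ?thesis by (subst measurable_cong[OF mean_eq[OF assms(1)]]) (use assms(3) in auto)
qed

lemma mean_info: "e \<in> V \<times> V \<Longrightarrow> mean e \<in> borel_measurable (info S)"
  by (rule mean_measurable_gen) (auto intro: theta_info)

abbreviation "lat \<equiv> latent_algebra P n \<theta>"

lemma space_lat [simp]: "space lat = space P"
  by (simp add: latent_algebra_def)

lemma theta_lat: "i \<in> V \<Longrightarrow> \<theta> i \<in> borel_measurable lat"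
proof -
  assume i: "i \<in> V"
  have "(\<lambda>w. \<lambda>i\<in>V. \<theta> i w) \<in> lat \<rightarrow>\<^sub>M Pi\<^sub>M V (\<lambda>_. borel)"
    unfolding latent_algebra_def by (rule measurable_vimage_algebra1) (auto simp: space_PiM)
  from measurable_compose[OF this measurable_component_singleton[OF i]]
  show ?thesis using i by simp
qed

lemma subalgebra_lat: "subalgebra P lat"
proof -
  have "(\<lambda>w. \<lambda>i\<in>V. \<theta> i w) \<in> P \<rightarrow>\<^sub>M Pi\<^sub>M V (\<lambda>_. borel)"
    by (intro measurable_restrict theta_measurable)
  then have "sets lat \<subseteq> sets P"
    unfolding latent_algebra_def by (rule sets_image_in_sets[OF refl])
  then show ?thesis unfolding subalgebra_def by simp
qed

lemma integrable_bounded: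
  fixes g :: "'w \<Rightarrow> real"
  assumes "g \<in> borel_measurable P" "\<And>w. w \<in> space P \<Longrightarrow> \<bar>g w\<bar> \<le> C"
  shows "integrable P g"
  by (rule integrable_const_bound[of _ C]) (use assms in auto)

sublocale lat: finite_measure_subalgebra P lat
  by unfold_locales (rule subalgebra_lat)

lemma bounded_mult:
  fixes x y :: real
  assumes "\<bar>x\<bar> \<le> 1" "\<bar>y\<bar> \<le> 1" shows "\<bar>x * y\<bar> \<le> 1"
  using mult_mono[OF assms] by (simp add: abs_mult)

lemma bounded_prod_indicator:
  "\<bar>\<Prod>e\<in>S. indicator (B e) (g e) :: real\<bar> \<le> 1"
  unfolding abs_prod by (rule prod_le_1) (auto simp: indicator_def)

text \<open>The model states conditional independence for products of indicators, whereas
  \<open>Z e\<close> enters here as a number. The indicator of the rectangle is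
  \<open>g * h\<close>, with \<open>g\<close> for the latent variables and \<open>h\<close> for the
  entries in \<open>S\<close>. First \<open>h\<close> is replaced by its conditional probability
  \<open>k\<close>, then \<open>Z e\<close> by its conditional mean, and finally \<open>k\<close> by
  \<open>h\<close> again.\<close>

lemma rect_mean_swap:
  assumes e: "e \<in> V \<times> V" "e \<notin> S" and S: "S \<subseteq> V \<times> V"
    and a: "range a \<subseteq> sets borel" and b: "range b \<subseteq> sets borel"
  shows "(\<integral>w. indicator (rect S a b) w * Z e w \<partial>P) = (\<integral>w. indicator (rect S a b) w * mean e w \<partial>P)"
proof -
  have finS [simp]: "finite S" using S finite_subset by blast
  have b' [measurable]: "b i \<in> sets borel" for i using b by auto
  have a' [measurable]: "a i \<in> sets borel" for i using a by auto
  have Zm [measurable]: "Z i \<in> borel_measurable P" if "i \<in> S" for i using that S Z_measurable by auto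
  have Zem [measurable]: "Z e \<in> borel_measurable P" using e Z_measurable by auto
  define g where "g = (\<lambda>w. \<Prod>i\<in>V. indicator (a i) (\<theta> i w) :: real)"
  define h where "h = (\<lambda>w. \<Prod>i\<in>S. indicator (b i) (Z i w) :: real)"
  define c where "c = (\<lambda>i. real_cond_exp P lat (\<lambda>w. indicator (b i) (Z i w)))"
  define k where "k = (\<lambda>w. \<Prod>i\<in>S. c i w)"
  have g_lat [measurable]: "g \<in> borel_measurable lat"
    unfolding g_def by (intro borel_measurable_prod measurable_compose[OF theta_lat] borel_measurable_indicator a') auto
  have k_lat [measurable]: "k \<in> borel_measurable lat"
    unfolding k_def c_def by (intro borel_measurable_prod) simp
  have gm [measurable]: "g \<in> borel_measurable P" and km [measurable]: "k \<in> borel_measurable P"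
    using g_lat k_lat by (auto intro: measurable_from_subalg[OF subalgebra_lat])
  have hm [measurable]: "h \<in> borel_measurable P"
    unfolding h_def by measurable
  have rect: "indicator (rect S a b) w = g w * h w" if "w \<in> space P" for w
    using that unfolding rect_def g_def h_def
    by (auto simp: indicator_def prod_zero_iff split: if_splits)
  have g1: "\<bar>g w\<bar> \<le> 1" and h1: "\<bar>h w\<bar> \<le> 1" for w
    unfolding g_def h_def by (rule bounded_prod_indicator)+
  have c1: "AE w in P. \<bar>c i w\<bar> \<le> 1" if "i \<in> S" for i
  proof -
    have int: "integrable P (\<lambda>w. indicator (b i) (Z i w) :: real)"
      using that by (intro integrable_bounded[of _ 1]) auto
    have "AE w in P. c i w \<ge> 0" unfolding c_def
      using that by (intro lat.real_cond_exp_pos) (auto intro!: borel_measurable_indicator' Zm)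
    moreover have "AE w in P. c i w \<le> 1" unfolding c_def
      by (rule lat.real_cond_exp_le_c[OF int]) auto
    ultimately show ?thesis by eventually_elim auto
  qed
  have k1: "AE w in P. \<bar>k w\<bar> \<le> 1"
  proof -
    have "AE w in P. \<forall>i\<in>S. \<bar>c i w\<bar> \<le> 1" using c1 by (simp add: AE_finite_all)
    then show ?thesis unfolding k_def abs_prod by eventually_elim (auto intro!: prod_le_1)
  qed
  have intk: "integrable P (\<lambda>w. g w * k w * y w)" if [measurable]: "y \<in> borel_measurable P"
    and "\<And>w. w \<in> space P \<Longrightarrow> \<bar>y w\<bar> \<le> 1" for y
  proof (rule integrable_const_bound[of _ 1])
    show "AE w in P. norm (g w * k w * y w) \<le> 1"
      using k1 AE_space by eventually_elim (use g1 that(2) bounded_mult in \<open>auto simp del: abs_mult\<close>)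
  qed simp
  have inth: "integrable P (\<lambda>w. g w * h w * y w)" if [measurable]: "y \<in> borel_measurable P"
    and "\<And>w. w \<in> space P \<Longrightarrow> \<bar>y w\<bar> \<le> 1" for y
    by (rule integrable_bounded[of _ 1]) (use g1 h1 that(2) bounded_mult in \<open>auto simp del: abs_mult\<close>)
  \<comment> \<open>The first replacement, tested on events about \<open>Z e\<close>. Given the
    latent variables the conditional expectation of the product factorizes, and the factor
    \<open>k\<close> may then be moved out, being measurable in them.\<close>
  have key: "(\<integral>w. g w * h w * indicator X (Z e w) \<partial>P) = (\<integral>w. g w * k w * indicator X (Z e w) \<partial>P)"
    if X [measurable]: "X \<in> sets borel" for X
  proof -
    \<comment> \<open>All other coordinates get the whole line, whose conditional probability is 1
      almost everywhere.\<close>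
    define A where "A = (\<lambda>i. if i \<in> S then b i else if i = e then X else UNIV)"
    have Ab: "\<forall>i\<in>V \<times> V. A i \<in> sets borel" by (auto simp: A_def)
    have split: "(\<Prod>i\<in>V \<times> V. y i) = (\<Prod>i\<in>S. y i) * y e"
      if "\<And>i. i \<in> V \<times> V \<Longrightarrow> i \<notin> S \<Longrightarrow> i \<noteq> e \<Longrightarrow> y i = 1" for y :: "nat \<times> nat \<Rightarrow> real"
    proof -
      have "(\<Prod>i\<in>V \<times> V. y i) = (\<Prod>i\<in>insert e S. y i)"
        by (rule prod.mono_neutral_right) (use e S that in auto)
      then show ?thesis using e by (simp add: mult.commute)
    qed
    have ind1: "(\<Prod>i\<in>V \<times> V. indicator (A i) (Z i w)) = h w * (indicator X (Z e w) :: real)" for w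
      by (subst split) (use e in \<open>auto simp: A_def h_def intro!: prod.cong\<close>)
    have one: "AE w in P. real_cond_exp P lat (\<lambda>w. 1) w = 1"
      by (rule lat.real_cond_exp_F_meas) auto
    define cX where "cX = real_cond_exp P lat (\<lambda>w. indicator X (Z e w))"
    have "AE w in P. real_cond_exp P lat (\<lambda>w. \<Prod>i\<in>V \<times> V. indicator (A i) (Z i w)) w =
                    (\<Prod>i\<in>V \<times> V. real_cond_exp P lat (\<lambda>w. indicator (A i) (Z i w)) w)"
      using Z_cond_indep Ab unfolding cond_indep_vars_def by blast
    then have ae: "AE w in P. real_cond_exp P lat (\<lambda>w. h w * indicator X (Z e w)) w = k w * cX w"
      using one unfolding ind1
    proof eventually_elim
      case (elim w)
      have "(\<Prod>i\<in>V \<times> V. real_cond_exp P lat (\<lambda>w. indicator (A i) (Z i w)) w) = k w * cX w"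
        by (subst split) (use e elim(2) in \<open>auto simp: A_def k_def c_def cX_def intro!: prod.cong\<close>)
      with elim show ?case by simp
    qed
    have iX: "(\<lambda>w. indicator X (Z e w) :: real) \<in> borel_measurable P" by measurable
    have "(\<integral>w. g w * h w * indicator X (Z e w) \<partial>P) = (\<integral>w. g w * (h w * indicator X (Z e w)) \<partial>P)"
      by (simp add: mult.assoc)
    also have "\<dots> = (\<integral>w. g w * real_cond_exp P lat (\<lambda>w. h w * indicator X (Z e w)) w \<partial>P)"
      by (rule lat.real_cond_exp_intg(2)[symmetric])
         (use inth[OF iX] in \<open>auto simp: mult.assoc indicator_def intro!: borel_measurable_times iX\<close>)
    also have "\<dots> = (\<integral>w. (g w * k w) * cX w \<partial>P)"
      by (rule integral_cong_AE) (use ae in \<open>auto simp: cX_def elim: eventually_mono\<close>)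
    also have "\<dots> = (\<integral>w. (g w * k w) * indicator X (Z e w) \<partial>P)"
      unfolding cX_def by (rule lat.real_cond_exp_intg(2)) (use intk[OF iX] in auto)
    finally show ?thesis .
  qed
  \<comment> \<open>By \<open>key\<close>, \<open>W\<close> integrates to 0 over every event about
    \<open>Z e\<close>. So its conditional expectation given \<open>Z e\<close> vanishes, and it
    integrates to 0 against \<open>Z e\<close> itself.\<close>
  define W where "W = (\<lambda>w. g w * h w - g w * k w)"
  have Zb: "\<bar>Z e w\<bar> \<le> 1" if "w \<in> space P" for w using Z_range[OF e(1) that] by auto
  have mb: "\<bar>mean e w\<bar> \<le> 1" if "w \<in> space P" for w using mean_range[OF e(1) that] by auto
  have mm [measurable]: "mean e \<in> borel_measurable P" by (rule mean_measurable_gen) (use e theta_measurable in auto)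
  have mlat [measurable]: "mean e \<in> borel_measurable lat" by (rule mean_measurable_gen) (use e theta_lat in auto)
  define G where "G = vimage_algebra (space P) (Z e) borel"
  have "sets G \<subseteq> sets P" unfolding G_def by (rule sets_image_in_sets[OF refl Zem])
  then interpret G: finite_measure_subalgebra P G
    by unfold_locales (auto simp: subalgebra_def G_def)
  have ZG: "Z e \<in> borel_measurable G" unfolding G_def by (rule measurable_vimage_algebra1) auto
  have W_int: "integrable P W"
    unfolding W_def using inth[of "\<lambda>_. 1"] intk[of "\<lambda>_. 1"] by (intro Bochner_Integration.integrable_diff) auto
  have "AE w in P. real_cond_exp P G W w = 0"
  proof (rule G.real_cond_exp_charact)
    fix Y assume "Y \<in> sets G"
    then obtain X where X: "X \<in> sets borel" "Y = Z e -` X \<inter> space P"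
      unfolding G_def by (auto simp: sets_vimage_algebra2)
    have "(\<integral>w\<in>Y. W w \<partial>P) = (\<integral>w. g w * h w * indicator X (Z e w) - g w * k w * indicator X (Z e w) \<partial>P)"
      unfolding set_lebesgue_integral_def
      by (rule Bochner_Integration.integral_cong) (auto simp: X W_def indicator_def)
    also have "\<dots> = 0"
      using key[OF X(1)] X(1) by (subst Bochner_Integration.integral_diff) (auto intro!: inth intk simp: indicator_def)
    finally show "(\<integral>w\<in>Y. W w \<partial>P) = (\<integral>w\<in>Y. 0 \<partial>P)" by simp
  qed (use W_int in auto)
  moreover have WZ: "integrable P (\<lambda>w. Z e w * W w)"
    using inth[OF Zem Zb] intk[OF Zem Zb] unfolding W_def
    by (subst right_diff_distrib, intro Bochner_Integration.integrable_diff) (auto simp: mult.commute)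
  ultimately have "(\<integral>w. Z e w * W w \<partial>P) = 0"
    by (subst G.real_cond_exp_intg(2)[symmetric, OF _ ZG])
       (use W_int in \<open>auto intro!: integral_eq_zero_AE elim: eventually_mono\<close>)
  then have "(\<integral>w. g w * h w * Z e w - g w * k w * Z e w \<partial>P) = 0"
    by (simp add: W_def algebra_simps)
  then have 1: "(\<integral>w. g w * h w * Z e w \<partial>P) = (\<integral>w. g w * k w * Z e w \<partial>P)"
    using inth[OF Zem Zb] intk[OF Zem Zb] by simp
  \<comment> \<open>The weight \<open>g * k\<close> is measurable in the latent variables, so the
    conditional mean of \<open>Z e\<close> may be inserted.\<close>
  have 2: "(\<integral>w. g w * k w * Z e w \<partial>P) = (\<integral>w. g w * k w * mean e w \<partial>P)"
  proof -
    have "AE w in P. real_cond_exp P lat (Z e) w = mean e w"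
      using Z_cond_mean[of "fst e" "snd e"] e by (auto simp: mean_def)
    then have "(\<integral>w. g w * k w * real_cond_exp P lat (Z e) w \<partial>P) = (\<integral>w. g w * k w * mean e w \<partial>P)"
      by (intro integral_cong_AE) (auto elim: eventually_mono)
    then show ?thesis
      by (subst (asm) lat.real_cond_exp_intg(2)) (use intk[OF Zem Zb] in auto)
  qed
  have 3: "(\<integral>w. g w * h w * mean e w \<partial>P) = (\<integral>w. g w * k w * mean e w \<partial>P)"
  proof -
    have h_eq: "(\<lambda>w. \<Prod>i\<in>V \<times> V. indicator (if i \<in> S then b i else UNIV) (Z i w)) = h"
      unfolding h_def by (intro ext prod.mono_neutral_cong_right) (use S in auto)
    have "AE w in P. real_cond_exp P lat (\<lambda>w. \<Prod>i\<in>V \<times> V. indicator (if i \<in> S then b i else UNIV) (Z i w)) w =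
                    (\<Prod>i\<in>V \<times> V. real_cond_exp P lat (\<lambda>w. indicator (if i \<in> S then b i else UNIV) (Z i w)) w)"
      using Z_cond_indep b' unfolding cond_indep_vars_def by (auto split: if_splits)
    moreover have "AE w in P. real_cond_exp P lat (\<lambda>w. 1) w = 1"
      by (rule lat.real_cond_exp_F_meas) auto
    ultimately have ae: "AE w in P. real_cond_exp P lat h w = k w"
      unfolding h_eq
    proof eventually_elim
      case (elim w)
      have "(\<Prod>i\<in>V \<times> V. real_cond_exp P lat (\<lambda>w. indicator (if i \<in> S then b i else UNIV) (Z i w)) w) = k w"
        unfolding k_def c_def
        by (rule prod.mono_neutral_cong_right) (use S elim in auto)
      with elim show ?case by simp
    qed
    have "(\<integral>w. g w * mean e w * h w \<partial>P) = (\<integral>w. g w * mean e w * real_cond_exp P lat h w \<partial>P)"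
      by (rule lat.real_cond_exp_intg(2)[symmetric])
         (use inth[OF mm mb] in \<open>auto simp: mult_ac\<close>)
    also have "\<dots> = (\<integral>w. g w * mean e w * k w \<partial>P)"
      using ae by (intro integral_cong_AE) (auto elim: eventually_mono)
    finally show ?thesis by (simp add: mult_ac)
  qed
  have "(\<integral>w. indicator (rect S a b) w * Z e w \<partial>P) = (\<integral>w. g w * h w * Z e w \<partial>P)"
    and "(\<integral>w. indicator (rect S a b) w * mean e w \<partial>P) = (\<integral>w. g w * h w * mean e w \<partial>P)"
    by (auto intro!: Bochner_Integration.integral_cong simp: rect)
  then show ?thesis using 1 2 3 by simp
qed

text \<open>The random functions treated below are bounded for fixed \<open>n\<close>, so
  integrability comes from closure rules for \<open>bdd\<close> instead of separate
  estimates.\<close>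

definition bdd :: "('w \<Rightarrow> real) \<Rightarrow> bool" where
  "bdd g \<longleftrightarrow> (\<exists>C. \<forall>w\<in>space P. \<bar>g w\<bar> \<le> C)"

lemma bddI: "(\<And>w. w \<in> space P \<Longrightarrow> \<bar>g w\<bar> \<le> C) \<Longrightarrow> bdd g"
  unfolding bdd_def by blast

lemma bdd_const [intro]: "bdd (\<lambda>_. c)"
  by (rule bddI) auto

lemma bdd_mult [intro]:
  assumes "bdd g" "bdd h" shows "bdd (\<lambda>w. g w * h w)"
proof -
  obtain C D where "\<forall>w\<in>space P. \<bar>g w\<bar> \<le> C" "\<forall>w\<in>space P. \<bar>h w\<bar> \<le> D"
    using assms unfolding bdd_def by blast
  then show ?thesis
    by (intro bddI[of _ "C * D"]) (auto simp: abs_mult intro!: mult_mono intro: order_trans[OF abs_ge_zero])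
qed

lemma bdd_add [intro]:
  assumes "bdd g" "bdd h" shows "bdd (\<lambda>w. g w + h w)"
proof -
  obtain C D where "\<forall>w\<in>space P. \<bar>g w\<bar> \<le> C" "\<forall>w\<in>space P. \<bar>h w\<bar> \<le> D"
    using assms unfolding bdd_def by blast
  then show ?thesis
    by (intro bddI[of _ "C + D"]) (fastforce intro: order_trans[OF abs_triangle_ineq] add_mono)
qed

lemma bdd_uminus [intro]: "bdd g \<Longrightarrow> bdd (\<lambda>w. - g w)"
  unfolding bdd_def by simp

lemma bdd_diff [intro]: "bdd g \<Longrightarrow> bdd h \<Longrightarrow> bdd (\<lambda>w. g w - h w)"
  using bdd_add[of g "\<lambda>w. - h w"] bdd_uminus[of h] by simp

lemma bdd_sum [intro]: "(\<And>i. i \<in> A \<Longrightarrow> bdd (g i)) \<Longrightarrow> bdd (\<lambda>w. \<Sum>i\<in>A. g i w)"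
  by (induction A rule: infinite_finite_induct) auto

lemma bdd_prod [intro]: "(\<And>i. i \<in> A \<Longrightarrow> bdd (g i)) \<Longrightarrow> bdd (\<lambda>w. \<Prod>i\<in>A. g i w)"
  by (induction A rule: infinite_finite_induct) auto

lemma bdd_exp [intro]:
  assumes "bdd g" shows "bdd (\<lambda>w. exp (g w))"
proof -
  obtain C where "\<forall>w\<in>space P. \<bar>g w\<bar> \<le> C"
    using assms unfolding bdd_def by blast
  then show ?thesis by (intro bddI[of _ "exp C"]) (auto simp: abs_le_iff)
qed

lemma bdd_Z [intro]: "e \<in> V \<times> V \<Longrightarrow> bdd (Z e)"
  using Z_range by (intro bddI[of _ 1]) fastforce

lemma bdd_mean [intro]: "e \<in> V \<times> V \<Longrightarrow> bdd (mean e)"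
  using mean_range by (intro bddI[of _ 1]) fastforce

lemma bdd_integrable: "g \<in> borel_measurable P \<Longrightarrow> bdd g \<Longrightarrow> integrable P g"
  unfolding bdd_def using integrable_bounded by blast

text \<open>By the pi-lambda theorem the identity passes from rectangles to all events of
  \<open>info S\<close>. Hence \<open>mean e\<close> is the conditional expectation of
  \<open>Z e\<close> given \<open>info S\<close>, and a bounded weight measurable there may be
  multiplied in.\<close>

lemma mean_swap:
  assumes e: "e \<in> V \<times> V" "e \<notin> S" and S: "S \<subseteq> V \<times> V"
    and g: "g \<in> borel_measurable (info S)" "bdd g"
  shows "(\<integral>w. g w * Z e w \<partial>P) = (\<integral>w. g w * mean e w \<partial>P)"
proof -
  interpret S: finite_measure_subalgebra P "info S"
    by unfold_locales (rule subalgebra_info[OF S])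
  have Zm [measurable]: "Z e \<in> borel_measurable P" using e Z_measurable by auto
  have mm [measurable]: "mean e \<in> borel_measurable P" by (rule mean_measurable_gen) (use e theta_measurable in auto)
  have iZ: "integrable P (Z e)" and im: "integrable P (mean e)"
    using bdd_integrable[OF Zm bdd_Z[OF e(1)]] bdd_integrable[OF mm bdd_mean[OF e(1)]] .
  have sub: "A \<in> sets P" if "A \<in> sets (info S)" for A
    using that subalgebra_info[OF S] unfolding subalgebra_def by auto
  have iA: "integrable P (\<lambda>w. indicator A w * Z e w)" "integrable P (\<lambda>w. indicator A w * mean e w)" if "A \<in> sets (info S)" for A
    using integrable_mult_indicator[OF sub[OF that] iZ] integrable_mult_indicator[OF sub[OF that] im] by auto
  let ?G = "{rect S a b | a b. range a \<subseteq> sets borel \<and> range b \<subseteq> sets borel}"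
  have Int_st: "Int_stable ?G"
  proof (rule Int_stableI)
    fix A B assume "A \<in> ?G" "B \<in> ?G"
    then obtain a b a' b' where *: "A = rect S a b" "B = rect S a' b'" "range a \<subseteq> sets borel" "range b \<subseteq> sets borel"
      "range a' \<subseteq> sets borel" "range b' \<subseteq> sets borel" by blast
    then have "A \<inter> B = rect S (\<lambda>i. a i \<inter> a' i) (\<lambda>i. b i \<inter> b' i)"
      "range (\<lambda>i. a i \<inter> a' i) \<subseteq> sets borel" "range (\<lambda>i. b i \<inter> b' i) \<subseteq> sets borel"
      by (auto simp: rect_def)
    then show "A \<inter> B \<in> ?G" by blast
  qed
  have closed: "?G \<subseteq> Pow (space P)" by (auto simp: rect_def)
  have set_eq: "(\<integral>w. indicator A w * Z e w \<partial>P) = (\<integral>w. indicator A w * mean e w \<partial>P)" if "A \<in> sets (info S)" for A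
    using Int_st closed that[unfolded sets_info]
  proof (induction A rule: sigma_sets_induct_disjoint)
    case (basic A)
    then show ?case
      using rect_mean_swap[OF e S] by blast
  next
    case empty
    show ?case by simp
  next
    case (compl A)
    note A = compl(1) and eq = compl(2)
    have As: "A \<in> sets (info S)" using A by (simp add: sets_info)
    have U: "rect S (\<lambda>_. UNIV) (\<lambda>_. UNIV) = space P" by (auto simp: rect_def)
    have "(\<integral>w. indicator (space P) w * Z e w \<partial>P) = (\<integral>w. indicator (space P) w * mean e w \<partial>P)"
      using rect_mean_swap[OF e S, of "\<lambda>_. UNIV" "\<lambda>_. UNIV"] by (simp add: U)
    moreover have "(\<integral>w. indicator (space P - A) w * y w \<partial>P)
        = (\<integral>w. indicator (space P) w * y w \<partial>P) - (\<integral>w. indicator A w * y w \<partial>P)"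
      if "integrable P (\<lambda>w. indicator A w * y w)" "integrable P (\<lambda>w. indicator (space P) w * y w)" for y :: "'w \<Rightarrow> real"
    proof -
      have "(\<integral>w. indicator (space P - A) w * y w \<partial>P) = (\<integral>w. indicator (space P) w * y w - indicator A w * y w \<partial>P)"
        using sets.sets_into_space[OF sub[OF As]]
        by (intro Bochner_Integration.integral_cong) (auto simp: indicator_def)
      then show ?thesis using that by simp
    qed
    ultimately show ?case
      using iA[OF As] iA[of "space P"] eq sets.top[of "info S"] by simp
  next
    case (union A)
    note A = union(1,2) and eq = union(3)
    have As: "A i \<in> sets (info S)" for i using A by (auto simp: sets_info)
    have UA: "(\<Union>i. A i) \<in> sets (info S)" using As by blast
    have "(\<integral>w\<in>(\<Union>i. A i). y w \<partial>P) = (\<Sum>i. \<integral>w\<in>A i. y w \<partial>P)" if y: "integrable P y" for y :: "'w \<Rightarrow> real"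
    proof (rule lebesgue_integral_countable_add)
      show "set_integrable P (\<Union>i. A i) y"
        unfolding set_integrable_def by (rule integrable_mult_indicator[OF sub[OF UA] y])
    qed (use A(1) sub[OF As] in \<open>auto simp: disjoint_family_on_def\<close>)
    from this[OF iZ] this[OF im] eq
    show ?case
      unfolding set_lebesgue_integral_def real_scaleR_def by simp
  qed
  have gm: "g \<in> borel_measurable P" using measurable_info[OF S g(1)] .
  have "AE w in P. real_cond_exp P (info S) (Z e) w = mean e w"
    by (rule S.real_cond_exp_charact)
       (use set_eq iZ im mean_info[OF e(1)] in \<open>auto simp: set_lebesgue_integral_def\<close>)
  then have "(\<integral>w. g w * real_cond_exp P (info S) (Z e) w \<partial>P) = (\<integral>w. g w * mean e w \<partial>P)"
    using gm by (intro integral_cong_AE) (auto elim: eventually_mono)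
  moreover have "integrable P (\<lambda>w. g w * Z e w)"
    by (intro bdd_integrable borel_measurable_times gm Zm bdd_mult g bdd_Z e)
  ultimately show ?thesis
    using S.real_cond_exp_intg(2)[of g "Z e"] g(1) by simp
qed

text \<open>The product is affine in each \<open>Z e\<close>, so entries are replaced one at a time.
  When \<open>e\<close> is treated, the other factors are measurable with respect to
  \<open>info (S \<union> J)\<close>, where \<open>J\<close> holds the remaining indices and
  \<open>e\<close> is absent, so \<open>mean_swap\<close> applies; the finished factor then joins
  \<open>g\<close>.\<close>

lemma prod_mean_swap:
  assumes "finite J" "J \<subseteq> V \<times> V" "J \<inter> S = {}" "S \<subseteq> V \<times> V"
    and "g \<in> borel_measurable (info S)" "bdd g"
    and "\<And>e. e \<in> J \<Longrightarrow> \<alpha> e \<in> borel_measurable (info S)" "\<And>e. e \<in> J \<Longrightarrow> bdd (\<alpha> e)"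
  shows "(\<integral>w. g w * (\<Prod>e\<in>J. 1 + \<alpha> e w * Z e w) \<partial>P) = (\<integral>w. g w * (\<Prod>e\<in>J. 1 + \<alpha> e w * mean e w) \<partial>P)"
  using assms
proof (induction J arbitrary: g rule: finite_induct)
  case (insert e J)
  note prems = insert.prems and hyps = insert.hyps
  have JS: "S \<subseteq> S \<union> J" "S \<union> J \<subseteq> V \<times> V" "e \<in> V \<times> V" "e \<notin> S \<union> J"
    using prems(1-3) hyps(2) by blast+
  have JV: "i \<in> V \<times> V" if "i \<in> J" for i using prems(1) that by blast
  have a: "\<alpha> i \<in> borel_measurable (info (S \<union> J))" if "i \<in> insert e J" for i
    using measurable_info_mono[OF JS(1) prems(6)[OF that]] .
  have ab: "bdd (\<alpha> i)" if "i \<in> insert e J" for i using prems(7)[OF that] .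
  have Zm: "Z i \<in> borel_measurable (info (S \<union> J))" if "i \<in> J" for i using that by (intro Z_info) blast
  define h where "h = (\<lambda>w. g w * (\<Prod>i\<in>J. 1 + \<alpha> i w * Z i w))"
  have h: "h \<in> borel_measurable (info (S \<union> J))"
    unfolding h_def
    by (intro borel_measurable_times borel_measurable_prod borel_measurable_add borel_measurable_const a Zm
        measurable_info_mono[OF JS(1) prems(4)]) blast+
  have hb: "bdd h" unfolding h_def
    by (intro bdd_mult bdd_prod bdd_add bdd_const bdd_Z prems(5) ab JV) auto
  have ha: "(\<lambda>w. h w * \<alpha> e w) \<in> borel_measurable (info (S \<union> J))" using h a[of e] by auto
  have hab: "bdd (\<lambda>w. h w * \<alpha> e w)" by (rule bdd_mult[OF hb ab]) simp
  have hP: "h \<in> borel_measurable P" "(\<lambda>w. h w * \<alpha> e w) \<in> borel_measurable P"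
    using measurable_info[OF JS(2)] h ha by auto
  have Zp: "Z e \<in> borel_measurable P" "mean e \<in> borel_measurable P"
    using Z_measurable JS(3) mean_measurable_gen[OF JS(3) theta_measurable] by auto
  have int: "integrable P h" "integrable P (\<lambda>w. (h w * \<alpha> e w) * Z e w)" "integrable P (\<lambda>w. (h w * \<alpha> e w) * mean e w)"
    by (intro bdd_integrable borel_measurable_times hP Zp hb hab bdd_mult bdd_Z bdd_mean JS)+
  have "(\<integral>w. g w * (\<Prod>i\<in>insert e J. 1 + \<alpha> i w * Z i w) \<partial>P) = (\<integral>w. h w + (h w * \<alpha> e w) * Z e w \<partial>P)"
    by (rule Bochner_Integration.integral_cong) (use hyps in \<open>auto simp: h_def algebra_simps\<close>)
  also have "\<dots> = (\<integral>w. h w + (h w * \<alpha> e w) * mean e w \<partial>P)"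
    using int mean_swap[OF JS(3,4,2) ha hab] by simp
  also have "\<dots> = (\<integral>w. (g w * (1 + \<alpha> e w * mean e w)) * (\<Prod>i\<in>J. 1 + \<alpha> i w * Z i w) \<partial>P)"
    by (rule Bochner_Integration.integral_cong) (auto simp: h_def algebra_simps)
  also have "\<dots> = (\<integral>w. (g w * (1 + \<alpha> e w * mean e w)) * (\<Prod>i\<in>J. 1 + \<alpha> i w * mean i w) \<partial>P)"
  proof (rule insert.IH)
    show "J \<subseteq> V \<times> V" "J \<inter> S = {}" using prems(1,2) by blast+
    show "(\<lambda>w. g w * (1 + \<alpha> e w * mean e w)) \<in> borel_measurable (info S)"
      by (intro borel_measurable_times borel_measurable_add borel_measurable_const mean_info[OF JS(3)] prems(4,6)) simp
    show "bdd (\<lambda>w. g w * (1 + \<alpha> e w * mean e w))"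
      by (intro bdd_mult bdd_add bdd_const bdd_mean[OF JS(3)] prems(5) ab) simp
  qed (use prems(3,6,7) in auto)
  also have "\<dots> = (\<integral>w. g w * (\<Prod>i\<in>insert e J. 1 + \<alpha> i w * mean i w) \<partial>P)"
    by (rule Bochner_Integration.integral_cong) (use hyps in \<open>auto simp: mult.assoc\<close>)
  finally show ?case .
qed simp

end

section \<open>The joint law of marks and trees\<close>

definition marks_pmf :: "nat \<Rightarrow> real \<Rightarrow> (nat \<times> nat \<Rightarrow> mark) pmf" where
  "marks_pmf n p = Pi_pmf ({1..n} \<times> {1..n}) Unobserved (\<lambda>_. mark_pmf p)"

definition trees_pmf :: "nat \<Rightarrow> (nat \<times> nat) set \<Rightarrow> (nat \<Rightarrow> (nat \<times> nat) set) pmf" where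
  "trees_pmf n E = Pi_pmf {1..n} {} (\<lambda>u. pmf_of_set (bfs_trees E u))"

lemma UNIV_mark: "UNIV = {Unobserved, Part1 True, Part1 False, Part2, Part3}"
proof -
  have "x \<in> {Unobserved, Part1 True, Part1 False, Part2, Part3}" for x
  proof (cases x)
    case (Part1 b)
    then show ?thesis by (cases b) auto
  qed auto
  then show ?thesis by blast
qed

lemma finite_UNIV_mark [simp]: "finite (UNIV :: mark set)"
  unfolding UNIV_mark by simp

lemma finite_marks [simp]: "finite (A :: mark set)"
  by (rule finite_subset[OF subset_UNIV finite_UNIV_mark])

lemma edges1_subset: "edges1 n \<mu> \<subseteq> {1..n} \<times> {1..n}"
  by (auto simp: edges1_def)

lemma set_pmf_bfs: "E \<subseteq> {1..n} \<times> {1..n} \<Longrightarrow> set_pmf (pmf_of_set (bfs_trees E u)) = bfs_trees E u"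
  using bfs_trees_nonempty[of E "{1..n}" u] finite_bfs_trees[of E u] finite_subset[of E "{1..n} \<times> {1..n}"] by simp

lemma bfs_trees_subset: "E \<subseteq> A \<Longrightarrow> G \<in> bfs_trees E u \<Longrightarrow> G \<subseteq> A"
  by (auto simp: bfs_trees_def)

lemma set_trees_pmf:
  assumes "E \<subseteq> {1..n} \<times> {1..n}" "\<tau> \<in> set_pmf (trees_pmf n E)" "u \<in> {1..n}"
  shows "\<tau> u \<in> bfs_trees E u"
  using assms(2,3) by (auto simp: trees_pmf_def set_Pi_pmf PiE_dflt_def set_pmf_bfs[OF assms(1)])

lemma finite_set_marks_pmf [simp]: "finite (set_pmf (marks_pmf n p))"
  unfolding marks_pmf_def by (rule finite_set_Pi_pmf) auto

lemma finite_set_trees_pmf: "E \<subseteq> {1..n} \<times> {1..n} \<Longrightarrow> finite (set_pmf (trees_pmf n E))"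
  unfolding trees_pmf_def
  by (rule finite_set_Pi_pmf) (auto simp: set_pmf_bfs finite_bfs_trees finite_subset)

lemma pexp_trees_component:
  assumes "u \<in> {1..n}"
  shows "pexp (trees_pmf n E) (\<lambda>\<tau>. h (\<tau> u)) = pexp (pmf_of_set (bfs_trees E u)) h"
proof -
  have "map_pmf (\<lambda>\<tau>. \<tau> u) (trees_pmf n E) = pmf_of_set (bfs_trees E u)"
    unfolding trees_pmf_def using assms by (subst Pi_pmf_component) auto
  then show ?thesis by (metis integral_map_pmf)
qed

lemma map_part1_mark_pmf:
  assumes "0 \<le> p" "p \<le> 1"
  shows "map_pmf (\<lambda>m. \<exists>b. m = Part1 b) (mark_pmf p) = bernoulli_pmf (p / 4)"
proof -
  let ?P = "pmf_of_list [(1::nat, 1/4), (2, 1/4), (3, 1/2)]"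
  have wf: "pmf_of_list_wf [(1::nat, 1/4), (2, 1/4), (3, 1/2 :: real)]"
    by (auto simp: pmf_of_list_wf_def)
  have P: "pmf ?P i = (if i = 1 then 1/4 else if i = 2 then 1/4 else if i = 3 then 1/2 else 0)" for i
    using wf by (simp add: pmf_pmf_of_list)
  have mP: "map_pmf (\<lambda>i. i = 1) ?P = bernoulli_pmf (1/4)"
  proof (rule pmf_eqI)
    fix b
    have "pmf (map_pmf (\<lambda>i. i = 1) ?P) True = 1/4"
    proof -
      have "(\<lambda>i. i = 1) -` {True} = {1::nat}" by auto
      then show ?thesis using P[of 1] by (simp add: pmf_map measure_pmf_single)
    qed
    moreover have "pmf (map_pmf (\<lambda>i. i = 1) ?P) False = 1 - pmf (map_pmf (\<lambda>i. i = 1) ?P) True"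
      by (rule pmf_False_conv_True)
    ultimately show "pmf (map_pmf (\<lambda>i. i = 1) ?P) b = pmf (bernoulli_pmf (1/4)) b" by (cases b) auto
  qed
  have "map_pmf (\<lambda>m. \<exists>b. m = Part1 b) (mark_pmf p) = bind_pmf (bernoulli_pmf p) (\<lambda>ob.
      if \<not> ob then return_pmf False else map_pmf (\<lambda>i. i = 1) ?P)"
    unfolding mark_pmf_def map_bind_pmf
    by (intro bind_pmf_cong refl)
      (auto simp: map_pmf_def bind_assoc_pmf bind_return_pmf if_distrib[of "\<lambda>x. bind_pmf x _"] intro!: bind_pmf_cong)
  also have "\<dots> = bernoulli_pmf (p / 4)"
  proof (rule pmf_eqI)
    fix b
    have "pmf (bind_pmf (bernoulli_pmf p) (\<lambda>ob. if \<not> ob then return_pmf False else map_pmf (\<lambda>i. i = 1) ?P)) True = p / 4"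
      unfolding mP using assms by (simp add: pmf_bind)
    then show "pmf (bind_pmf (bernoulli_pmf p) (\<lambda>ob. if \<not> ob then return_pmf False else map_pmf (\<lambda>i. i = 1) ?P)) b = pmf (bernoulli_pmf (p / 4)) b"
      using assms by (cases b) (auto simp: pmf_False_conv_True)
  qed
  finally show ?thesis .
qed

text \<open>The graph to be explored is thus a directed Erdos-Renyi graph, loops included, with edge
  probability \<open>p / 4\<close>.\<close>

lemma map_edges1_marks:
  assumes "0 \<le> p" "p \<le> 1"
  shows "map_pmf (edges1 n) (marks_pmf n p) = rset ({1..n} \<times> {1..n}) (p / 4)"
proof -
  have "Pi_pmf ({1..n} \<times> {1..n}) False (\<lambda>_. bernoulli_pmf (p / 4)) = map_pmf (\<lambda>\<mu>. (\<lambda>m. \<exists>b. m = Part1 b) \<circ> \<mu>) (marks_pmf n p)"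
    unfolding map_part1_mark_pmf[OF assms, symmetric] marks_pmf_def by (rule Pi_pmf_map) auto
  then show ?thesis unfolding rset_def
    by (simp add: pmf.map_comp o_def edges1_def[abs_def])
qed

lemma pexp_edges1:
  assumes "0 \<le> p" "p \<le> 1"
  shows "pexp (marks_pmf n p) (\<lambda>\<mu>. h (edges1 n \<mu>)) = pexp (rset ({1..n} \<times> {1..n}) (p / 4)) h"
  unfolding map_edges1_marks[OF assms, symmetric] by simp

lemma measurable_count_space_eq:
  assumes "g \<in> M \<rightarrow>\<^sub>M count_space UNIV" shows "{w \<in> space M. g w = x} \<in> sets M"
proof -
  have "{w \<in> space M. g w = x} = g -` {x} \<inter> space M" by auto
  then show ?thesis using measurable_sets[OF assms, of "{x}"] by simp
qed

context sample_model
begin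

text \<open>Marks, and trees in \<open>tr\<close>, are reset to a default off their index sets. They
  then range over the finite sets \<open>MS\<close> and \<open>TS\<close> and can be compared with
  \<open>marks_pmf\<close> and \<open>trees_pmf\<close>, which use the same defaults.\<close>

definition mk :: "'w \<Rightarrow> nat \<times> nat \<Rightarrow> mark" where
  "mk w = (\<lambda>e. if e \<in> V \<times> V then mrk e w else Unobserved)"

definition tr :: "'w \<Rightarrow> nat \<Rightarrow> (nat \<times> nat) set" where
  "tr w = (\<lambda>u. if u \<in> V then T u w else {})"

definition MS :: "(nat \<times> nat \<Rightarrow> mark) set" where "MS = PiE_dflt (V \<times> V) Unobserved (\<lambda>_. UNIV)"
definition TS :: "(nat \<Rightarrow> (nat \<times> nat) set) set" where "TS = PiE_dflt V {} (\<lambda>_. Pow (V \<times> V))"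

lemma finite_MS [simp]: "finite MS" and finite_TS [simp]: "finite TS"
  unfolding MS_def TS_def by auto

lemma mk_MS: "mk w \<in> MS"
  by (auto simp: MS_def PiE_dflt_def mk_def)

lemma tr_TS: "w \<in> space P \<Longrightarrow> tr w \<in> TS"
  using measurable_space[OF tree_measurable] by (fastforce simp: TS_def PiE_dflt_def tr_def)

lemma MS_outside: "\<mu> \<in> MS \<Longrightarrow> e \<notin> V \<times> V \<Longrightarrow> \<mu> e = Unobserved"
  unfolding MS_def PiE_dflt_def by blast

lemma set_marks_MS: "\<mu> \<in> set_pmf (marks_pmf n p) \<Longrightarrow> \<mu> \<in> MS"
  using set_Pi_pmf_subset[of "V \<times> V" Unobserved "\<lambda>_. mark_pmf p"]
  unfolding marks_pmf_def MS_def PiE_dflt_def by blast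

lemma mk_eq_iff:
  assumes "\<mu> \<in> MS" shows "mk w = \<mu> \<longleftrightarrow> (\<forall>e\<in>V \<times> V. mrk e w = \<mu> e)"
proof -
  show ?thesis unfolding mk_def fun_eq_iff using MS_outside[OF assms] by metis
qed

lemma tr_eq_iff: "\<tau> \<in> TS \<Longrightarrow> tr w = \<tau> \<longleftrightarrow> (\<forall>u\<in>V. T u w = \<tau> u)"
  by (auto simp: TS_def PiE_dflt_def tr_def fun_eq_iff)

lemma VV_ne: "V \<times> V \<noteq> {}" "V \<noteq> {}" using n_pos by auto

lemma mk_event: "{w \<in> space P. mk w = \<mu>} \<in> sets P" if "\<mu> \<in> MS"
  unfolding mk_eq_iff[OF that]
  by (intro sets.sets_Collect_finite_All measurable_count_space_eq[OF mark_measurable]) auto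

lemma tr_event: "{w \<in> space P. tr w = \<tau>} \<in> sets P" if "\<tau> \<in> TS"
  unfolding tr_eq_iff[OF that]
proof (intro sets.sets_Collect_finite_All)
  fix u assume u: "u \<in> V"
  have "{w \<in> space P. T u w = \<tau> u} = T u -` {\<tau> u} \<inter> space P" by auto
  moreover have "{\<tau> u} \<in> sets (count_space (Pow (V \<times> V)))" using that u by (auto simp: TS_def PiE_dflt_def)
  ultimately show "{w \<in> space P. T u w = \<tau> u} \<in> sets P" using measurable_sets[OF tree_measurable[OF u]] by simp
qed simp

lemma prob_mk:
  assumes "\<mu> \<in> MS" shows "prob {w \<in> space P. mk w = \<mu>} = pmf (marks_pmf n p) \<mu>"
proof -
  have "{w \<in> space P. mk w = \<mu>} = (\<Inter>e\<in>V \<times> V. mrk e -` {\<mu> e} \<inter> space P)"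
    using VV_ne by (auto simp: mk_eq_iff[OF assms])
  then have "prob {w \<in> space P. mk w = \<mu>} = (\<Prod>e\<in>V \<times> V. prob (mrk e -` {\<mu> e} \<inter> space P))"
    using VV_ne by (simp only:) (rule indep_varsD[OF mark_indep], auto)
  also have "\<dots> = (\<Prod>e\<in>V \<times> V. pmf (mark_pmf p) (\<mu> e))"
  proof (rule prod.cong[OF refl])
    fix e assume e: "e \<in> V \<times> V"
    have "prob (mrk e -` {\<mu> e} \<inter> space P) = measure (distr P (count_space UNIV) (mrk e)) {\<mu> e}"
      by (rule measure_distr[symmetric]) (use mark_measurable[OF e] in auto)
    then show "prob (mrk e -` {\<mu> e} \<inter> space P) = pmf (mark_pmf p) (\<mu> e)"
      unfolding mark_distr[OF e] by (simp add: measure_pmf_single)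
  qed
  also have "\<dots> = pmf (marks_pmf n p) \<mu>"
    unfolding marks_pmf_def using MS_outside[OF assms] by (subst pmf_Pi'; blast)
  finally show ?thesis .
qed

definition data_alg :: "'w measure" where
  "data_alg = vimage_algebra (space P) (\<lambda>w. (\<lambda>i\<in>{1..n}. \<theta> i w, \<lambda>e\<in>{1..n}\<times>{1..n}. Z e w))
        (Pi\<^sub>M {1..n} (\<lambda>_. borel) \<Otimes>\<^sub>M Pi\<^sub>M ({1..n}\<times>{1..n}) (\<lambda>_. borel))"

definition mark_alg :: "'w measure" where
  "mark_alg = vimage_algebra (space P) (\<lambda>w. \<lambda>e\<in>{1..n}\<times>{1..n}. mrk e w)
        (Pi\<^sub>M ({1..n}\<times>{1..n}) (\<lambda>_. count_space UNIV))"

lemma info_measurable_gen: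
  assumes th: "\<And>i. i \<in> V \<Longrightarrow> \<theta> i \<in> borel_measurable M" and Z: "\<And>e. e \<in> V \<times> V \<Longrightarrow> Z e \<in> borel_measurable M"
    and sp: "space M = space P" and g: "g \<in> borel_measurable (info (V \<times> V))"
  shows "g \<in> borel_measurable M"
proof -
  have "rect (V \<times> V) a b \<in> sets M" if "range a \<subseteq> sets borel" "range b \<subseteq> sets borel" for a b
  proof -
    have a: "a i \<in> sets borel" and b: "b e \<in> sets borel" for i e using that by auto
    have "{w \<in> space M. \<forall>i\<in>V. \<theta> i w \<in> a i} \<in> sets M"
      by (intro sets.sets_Collect_finite_All measurable_sets_Collect[OF th]) (use a in auto)
    moreover have "{w \<in> space M. \<forall>e\<in>V \<times> V. Z e w \<in> b e} \<in> sets M"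
      by (intro sets.sets_Collect_finite_All measurable_sets_Collect[OF Z]) (use b in auto)
    ultimately have "{w \<in> space M. \<forall>i\<in>V. \<theta> i w \<in> a i} \<inter> {w \<in> space M. \<forall>e\<in>V \<times> V. Z e w \<in> b e} \<in> sets M" by blast
    then show ?thesis unfolding rect_def sp by (simp add: Int_def conj_ac cong: conj_cong)
  qed
  then have "sigma_sets (space M) {rect (V \<times> V) a b | a b. range a \<subseteq> sets borel \<and> range b \<subseteq> sets borel} \<subseteq> sets M"
    by (intro sets.sigma_sets_subset) blast
  then have "sets (info (V \<times> V)) \<subseteq> sets M" by (simp add: sets_info sp)
  then show ?thesis using g sp by (auto simp: measurable_def)
qed

lemma data_alg_measurable:
  assumes g: "g \<in> borel_measurable (info (V \<times> V))" shows "g \<in> borel_measurable data_alg"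
proof -
  have m: "(\<lambda>w. (\<lambda>i\<in>V. \<theta> i w, \<lambda>e\<in>V \<times> V. Z e w)) \<in> data_alg \<rightarrow>\<^sub>M (Pi\<^sub>M V (\<lambda>_. borel) \<Otimes>\<^sub>M Pi\<^sub>M (V \<times> V) (\<lambda>_. borel))"
    unfolding data_alg_def by (rule measurable_vimage_algebra1) (auto simp: space_PiM space_pair_measure)
  show ?thesis
  proof (rule info_measurable_gen[OF _ _ _ g])
    fix i assume i: "i \<in> V"
    from measurable_compose[OF measurable_compose[OF m measurable_fst] measurable_component_singleton[OF i]]
    show "\<theta> i \<in> borel_measurable data_alg" using i by simp
  next
    fix e assume e: "e \<in> V \<times> V"
    from measurable_compose[OF measurable_compose[OF m measurable_snd] measurable_component_singleton[OF e]]
    show "Z e \<in> borel_measurable data_alg" using e by simp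
  qed (simp add: data_alg_def)
qed

lemma mark_alg_event: "{w \<in> space P. mk w = \<mu>} \<in> sets mark_alg" if mu: "\<mu> \<in> MS"
proof -
  have sp: "space mark_alg = space P" by (simp add: mark_alg_def)
  have m: "(\<lambda>w. \<lambda>e\<in>V \<times> V. mrk e w) \<in> mark_alg \<rightarrow>\<^sub>M Pi\<^sub>M (V \<times> V) (\<lambda>_. count_space UNIV)"
    unfolding mark_alg_def by (rule measurable_vimage_algebra1) (auto simp: space_PiM)
  have c: "mrk e \<in> mark_alg \<rightarrow>\<^sub>M count_space UNIV" if e: "e \<in> V \<times> V" for e
    using measurable_compose[OF m measurable_component_singleton[OF e]] e by simp
  show ?thesis unfolding mk_eq_iff[OF mu] sp[symmetric]
    by (intro sets.sets_Collect_finite_All measurable_count_space_eq[OF c]) auto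
qed

lemma integral_mk:
  assumes mu: "\<mu> \<in> MS" and g: "g \<in> borel_measurable (info (V \<times> V))" "bdd g"
  shows "(\<integral>w. indicator {w \<in> space P. mk w = \<mu>} w * g w \<partial>P) = pmf (marks_pmf n p) \<mu> * (\<integral>w. g w \<partial>P)"
proof -
  let ?Y = "indicator {w \<in> space P. mk w = \<mu>} :: 'w \<Rightarrow> real"
  have gP: "g \<in> borel_measurable P" by (rule measurable_info[OF order.refl g(1)])
  have YP: "?Y \<in> borel_measurable P" using mk_event[OF mu] by simp
  have "sigma_sets (space P) {g -` A \<inter> space P | A. A \<in> sets borel} \<subseteq> sets data_alg"
  proof -
    have "{g -` A \<inter> space P | A. A \<in> sets borel} \<subseteq> sets data_alg"
      using measurable_sets[OF data_alg_measurable[OF g(1)]] by (auto simp: data_alg_def)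
    then have "sigma_sets (space data_alg) {g -` A \<inter> space P | A. A \<in> sets borel} \<subseteq> sets data_alg"
      by (rule sets.sigma_sets_subset)
    then show ?thesis by (simp add: data_alg_def)
  qed
  moreover have "sigma_sets (space P) {?Y -` A \<inter> space P | A. A \<in> sets borel} \<subseteq> sets mark_alg"
  proof -
    have "?Y \<in> borel_measurable mark_alg" using mark_alg_event[OF mu] by simp
    then have "{?Y -` A \<inter> space P | A. A \<in> sets borel} \<subseteq> sets mark_alg"
      using measurable_sets[of ?Y mark_alg borel] by (auto simp: mark_alg_def)
    then have "sigma_sets (space mark_alg) {?Y -` A \<inter> space P | A. A \<in> sets borel} \<subseteq> sets mark_alg"
      by (rule sets.sigma_sets_subset)
    then show ?thesis by (simp add: mark_alg_def)
  qed
  moreover have "indep_set (sets data_alg) (sets mark_alg)"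
    using mark_indep_data unfolding data_alg_def mark_alg_def .
  ultimately have "indep_set (sigma_sets (space P) {g -` A \<inter> space P | A. A \<in> sets borel})
      (sigma_sets (space P) {?Y -` A \<inter> space P | A. A \<in> sets borel})"
    unfolding indep_set_def by (elim indep_sets_mono_sets) (auto split: bool.split)
  then have "indep_var borel g borel ?Y"
    unfolding indep_var_eq using gP YP by simp
  then have "(\<integral>w. g w * ?Y w \<partial>P) = (\<integral>w. g w \<partial>P) * (\<integral>w. ?Y w \<partial>P)"
    using bdd_integrable[OF gP g(2)] mk_event[OF mu]
    by (intro indep_var_lebesgue_integral) (auto simp: emeasure_eq_measure)
  moreover have "(\<integral>w. ?Y w \<partial>P) = pmf (marks_pmf n p) \<mu>"
    using prob_mk[OF mu] mk_event[OF mu] by simp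
  ultimately show ?thesis by (simp add: mult.commute)
qed

abbreviation "samp \<equiv> sample_algebra P n \<theta> Z mrk"

lemma space_samp [simp]: "space samp = space P"
  by (simp add: sample_algebra_def)

lemma samp_measurable:
  "i \<in> V \<Longrightarrow> \<theta> i \<in> borel_measurable samp"
  "e \<in> V \<times> V \<Longrightarrow> Z e \<in> borel_measurable samp"
  "e \<in> V \<times> V \<Longrightarrow> mrk e \<in> samp \<rightarrow>\<^sub>M count_space UNIV"
proof -
  have m: "(\<lambda>w. (\<lambda>i\<in>V. \<theta> i w, \<lambda>e\<in>V\<times>V. Z e w, \<lambda>e\<in>V\<times>V. mrk e w)) \<in> samp \<rightarrow>\<^sub>M
       (Pi\<^sub>M V (\<lambda>_. borel) \<Otimes>\<^sub>M Pi\<^sub>M (V\<times>V) (\<lambda>_. borel) \<Otimes>\<^sub>M Pi\<^sub>M (V\<times>V) (\<lambda>_. count_space UNIV))"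
    unfolding sample_algebra_def
    by (rule measurable_vimage_algebra1) (auto simp: space_PiM space_pair_measure)
  show "\<theta> i \<in> borel_measurable samp" if "i \<in> V"
    using measurable_compose[OF measurable_compose[OF m measurable_fst] measurable_component_singleton[OF that]] that by simp
  show "Z e \<in> borel_measurable samp" if "e \<in> V \<times> V"
    using measurable_compose[OF measurable_compose[OF measurable_compose[OF m measurable_snd] measurable_fst] measurable_component_singleton[OF that]] that by simp
  show "mrk e \<in> samp \<rightarrow>\<^sub>M count_space UNIV" if "e \<in> V \<times> V"
    using measurable_compose[OF measurable_compose[OF measurable_compose[OF m measurable_snd] measurable_snd] measurable_component_singleton[OF that]] that by simp
qed

lemma subalgebra_samp: "subalgebra P samp"
proof -
  have "(\<lambda>w. (\<lambda>i\<in>V. \<theta> i w, \<lambda>e\<in>V\<times>V. Z e w, \<lambda>e\<in>V\<times>V. mrk e w)) \<in> P \<rightarrow>\<^sub>M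
       (Pi\<^sub>M V (\<lambda>_. borel) \<Otimes>\<^sub>M Pi\<^sub>M (V\<times>V) (\<lambda>_. borel) \<Otimes>\<^sub>M Pi\<^sub>M (V\<times>V) (\<lambda>_. count_space UNIV))"
    by (intro measurable_Pair measurable_restrict theta_measurable Z_measurable mark_measurable)
  then have "sets samp \<subseteq> sets P"
    unfolding sample_algebra_def by (rule sets_image_in_sets[OF refl])
  then show ?thesis unfolding subalgebra_def by simp
qed

sublocale samp: finite_measure_subalgebra P samp
  by unfold_locales (rule subalgebra_samp)

text \<open>Conditioning on everything but the trees replaces the tree event by its conditional
  probability. On \<open>mk w = \<mu>\<close> this is a constant, since the graph is a function of
  the marks; independence of marks and data does the rest.\<close>

lemma integral_mk_tr:
  assumes mu: "\<mu> \<in> MS" and tau: "\<tau> \<in> TS" and g: "g \<in> borel_measurable (info (V \<times> V))" "bdd g"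
  shows "(\<integral>w. indicator {w \<in> space P. mk w = \<mu>} w * (indicator {w \<in> space P. tr w = \<tau>} w * g w) \<partial>P) =
    pmf (marks_pmf n p) \<mu> * pmf (trees_pmf n (edges1 n \<mu>)) \<tau> * (\<integral>w. g w \<partial>P)"
proof -
  let ?Y = "indicator {w \<in> space P. mk w = \<mu>} :: 'w \<Rightarrow> real" and ?X = "indicator {w \<in> space P. tr w = \<tau>} :: 'w \<Rightarrow> real"
  have gP [measurable]: "g \<in> borel_measurable P" by (rule measurable_info[OF order.refl g(1)])
  have gs: "g \<in> borel_measurable samp"
    by (rule info_measurable_gen[OF samp_measurable(1,2) space_samp g(1)])
  have YP [measurable]: "?Y \<in> borel_measurable P" using mk_event[OF mu] by simp
  have XP [measurable]: "?X \<in> borel_measurable P" using tr_event[OF tau] by simp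
  have "{w \<in> space samp. mk w = \<mu>} \<in> sets samp"
    unfolding mk_eq_iff[OF mu]
    by (intro sets.sets_Collect_finite_All measurable_count_space_eq[OF samp_measurable(3)]) auto
  then have Ys: "?Y \<in> borel_measurable samp" by simp
  have Xeq: "{w \<in> space P. tr w = \<tau>} = {w \<in> space P. \<forall>u\<in>{1..n}. T u w = \<tau> u}"
    by (simp add: tr_eq_iff[OF tau])
  have Yb: "bdd ?Y" and Xb: "bdd ?X" by (auto intro!: bddI[of _ 1])
  have "(\<integral>w. ?Y w * (?X w * g w) \<partial>P) = (\<integral>w. (?Y w * g w) * ?X w \<partial>P)" by (simp add: mult_ac)
  also have "\<dots> = (\<integral>w. (?Y w * g w) * real_cond_exp P samp ?X w \<partial>P)"
    by (rule samp.real_cond_exp_intg(2)[symmetric])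
       (use Ys gs XP in \<open>auto intro!: bdd_integrable bdd_mult Xb Yb g(2)\<close>)
  also have "\<dots> = (\<integral>w. pmf (trees_pmf n (edges1 n \<mu>)) \<tau> * (?Y w * g w) \<partial>P)"
  proof (rule integral_cong_AE)
    show "AE w in P. ?Y w * g w * real_cond_exp P samp ?X w = pmf (trees_pmf n (edges1 n \<mu>)) \<tau> * (?Y w * g w)"
      using tree_cond_distr[of \<tau>] unfolding Xeq[symmetric]
    proof eventually_elim
      case (elim w)
      show ?case
      proof (cases "mk w = \<mu> \<and> w \<in> space P")
        case True
        then have "edges1 n (\<lambda>e. mrk e w) = edges1 n \<mu>"
          using mk_eq_iff[OF mu, of w] by (auto simp: edges1_def)
        moreover have "pmf (trees_pmf n (edges1 n \<mu>)) \<tau> = (\<Prod>u=1..n. pmf (pmf_of_set (bfs_trees (edges1 n \<mu>) u)) (\<tau> u))"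
          unfolding trees_pmf_def using tau by (subst pmf_Pi') (auto simp: TS_def PiE_dflt_def)
        ultimately show ?thesis using elim by simp
      qed auto
    qed
  qed auto
  also have "\<dots> = pmf (trees_pmf n (edges1 n \<mu>)) \<tau> * (pmf (marks_pmf n p) \<mu> * (\<integral>w. g w \<partial>P))"
    using integral_mk[OF mu g] by simp
  finally show ?thesis by (simp add: mult_ac)
qed

lemma mk_tr_decomp:
  fixes \<Phi> :: "_ \<Rightarrow> _ \<Rightarrow> 'w \<Rightarrow> real"
  assumes "w \<in> space P"
  shows "\<Phi> (mk w) (tr w) w = (\<Sum>\<mu>\<in>MS. \<Sum>\<tau>\<in>TS. indicator {w \<in> space P. mk w = \<mu>} w * (indicator {w \<in> space P. tr w = \<tau>} w * \<Phi> \<mu> \<tau> w))"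
proof -
  have "(\<Sum>\<mu>\<in>MS. \<Sum>\<tau>\<in>TS. indicator {w \<in> space P. mk w = \<mu>} w * (indicator {w \<in> space P. tr w = \<tau>} w * \<Phi> \<mu> \<tau> w))
    = (\<Sum>\<mu>\<in>MS. if \<mu> = mk w then \<Sum>\<tau>\<in>TS. if \<tau> = tr w then \<Phi> \<mu> \<tau> w else 0 else 0)"
    using assms by (intro sum.cong refl) (auto simp: indicator_def intro!: sum.cong)
  also have "\<dots> = \<Phi> (mk w) (tr w) w"
    using mk_MS[of w] tr_TS[OF assms] by (simp add: sum.delta')
  finally show ?thesis ..
qed

lemma mk_tr_measurable:
  fixes \<Phi> :: "_ \<Rightarrow> _ \<Rightarrow> 'w \<Rightarrow> real"
  assumes "\<And>\<mu> \<tau>. \<Phi> \<mu> \<tau> \<in> borel_measurable P"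
  shows "(\<lambda>w. \<Phi> (mk w) (tr w) w) \<in> borel_measurable P"
proof -
  have "(\<lambda>w. \<Sum>\<mu>\<in>MS. \<Sum>\<tau>\<in>TS. indicator {w \<in> space P. mk w = \<mu>} w * (indicator {w \<in> space P. tr w = \<tau>} w * \<Phi> \<mu> \<tau> w)) \<in> borel_measurable P"
    by (intro borel_measurable_sum borel_measurable_times borel_measurable_indicator mk_event tr_event assms)
  then show ?thesis
    using measurable_cong[where f = "\<lambda>w. \<Phi> (mk w) (tr w) w" and M = P, OF mk_tr_decomp[of _ \<Phi>]] by simp
qed

text \<open>The joint law of marks and trees, with the data \<open>(\<theta>, Z)\<close> integrated innermost.\<close>

lemma expectation_mk_tr:
  fixes \<Phi> :: "_ \<Rightarrow> _ \<Rightarrow> 'w \<Rightarrow> real"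
  assumes \<Phi>: "\<And>\<mu> \<tau>. \<Phi> \<mu> \<tau> \<in> borel_measurable (info (V \<times> V))" "\<And>\<mu> \<tau>. bdd (\<Phi> \<mu> \<tau>)"
  shows "(\<integral>w. \<Phi> (mk w) (tr w) w \<partial>P) =
    pexp (marks_pmf n p) (\<lambda>\<mu>. pexp (trees_pmf n (edges1 n \<mu>)) (\<lambda>\<tau>. \<integral>w. \<Phi> \<mu> \<tau> w \<partial>P))"
proof -
  have \<Phi>P: "\<Phi> \<mu> \<tau> \<in> borel_measurable P" for \<mu> \<tau> by (rule measurable_info[OF order.refl \<Phi>(1)])
  let ?f = "\<lambda>\<mu> \<tau> w. indicator {w \<in> space P. mk w = \<mu>} w * (indicator {w \<in> space P. tr w = \<tau>} w * \<Phi> \<mu> \<tau> w) :: real"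
  have int: "integrable P (\<lambda>w. indicator {w \<in> space P. mk w = \<mu>} w * (indicator {w \<in> space P. tr w = \<tau>} w * \<Phi> \<mu> \<tau> w))"
    if "\<mu> \<in> MS" "\<tau> \<in> TS" for \<mu> \<tau>
    using mk_event[OF that(1)] tr_event[OF that(2)]
    by (intro bdd_integrable borel_measurable_times borel_measurable_indicator \<Phi>P bdd_mult \<Phi>(2)) (auto intro!: bddI[of _ 1])
  have "(\<integral>w. \<Phi> (mk w) (tr w) w \<partial>P) = (\<integral>w. (\<Sum>\<mu>\<in>MS. \<Sum>\<tau>\<in>TS. indicator {w \<in> space P. mk w = \<mu>} w * (indicator {w \<in> space P. tr w = \<tau>} w * \<Phi> \<mu> \<tau> w)) \<partial>P)"
    by (rule Bochner_Integration.integral_cong[OF refl mk_tr_decomp])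
  also have "\<dots> = (\<Sum>\<mu>\<in>MS. \<Sum>\<tau>\<in>TS. pmf (marks_pmf n p) \<mu> * pmf (trees_pmf n (edges1 n \<mu>)) \<tau> * (\<integral>w. \<Phi> \<mu> \<tau> w \<partial>P))"
  proof -
    have "(\<integral>w. (\<Sum>\<mu>\<in>MS. \<Sum>\<tau>\<in>TS. ?f \<mu> \<tau> w) \<partial>P) = (\<Sum>\<mu>\<in>MS. \<integral>w. (\<Sum>\<tau>\<in>TS. ?f \<mu> \<tau> w) \<partial>P)"
      by (rule Bochner_Integration.integral_sum, rule Bochner_Integration.integrable_sum, rule int)
    also have "\<dots> = (\<Sum>\<mu>\<in>MS. \<Sum>\<tau>\<in>TS. \<integral>w. ?f \<mu> \<tau> w \<partial>P)"
      by (rule sum.cong[OF refl], rule Bochner_Integration.integral_sum, rule int)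
    also have "\<dots> = (\<Sum>\<mu>\<in>MS. \<Sum>\<tau>\<in>TS. pmf (marks_pmf n p) \<mu> * pmf (trees_pmf n (edges1 n \<mu>)) \<tau> * (\<integral>w. \<Phi> \<mu> \<tau> w \<partial>P))"
      by (intro sum.cong refl integral_mk_tr \<Phi>)
    finally show ?thesis .
  qed
  also have "\<dots> = (\<Sum>\<mu>\<in>MS. pexp (trees_pmf n (edges1 n \<mu>)) (\<lambda>\<tau>. \<integral>w. \<Phi> \<mu> \<tau> w \<partial>P) * pmf (marks_pmf n p) \<mu>)"
  proof (rule sum.cong[OF refl])
    fix \<mu>
    have "pexp (trees_pmf n (edges1 n \<mu>)) (\<lambda>\<tau>. \<integral>w. \<Phi> \<mu> \<tau> w \<partial>P) = (\<Sum>\<tau>\<in>TS. (\<integral>w. \<Phi> \<mu> \<tau> w \<partial>P) * pmf (trees_pmf n (edges1 n \<mu>)) \<tau>)"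
    proof (rule integral_measure_pmf_real)
      fix \<tau> assume t: "\<tau> \<in> set_pmf (trees_pmf n (edges1 n \<mu>))"
      have "\<tau> u \<subseteq> V \<times> V" if "u \<in> V" for u
        using bfs_trees_subset[OF edges1_subset set_trees_pmf[OF edges1_subset t that]] .
      moreover have "\<tau> u = {}" if "u \<notin> V" for u
        using set_Pi_pmf_subset[of V "{}" "\<lambda>u. pmf_of_set (bfs_trees (edges1 n \<mu>) u)"] t that by (auto simp: trees_pmf_def)
      ultimately show "\<tau> \<in> TS" by (auto simp: TS_def PiE_dflt_def)
    qed simp
    then show "(\<Sum>\<tau>\<in>TS. pmf (marks_pmf n p) \<mu> * pmf (trees_pmf n (edges1 n \<mu>)) \<tau> * (\<integral>w. \<Phi> \<mu> \<tau> w \<partial>P)) =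
        pexp (trees_pmf n (edges1 n \<mu>)) (\<lambda>\<tau>. \<integral>w. \<Phi> \<mu> \<tau> w \<partial>P) * pmf (marks_pmf n p) \<mu>"
      by (simp add: sum_distrib_left mult_ac)
  qed
  also have "\<dots> = pexp (marks_pmf n p) (\<lambda>\<mu>. pexp (trees_pmf n (edges1 n \<mu>)) (\<lambda>\<tau>. \<integral>w. \<Phi> \<mu> \<tau> w \<partial>P))"
    by (rule integral_measure_pmf_real[symmetric]) (simp, rule set_marks_MS)
  finally show ?thesis .
qed

text \<open>A bound in two stages. With graph and trees fixed, \<open>\<Phi>\<close> is compared
  with \<open>\<Psi>\<close> after integrating the data, where entries can be replaced by means.
  With the data fixed, \<open>\<Psi>\<close> is then averaged over graph and trees, where the
  exploration applies. Exchanging the two averages links the stages.\<close>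

lemma expectation_mk_tr_le:
  fixes \<Phi> \<Psi> :: "_ \<Rightarrow> _ \<Rightarrow> 'w \<Rightarrow> real"
  assumes \<Phi>: "\<And>\<mu> \<tau>. \<Phi> \<mu> \<tau> \<in> borel_measurable (info (V \<times> V))" "\<And>\<mu> \<tau>. bdd (\<Phi> \<mu> \<tau>)"
    and \<Psi>: "\<And>\<mu> \<tau>. \<Psi> \<mu> \<tau> \<in> borel_measurable (info (V \<times> V))" "\<And>\<mu> \<tau>. bdd (\<Psi> \<mu> \<tau>)"
    and le: "\<And>\<mu> \<tau>. (\<And>u. u \<in> V \<Longrightarrow> \<tau> u \<in> bfs_trees (edges1 n \<mu>) u) \<Longrightarrow> (\<integral>w. \<Phi> \<mu> \<tau> w \<partial>P) \<le> (\<integral>w. \<Psi> \<mu> \<tau> w \<partial>P)"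
    and K: "\<And>w. w \<in> space P \<Longrightarrow> pexp (marks_pmf n p) (\<lambda>\<mu>. pexp (trees_pmf n (edges1 n \<mu>)) (\<lambda>\<tau>. \<Psi> \<mu> \<tau> w)) \<le> K"
  shows "(\<integral>w. \<Phi> (mk w) (tr w) w \<partial>P) \<le> K"
proof -
  have \<Psi>i: "integrable P (\<Psi> \<mu> \<tau>)" for \<mu> \<tau> by (rule bdd_integrable[OF measurable_info[OF order.refl \<Psi>(1)] \<Psi>(2)])
  have ft: "finite (set_pmf (trees_pmf n (edges1 n \<mu>)))" for \<mu> by (rule finite_set_trees_pmf[OF edges1_subset])
  have "(\<integral>w. \<Phi> (mk w) (tr w) w \<partial>P) = pexp (marks_pmf n p) (\<lambda>\<mu>. pexp (trees_pmf n (edges1 n \<mu>)) (\<lambda>\<tau>. \<integral>w. \<Phi> \<mu> \<tau> w \<partial>P))"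
    by (rule expectation_mk_tr[OF \<Phi>])
  also have "\<dots> \<le> pexp (marks_pmf n p) (\<lambda>\<mu>. pexp (trees_pmf n (edges1 n \<mu>)) (\<lambda>\<tau>. \<integral>w. \<Psi> \<mu> \<tau> w \<partial>P))"
    by (intro pexp_mono ft finite_set_marks_pmf le set_trees_pmf[OF edges1_subset])
  also have "\<dots> = (\<integral>w. pexp (marks_pmf n p) (\<lambda>\<mu>. pexp (trees_pmf n (edges1 n \<mu>)) (\<lambda>\<tau>. \<Psi> \<mu> \<tau> w)) \<partial>P)"
    by (simp add: pexp_sum[OF ft] pexp_sum[OF finite_set_marks_pmf] \<Psi>i)
  also have "\<dots> \<le> (\<integral>w. K \<partial>P)"
    by (rule integral_mono) (auto simp: pexp_sum[OF ft] pexp_sum[OF finite_set_marks_pmf] \<Psi>i K[unfolded pexp_sum[OF ft] pexp_sum[OF finite_set_marks_pmf]])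
  finally show ?thesis by (simp add: prob_space)
qed

end

section \<open>Exponential moment of a level deviation in the model\<close>

lemma nbr_vec_step:
  assumes G: "G \<in> bfs_trees E u" and i: "i \<in> sphere_at E u (Suc s)"
  shows "tree_parent G i \<in> sphere_at E u s" "(tree_parent G i, i) \<in> E"
    "nbr_vec E A G u (Suc s) i = nbr_vec E A G u s (tree_parent G i) * A (tree_parent G i) i"
proof -
  obtain \<pi> where \<pi>: "G = tree_of (targets E u) \<pi>" "\<pi> \<in> PiE_dflt (targets E u) 0 (parents E u)"
    using G unfolding bfs_trees_eq by blast
  have valid: "\<pi> i \<in> parents E u i" if "i \<in> targets E u" for i using \<pi>(2) that by (auto simp: PiE_dflt_def)
  have it: "i \<in> targets E u" using i targets_iff by blast
  have tp: "tree_parent G i = \<pi> i" unfolding \<pi>(1) by (rule tree_parent_tree_of[OF it])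
  show "tree_parent G i \<in> sphere_at E u s" "(tree_parent G i, i) \<in> E"
    using valid[OF it] unfolding tp parents_eq[OF i] by auto
  show "nbr_vec E A G u (Suc s) i = nbr_vec E A G u s (tree_parent G i) * A (tree_parent G i) i"
    unfolding tp by (rule nbr_vec_Suc[OF valid \<pi>(1) i])
qed

lemma nbr_vec_outside: "i \<notin> sphere_at E u s \<Longrightarrow> nbr_vec E A G u s i = 0"
  by (simp add: nbr_vec_def)

lemma nbr_vec_cong:
  assumes G: "G \<in> bfs_trees E u" and A: "\<And>a b. (a, b) \<in> E \<Longrightarrow> A a b = A' a b"
  shows "nbr_vec E A G u s i = nbr_vec E A' G u s i"
proof (induction s arbitrary: i)
  case (Suc s)
  show ?case
  proof (cases "i \<in> sphere_at E u (Suc s)")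
    case True
    show ?thesis using Suc nbr_vec_step[OF G True] A by simp
  qed (simp add: nbr_vec_outside)
qed (simp add: nbr_vec_0[OF G])

text \<open>The chord of \<open>exp\<close> over the unit interval. It is affine in
  \<open>x\<close>, so afterwards only the mean of a variable with values in that interval
  matters.\<close>

lemma exp_convex_bound:
  fixes x y :: real assumes "x \<in> {0..1}" shows "exp (y * x) \<le> 1 + x * (exp y - 1)"
proof -
  have "exp ((1 - x) * 0 + x * y) \<le> (1 - x) * exp 0 + x * exp y"
    using convex_onD[OF exp_convex, of x 0 y] assms by simp
  then show ?thesis by (simp add: algebra_simps)
qed

lemma pexp_mark:
  assumes p: "0 \<le> p" "p \<le> 1"
  shows "pexp (mark_pmf p) g = (1 - p) * g Unobserved +
    p / 4 * (subsample_prob p * g (Part1 True) + (1 - subsample_prob p) * g (Part1 False)) + p / 4 * g Part2 + p / 2 * g Part3"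
proof -
  define Q where "Q = pmf_of_list [(1::nat, 1/4), (2, 1/4), (3, 1/2)]"
  have wf: "pmf_of_list_wf [(1::nat, 1/4), (2, 1/4), (3, 1/2 :: real)]"
    by (auto simp: pmf_of_list_wf_def)
  have setP: "set_pmf Q \<subseteq> {1, 2, 3}" unfolding Q_def using set_pmf_of_list[OF wf] by simp
  have finP: "finite (set_pmf Q)" using finite_subset[OF setP] by simp
  have vals: "pmf Q 1 = 1/4" "pmf Q 2 = 1/4" "pmf Q 3 = 1/2"
    unfolding Q_def by (simp_all only: pmf_pmf_of_list[OF wf]) simp_all
  have P: "pexp Q h = h 1 / 4 + h 2 / 4 + h 3 / 2" for h
  proof -
    have "pexp Q h = (\<Sum>i\<in>{1, 2, 3}. pmf Q i * h i)"
      using setP by (subst integral_measure_pmf[of "{1, 2, 3}"]) auto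
    then show ?thesis using vals by simp
  qed
  have q: "0 \<le> subsample_prob p" "subsample_prob p \<le> 1"
    using p by (auto simp: subsample_prob_def field_simps)
  have b: "pexp (bernoulli_pmf c) h = c * h True + (1 - c) * h False" if "0 \<le> c" "c \<le> 1" for c h
    using that by (simp add: mult.commute)
  show ?thesis unfolding mark_pmf_def Q_def[symmetric]
    apply (subst pexp_bind)
    subgoal by simp
    subgoal using finP by (auto simp: set_bind_pmf)
    subgoal
      unfolding b[OF p]
      apply simp
      apply (subst pexp_bind)
      subgoal by (rule finP)
      subgoal by auto
      subgoal unfolding P using q by (simp add: algebra_simps)
      done
    done
qed

lemma edges1_alt: "edges1 n \<mu> = E \<longleftrightarrow> E \<subseteq> {1..n} \<times> {1..n} \<and> (\<forall>e\<in>{1..n} \<times> {1..n}. (\<exists>b. \<mu> e = Part1 b) \<longleftrightarrow> e \<in> E)"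
  unfolding edges1_def by blast

lemma borel_measurable_exp_comp:
  fixes g :: "'a \<Rightarrow> real"
  assumes "g \<in> borel_measurable M" shows "(\<lambda>w. exp (g w)) \<in> borel_measurable M"
  using assms by measurable

lemma borel_measurable_If_const:
  assumes "c \<Longrightarrow> g \<in> borel_measurable M" "\<not> c \<Longrightarrow> h \<in> borel_measurable M"
  shows "(\<lambda>w. if c then g w else h w) \<in> borel_measurable M"
  using assms by (cases c) simp_all

context sample_model
begin

lemma bdd_If_const:
  assumes "c \<Longrightarrow> bdd g" "\<not> c \<Longrightarrow> bdd h" shows "bdd (\<lambda>w. if c then g w else h w)"
  using assms by (cases c) simp_all

text \<open>Extended by 0 off the index set, as is \<open>ff\<close>, because
  \<open>level_mgf\<close> asks for values in the unit interval at all pairs of naturals.\<close>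

definition zz :: "'w \<Rightarrow> nat \<Rightarrow> nat \<Rightarrow> real" where
  "zz w a b = (if (a, b) \<in> V \<times> V then Z (a, b) w else 0)"

definition ff :: "'w \<Rightarrow> nat \<Rightarrow> nat \<Rightarrow> real" where
  "ff w a b = (if (a, b) \<in> V \<times> V then mean (a, b) w else 0)"

definition nv :: "(nat \<times> nat) set \<Rightarrow> (nat \<times> nat) set \<Rightarrow> nat \<Rightarrow> nat \<Rightarrow> nat \<Rightarrow> 'w \<Rightarrow> real" where
  "nv E G u s a w = nbr_vec E (restrict_matrix E (zz w)) G u s a"

lemma zz_unit: "w \<in> space P \<Longrightarrow> zz w a b \<in> {0..1}"
  using Z_range[of "(a, b)" w] by (simp add: zz_def)

lemma ff_unit: "w \<in> space P \<Longrightarrow> ff w a b \<in> {0..1}"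
  using mean_range[of "(a, b)" w] by (simp add: ff_def)

lemma zz_info: "(a, b) \<in> R \<or> (a, b) \<notin> V \<times> V \<Longrightarrow> (\<lambda>w. zz w a b) \<in> borel_measurable (info R)"
  unfolding zz_def using Z_info[of "(a, b)" R] by (cases "(a, b) \<in> V \<times> V") auto

lemma ff_info: "(\<lambda>w. ff w a b) \<in> borel_measurable (info R)"
  unfolding ff_def using mean_info[of "(a, b)" R] by (cases "(a, b) \<in> V \<times> V") auto

lemma bdd_zz [intro]: "bdd (\<lambda>w. zz w a b)"
  using zz_unit by (intro bddI[of _ 1]) fastforce

lemma bdd_ff [intro]: "bdd (\<lambda>w. ff w a b)"
  using ff_unit by (intro bddI[of _ 1]) fastforce

lemma nv_unit: "w \<in> space P \<Longrightarrow> nv E G u s a w \<in> {0..1}"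
  unfolding nv_def using zz_unit by (intro nbr_vec_unit) (auto simp: restrict_matrix_def)

lemma bdd_nv [intro]: "bdd (nv E G u s a)"
  using nv_unit by (intro bddI[of _ 1]) fastforce

lemma nv_outside: "a \<notin> sphere_at E u s \<Longrightarrow> nv E G u s a w = 0"
  by (simp add: nv_def nbr_vec_outside)

lemma nv_info:
  assumes "E \<subseteq> R" shows "nv E G u s a \<in> borel_measurable (info R)"
proof -
  have "(\<lambda>w. \<Prod>(a, b)\<leftarrow>xs. restrict_matrix E (zz w) a b) \<in> borel_measurable (info R)" for xs
  proof (induction xs)
    case (Cons e xs)
    have "(\<lambda>w. restrict_matrix E (zz w) (fst e) (snd e)) \<in> borel_measurable (info R)"
      using assms zz_info[of "fst e" "snd e" R] by (cases "e \<in> E") (auto simp: restrict_matrix_def)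
    then have "(\<lambda>w. restrict_matrix E (zz w) (fst e) (snd e) * (\<Prod>(a, b)\<leftarrow>xs. restrict_matrix E (zz w) a b)) \<in> borel_measurable (info R)"
      using Cons by (rule borel_measurable_times)
    then show ?case by (simp add: case_prod_unfold)
  qed simp
  then show ?thesis unfolding nv_def nbr_vec_def by (cases "a \<in> sphere_at E u s") auto
qed

text \<open>Along a breadth-first tree, level \<open>s\<close> uses only edges into levels 1 to
  \<open>s\<close>. So it stays measurable when the values on edges into level \<open>Suc s\<close>
  are withheld, which \<open>nv_info\<close> does not give.\<close>

lemma nv_info_tree:
  assumes G: "G \<in> bfs_trees E u" and E: "E \<subseteq> V \<times> V"
    and R: "\<And>a b k. k < s \<Longrightarrow> b \<in> sphere_at E u (Suc k) \<Longrightarrow> (a, b) \<in> E \<Longrightarrow> (a, b) \<in> R"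
  shows "nv E G u s a \<in> borel_measurable (info R)"
  using R
proof (induction s arbitrary: a)
  case 0
  show ?case unfolding nv_def nbr_vec_0[OF G] by simp
next
  case (Suc s)
  show ?case
  proof (cases "a \<in> sphere_at E u (Suc s)")
    case True
    note st = nbr_vec_step[OF G True]
    have "(tree_parent G a, a) \<in> R" using Suc.prems[of s a] st(2) True by blast
    moreover have "nv E G u s (tree_parent G a) \<in> borel_measurable (info R)"
      by (rule Suc.IH, rule Suc.prems) auto
    ultimately show ?thesis
      unfolding nv_def st(3) restrict_matrix_def using st(2) zz_info[of "tree_parent G a" a R]
      by (auto simp: nv_def restrict_matrix_def)
  qed (simp add: nv_outside)
qed

lemma p4: "0 \<le> p / 4" "p / 4 \<le> 1" "0 \<le> p" using p_pos p_le_1 by auto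

definition p' :: real where "p' = subsample_prob p"

lemma p'_pos: "0 < p'" "p' \<le> 1"
  using p_pos p_le_1 by (auto simp: p'_def subsample_prob_def field_simps)

text \<open>Chernoff's bound restricted to an event \<open>A\<close>, to match exponential moments
  that are controlled only on a truncation event.\<close>

lemma markov_exp:
  assumes h: "h \<in> borel_measurable P" and A: "{w \<in> space P. A w} \<in> sets P" and \<sigma>: "0 \<le> \<sigma>"
    and b: "bdd h"
  shows "prob {w \<in> space P. A w \<and> \<zeta> < h w} \<le> exp (- (\<sigma> * \<zeta>)) * (\<integral>w. (if A w then exp (\<sigma> * h w) else 0) \<partial>P)"
proof -
  have eq: "(if A w then exp (\<sigma> * h w) else 0) = indicator {w \<in> space P. A w} w * exp (\<sigma> * h w)" if "w \<in> space P" for w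
    using that by simp
  have m: "(\<lambda>w. indicator {w \<in> space P. A w} w * exp (\<sigma> * h w)) \<in> borel_measurable P"
    using h A by auto
  have i: "integrable P (\<lambda>w. indicator {w \<in> space P. A w} w * exp (\<sigma> * h w))"
    using m by (rule bdd_integrable) (intro bdd_mult bdd_exp bdd_const b, auto intro!: bddI[of _ 1])
  have sub: "{w \<in> space P. A w \<and> \<zeta> < h w} = {w \<in> space P. A w} \<inter> {w \<in> space P. \<zeta> < h w}" by auto
  have ev: "{w \<in> space P. A w \<and> \<zeta> < h w} \<in> sets P" unfolding sub using A h by auto
  have "prob {w \<in> space P. A w \<and> \<zeta> < h w} = (\<integral>w. indicator {w \<in> space P. A w \<and> \<zeta> < h w} w \<partial>P)"
    using ev by simp
  also have "\<dots> \<le> (\<integral>w. exp (- (\<sigma> * \<zeta>)) * (indicator {w \<in> space P. A w} w * exp (\<sigma> * h w)) \<partial>P)"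
  proof (rule integral_mono)
    show "integrable P (indicat_real {w \<in> space P. A w \<and> \<zeta> < h w})" using ev by (simp add: emeasure_eq_measure)
    show "integrable P (\<lambda>w. exp (- (\<sigma> * \<zeta>)) * (indicator {w \<in> space P. A w} w * exp (\<sigma> * h w)))" using i by simp
    fix w
    show "indicat_real {w \<in> space P. A w \<and> \<zeta> < h w} w \<le> exp (- (\<sigma> * \<zeta>)) * (indicator {w \<in> space P. A w} w * exp (\<sigma> * h w))"
    proof (cases "w \<in> {w \<in> space P. A w \<and> \<zeta> < h w}")
      case True
      then have "\<sigma> * \<zeta> \<le> \<sigma> * h w" using \<sigma> by (intro mult_left_mono) auto
      then show ?thesis using True by (simp add: exp_add[symmetric])
    qed simp
  qed
  also have "\<dots> = exp (- (\<sigma> * \<zeta>)) * (\<integral>w. (if A w then exp (\<sigma> * h w) else 0) \<partial>P)"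
    by (simp, rule Bochner_Integration.integral_cong) (use eq in auto)
  finally show ?thesis .
qed

lemma two_sided_tail:
  assumes h: "h \<in> borel_measurable P" "bdd h" and A: "{w \<in> space P. A w} \<in> sets P" and \<sigma>: "0 \<le> \<sigma>"
    and K: "(\<integral>w. (if A w then exp (\<sigma> * h w) else 0) \<partial>P) \<le> K" "(\<integral>w. (if A w then exp (\<sigma> * - h w) else 0) \<partial>P) \<le> K"
  shows "prob {w \<in> space P. A w \<and> \<zeta> < \<bar>h w\<bar>} \<le> 2 * K * exp (- (\<sigma> * \<zeta>))"
proof -
  have ev: "{w \<in> space P. A w \<and> \<zeta> < g w} \<in> sets P" if "g \<in> borel_measurable P" for g
  proof -
    have "{w \<in> space P. A w \<and> \<zeta> < g w} = {w \<in> space P. A w} \<inter> {w \<in> space P. \<zeta> < g w}" by auto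
    then show ?thesis using A that by auto
  qed
  have "prob {w \<in> space P. A w \<and> \<zeta> < \<bar>h w\<bar>} \<le> prob ({w \<in> space P. A w \<and> \<zeta> < h w} \<union> {w \<in> space P. A w \<and> \<zeta> < - h w})"
    by (rule finite_measure_mono) (use ev[of h] ev[of "\<lambda>w. - h w"] h in auto)
  also have "\<dots> \<le> prob {w \<in> space P. A w \<and> \<zeta> < h w} + prob {w \<in> space P. A w \<and> \<zeta> < - h w}"
    by (rule measure_Un_le) (use ev[of h] ev[of "\<lambda>w. - h w"] h in auto)
  also have "prob {w \<in> space P. A w \<and> \<zeta> < h w} \<le> exp (- (\<sigma> * \<zeta>)) * K"
    using markov_exp[OF h(1) A \<sigma> h(2), of \<zeta>] K(1) by (meson exp_ge_zero mult_left_mono order_trans)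
  also have "prob {w \<in> space P. A w \<and> \<zeta> < - h w} \<le> exp (- (\<sigma> * \<zeta>)) * K"
    by (rule order_trans[OF markov_exp[OF borel_measurable_uminus[OF h(1)] A \<sigma> bdd_uminus[OF h(2)]]], intro mult_left_mono)
       (use K(2) in simp_all)
  finally show ?thesis by (simp add: mult_ac)
qed

definition ball :: "(nat \<times> nat) set \<Rightarrow> nat \<Rightarrow> nat \<Rightarrow> nat set" where
  "ball E u s = (\<Union>j\<le>s. sphere_at E u j)"

definition hit_prob :: "(nat \<times> nat) set \<Rightarrow> nat \<Rightarrow> nat \<Rightarrow> real" where
  "hit_prob E u s = 1 - (1 - p / 4) ^ card (sphere_at E u s)"

text \<open>A martingale increment. Given the first \<open>s\<close> levels, a vertex
  \<open>i\<close> outside the ball is reached with probability \<open>hit_prob\<close>, from a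
  parent \<open>a\<close> uniform on the sphere, and then its entry has conditional mean
  \<open>nv E G u s a w * ff w a i\<close>. The second sum collects these expectations.\<close>

definition level_dev :: "nat \<Rightarrow> nat \<Rightarrow> (nat \<Rightarrow> 'w \<Rightarrow> real) \<Rightarrow> (nat \<times> nat) set \<Rightarrow> (nat \<times> nat) set \<Rightarrow> 'w \<Rightarrow> real" where
  "level_dev u s x E G w = (\<Sum>i\<in>sphere_at E u (Suc s). x i w * nv E G u (Suc s) i w) -
     (\<Sum>i\<in>V - ball E u s. x i w * (hit_prob E u s * ((\<Sum>a\<in>sphere_at E u s. nv E G u s a w * ff w a i) / card (sphere_at E u s))))"

lemma nv_info_VV: "E \<subseteq> V \<times> V \<Longrightarrow> nv E G u s a \<in> borel_measurable (info (V \<times> V))"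
  by (rule nv_info)

lemma level_dev_info:
  assumes E: "E \<subseteq> V \<times> V" and x: "\<And>i. x i \<in> borel_measurable (info {})"
  shows "level_dev u s x E G \<in> borel_measurable (info (V \<times> V))"
proof -
  have xi: "x i \<in> borel_measurable (info (V \<times> V))" for i by (rule measurable_info_mono[OF empty_subsetI x])
  show ?thesis unfolding level_dev_def[abs_def]
    by (intro borel_measurable_diff borel_measurable_sum borel_measurable_times xi nv_info_VV[OF E]
        borel_measurable_const borel_measurable_divide ff_info)
qed

lemma bdd_divide [intro]: "bdd g \<Longrightarrow> bdd (\<lambda>w. g w / c)"
  using bdd_mult[of g "\<lambda>_. 1 / c"] by auto

lemma bdd_level_dev:
  assumes x: "\<And>i. bdd (x i)"
  shows "bdd (level_dev u s x E G)"
  unfolding level_dev_def[abs_def]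
  by (intro bdd_diff bdd_sum bdd_mult x bdd_nv bdd_const bdd_divide bdd_ff)

text \<open>The two stages of \<open>expectation_mk_tr_le\<close>: with graph and tree fixed, the
  chord bound and \<open>prod_mean_swap\<close> turn the exponential into
  \<open>level_weight\<close>; with the data fixed, \<open>level_mgf\<close> averages that weight
  for edge probability \<open>p / 4\<close>.\<close>

lemma level_dev_mgf:
  assumes u: "u \<in> V" and x: "\<And>i. x i \<in> borel_measurable (info {})" "\<And>i w. w \<in> space P \<Longrightarrow> \<bar>x i w\<bar> \<le> b"
    and \<sigma>: "\<bar>\<sigma>\<bar> * b \<le> 1"
  shows "(\<integral>w. (if real (card (sphere_at (edges1 n (mk w)) u s)) \<le> m
      then exp (\<sigma> * level_dev u s x (edges1 n (mk w)) (tr w u) w) else 0) \<partial>P)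
    \<le> exp (n * (p / 4 * m) * (\<sigma> * b)\<^sup>2)"
proof -
  let ?E = "edges1 n"
  define y where "y w i = \<sigma> * x i w" for w i
  define \<Psi> where "\<Psi> \<mu> \<tau> w = (if real (card (sphere_at (?E \<mu>) u s)) \<le> m
      then level_weight V (p / 4) u s (ff w) (zz w) (y w) (?E \<mu>) (\<tau> u) else 0)" for \<mu> and \<tau> :: "nat \<Rightarrow> (nat \<times> nat) set" and w
  have bx: "bdd (x i)" for i using x(2) by (rule bddI)
  have xP: "x i \<in> borel_measurable (info R)" for i R by (rule measurable_info_mono[OF empty_subsetI x(1)])
  have yP: "(\<lambda>w. y w i) \<in> borel_measurable (info R)" for i R unfolding y_def using xP by auto
  have by': "bdd (\<lambda>w. y w i)" for i unfolding y_def using bx by auto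
  have bl: "bdd (level_dev u s x E G)" for E G by (rule bdd_level_dev[OF bx])
  have nbr_eq: "nbr_vec (?E \<mu>) (zz w) G u j a = nv (?E \<mu>) G u j a w" if "G \<in> bfs_trees (?E \<mu>) u" for \<mu> G j a w
    unfolding nv_def by (rule nbr_vec_cong[OF that]) (simp add: restrict_matrix_def)
  have nbr_info: "(\<lambda>w. nbr_vec E (zz w) G u j a) \<in> borel_measurable (info (V \<times> V))" for E G j a
  proof -
    have "(\<lambda>w. \<Prod>(a, b)\<leftarrow>xs. zz w a b) \<in> borel_measurable (info (V \<times> V))" for xs
      by (induction xs) (auto intro!: borel_measurable_times zz_info)
    then show ?thesis unfolding nbr_vec_def by (cases "a \<in> sphere_at E u j") auto
  qed
  have nbr_bdd: "bdd (\<lambda>w. nbr_vec E (zz w) G u j a)" for E G j a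
  proof (rule bddI[of _ 1])
    fix w assume "w \<in> space P"
    then have "nbr_vec E (zz w) G u j a \<in> {0..1}" by (intro nbr_vec_unit zz_unit)
    then show "\<bar>nbr_vec E (zz w) G u j a\<bar> \<le> 1" by simp
  qed
  have "(\<integral>w. (\<lambda>\<mu> \<tau> w. if real (card (sphere_at (?E \<mu>) u s)) \<le> m then exp (\<sigma> * level_dev u s x (?E \<mu>) (\<tau> u) w) else 0) (mk w) (tr w) w \<partial>P)
    \<le> exp (n * (p / 4 * m) * (\<sigma> * b)\<^sup>2)"
  proof (rule expectation_mk_tr_le[where \<Psi> = \<Psi>])
    fix \<mu> \<tau>
    show "(\<lambda>w. if real (card (sphere_at (?E \<mu>) u s)) \<le> m then exp (\<sigma> * level_dev u s x (?E \<mu>) (\<tau> u) w) else 0) \<in> borel_measurable (info (V \<times> V))"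
      by (intro borel_measurable_If_const borel_measurable_exp_comp borel_measurable_times borel_measurable_const
          level_dev_info[OF edges1_subset x(1)])
    show "bdd (\<lambda>w. if real (card (sphere_at (?E \<mu>) u s)) \<le> m then exp (\<sigma> * level_dev u s x (?E \<mu>) (\<tau> u) w) else 0)"
      by (intro bdd_If_const bdd_exp bdd_mult bdd_const bl)
    show "\<Psi> \<mu> \<tau> \<in> borel_measurable (info (V \<times> V))"
      unfolding \<Psi>_def[abs_def] level_weight_def
      by (intro borel_measurable_If_const borel_measurable_prod borel_measurable_times borel_measurable_exp_comp
          borel_measurable_uminus borel_measurable_sum borel_measurable_divide borel_measurable_const
          borel_measurable_add borel_measurable_diff yP nbr_info ff_info)
    show "bdd (\<Psi> \<mu> \<tau>)"
      unfolding \<Psi>_def[abs_def] level_weight_def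
      by (intro bdd_If_const bdd_prod bdd_mult bdd_exp bdd_uminus bdd_sum bdd_divide bdd_const bdd_add bdd_diff
          by' nbr_bdd bdd_ff)
  next
    fix \<mu> :: "nat \<times> nat \<Rightarrow> mark" and \<tau> :: "nat \<Rightarrow> (nat \<times> nat) set"
    assume "\<And>u. u \<in> V \<Longrightarrow> \<tau> u \<in> bfs_trees (?E \<mu>) u"
    then have G: "\<tau> u \<in> bfs_trees (?E \<mu>) u" using u by blast
    let ?G = "\<tau> u" and ?S = "sphere_at (?E \<mu>) u s" and ?S' = "sphere_at (?E \<mu>) u (Suc s)" and ?N = "nv (?E \<mu>) (\<tau> u) u s"
    have EV: "?E \<mu> \<subseteq> V \<times> V" by (rule edges1_subset)
    have SV: "sphere_at (?E \<mu>) u j \<subseteq> V" for j by (rule sphere_at_subset[OF EV u])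
    have finS': "finite ?S'" using SV finite_subset by blast
    define tp where "tp i = tree_parent ?G i" for i
    \<comment> \<open>The tree edges into level \<open>Suc s\<close>, one for each of its vertices.
      The entries outside \<open>J\<close> determine the earlier levels and the compensator, so
      those on \<open>J\<close> are fresh.\<close>
    define J where "J = (\<lambda>i. (tp i, i)) ` ?S'"
    define R where "R = V \<times> V - J"
    define g where "g w = exp (- (\<Sum>i\<in>V - ball (?E \<mu>) u s. y w i * (hit_prob (?E \<mu>) u s * ((\<Sum>a\<in>?S. ?N a w * ff w a i) / card ?S))))" for w
    define \<alpha> where "\<alpha> e w = exp (y w (snd e) * ?N (fst e) w) - 1" for e w
    have JE: "J \<subseteq> ?E \<mu>" unfolding J_def tp_def using nbr_vec_step(2)[OF G] by blast
    have NR: "?N a \<in> borel_measurable (info R)" for a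
    proof (rule nv_info_tree[OF G EV])
      fix a b k assume k: "k < s" "b \<in> sphere_at (?E \<mu>) u (Suc k)" "(a, b) \<in> ?E \<mu>"
      then have "b \<notin> ?S'" using sphere_at_unique[of b "?E \<mu>" u "Suc k" "Suc s"] by auto
      then show "(a, b) \<in> R" using k EV by (auto simp: R_def J_def)
    qed
    have inj: "inj_on (\<lambda>i. (tp i, i)) ?S'" by (auto simp: inj_on_def)
    have S'U: "?S' \<subseteq> V - ball (?E \<mu>) u s" using SV[of "Suc s"] by (auto simp: ball_def sphere_at_Suc)
    show "(\<integral>w. (if real (card ?S) \<le> m then exp (\<sigma> * level_dev u s x (?E \<mu>) ?G w) else 0) \<partial>P) \<le> (\<integral>w. \<Psi> \<mu> \<tau> w \<partial>P)"
    proof (cases "real (card ?S) \<le> m")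
      case True
      \<comment> \<open>A new vector entry is the parent's entry times one fresh value of
        \<open>Z\<close>; the chord bound is applied to that value.\<close>
      have up: "exp (\<sigma> * level_dev u s x (?E \<mu>) ?G w) \<le> g w * (\<Prod>e\<in>J. 1 + \<alpha> e w * Z e w)" if w: "w \<in> space P" for w
      proof -
        have "\<sigma> * level_dev u s x (?E \<mu>) ?G w = (\<Sum>i\<in>?S'. y w i * nv (?E \<mu>) ?G u (Suc s) i w) -
            (\<Sum>i\<in>V - ball (?E \<mu>) u s. y w i * (hit_prob (?E \<mu>) u s * ((\<Sum>a\<in>?S. ?N a w * ff w a i) / card ?S)))"
          unfolding level_dev_def y_def by (simp add: right_diff_distrib sum_distrib_left mult.assoc)
        then have "exp (\<sigma> * level_dev u s x (?E \<mu>) ?G w) = g w * (\<Prod>i\<in>?S'. exp (y w i * nv (?E \<mu>) ?G u (Suc s) i w))"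
          unfolding g_def using finS' by (simp add: exp_diff exp_minus exp_sum divide_inverse mult.commute)
        also have "\<dots> \<le> g w * (\<Prod>i\<in>?S'. 1 + \<alpha> (tp i, i) w * Z (tp i, i) w)"
        proof (intro mult_left_mono prod_mono conjI)
          fix i assume i: "i \<in> ?S'"
          note st = nbr_vec_step[OF G i]
          have iV: "(tp i, i) \<in> V \<times> V" using st(2) EV unfolding tp_def by blast
          have "nv (?E \<mu>) ?G u (Suc s) i w = ?N (tp i) w * Z (tp i, i) w"
            unfolding nv_def st(3) using st(2) iV by (simp add: restrict_matrix_def tp_def zz_def)
          then have "exp (y w i * nv (?E \<mu>) ?G u (Suc s) i w) = exp ((y w i * ?N (tp i) w) * Z (tp i, i) w)" by (simp add: mult.assoc)
          also have "\<dots> \<le> 1 + Z (tp i, i) w * (exp (y w i * ?N (tp i) w) - 1)"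
            by (rule exp_convex_bound[OF Z_range[OF iV w]])
          finally show "exp (y w i * nv (?E \<mu>) ?G u (Suc s) i w) \<le> 1 + \<alpha> (tp i, i) w * Z (tp i, i) w"
            by (simp add: \<alpha>_def mult.commute)
        qed (auto simp: g_def)
        also have "(\<Prod>i\<in>?S'. 1 + \<alpha> (tp i, i) w * Z (tp i, i) w) = (\<Prod>e\<in>J. 1 + \<alpha> e w * Z e w)"
          unfolding J_def by (simp add: prod.reindex[OF inj])
        finally show ?thesis .
      qed
      have gR: "g \<in> borel_measurable (info R)" unfolding g_def[abs_def]
        by (intro borel_measurable_exp_comp borel_measurable_uminus borel_measurable_sum borel_measurable_times
            borel_measurable_divide borel_measurable_const yP NR ff_info)
      have gb: "bdd g" unfolding g_def[abs_def] by (intro bdd_exp bdd_uminus bdd_sum bdd_mult bdd_const bdd_divide by' bdd_nv bdd_ff)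
      have aR: "\<alpha> e \<in> borel_measurable (info R)" for e unfolding \<alpha>_def[abs_def]
        by (intro borel_measurable_diff borel_measurable_exp_comp borel_measurable_times yP NR borel_measurable_const)
      have ab: "bdd (\<alpha> e)" for e unfolding \<alpha>_def[abs_def] by (intro bdd_diff bdd_exp bdd_mult by' bdd_nv bdd_const)
      have JV: "J \<subseteq> V \<times> V" using JE EV by blast
      have gP: "g \<in> borel_measurable P" "\<And>e. \<alpha> e \<in> borel_measurable P"
        using gR aR by (auto intro!: measurable_info[of R] simp: R_def)
      have "(\<integral>w. exp (\<sigma> * level_dev u s x (?E \<mu>) ?G w) \<partial>P) \<le> (\<integral>w. g w * (\<Prod>e\<in>J. 1 + \<alpha> e w * Z e w) \<partial>P)"
      proof (rule integral_mono[OF _ _ up])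
        show "integrable P (\<lambda>w. exp (\<sigma> * level_dev u s x (?E \<mu>) ?G w))"
          using measurable_info[OF order.refl level_dev_info[OF EV x(1)]]
          by (intro bdd_integrable bdd_exp bdd_mult bdd_const bl) auto
        show "integrable P (\<lambda>w. g w * (\<Prod>e\<in>J. 1 + \<alpha> e w * Z e w))"
          using JV by (intro bdd_integrable borel_measurable_times borel_measurable_prod borel_measurable_add
              borel_measurable_const gP Z_measurable bdd_mult bdd_prod bdd_add bdd_const gb ab bdd_Z) blast+
      qed
      also have "\<dots> = (\<integral>w. g w * (\<Prod>e\<in>J. 1 + \<alpha> e w * mean e w) \<partial>P)"
        by (rule prod_mean_swap[OF _ JV _ _ gR gb aR ab]) (use finS' in \<open>auto simp: J_def R_def\<close>)
      \<comment> \<open>Vertices outside the ball that are not reached contribute the factor 1, so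
        the product over \<open>J\<close> extends to the product in
        \<open>level_weight\<close>.\<close>
      also have "\<dots> = (\<integral>w. \<Psi> \<mu> \<tau> w \<partial>P)"
      proof (rule Bochner_Integration.integral_cong[OF refl])
        fix w
        have "(\<Prod>e\<in>J. 1 + \<alpha> e w * mean e w) = (\<Prod>i\<in>?S'. 1 + \<alpha> (tp i, i) w * mean (tp i, i) w)"
          unfolding J_def by (simp add: prod.reindex[OF inj])
        also have "\<dots> = (\<Prod>i\<in>?S'. 1 + ff w (tp i) i * (exp (y w i * ?N (tp i) w) - 1))"
        proof (rule prod.cong[OF refl])
          fix i assume "i \<in> ?S'"
          then have "(tp i, i) \<in> V \<times> V" using JV by (auto simp: J_def)
          then show "1 + \<alpha> (tp i, i) w * mean (tp i, i) w = 1 + ff w (tp i) i * (exp (y w i * ?N (tp i) w) - 1)"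
            by (simp add: ff_def \<alpha>_def)
        qed
        also have "\<dots> = (\<Prod>i\<in>V - ball (?E \<mu>) u s. if i \<in> ?S' then 1 + ff w (tp i) i * (exp (y w i * ?N (tp i) w) - 1) else 1)"
          by (rule prod.mono_neutral_cong_left) (use S'U in auto)
        finally have "g w * (\<Prod>e\<in>J. 1 + \<alpha> e w * mean e w) = (\<Prod>i\<in>V - ball (?E \<mu>) u s.
            exp (- (y w i * (hit_prob (?E \<mu>) u s * ((\<Sum>a\<in>?S. ?N a w * ff w a i) / card ?S)))) *
            (if i \<in> ?S' then 1 + ff w (tp i) i * (exp (y w i * ?N (tp i) w) - 1) else 1))"
          unfolding g_def by (simp add: exp_sum sum_negf[symmetric] prod.distrib)
        then show "g w * (\<Prod>e\<in>J. 1 + \<alpha> e w * mean e w) = \<Psi> \<mu> \<tau> w"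
          using True unfolding \<Psi>_def level_weight_def nbr_eq[OF G] ball_def hit_prob_def tp_def by simp
      qed
      finally show ?thesis using True by simp
    qed (simp add: \<Psi>_def)
  next
    fix w assume w: "w \<in> space P"
    have yb: "\<bar>y w i\<bar> \<le> \<bar>\<sigma>\<bar> * b" for i using x(2)[OF w, of i] by (simp add: y_def abs_mult mult_left_mono)
    have "pexp (marks_pmf n p) (\<lambda>\<mu>. pexp (trees_pmf n (?E \<mu>)) (\<lambda>\<tau>. \<Psi> \<mu> \<tau> w)) =
      pexp (rset (V \<times> V) (p / 4)) (\<lambda>E. pexp (pmf_of_set (bfs_trees E u)) (\<lambda>G.
      if real (card (sphere_at E u s)) \<le> m then level_weight V (p / 4) u s (ff w) (zz w) (y w) E G else 0))"
      unfolding \<Psi>_def pexp_trees_component[OF u, of _ "\<lambda>G. if _ then level_weight V (p / 4) u s (ff w) (zz w) (y w) _ G else 0"]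
      by (rule pexp_edges1[OF p4(3) p_le_1])
    also have "\<dots> \<le> exp (card V * (p / 4 * m) * (\<bar>\<sigma>\<bar> * b)\<^sup>2)"
      by (rule level_mgf[OF _ u p4(1,2) ff_unit[OF w] zz_unit[OF w] yb \<sigma>]) simp
    finally show "pexp (marks_pmf n p) (\<lambda>\<mu>. pexp (trees_pmf n (?E \<mu>)) (\<lambda>\<tau>. \<Psi> \<mu> \<tau> w)) \<le> exp (n * (p / 4 * m) * (\<sigma> * b)\<^sup>2)"
      by (simp add: power_mult_distrib)
  qed
  then show ?thesis by simp
qed

end

section \<open>Level sizes and the bilinear form in the fresh sample\<close>

lemma nbr_vec_one:
  assumes G: "G \<in> bfs_trees E u"
  shows "i \<in> sphere_at E u s \<Longrightarrow> nbr_vec E (\<lambda>_ _. 1) G u s i = 1"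
proof (induction s arbitrary: i)
  case (Suc s)
  then show ?case using nbr_vec_step[OF G Suc.prems] by simp
qed (simp add: nbr_vec_0[OF G])

lemma sum_pexp_select:
  assumes "finite A" "e \<in> A"
  shows "(\<Sum>E\<in>A. pexp (M E) (\<lambda>\<tau>. (if e = E then 1 else 0) * Q E \<tau>)) = pexp (M e) (Q e)"
proof -
  have "(\<Sum>E\<in>A. pexp (M E) (\<lambda>\<tau>. (if e = E then 1 else 0) * Q E \<tau>)) = (\<Sum>E\<in>A. if E = e then pexp (M e) (Q e) else 0)"
    by (rule sum.cong) auto
  then show ?thesis using assms by simp
qed

lemma sum_pairs:
  fixes g h :: "_ \<Rightarrow> real"
  shows "(\<Sum>e\<in>A \<times> B. c * (g (fst e) * h (snd e))) = c * ((\<Sum>a\<in>A. g a) * (\<Sum>b\<in>B. h b))"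
proof -
  have "(\<Sum>a\<in>A. g a) * (\<Sum>b\<in>B. h b) = (\<Sum>e\<in>A \<times> B. g (fst e) * h (snd e))"
    unfolding sum_product sum.cartesian_product case_prod_unfold ..
  then show ?thesis by (simp only: sum_distrib_left)
qed

lemma pexp_swap:
  assumes "finite (set_pmf M)" "finite (set_pmf N)"
  shows "pexp M (\<lambda>x. pexp N (h x)) = pexp N (\<lambda>y. pexp M (\<lambda>x. h x y))"
  unfolding pexp_sum[OF assms(1)] pexp_sum[OF assms(2)] sum_distrib_left
  by (subst sum.swap) (simp add: mult_ac)

lemma pexp_nonneg: "(\<And>x. 0 \<le> h x) \<Longrightarrow> 0 \<le> pexp M h"
  by (rule Bochner_Integration.integral_nonneg)

lemma exp_cancel_left: "exp (- a) * (c * exp (a + b)) = exp b * (c :: real)"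
  by (simp add: exp_add exp_minus field_simps)

context sample_model
begin

text \<open>Sizes are the case of unit entries: the vector is then 1 on its whole sphere, and
  \<open>level_weight\<close> is itself the exponential of the size deviation, so
  \<open>level_mgf\<close> applies without a first stage.\<close>

lemma size_mgf:
  assumes u: "u \<in> V" and \<sigma>: "\<bar>\<sigma>\<bar> \<le> 1"
  shows "(\<integral>w. (if real (card (sphere_at (edges1 n (mk w)) u s)) \<le> m
      then exp (\<sigma> * (real (card (sphere_at (edges1 n (mk w)) u (Suc s))) -
        hit_prob (edges1 n (mk w)) u s * card (V - ball (edges1 n (mk w)) u s))) else 0) \<partial>P)
    \<le> exp (n * (p / 4 * m) * \<sigma>\<^sup>2)"
proof -
  let ?E = "edges1 n"
  let ?\<Phi> = "\<lambda>\<mu> (\<tau> :: nat \<Rightarrow> (nat \<times> nat) set) (w :: 'w). if real (card (sphere_at (?E \<mu>) u s)) \<le> m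
      then exp (\<sigma> * (real (card (sphere_at (?E \<mu>) u (Suc s))) - hit_prob (?E \<mu>) u s * card (V - ball (?E \<mu>) u s))) else 0"
  let ?\<Psi> = "\<lambda>\<mu> (\<tau> :: nat \<Rightarrow> (nat \<times> nat) set) (w :: 'w). if real (card (sphere_at (?E \<mu>) u s)) \<le> m
      then level_weight V (p / 4) u s (\<lambda>_ _. 1) (\<lambda>_ _. 1) (\<lambda>_. \<sigma>) (?E \<mu>) (\<tau> u) else 0"
  have "(\<integral>w. ?\<Phi> (mk w) (tr w) w \<partial>P) \<le> exp (n * (p / 4 * m) * \<sigma>\<^sup>2)"
  proof (rule expectation_mk_tr_le[where \<Psi> = ?\<Psi>])
    fix \<mu> :: "nat \<times> nat \<Rightarrow> mark" and \<tau> :: "nat \<Rightarrow> (nat \<times> nat) set"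
    assume "\<And>u. u \<in> V \<Longrightarrow> \<tau> u \<in> bfs_trees (?E \<mu>) u"
    then have G: "\<tau> u \<in> bfs_trees (?E \<mu>) u" using u by blast
    let ?S = "sphere_at (?E \<mu>) u s" and ?S' = "sphere_at (?E \<mu>) u (Suc s)" and ?U = "V - ball (?E \<mu>) u s"
    have SV: "sphere_at (?E \<mu>) u j \<subseteq> V" for j by (rule sphere_at_subset[OF edges1_subset u])
    have S'U: "?S' \<subseteq> ?U" using SV[of "Suc s"] by (auto simp: ball_def sphere_at_Suc)
    have hit: "hit_prob (?E \<mu>) u s * ((\<Sum>a\<in>?S. nbr_vec (?E \<mu>) (\<lambda>_ _. 1) (\<tau> u) u s a * 1) / card ?S) = hit_prob (?E \<mu>) u s"
    proof (cases "?S = {}")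
      case False
      then have "card ?S > 0" using SV[of s] finite_subset[of ?S V] by (simp add: card_gt_0_iff)
      then show ?thesis by (simp add: nbr_vec_one[OF G] cong: sum.cong)
    qed (simp add: hit_prob_def)
    have "level_weight V (p / 4) u s (\<lambda>_ _. 1) (\<lambda>_ _. 1) (\<lambda>_. \<sigma>) (?E \<mu>) (\<tau> u)
      = (\<Prod>i\<in>?U. exp (- (\<sigma> * hit_prob (?E \<mu>) u s)) * (if i \<in> ?S' then exp \<sigma> else 1))"
      unfolding level_weight_def ball_def[symmetric] hit_prob_def[symmetric]
      by (rule prod.cong[OF refl]) (use hit nbr_vec_step(1)[OF G] nbr_vec_one[OF G] in auto)
    also have "\<dots> = exp (- (\<sigma> * hit_prob (?E \<mu>) u s)) ^ card ?U * (\<Prod>i\<in>?U. if i \<in> ?S' then exp \<sigma> else 1)"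
      by (simp add: prod.distrib)
    also have "(\<Prod>i\<in>?U. if i \<in> ?S' then exp \<sigma> else 1) = (\<Prod>i\<in>?S'. exp \<sigma>)"
      by (rule prod.mono_neutral_cong_right) (use S'U in auto)
    finally have "level_weight V (p / 4) u s (\<lambda>_ _. 1) (\<lambda>_ _. 1) (\<lambda>_. \<sigma>) (?E \<mu>) (\<tau> u)
      = exp (\<sigma> * (real (card ?S') - hit_prob (?E \<mu>) u s * card ?U))"
      by (simp add: exp_of_nat_mult[symmetric] exp_add[symmetric] algebra_simps)
    then show "(\<integral>w. ?\<Phi> \<mu> \<tau> w \<partial>P) \<le> (\<integral>w. ?\<Psi> \<mu> \<tau> w \<partial>P)" by simp
  next
    fix w
    have "pexp (marks_pmf n p) (\<lambda>\<mu>. pexp (trees_pmf n (?E \<mu>)) (\<lambda>\<tau>. ?\<Psi> \<mu> \<tau> w)) =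
      pexp (rset (V \<times> V) (p / 4)) (\<lambda>E. pexp (pmf_of_set (bfs_trees E u)) (\<lambda>G.
      if real (card (sphere_at E u s)) \<le> m then level_weight V (p / 4) u s (\<lambda>_ _. 1) (\<lambda>_ _. 1) (\<lambda>_. \<sigma>) E G else 0))"
      unfolding pexp_trees_component[OF u, of _ "\<lambda>G. if _ then level_weight V (p / 4) u s (\<lambda>_ _. 1) (\<lambda>_ _. 1) (\<lambda>_. \<sigma>) _ G else 0"]
      by (rule pexp_edges1[OF p4(3) p_le_1])
    also have "\<dots> \<le> exp (card V * (p / 4 * m) * \<bar>\<sigma>\<bar>\<^sup>2)"
      by (rule level_mgf[OF _ u p4(1,2)]) (use \<sigma> in auto)
    finally show "pexp (marks_pmf n p) (\<lambda>\<mu>. pexp (trees_pmf n (?E \<mu>)) (\<lambda>\<tau>. ?\<Psi> \<mu> \<tau> w)) \<le> exp (n * (p / 4 * m) * \<sigma>\<^sup>2)"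
      by simp
  qed auto
  then show ?thesis by simp
qed

definition Nn :: "(nat \<times> nat) set \<Rightarrow> (nat \<times> nat) set \<Rightarrow> nat \<Rightarrow> nat \<Rightarrow> nat \<Rightarrow> 'w \<Rightarrow> real" where
  "Nn E G u s a w = nv E G u s a w / card (sphere_at E u s)"

text \<open>The entry of \<open>M'' + M'_ind\<close>; the two edge sets are disjoint, so the sum is
  a case distinction.\<close>

definition aa :: "(nat \<times> nat \<Rightarrow> mark) \<Rightarrow> 'w \<Rightarrow> nat \<Rightarrow> nat \<Rightarrow> real" where
  "aa \<mu> w a b = (if \<mu> (a, b) = Part2 \<or> \<mu> (a, b) = Part1 True then zz w a b else 0)"

text \<open>The conditional mean of \<open>aa / p'\<close> given the latent variables, the first
  sample and its values: on an edge of that sample the entry is already revealed and is its own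
  mean, elsewhere the mean is \<open>ff\<close>.\<close>

definition gg :: "(nat \<times> nat) set \<Rightarrow> 'w \<Rightarrow> nat \<Rightarrow> nat \<Rightarrow> real" where
  "gg E w a b = (if (a, b) \<in> E then zz w a b else ff w a b)"

definition bil_dev :: "nat \<Rightarrow> nat \<Rightarrow> nat \<Rightarrow> nat \<Rightarrow> (nat \<times> nat \<Rightarrow> mark) \<Rightarrow> (nat \<Rightarrow> (nat \<times> nat) set) \<Rightarrow> 'w \<Rightarrow> real" where
  "bil_dev u s v s' \<mu> \<tau> w = (\<Sum>e\<in>V \<times> V. Nn (edges1 n \<mu>) (\<tau> u) u s (fst e) w * Nn (edges1 n \<mu>) (\<tau> v) v s' (snd e) w *
     (aa \<mu> w (fst e) (snd e) / p' - gg (edges1 n \<mu>) w (fst e) (snd e)))"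

lemma Nn_nonneg: "w \<in> space P \<Longrightarrow> 0 \<le> Nn E G u s a w"
  using nv_unit[of w E G u s a] by (simp add: Nn_def)

lemma Nn_le: "w \<in> space P \<Longrightarrow> Nn E G u s a w \<le> 1 / card (sphere_at E u s)"
  using nv_unit[of w E G u s a] by (simp add: Nn_def divide_right_mono)

lemma Nn_sum_le:
  assumes w: "w \<in> space P" and fin: "finite A" and S: "sphere_at E u s \<subseteq> A"
  shows "(\<Sum>a\<in>A. Nn E G u s a w) \<le> 1"
proof -
  have "(\<Sum>a\<in>A. Nn E G u s a w) = (\<Sum>a\<in>sphere_at E u s. Nn E G u s a w)"
    by (rule sum.mono_neutral_right[OF fin S]) (auto simp: Nn_def nv_outside)
  also have "\<dots> \<le> (\<Sum>a\<in>sphere_at E u s. 1 / card (sphere_at E u s))"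
    by (rule sum_mono) (rule Nn_le[OF w])
  also have "\<dots> \<le> 1" by simp
  finally show ?thesis .
qed

lemma Nn_info: "E \<subseteq> R \<Longrightarrow> Nn E G u s a \<in> borel_measurable (info R)"
  unfolding Nn_def[abs_def] using nv_info[of E R G u s a] by auto

lemma bdd_Nn [intro]: "bdd (Nn E G u s a)"
  unfolding Nn_def[abs_def] by auto

lemma aa_info: "(\<lambda>w. aa \<mu> w a b) \<in> borel_measurable (info (V \<times> V))"
  unfolding aa_def using zz_info[of a b "V \<times> V"] by (cases "\<mu> (a, b) = Part2 \<or> \<mu> (a, b) = Part1 True") auto

lemma gg_info: "E \<subseteq> R \<Longrightarrow> (\<lambda>w. gg E w a b) \<in> borel_measurable (info R)"
  unfolding gg_def using zz_info[of a b R] ff_info[of a b R] by (cases "(a, b) \<in> E") auto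

lemma bdd_aa [intro]: "bdd (\<lambda>w. aa \<mu> w a b)"
  unfolding aa_def by (cases "\<mu> (a, b) = Part2 \<or> \<mu> (a, b) = Part1 True") auto

lemma bdd_gg [intro]: "bdd (\<lambda>w. gg E w a b)"
  unfolding gg_def by (cases "(a, b) \<in> E") auto

lemma bil_dev_info: "bil_dev u s v s' \<mu> \<tau> \<in> borel_measurable (info (V \<times> V))"
  unfolding bil_dev_def[abs_def]
  by (intro borel_measurable_sum borel_measurable_times borel_measurable_diff borel_measurable_divide
      borel_measurable_const Nn_info gg_info aa_info edges1_subset)

lemma bdd_bil_dev: "bdd (bil_dev u s v s' \<mu> \<tau>)"
  unfolding bil_dev_def[abs_def] by (intro bdd_sum bdd_mult bdd_diff bdd_divide bdd_Nn bdd_aa bdd_gg)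

lemma part1_ex: "(\<exists>b. Part1 c = Part1 b) = True" "(\<exists>b. Unobserved = Part1 b) = False"
    "(\<exists>b. Part2 = Part1 b) = False" "(\<exists>b. Part3 = Part1 b) = False"
  by auto

text \<open>Given the first sample, every entry of the observation matrix \<open>M'' + M'\<^sub>i\<^sub>n\<^sub>d\<close> survives
  with the same probability \<open>p'\<close>, whether or not its edge lies in the first sample.\<close>

lemma pexp_mark_split:
  assumes z: "z0 \<in> {0..1}" "f0 \<in> {0..1}" and x: "\<bar>x\<bar> \<le> 1"
  shows "pexp (mark_pmf p) (\<lambda>m. (if (\<exists>b. m = Part1 b) = inE then 1 else 0) *
      (if m = Part2 then 1 + f0 * (exp x - 1) else if m = Part1 True then 1 + z0 * (exp x - 1) else 1))
    \<le> (if inE then p / 4 else 1 - p / 4) * exp (p' * ((if inE then z0 else f0) * x + x\<^sup>2))"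
proof -
  have p'eq: "p' * (1 - p / 4) = p / 4" using p_pos p_le_1 by (simp add: p'_def subsample_prob_def field_simps)
  have step: "1 + p' * (g * (exp x - 1)) \<le> exp (p' * (g * x + x\<^sup>2))" if g: "g \<in> {0..1}" for g
  proof -
    have "exp x \<le> 1 + x + x\<^sup>2" by (rule exp_quadratic_bound) (use x in linarith)
    then have "g * (exp x - 1) \<le> g * (x + x\<^sup>2)" using g by (intro mult_left_mono) auto
    also have "\<dots> \<le> g * x + x\<^sup>2" using g by (simp add: distrib_left mult_left_le_one_le)
    finally have "p' * (g * (exp x - 1)) \<le> p' * (g * x + x\<^sup>2)" using p'_pos by (intro mult_left_mono) auto
    then show ?thesis using exp_ge_add_one_self[of "p' * (g * x + x\<^sup>2)"] by linarith
  qed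
  show ?thesis
  proof (cases inE)
    case True
    have "pexp (mark_pmf p) (\<lambda>m. (if (\<exists>b. m = Part1 b) = inE then 1 else 0) *
      (if m = Part2 then 1 + f0 * (exp x - 1) else if m = Part1 True then 1 + z0 * (exp x - 1) else 1))
      = p / 4 * (1 + p' * (z0 * (exp x - 1)))"
      using True unfolding pexp_mark[OF p4(3) p_le_1] part1_ex by (simp add: p'_def[symmetric] algebra_simps)
    also have "\<dots> \<le> p / 4 * exp (p' * (z0 * x + x\<^sup>2))"
      using step[OF z(1)] p4 by (intro mult_left_mono) auto
    finally show ?thesis using True by simp
  next
    case False
    have "pexp (mark_pmf p) (\<lambda>m. (if (\<exists>b. m = Part1 b) = inE then 1 else 0) *
      (if m = Part2 then 1 + f0 * (exp x - 1) else if m = Part1 True then 1 + z0 * (exp x - 1) else 1))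
      = (1 - p / 4) + p / 4 * (f0 * (exp x - 1))"
      using False unfolding pexp_mark[OF p4(3) p_le_1] part1_ex by (simp add: field_simps)
    also have "\<dots> = (1 - p / 4) * (1 + p' * (f0 * (exp x - 1)))"
    proof -
      have "(1 - p / 4) * (1 + p' * k) = (1 - p / 4) + (p' * (1 - p / 4)) * k" for k by (simp add: algebra_simps)
      then show ?thesis unfolding p'eq by simp
    qed
    also have "\<dots> \<le> (1 - p / 4) * exp (p' * (f0 * x + x\<^sup>2))"
      using step[OF z(2)] p4 by (intro mult_left_mono) auto
    finally show ?thesis using False by simp
  qed
qed

text \<open>On the truncation event the weights \<open>Nn * Nn\<close> are at most \<open>c\<close>,
  and they sum to at most 1, so their squares sum to at most \<open>c\<close>. An entry of weight
  \<open>k\<close> contributes a variance of order \<open>p' * (\<sigma> * k / p')\<^sup>2\<close>,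
  which adds up to \<open>\<sigma>\<^sup>2 * c / p'\<close>. The condition on
  \<open>\<sigma>\<close> keeps all exponents \<open>x\<close> in the range where the quadratic
  bound of \<open>exp\<close> holds.\<close>

lemma bil_dev_mgf:
  assumes u: "u \<in> V" and v: "v \<in> V" and c: "0 \<le> c" and \<sigma>: "\<bar>\<sigma>\<bar> * c \<le> p'"
  shows "(\<integral>w. (if 1 \<le> c * (card (sphere_at (edges1 n (mk w)) u s) * card (sphere_at (edges1 n (mk w)) v s'))
      then exp (\<sigma> * bil_dev u s v s' (mk w) (tr w) w) else 0) \<partial>P) \<le> exp (\<sigma>\<^sup>2 * c / p')"
proof -
  let ?E = "edges1 n"
  define C where "C E \<longleftrightarrow> 1 \<le> c * (card (sphere_at E u s) * card (sphere_at E v s'))" for E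
  define x where "x E \<tau> e w = \<sigma> * (Nn E (\<tau> u) u s (fst e) w * Nn E (\<tau> v) v s' (snd e) w) / p'" for E and \<tau> :: "nat \<Rightarrow> (nat \<times> nat) set" and e w
  \<comment> \<open>The factor of one entry as a function of its mark. An entry of the second sample
    carries its mean; one of the subsample keeps its value of \<open>Z\<close>, on which the vectors
    may depend.\<close>
  define \<psi> where "\<psi> E \<tau> w e m = (if m = Part2 then 1 + ff w (fst e) (snd e) * (exp (x E \<tau> e w) - 1)
      else if m = Part1 True then 1 + zz w (fst e) (snd e) * (exp (x E \<tau> e w) - 1) else 1)" for E \<tau> w e and m :: mark
  define H where "H E \<tau> w = exp (- (\<Sum>e\<in>V \<times> V. p' * x E \<tau> e w * gg E w (fst e) (snd e)))" for E \<tau> w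
  define \<Psi> where "\<Psi> \<mu> \<tau> w = (if C (?E \<mu>) then H (?E \<mu>) \<tau> w * (\<Prod>e\<in>V \<times> V. \<psi> (?E \<mu>) \<tau> w e (\<mu> e)) else 0)" for \<mu> \<tau> w
  have xI: "x E \<tau> e \<in> borel_measurable (info R)" if "E \<subseteq> R" for E \<tau> e R
    unfolding x_def[abs_def] by (intro borel_measurable_divide borel_measurable_times borel_measurable_const Nn_info[OF that])
  have xb: "bdd (x E \<tau> e)" for E \<tau> e
    unfolding x_def[abs_def] by (intro bdd_divide bdd_mult bdd_const bdd_Nn)
  have HI: "H E \<tau> \<in> borel_measurable (info R)" if "E \<subseteq> R" for E \<tau> R
    unfolding H_def[abs_def]
    by (intro borel_measurable_exp_comp borel_measurable_uminus borel_measurable_sum borel_measurable_times borel_measurable_const xI[OF that] gg_info[OF that])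
  have Hb: "bdd (H E \<tau>)" for E \<tau>
    unfolding H_def[abs_def] by (intro bdd_exp bdd_uminus bdd_sum bdd_mult bdd_const xb bdd_gg)
  have x1: "\<bar>x E \<tau> e w\<bar> \<le> 1" and xc: "p' * (x E \<tau> e w)\<^sup>2 \<le> \<sigma>\<^sup>2 / p' * c * (Nn E (\<tau> u) u s (fst e) w * Nn E (\<tau> v) v s' (snd e) w)"
    if w: "w \<in> space P" and CE: "C E" for E \<tau> e w
  proof -
    let ?k = "Nn E (\<tau> u) u s (fst e) w * Nn E (\<tau> v) v s' (snd e) w"
    have k0: "0 \<le> ?k" using Nn_nonneg[OF w] by simp
    have "?k \<le> 1 / card (sphere_at E u s) * (1 / card (sphere_at E v s'))"
      by (rule mult_mono[OF Nn_le[OF w] Nn_le[OF w]]) (auto intro: Nn_nonneg[OF w])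
    also have "\<dots> \<le> c" using CE unfolding C_def
      by (cases "card (sphere_at E u s) = 0 \<or> card (sphere_at E v s') = 0") (auto simp: field_simps)
    finally have kc: "?k \<le> c" .
    have "\<bar>\<sigma> * ?k\<bar> \<le> \<bar>\<sigma>\<bar> * c" using k0 kc by (simp add: abs_mult mult_left_mono)
    then have "\<bar>\<sigma> * ?k\<bar> \<le> p'" using \<sigma> by linarith
    then show "\<bar>x E \<tau> e w\<bar> \<le> 1" using p'_pos by (simp add: x_def)
    have "p' * (x E \<tau> e w)\<^sup>2 = \<sigma>\<^sup>2 / p' * (?k * ?k)"
      using p'_pos by (simp add: x_def power2_eq_square field_simps)
    also have "\<dots> \<le> \<sigma>\<^sup>2 / p' * (c * ?k)"
      using k0 kc p'_pos by (intro mult_left_mono mult_right_mono) auto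
    finally show "p' * (x E \<tau> e w)\<^sup>2 \<le> \<sigma>\<^sup>2 / p' * c * ?k" by (simp add: mult.assoc)
  qed
  have "(\<integral>w. (\<lambda>\<mu> \<tau> w. if C (?E \<mu>) then exp (\<sigma> * bil_dev u s v s' \<mu> \<tau> w) else 0) (mk w) (tr w) w \<partial>P) \<le> exp (\<sigma>\<^sup>2 * c / p')"
  proof (rule expectation_mk_tr_le[where \<Psi> = \<Psi>])
    fix \<mu> :: "nat \<times> nat \<Rightarrow> mark" and \<tau> :: "nat \<Rightarrow> (nat \<times> nat) set"
    have E: "?E \<mu> \<subseteq> V \<times> V" by (rule edges1_subset)
    show "(\<lambda>w. if C (?E \<mu>) then exp (\<sigma> * bil_dev u s v s' \<mu> \<tau> w) else 0) \<in> borel_measurable (info (V \<times> V))"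
      using bil_dev_info[of u s v s' \<mu> \<tau>] by (cases "C (?E \<mu>)") auto
    show "bdd (\<lambda>w. if C (?E \<mu>) then exp (\<sigma> * bil_dev u s v s' \<mu> \<tau> w) else 0)"
      by (intro bdd_If_const bdd_exp bdd_mult bdd_const bdd_bil_dev)
    have \<psi>I: "(\<lambda>w. \<psi> (?E \<mu>) \<tau> w e m) \<in> borel_measurable (info (V \<times> V))" for e m
      unfolding \<psi>_def using xI[OF E] zz_info[of "fst e" "snd e" "V \<times> V"] ff_info[of "fst e" "snd e" "V \<times> V"]
      by (cases "m = Part2"; cases "m = Part1 True"; auto)
    have \<psi>b: "bdd (\<lambda>w. \<psi> (?E \<mu>) \<tau> w e m)" for e m
      unfolding \<psi>_def by (intro bdd_If_const bdd_add bdd_mult bdd_diff bdd_exp bdd_const bdd_ff bdd_zz xb)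
    show "\<Psi> \<mu> \<tau> \<in> borel_measurable (info (V \<times> V))"
      unfolding \<Psi>_def[abs_def]
      by (intro borel_measurable_If_const borel_measurable_times borel_measurable_prod borel_measurable_const HI[OF E] \<psi>I)
    show "bdd (\<Psi> \<mu> \<tau>)"
      unfolding \<Psi>_def[abs_def] by (intro bdd_If_const bdd_mult bdd_prod bdd_const Hb \<psi>b)
    show "(\<integral>w. (if C (?E \<mu>) then exp (\<sigma> * bil_dev u s v s' \<mu> \<tau> w) else 0) \<partial>P) \<le> (\<integral>w. \<Psi> \<mu> \<tau> w \<partial>P)"
    proof (cases "C (?E \<mu>)")
      case True
      \<comment> \<open>Only entries of the second sample are fresh. Those of the subsample lie on
        edges of the explored graph and stay inside \<open>g\<close>.\<close>
      define J where "J = {e \<in> V \<times> V. \<mu> e = Part2}"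
      define R where "R = V \<times> V - J"
      have JV: "J \<subseteq> V \<times> V" and RV: "R \<subseteq> V \<times> V" and finJ: "finite J" by (auto simp: J_def R_def)
      have ER: "?E \<mu> \<subseteq> R" by (auto simp: edges1_def R_def J_def)
      define I2 where "I2 = {e \<in> V \<times> V. \<mu> e = Part1 True}"
      have I2R: "I2 \<subseteq> R" by (auto simp: I2_def R_def J_def)
      define g where "g w = H (?E \<mu>) \<tau> w * (\<Prod>e\<in>I2. 1 + zz w (fst e) (snd e) * (exp (x (?E \<mu>) \<tau> e w) - 1))" for w
      define \<alpha> where "\<alpha> e w = exp (x (?E \<mu>) \<tau> e w) - 1" for e w
      have split: "(\<Prod>e\<in>V \<times> V. if \<mu> e = Part2 then k e else if \<mu> e = Part1 True then l e else 1) = (\<Prod>e\<in>I2. l e) * (\<Prod>e\<in>J. k e)" for k l :: "nat \<times> nat \<Rightarrow> real"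
      proof -
        have "(\<Prod>e\<in>V \<times> V. if \<mu> e = Part2 then k e else if \<mu> e = Part1 True then l e else 1)
          = (\<Prod>e\<in>V \<times> V. (if e \<in> I2 then l e else 1) * (if e \<in> J then k e else 1))"
          by (rule prod.cong[OF refl]) (auto simp: I2_def J_def)
        also have "\<dots> = (\<Prod>e\<in>V \<times> V. if e \<in> I2 then l e else 1) * (\<Prod>e\<in>V \<times> V. if e \<in> J then k e else 1)"
          by (rule prod.distrib)
        also have "(\<Prod>e\<in>V \<times> V. if e \<in> I2 then l e else 1) = (\<Prod>e\<in>I2. l e)"
          by (rule prod.mono_neutral_cong_right) (auto simp: I2_def)
        also have "(\<Prod>e\<in>V \<times> V. if e \<in> J then k e else 1) = (\<Prod>e\<in>J. k e)"
          by (rule prod.mono_neutral_cong_right) (auto simp: J_def)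
        finally show ?thesis .
      qed
      have gR: "g \<in> borel_measurable (info R)" unfolding g_def[abs_def]
      proof (intro borel_measurable_times borel_measurable_prod borel_measurable_add borel_measurable_const borel_measurable_diff borel_measurable_exp_comp HI[OF ER] xI[OF ER])
        fix e assume "e \<in> I2"
        then show "(\<lambda>w. zz w (fst e) (snd e)) \<in> borel_measurable (info R)" using I2R by (intro zz_info) auto
      qed
      have gb: "bdd g" unfolding g_def[abs_def]
        by (intro bdd_mult bdd_prod bdd_add bdd_const bdd_diff bdd_exp Hb xb bdd_zz)
      have aR: "\<alpha> e \<in> borel_measurable (info R)" for e unfolding \<alpha>_def[abs_def]
        by (intro borel_measurable_diff borel_measurable_exp_comp borel_measurable_const xI[OF ER])
      have ab: "bdd (\<alpha> e)" for e unfolding \<alpha>_def[abs_def] by (intro bdd_diff bdd_exp bdd_const xb)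
      have gP: "g \<in> borel_measurable P" "\<And>e. \<alpha> e \<in> borel_measurable P"
        using gR aR by (auto intro!: measurable_info[OF RV])
      have up: "exp (\<sigma> * bil_dev u s v s' \<mu> \<tau> w) \<le> g w * (\<Prod>e\<in>J. 1 + \<alpha> e w * Z e w)" if w: "w \<in> space P" for w
      proof -
        have "\<sigma> * bil_dev u s v s' \<mu> \<tau> w = (\<Sum>e\<in>V \<times> V. x (?E \<mu>) \<tau> e w * aa \<mu> w (fst e) (snd e) - p' * x (?E \<mu>) \<tau> e w * gg (?E \<mu>) w (fst e) (snd e))"
          unfolding bil_dev_def sum_distrib_left using p'_pos
          by (intro sum.cong refl) (simp add: x_def field_simps)
        then have "exp (\<sigma> * bil_dev u s v s' \<mu> \<tau> w) = H (?E \<mu>) \<tau> w * (\<Prod>e\<in>V \<times> V. exp (x (?E \<mu>) \<tau> e w * aa \<mu> w (fst e) (snd e)))"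
          unfolding H_def by (simp add: sum_subtractf exp_diff exp_minus exp_sum divide_inverse mult.commute)
        also have "\<dots> \<le> H (?E \<mu>) \<tau> w * (\<Prod>e\<in>V \<times> V. if \<mu> e = Part2 then 1 + \<alpha> e w * Z e w else if \<mu> e = Part1 True
             then 1 + zz w (fst e) (snd e) * (exp (x (?E \<mu>) \<tau> e w) - 1) else 1)"
        proof (intro mult_left_mono prod_mono conjI)
          fix e assume e: "e \<in> V \<times> V"
          have Ze: "zz w (fst e) (snd e) = Z e w" using e by (simp add: zz_def)
          show "exp (x (?E \<mu>) \<tau> e w * aa \<mu> w (fst e) (snd e)) \<le> (if \<mu> e = Part2 then 1 + \<alpha> e w * Z e w else if \<mu> e = Part1 True
             then 1 + zz w (fst e) (snd e) * (exp (x (?E \<mu>) \<tau> e w) - 1) else 1)"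
            using exp_convex_bound[OF Z_range[OF e w], of "x (?E \<mu>) \<tau> e w"] by (auto simp: aa_def Ze \<alpha>_def mult.commute)
        qed (auto simp: H_def)
        also have "\<dots> = g w * (\<Prod>e\<in>J. 1 + \<alpha> e w * Z e w)" unfolding split g_def by simp
        finally show ?thesis .
      qed
      have "(\<integral>w. exp (\<sigma> * bil_dev u s v s' \<mu> \<tau> w) \<partial>P) \<le> (\<integral>w. g w * (\<Prod>e\<in>J. 1 + \<alpha> e w * Z e w) \<partial>P)"
      proof (rule integral_mono[OF _ _ up])
        show "integrable P (\<lambda>w. exp (\<sigma> * bil_dev u s v s' \<mu> \<tau> w))"
          by (intro bdd_integrable bdd_exp bdd_mult bdd_const bdd_bil_dev borel_measurable_exp_comp borel_measurable_times
              borel_measurable_const measurable_info[OF order.refl bil_dev_info])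
        show "integrable P (\<lambda>w. g w * (\<Prod>e\<in>J. 1 + \<alpha> e w * Z e w))"
          using JV by (intro bdd_integrable borel_measurable_times borel_measurable_prod borel_measurable_add
              borel_measurable_const gP Z_measurable bdd_mult bdd_prod bdd_add bdd_const gb ab bdd_Z) blast+
      qed
      also have "\<dots> = (\<integral>w. g w * (\<Prod>e\<in>J. 1 + \<alpha> e w * mean e w) \<partial>P)"
        by (rule prod_mean_swap[OF finJ JV _ RV gR gb aR ab]) (auto simp: R_def)
      also have "\<dots> = (\<integral>w. \<Psi> \<mu> \<tau> w \<partial>P)"
      proof (rule Bochner_Integration.integral_cong[OF refl])
        fix w
        have "(\<Prod>e\<in>J. 1 + \<alpha> e w * mean e w) = (\<Prod>e\<in>J. 1 + ff w (fst e) (snd e) * (exp (x (?E \<mu>) \<tau> e w) - 1))"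
          by (rule prod.cong[OF refl]) (auto simp: J_def ff_def \<alpha>_def)
        then show "g w * (\<Prod>e\<in>J. 1 + \<alpha> e w * mean e w) = \<Psi> \<mu> \<tau> w"
          unfolding \<Psi>_def \<psi>_def split g_def using True by simp
      qed
      finally show ?thesis using True by simp
    qed (simp add: \<Psi>_def)
  next
    fix w assume w: "w \<in> space P"
    have ft: "finite (set_pmf (trees_pmf n E))" if "E \<subseteq> V \<times> V" for E by (rule finite_set_trees_pmf[OF that])
    let ?K = "exp (\<sigma>\<^sup>2 * c / p')"
    \<comment> \<open>Once the graph \<open>E\<close> is prescribed, the vectors no longer depend on
      the marks. The marks remain independent, each constrained to lie in the first part or outside
      it, so the average factorizes over entries and \<open>pexp_mark_split\<close> treats each
      factor.\<close>
    have one: "pexp (marks_pmf n p) (\<lambda>\<mu>. (if ?E \<mu> = E then 1 else 0) * (H E \<tau> w * (\<Prod>e\<in>V \<times> V. \<psi> E \<tau> w e (\<mu> e))))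
        \<le> ?K * pexp (marks_pmf n p) (\<lambda>\<mu>. if ?E \<mu> = E then 1 else 0)" if E: "E \<subseteq> V \<times> V" and CE: "C E" for E \<tau>
    proof -
      let ?i = "\<lambda>e m. (if (\<exists>b. m = Part1 b) = (e \<in> E) then 1 else 0 :: real)"
      have ind: "(if ?E \<mu> = E then 1 else 0) = (\<Prod>e\<in>V \<times> V. ?i e (\<mu> e))" for \<mu>
        using E unfolding edges1_alt by (auto intro!: prod.neutral)
      have \<psi>0: "0 \<le> \<psi> E \<tau> w e m" for e m
      proof -
        have "0 \<le> 1 + g * (exp y - 1)" if "g \<in> {0..1}" for g y :: real
        proof -
          have "0 \<le> g * exp y" using that by simp
          moreover have "g * (exp y - 1) = g * exp y - g" by (simp add: algebra_simps)
          ultimately show ?thesis using that by (simp only: atLeastAtMost_iff) linarith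
        qed
        then show ?thesis unfolding \<psi>_def using zz_unit[OF w] ff_unit[OF w] by (simp del: atLeastAtMost_iff)
      qed
      have pr: "pexp (marks_pmf n p) (\<lambda>\<mu>. \<Prod>e\<in>V \<times> V. h e (\<mu> e)) = (\<Prod>e\<in>V \<times> V. pexp (mark_pmf p) (h e))"
        if "\<And>e m. 0 \<le> h e m" for h :: "nat \<times> nat \<Rightarrow> mark \<Rightarrow> real"
        unfolding marks_pmf_def using that by (intro expectation_prod_Pi_pmf) (auto simp: integrable_measure_pmf_finite)
      have fac: "pexp (marks_pmf n p) (\<lambda>\<mu>. (if ?E \<mu> = E then 1 else 0) * (H E \<tau> w * (\<Prod>e\<in>V \<times> V. \<psi> E \<tau> w e (\<mu> e))))
        = H E \<tau> w * pexp (marks_pmf n p) (\<lambda>\<mu>. \<Prod>e\<in>V \<times> V. ?i e (\<mu> e) * \<psi> E \<tau> w e (\<mu> e))"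
        unfolding ind prod.distrib by (simp add: mult.left_commute)
      have "pexp (marks_pmf n p) (\<lambda>\<mu>. \<Prod>e\<in>V \<times> V. ?i e (\<mu> e) * \<psi> E \<tau> w e (\<mu> e)) = (\<Prod>e\<in>V \<times> V. pexp (mark_pmf p) (\<lambda>m. ?i e m * \<psi> E \<tau> w e m))"
        using \<psi>0 by (intro pr) auto
      also have "\<dots> \<le> (\<Prod>e\<in>V \<times> V. pexp (mark_pmf p) (?i e) * exp (p' * (gg E w (fst e) (snd e) * x E \<tau> e w + (x E \<tau> e w)\<^sup>2)))"
      proof (intro prod_mono conjI)
        fix e
        show "0 \<le> pexp (mark_pmf p) (\<lambda>m. ?i e m * \<psi> E \<tau> w e m)" using \<psi>0 by (intro Bochner_Integration.integral_nonneg) auto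
        have ie: "pexp (mark_pmf p) (?i e) = (if e \<in> E then p / 4 else 1 - p / 4)"
          unfolding pexp_mark[OF p4(3) p_le_1] part1_ex by (simp add: algebra_simps)
        show "pexp (mark_pmf p) (\<lambda>m. ?i e m * \<psi> E \<tau> w e m) \<le> pexp (mark_pmf p) (?i e) * exp (p' * (gg E w (fst e) (snd e) * x E \<tau> e w + (x E \<tau> e w)\<^sup>2))"
          unfolding \<psi>_def gg_def prod.collapse ie
          by (rule pexp_mark_split[OF zz_unit[OF w] ff_unit[OF w] x1[OF w CE]])
      qed
      also have "\<dots> = pexp (marks_pmf n p) (\<lambda>\<mu>. \<Prod>e\<in>V \<times> V. ?i e (\<mu> e)) * exp (\<Sum>e\<in>V \<times> V. p' * (gg E w (fst e) (snd e) * x E \<tau> e w + (x E \<tau> e w)\<^sup>2))"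
      proof -
        have "pexp (marks_pmf n p) (\<lambda>\<mu>. \<Prod>e\<in>V \<times> V. ?i e (\<mu> e)) = (\<Prod>e\<in>V \<times> V. pexp (mark_pmf p) (?i e))"
          by (rule pr) simp
        moreover have "exp (\<Sum>e\<in>V \<times> V. k e) = (\<Prod>e\<in>V \<times> V. exp (k e))" for k :: "nat \<times> nat \<Rightarrow> real"
          by (rule exp_sum) simp
        ultimately show ?thesis unfolding prod.distrib by (simp only:)
      qed
      finally have le: "pexp (marks_pmf n p) (\<lambda>\<mu>. \<Prod>e\<in>V \<times> V. ?i e (\<mu> e) * \<psi> E \<tau> w e (\<mu> e)) \<le> pexp (marks_pmf n p) (\<lambda>\<mu>. \<Prod>e\<in>V \<times> V. ?i e (\<mu> e)) * exp (\<Sum>e\<in>V \<times> V. p' * (gg E w (fst e) (snd e) * x E \<tau> e w + (x E \<tau> e w)\<^sup>2))" .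
      have "pexp (marks_pmf n p) (\<lambda>\<mu>. (if ?E \<mu> = E then 1 else 0) * (H E \<tau> w * (\<Prod>e\<in>V \<times> V. \<psi> E \<tau> w e (\<mu> e))))
        \<le> H E \<tau> w * (pexp (marks_pmf n p) (\<lambda>\<mu>. if ?E \<mu> = E then 1 else 0) * exp (\<Sum>e\<in>V \<times> V. p' * (gg E w (fst e) (snd e) * x E \<tau> e w + (x E \<tau> e w)\<^sup>2)))"
        unfolding fac unfolding ind by (rule mult_left_mono[OF le]) (simp add: H_def)
      also have "(\<Sum>e\<in>V \<times> V. p' * (gg E w (fst e) (snd e) * x E \<tau> e w + (x E \<tau> e w)\<^sup>2))
        = (\<Sum>e\<in>V \<times> V. p' * x E \<tau> e w * gg E w (fst e) (snd e)) + (\<Sum>e\<in>V \<times> V. p' * (x E \<tau> e w)\<^sup>2)"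
        unfolding sum.distrib[symmetric] by (rule sum.cong[OF refl]) (simp add: algebra_simps)
      also have "H E \<tau> w * (pexp (marks_pmf n p) (\<lambda>\<mu>. if ?E \<mu> = E then 1 else 0) * exp \<dots>)
        = exp (\<Sum>e\<in>V \<times> V. p' * (x E \<tau> e w)\<^sup>2) * pexp (marks_pmf n p) (\<lambda>\<mu>. if ?E \<mu> = E then 1 else 0)"
        unfolding H_def by (rule exp_cancel_left)
      also have "\<dots> \<le> ?K * pexp (marks_pmf n p) (\<lambda>\<mu>. if ?E \<mu> = E then 1 else 0)"
      proof (rule mult_right_mono)
        have "(\<Sum>e\<in>V \<times> V. p' * (x E \<tau> e w)\<^sup>2) \<le> (\<Sum>e\<in>V \<times> V. \<sigma>\<^sup>2 / p' * c * (Nn E (\<tau> u) u s (fst e) w * Nn E (\<tau> v) v s' (snd e) w))"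
          by (rule sum_mono) (rule xc[OF w CE])
        also have "\<dots> = \<sigma>\<^sup>2 / p' * c * ((\<Sum>a\<in>V. Nn E (\<tau> u) u s a w) * (\<Sum>b\<in>V. Nn E (\<tau> v) v s' b w))"
          by (rule sum_pairs)
        also have "\<dots> \<le> \<sigma>\<^sup>2 / p' * c * (1 * 1)"
          using p'_pos c by (intro mult_left_mono mult_mono Nn_sum_le[OF w] sphere_at_subset[OF E] u v sum_nonneg Nn_nonneg[OF w]) auto
        finally show "exp (\<Sum>e\<in>V \<times> V. p' * (x E \<tau> e w)\<^sup>2) \<le> ?K" by simp
        show "0 \<le> pexp (marks_pmf n p) (\<lambda>\<mu>. if ?E \<mu> = E then 1 else 0)" by (rule pexp_nonneg) simp
      qed
      finally show ?thesis .
    qed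
    \<comment> \<open>The tree law depends on the marks only through the graph. Splitting by the
      value \<open>E\<close> of the graph freezes that law, so that marks can be averaged before
      trees.\<close>
    define Q where "Q E \<tau> \<mu> = (if C E then H E \<tau> w * (\<Prod>e\<in>V \<times> V. \<psi> E \<tau> w e (\<mu> e)) else 0)" for E \<tau> \<mu>
    let ?i = "\<lambda>E \<mu>. if ?E \<mu> = E then 1 else 0 :: real"
    have "pexp (marks_pmf n p) (\<lambda>\<mu>. pexp (trees_pmf n (?E \<mu>)) (\<lambda>\<tau>. \<Psi> \<mu> \<tau> w)) =
      pexp (marks_pmf n p) (\<lambda>\<mu>. \<Sum>E\<in>Pow (V \<times> V). pexp (trees_pmf n E) (\<lambda>\<tau>. ?i E \<mu> * Q E \<tau> \<mu>))"
    proof (rule pexp_cong)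
      fix \<mu>
      have "(\<lambda>\<tau>. \<Psi> \<mu> \<tau> w) = (\<lambda>\<tau>. Q (?E \<mu>) \<tau> \<mu>)" by (simp only: \<Psi>_def Q_def)
      moreover have "(\<Sum>E\<in>Pow (V \<times> V). pexp (trees_pmf n E) (\<lambda>\<tau>. ?i E \<mu> * Q E \<tau> \<mu>)) = pexp (trees_pmf n (?E \<mu>)) (\<lambda>\<tau>. Q (?E \<mu>) \<tau> \<mu>)"
        by (rule sum_pexp_select) (use edges1_subset[of n \<mu>] in auto)
      ultimately show "pexp (trees_pmf n (?E \<mu>)) (\<lambda>\<tau>. \<Psi> \<mu> \<tau> w) = (\<Sum>E\<in>Pow (V \<times> V). pexp (trees_pmf n E) (\<lambda>\<tau>. ?i E \<mu> * Q E \<tau> \<mu>))"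
        by (simp only:)
    qed
    also have "\<dots> = (\<Sum>E\<in>Pow (V \<times> V). pexp (marks_pmf n p) (\<lambda>\<mu>. pexp (trees_pmf n E) (\<lambda>\<tau>. ?i E \<mu> * Q E \<tau> \<mu>)))"
      by (rule pexp_swap_sum[OF finite_set_marks_pmf])
    also have "\<dots> \<le> (\<Sum>E\<in>Pow (V \<times> V). ?K * pexp (marks_pmf n p) (?i E))"
    proof (rule sum_mono)
      fix E assume E: "E \<in> Pow (V \<times> V)"
      then have fE: "finite (set_pmf (trees_pmf n E))" using ft by blast
      have nn: "0 \<le> pexp (marks_pmf n p) (?i E)" by (rule pexp_nonneg) simp
      have "pexp (marks_pmf n p) (\<lambda>\<mu>. pexp (trees_pmf n E) (\<lambda>\<tau>. ?i E \<mu> * Q E \<tau> \<mu>))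
        = pexp (trees_pmf n E) (\<lambda>\<tau>. pexp (marks_pmf n p) (\<lambda>\<mu>. ?i E \<mu> * Q E \<tau> \<mu>))"
        by (rule pexp_swap[OF finite_set_marks_pmf fE])
      also have "\<dots> \<le> pexp (trees_pmf n E) (\<lambda>\<tau>. ?K * pexp (marks_pmf n p) (?i E))"
      proof (rule pexp_mono[OF fE])
        fix \<tau>
        show "pexp (marks_pmf n p) (\<lambda>\<mu>. ?i E \<mu> * Q E \<tau> \<mu>) \<le> ?K * pexp (marks_pmf n p) (?i E)"
        proof (cases "C E")
          case True
          then have "Q E \<tau> = (\<lambda>\<mu>. H E \<tau> w * (\<Prod>e\<in>V \<times> V. \<psi> E \<tau> w e (\<mu> e)))" by (intro ext) (simp only: Q_def if_True)
          then show ?thesis using one[of E \<tau>] E True by (simp only: Pow_iff)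
        next
          case False
          then have "Q E \<tau> = (\<lambda>\<mu>. 0)" by (intro ext) (simp only: Q_def if_False)
          then show ?thesis using nn by simp
        qed
      qed
      finally show "pexp (marks_pmf n p) (\<lambda>\<mu>. pexp (trees_pmf n E) (\<lambda>\<tau>. ?i E \<mu> * Q E \<tau> \<mu>)) \<le> ?K * pexp (marks_pmf n p) (?i E)" by simp
    qed
    also have "\<dots> = ?K * pexp (marks_pmf n p) (\<lambda>\<mu>. \<Sum>E\<in>Pow (V \<times> V). ?i E \<mu>)"
      unfolding pexp_swap_sum[OF finite_set_marks_pmf] sum_distrib_left ..
    also have "(\<lambda>\<mu>. \<Sum>E\<in>Pow (V \<times> V). ?i E \<mu>) = (\<lambda>_. 1)"
    proof
      fix \<mu>
      have "?E \<mu> \<in> Pow (V \<times> V)" using edges1_subset[of n \<mu>] by blast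
      then show "(\<Sum>E\<in>Pow (V \<times> V). ?i E \<mu>) = 1" by (subst sum.delta') auto
    qed
    finally show "pexp (marks_pmf n p) (\<lambda>\<mu>. pexp (trees_pmf n (?E \<mu>)) (\<lambda>\<tau>. \<Psi> \<mu> \<tau> w)) \<le> ?K" by simp
  qed
  then show ?thesis unfolding C_def by simp
qed

end

section \<open>Tail bounds for level sums, level sizes and the bilinear form\<close>

context sample_model
begin

lemma bdd_cong: "(\<And>w. w \<in> space P \<Longrightarrow> g w = h w) \<Longrightarrow> bdd g \<longleftrightarrow> bdd h"
  by (simp add: bdd_def)

lemma mk_tr_bdd:
  fixes \<Phi> :: "_ \<Rightarrow> _ \<Rightarrow> 'w \<Rightarrow> real"
  assumes "\<And>\<mu> \<tau>. bdd (\<Phi> \<mu> \<tau>)"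
  shows "bdd (\<lambda>w. \<Phi> (mk w) (tr w) w)"
proof -
  have i: "bdd (indicator A)" for A by (rule bddI[of _ 1]) simp
  have "bdd (\<lambda>w. \<Sum>\<mu>\<in>MS. \<Sum>\<tau>\<in>TS. indicator {w \<in> space P. mk w = \<mu>} w * (indicator {w \<in> space P. tr w = \<tau>} w * \<Phi> \<mu> \<tau> w))"
    by (intro bdd_sum bdd_mult assms i)
  then show ?thesis using bdd_cong[OF mk_tr_decomp[of _ \<Phi>]] by simp
qed

lemma mk_event_gen: "{w \<in> space P. Q (mk w)} \<in> sets P"
proof -
  have "{w \<in> space P. Q (mk w)} = (\<Union>\<mu>\<in>{\<mu> \<in> MS. Q \<mu>}. {w \<in> space P. mk w = \<mu>})" using mk_MS by auto
  also have "\<dots> \<in> sets P" using mk_event by (intro sets.finite_UN) auto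
  finally show ?thesis .
qed

lemma level_dev_P:
  assumes x: "\<And>i. x i \<in> borel_measurable (info {})" "\<And>i. bdd (x i)"
  shows "(\<lambda>w. level_dev u s x (edges1 n (mk w)) (tr w u) w) \<in> borel_measurable P"
    "bdd (\<lambda>w. level_dev u s x (edges1 n (mk w)) (tr w u) w)"
  using mk_tr_measurable[of "\<lambda>\<mu> \<tau> w. level_dev u s x (edges1 n \<mu>) (\<tau> u) w", OF measurable_info[OF order.refl level_dev_info[OF edges1_subset x(1)]]]
    mk_tr_bdd[of "\<lambda>\<mu> \<tau> w. level_dev u s x (edges1 n \<mu>) (\<tau> u) w", OF bdd_level_dev[OF x(2)]] by auto

lemma level_tail:
  assumes u: "u \<in> V" and x: "\<And>i. x i \<in> borel_measurable (info {})" "\<And>i w. w \<in> space P \<Longrightarrow> \<bar>x i w\<bar> \<le> b"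
    and \<sigma>: "0 \<le> \<sigma>" "\<sigma> * b \<le> 1"
  shows "prob {w \<in> space P. real (card (sphere_at (edges1 n (mk w)) u s)) \<le> m \<and>
      \<zeta> < \<bar>level_dev u s x (edges1 n (mk w)) (tr w u) w\<bar>} \<le> 2 * exp (n * (p / 4 * m) * (\<sigma> * b)\<^sup>2) * exp (- (\<sigma> * \<zeta>))"
proof (rule two_sided_tail)
  have bx: "bdd (x i)" for i using x(2) by (rule bddI)
  show "(\<lambda>w. level_dev u s x (edges1 n (mk w)) (tr w u) w) \<in> borel_measurable P"
    "bdd (\<lambda>w. level_dev u s x (edges1 n (mk w)) (tr w u) w)" using level_dev_P[OF x(1) bx] by auto
  show "{w \<in> space P. real (card (sphere_at (edges1 n (mk w)) u s)) \<le> m} \<in> sets P" by (rule mk_event_gen)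
  show "(\<integral>w. (if real (card (sphere_at (edges1 n (mk w)) u s)) \<le> m
      then exp (\<sigma> * level_dev u s x (edges1 n (mk w)) (tr w u) w) else 0) \<partial>P) \<le> exp (n * (p / 4 * m) * (\<sigma> * b)\<^sup>2)"
    using level_dev_mgf[OF u x, of \<sigma> s m] \<sigma> by simp
  show "(\<integral>w. (if real (card (sphere_at (edges1 n (mk w)) u s)) \<le> m
      then exp (\<sigma> * - level_dev u s x (edges1 n (mk w)) (tr w u) w) else 0) \<partial>P) \<le> exp (n * (p / 4 * m) * (\<sigma> * b)\<^sup>2)"
    using level_dev_mgf[OF u x, of "- \<sigma>" s m] \<sigma> unfolding minus_mult_commute by simp
qed fact

definition size_dev :: "nat \<Rightarrow> nat \<Rightarrow> (nat \<times> nat) set \<Rightarrow> real" where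
  "size_dev u s E = real (card (sphere_at E u (Suc s))) - hit_prob E u s * card (V - ball E u s)"

lemma size_tail:
  assumes u: "u \<in> V" and \<sigma>: "0 \<le> \<sigma>" "\<sigma> \<le> 1"
  shows "prob {w \<in> space P. real (card (sphere_at (edges1 n (mk w)) u s)) \<le> m \<and>
      \<zeta> < \<bar>size_dev u s (edges1 n (mk w))\<bar>} \<le> 2 * exp (n * (p / 4 * m) * \<sigma>\<^sup>2) * exp (- (\<sigma> * \<zeta>))"
proof (rule two_sided_tail)
  show "(\<lambda>w. size_dev u s (edges1 n (mk w))) \<in> borel_measurable P"
    using mk_tr_measurable[of "\<lambda>\<mu> \<tau> w. size_dev u s (edges1 n \<mu>)"] by simp
  show "bdd (\<lambda>w. size_dev u s (edges1 n (mk w)))"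
    using mk_tr_bdd[of "\<lambda>\<mu> \<tau> w. size_dev u s (edges1 n \<mu>)"] by auto
  show "{w \<in> space P. real (card (sphere_at (edges1 n (mk w)) u s)) \<le> m} \<in> sets P" by (rule mk_event_gen)
  show "(\<integral>w. (if real (card (sphere_at (edges1 n (mk w)) u s)) \<le> m
      then exp (\<sigma> * size_dev u s (edges1 n (mk w))) else 0) \<partial>P) \<le> exp (n * (p / 4 * m) * \<sigma>\<^sup>2)"
    using size_mgf[OF u, of \<sigma> s m] \<sigma> unfolding size_dev_def by simp
  show "(\<integral>w. (if real (card (sphere_at (edges1 n (mk w)) u s)) \<le> m
      then exp (\<sigma> * - size_dev u s (edges1 n (mk w))) else 0) \<partial>P) \<le> exp (n * (p / 4 * m) * \<sigma>\<^sup>2)"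
    using size_mgf[OF u, of "- \<sigma>" s m] \<sigma> unfolding size_dev_def minus_mult_commute by simp
qed fact

lemma bil_tail:
  assumes u: "u \<in> V" and v: "v \<in> V" and c: "0 \<le> c" and \<sigma>: "0 \<le> \<sigma>" "\<sigma> * c \<le> p'"
  shows "prob {w \<in> space P. 1 \<le> c * (card (sphere_at (edges1 n (mk w)) u s) * card (sphere_at (edges1 n (mk w)) v s')) \<and>
      \<zeta> < \<bar>bil_dev u s v s' (mk w) (tr w) w\<bar>} \<le> 2 * exp (\<sigma>\<^sup>2 * c / p') * exp (- (\<sigma> * \<zeta>))"
proof (rule two_sided_tail)
  show "(\<lambda>w. bil_dev u s v s' (mk w) (tr w) w) \<in> borel_measurable P"
    by (rule mk_tr_measurable) (rule measurable_info[OF order.refl bil_dev_info])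
  show "bdd (\<lambda>w. bil_dev u s v s' (mk w) (tr w) w)" by (rule mk_tr_bdd) (rule bdd_bil_dev)
  show "{w \<in> space P. 1 \<le> c * (card (sphere_at (edges1 n (mk w)) u s) * card (sphere_at (edges1 n (mk w)) v s'))} \<in> sets P"
    by (rule mk_event_gen)
  show "(\<integral>w. (if 1 \<le> c * (card (sphere_at (edges1 n (mk w)) u s) * card (sphere_at (edges1 n (mk w)) v s'))
      then exp (\<sigma> * bil_dev u s v s' (mk w) (tr w) w) else 0) \<partial>P) \<le> exp (\<sigma>\<^sup>2 * c / p')"
    using bil_dev_mgf[OF u v c, of \<sigma> s s'] \<sigma> by simp
  show "(\<integral>w. (if 1 \<le> c * (card (sphere_at (edges1 n (mk w)) u s) * card (sphere_at (edges1 n (mk w)) v s'))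
      then exp (\<sigma> * - bil_dev u s v s' (mk w) (tr w) w) else 0) \<partial>P) \<le> exp (\<sigma>\<^sup>2 * c / p')"
    using bil_dev_mgf[OF u v c, of "- \<sigma>" s s'] \<sigma> unfolding minus_mult_commute by simp
qed fact

section \<open>Near pairs in the third sample\<close>

text \<open>Marks and trees are free arguments here, so that the distance estimate can be studied
  with both fixed.\<close>

definition dh :: "nat \<Rightarrow> (nat \<times> nat \<Rightarrow> mark) \<Rightarrow> (nat \<Rightarrow> (nat \<times> nat) set) \<Rightarrow> nat \<Rightarrow> nat \<Rightarrow> 'w \<Rightarrow> real" where
  "dh t \<mu> \<tau> u v w = dist_estimate n p t \<mu> (\<lambda>e. Z e w) \<tau> u v"

lemma dh_eq:
  "dh t \<mu> \<tau> u v w = 1 / p' * (\<Sum>a\<in>V. \<Sum>b\<in>V.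
    (Nn (edges1 n \<mu>) (\<tau> u) u t a w - Nn (edges1 n \<mu>) (\<tau> v) v t a w) * aa \<mu> w a b *
    (Nn (edges1 n \<mu>) (\<tau> u) u (t + 1) b w - Nn (edges1 n \<mu>) (\<tau> v) v (t + 1) b w))"
proof -
  have M1: "restrict_matrix (edges1 n \<mu>) (data_matrix n \<mu> (\<lambda>e. Z e w)) = restrict_matrix (edges1 n \<mu>) (zz w)"
    by (auto simp: restrict_matrix_def data_matrix_def edges_obs_def edges1_def zz_def fun_eq_iff)
  have A: "restrict_matrix (edges2 n \<mu>) (data_matrix n \<mu> (\<lambda>e. Z e w)) a b + restrict_matrix (edges1_ind n \<mu>) (data_matrix n \<mu> (\<lambda>e. Z e w)) a b = aa \<mu> w a b"
    if "a \<in> V" "b \<in> V" for a b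
    using that by (auto simp: restrict_matrix_def data_matrix_def edges_obs_def edges2_def edges1_ind_def aa_def zz_def)
  show ?thesis
    unfolding dh_def dist_estimate_def Let_def M1 p'_def[symmetric] nbr_vec_normalized_def nv_def[symmetric] Nn_def[symmetric]
    by (intro arg_cong2[where f = times] refl sum.cong) (simp add: A)
qed

lemma aa_info': "(\<lambda>w. aa \<mu> w a b) \<in> borel_measurable (info (V \<times> V - edges3 n \<mu>))"
  unfolding aa_def
proof (rule borel_measurable_If_const)
  assume "\<mu> (a, b) = Part2 \<or> \<mu> (a, b) = Part1 True"
  then show "(\<lambda>w. zz w a b) \<in> borel_measurable (info (V \<times> V - edges3 n \<mu>))"
    by (intro zz_info) (auto simp: edges3_def)
qed simp

text \<open>The distance estimates never look at entries of the third sample. This is the purpose of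
  that part of the split: the selection of near pairs does not bias the entries that are
  averaged.\<close>

lemma dh_info: "dh t \<mu> \<tau> u v \<in> borel_measurable (info (V \<times> V - edges3 n \<mu>))"
proof -
  have "edges1 n \<mu> \<subseteq> V \<times> V - edges3 n \<mu>" by (auto simp: edges1_def edges3_def)
  then show ?thesis unfolding dh_eq[abs_def]
    by (intro borel_measurable_times borel_measurable_sum borel_measurable_diff borel_measurable_const Nn_info aa_info')
qed

definition near_ind :: "nat \<Rightarrow> real \<Rightarrow> nat \<Rightarrow> nat \<Rightarrow> (nat \<times> nat \<Rightarrow> mark) \<Rightarrow> (nat \<Rightarrow> (nat \<times> nat) set) \<Rightarrow> nat \<times> nat \<Rightarrow> 'w \<Rightarrow> real" where
  "near_ind t \<eta> u v \<mu> \<tau> e w = (if dh t \<mu> \<tau> u (fst e) w < \<eta> \<and> dh t \<mu> \<tau> v (snd e) w < \<eta> then 1 else 0)"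

definition near_count :: "nat \<Rightarrow> real \<Rightarrow> nat \<Rightarrow> nat \<Rightarrow> (nat \<times> nat \<Rightarrow> mark) \<Rightarrow> (nat \<Rightarrow> (nat \<times> nat) set) \<Rightarrow> 'w \<Rightarrow> real" where
  "near_count t \<eta> u v \<mu> \<tau> w = (\<Sum>e\<in>edges3 n \<mu>. near_ind t \<eta> u v \<mu> \<tau> e w)"

definition near_dev :: "nat \<Rightarrow> real \<Rightarrow> nat \<Rightarrow> nat \<Rightarrow> (nat \<times> nat \<Rightarrow> mark) \<Rightarrow> (nat \<Rightarrow> (nat \<times> nat) set) \<Rightarrow> 'w \<Rightarrow> real" where
  "near_dev t \<eta> u v \<mu> \<tau> w = (\<Sum>e\<in>edges3 n \<mu>. near_ind t \<eta> u v \<mu> \<tau> e w * (Z e w - mean e w))"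

lemma edges3_sub: "edges3 n \<mu> \<subseteq> V \<times> V" by (auto simp: edges3_def)

lemma near_ind_info: "near_ind t \<eta> u v \<mu> \<tau> e \<in> borel_measurable (info (V \<times> V - edges3 n \<mu>))"
  unfolding near_ind_def[abs_def]
  using dh_info[of t \<mu> \<tau> u "fst e"] dh_info[of t \<mu> \<tau> v "snd e"] by measurable

lemma bdd_near_ind: "bdd (near_ind t \<eta> u v \<mu> \<tau> e)"
  by (rule bddI[of _ 1]) (simp add: near_ind_def)

lemma near_info: "near_count t \<eta> u v \<mu> \<tau> \<in> borel_measurable (info (V \<times> V))" "near_dev t \<eta> u v \<mu> \<tau> \<in> borel_measurable (info (V \<times> V))"
proof -
  have ni: "near_ind t \<eta> u v \<mu> \<tau> e \<in> borel_measurable (info (V \<times> V))" for e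
    by (rule measurable_info_mono[OF Diff_subset near_ind_info])
  show "near_count t \<eta> u v \<mu> \<tau> \<in> borel_measurable (info (V \<times> V))"
    unfolding near_count_def[abs_def] by (intro borel_measurable_sum ni)
  show "near_dev t \<eta> u v \<mu> \<tau> \<in> borel_measurable (info (V \<times> V))"
    unfolding near_dev_def[abs_def] using edges3_sub[of \<mu>]
    by (intro borel_measurable_sum borel_measurable_times borel_measurable_diff ni Z_info mean_info) auto
qed

lemma bdd_near: "bdd (near_count t \<eta> u v \<mu> \<tau>)" "bdd (near_dev t \<eta> u v \<mu> \<tau>)"
proof -
  show "bdd (near_count t \<eta> u v \<mu> \<tau>)" unfolding near_count_def[abs_def] by (intro bdd_sum bdd_near_ind)
  show "bdd (near_dev t \<eta> u v \<mu> \<tau>)" unfolding near_dev_def[abs_def] using edges3_sub[of \<mu>]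
    by (intro bdd_sum bdd_mult bdd_diff bdd_near_ind bdd_Z bdd_mean) auto
qed

text \<open>The number of near pairs is random, so the exponential moment is normalized by
  \<open>\<sigma>\<^sup>2 * near_count\<close> instead of a deterministic variance. With marks and
  trees fixed the selection is measurable without the third sample; its entries are replaced by
  their means, and each selected pair leaves a factor of at most 1.\<close>

lemma near_mgf:
  assumes \<sigma>: "\<bar>\<sigma>\<bar> \<le> 1"
  shows "(\<integral>w. exp (\<sigma> * near_dev t \<eta> u v (mk w) (tr w) w - \<sigma>\<^sup>2 * near_count t \<eta> u v (mk w) (tr w) w) \<partial>P) \<le> 1"
proof -
  let ?\<Phi> = "\<lambda>\<mu> \<tau> w. exp (\<sigma> * near_dev t \<eta> u v \<mu> \<tau> w - \<sigma>\<^sup>2 * near_count t \<eta> u v \<mu> \<tau> w)"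
  have "(\<integral>w. ?\<Phi> (mk w) (tr w) w \<partial>P) \<le> 1"
  proof (rule expectation_mk_tr_le[where \<Psi> = "\<lambda>_ _ _. 1"])
    fix \<mu> :: "nat \<times> nat \<Rightarrow> mark" and \<tau> :: "nat \<Rightarrow> (nat \<times> nat) set"
    have meas: "?\<Phi> \<mu> \<tau> \<in> borel_measurable (info (V \<times> V))"
      by (intro borel_measurable_exp_comp borel_measurable_diff borel_measurable_times borel_measurable_const near_info)
    have bd: "bdd (?\<Phi> \<mu> \<tau>)" by (intro bdd_exp bdd_diff bdd_mult bdd_const bdd_near)
    show "?\<Phi> \<mu> \<tau> \<in> borel_measurable (info (V \<times> V))" "bdd (?\<Phi> \<mu> \<tau>)" by fact+
    let ?J = "edges3 n \<mu>" and ?I = "near_ind t \<eta> u v \<mu> \<tau>"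
    let ?R = "V \<times> V - edges3 n \<mu>"
    define g where "g w = exp (- (\<Sum>e\<in>?J. ?I e w * (\<sigma> * mean e w + \<sigma>\<^sup>2)))" for w
    define \<alpha> where "\<alpha> e w = exp (\<sigma> * ?I e w) - 1" for e w
    have JV: "e \<in> V \<times> V" if "e \<in> ?J" for e using that edges3_sub by blast
    have finJ: "finite ?J" by (rule finite_subset[OF edges3_sub]) simp
    have gR: "g \<in> borel_measurable (info ?R)" unfolding g_def[abs_def]
      by (intro borel_measurable_exp_comp borel_measurable_uminus borel_measurable_sum borel_measurable_times
          borel_measurable_add borel_measurable_const near_ind_info mean_info JV)
    have gb: "bdd g" unfolding g_def[abs_def]
      by (intro bdd_exp bdd_uminus bdd_sum bdd_mult bdd_add bdd_const bdd_near_ind bdd_mean JV)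
    have aR: "\<alpha> e \<in> borel_measurable (info ?R)" for e unfolding \<alpha>_def[abs_def]
      by (intro borel_measurable_diff borel_measurable_exp_comp borel_measurable_times borel_measurable_const near_ind_info)
    have ab: "bdd (\<alpha> e)" for e unfolding \<alpha>_def[abs_def] by (intro bdd_diff bdd_exp bdd_mult bdd_const bdd_near_ind)
    have gP: "g \<in> borel_measurable P" "\<And>e. \<alpha> e \<in> borel_measurable P"
      using gR aR by (auto intro!: measurable_info[of ?R])
    have mP: "mean e \<in> borel_measurable P" if "e \<in> ?J" for e
      using measurable_info[OF order.refl mean_info[OF JV[OF that]]] .
    have up: "?\<Phi> \<mu> \<tau> w \<le> g w * (\<Prod>e\<in>?J. 1 + \<alpha> e w * Z e w)" if w: "w \<in> space P" for w
    proof -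
      have "\<sigma> * near_dev t \<eta> u v \<mu> \<tau> w - \<sigma>\<^sup>2 * near_count t \<eta> u v \<mu> \<tau> w = (\<Sum>e\<in>?J. (\<sigma> * ?I e w) * Z e w) - (\<Sum>e\<in>?J. ?I e w * (\<sigma> * mean e w + \<sigma>\<^sup>2))"
        unfolding near_dev_def near_count_def sum_distrib_left sum_subtractf[symmetric]
        by (rule sum.cong[OF refl]) (simp add: algebra_simps)
      then have "?\<Phi> \<mu> \<tau> w = g w * (\<Prod>e\<in>?J. exp ((\<sigma> * ?I e w) * Z e w))"
        unfolding g_def using finJ by (simp add: exp_diff exp_minus exp_sum divide_inverse mult.commute)
      also have "\<dots> \<le> g w * (\<Prod>e\<in>?J. 1 + \<alpha> e w * Z e w)"
      proof (intro mult_left_mono prod_mono conjI)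
        fix e assume "e \<in> ?J"
        then show "exp ((\<sigma> * ?I e w) * Z e w) \<le> 1 + \<alpha> e w * Z e w"
          using exp_convex_bound[OF Z_range[OF JV w], of e "\<sigma> * ?I e w"] by (simp add: \<alpha>_def mult.commute)
      qed (auto simp: g_def)
      finally show ?thesis .
    qed
    have "(\<integral>w. ?\<Phi> \<mu> \<tau> w \<partial>P) \<le> (\<integral>w. g w * (\<Prod>e\<in>?J. 1 + \<alpha> e w * Z e w) \<partial>P)"
      by (rule integral_mono[OF _ _ up])
        (intro bdd_integrable measurable_info[OF order.refl meas] bd borel_measurable_times borel_measurable_prod borel_measurable_add
              borel_measurable_const gP Z_measurable bdd_mult bdd_prod bdd_add bdd_const gb ab bdd_Z JV, assumption?)+
    also have "\<dots> = (\<integral>w. g w * (\<Prod>e\<in>?J. 1 + \<alpha> e w * mean e w) \<partial>P)"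
      by (rule prod_mean_swap[OF finJ edges3_sub _ _ gR gb aR ab]) auto
    also have "\<dots> \<le> (\<integral>w. 1 \<partial>P)"
    proof (rule integral_mono)
      show "integrable P (\<lambda>w. g w * (\<Prod>e\<in>?J. 1 + \<alpha> e w * mean e w))"
        by (intro bdd_integrable borel_measurable_times borel_measurable_prod borel_measurable_add
              borel_measurable_const gP mP bdd_mult bdd_prod bdd_add bdd_const gb ab bdd_mean JV)
      fix w assume w: "w \<in> space P"
      have "(\<Prod>e\<in>?J. 1 + \<alpha> e w * mean e w) \<le> (\<Prod>e\<in>?J. exp (?I e w * (\<sigma> * mean e w + \<sigma>\<^sup>2)))"
      proof (intro prod_mono conjI)
        fix e assume e: "e \<in> ?J"
        have m: "mean e w \<in> {0..1}" by (rule mean_range[OF JV[OF e] w])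
        have "0 \<le> exp \<sigma> * mean e w" using m by simp
        moreover have "mean e w * (exp \<sigma> - 1) = exp \<sigma> * mean e w - mean e w" by (simp add: algebra_simps)
        ultimately have nn: "0 \<le> 1 + mean e w * (exp \<sigma> - 1)" using m by (simp only: atLeastAtMost_iff) linarith
        then show "0 \<le> 1 + \<alpha> e w * mean e w" by (simp add: \<alpha>_def near_ind_def mult.commute)
        have "exp \<sigma> \<le> 1 + \<sigma> + \<sigma>\<^sup>2" by (rule exp_quadratic_bound) (use \<sigma> in linarith)
        then have "mean e w * (exp \<sigma> - 1) \<le> mean e w * (\<sigma> + \<sigma>\<^sup>2)" using m by (intro mult_left_mono) auto
        also have "\<dots> \<le> \<sigma> * mean e w + \<sigma>\<^sup>2" using mult_left_le_one_le[of "\<sigma>\<^sup>2" "mean e w"] m by (simp add: distrib_left mult.commute)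
        finally have "1 + mean e w * (exp \<sigma> - 1) \<le> exp (\<sigma> * mean e w + \<sigma>\<^sup>2)"
          using exp_ge_add_one_self[of "\<sigma> * mean e w + \<sigma>\<^sup>2"] by linarith
        then show "1 + \<alpha> e w * mean e w \<le> exp (?I e w * (\<sigma> * mean e w + \<sigma>\<^sup>2))"
          by (simp add: \<alpha>_def near_ind_def mult.commute)
      qed
      then have "g w * (\<Prod>e\<in>?J. 1 + \<alpha> e w * mean e w) \<le> g w * (\<Prod>e\<in>?J. exp (?I e w * (\<sigma> * mean e w + \<sigma>\<^sup>2)))"
        by (intro mult_left_mono) (auto simp: g_def)
      also have "\<dots> = 1" unfolding g_def using finJ by (simp add: exp_sum[symmetric] exp_add[symmetric])
      finally show "g w * (\<Prod>e\<in>?J. 1 + \<alpha> e w * mean e w) \<le> 1" .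
    qed simp
    finally show "(\<integral>w. ?\<Phi> \<mu> \<tau> w \<partial>P) \<le> (\<integral>w. 1 \<partial>P)" .
  qed auto
  then show ?thesis by simp
qed

lemma near_P:
  "(\<lambda>w. near_dev t \<eta> u v (mk w) (tr w) w) \<in> borel_measurable P" "(\<lambda>w. near_count t \<eta> u v (mk w) (tr w) w) \<in> borel_measurable P"
  "bdd (\<lambda>w. near_dev t \<eta> u v (mk w) (tr w) w)" "bdd (\<lambda>w. near_count t \<eta> u v (mk w) (tr w) w)"
  by (rule mk_tr_measurable mk_tr_bdd; intro measurable_info[OF order.refl] near_info bdd_near)+

lemma near_tail:
  assumes x: "0 < x" "x \<le> 2"
  shows "prob {w \<in> space P. m \<le> near_count t \<eta> u v (mk w) (tr w) w \<and>
      x * near_count t \<eta> u v (mk w) (tr w) w < \<bar>near_dev t \<eta> u v (mk w) (tr w) w\<bar>} \<le> 2 * exp (- (x\<^sup>2 * m / 4))"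
proof -
  let ?d = "\<lambda>w. near_dev t \<eta> u v (mk w) (tr w) w" and ?c = "\<lambda>w. near_count t \<eta> u v (mk w) (tr w) w"
  have one: "prob {w \<in> space P. True \<and> x\<^sup>2 * m / 4 < \<sigma> * ?d w - \<sigma>\<^sup>2 * ?c w} \<le> exp (- (x\<^sup>2 * m / 4))" if "\<bar>\<sigma>\<bar> \<le> 1" for \<sigma>
  proof -
    have "prob {w \<in> space P. True \<and> x\<^sup>2 * m / 4 < \<sigma> * ?d w - \<sigma>\<^sup>2 * ?c w}
      \<le> exp (- (1 * (x\<^sup>2 * m / 4))) * (\<integral>w. (if True then exp (1 * (\<sigma> * ?d w - \<sigma>\<^sup>2 * ?c w)) else 0) \<partial>P)"
    proof (rule markov_exp)
      show "(\<lambda>w. \<sigma> * ?d w - \<sigma>\<^sup>2 * ?c w) \<in> borel_measurable P"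
        using near_P(1,2)[of t \<eta> u v] by measurable
      show "bdd (\<lambda>w. \<sigma> * ?d w - \<sigma>\<^sup>2 * ?c w)" by (intro bdd_diff bdd_mult bdd_const near_P)
    qed auto
    also have "\<dots> \<le> exp (- (x\<^sup>2 * m / 4)) * 1"
      using near_mgf[OF that, of t \<eta> u v] by simp
    finally show ?thesis by simp
  qed
  have ev: "{w \<in> space P. True \<and> x\<^sup>2 * m / 4 < \<sigma> * ?d w - \<sigma>\<^sup>2 * ?c w} \<in> sets P" for \<sigma>
    using near_P(1,2)[of t \<eta> u v] by measurable
  \<comment> \<open>The values \<open>x / 2\<close> and \<open>- (x / 2)\<close> for
    \<open>\<sigma>\<close> maximize \<open>\<bar>\<sigma>\<bar> * x - \<sigma>\<^sup>2\<close>. On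
    the event one of the two exponents then exceeds \<open>x\<^sup>2 / 4\<close> times the count,
    hence \<open>x\<^sup>2 * m / 4\<close>.\<close>
  have "prob {w \<in> space P. m \<le> ?c w \<and> x * ?c w < \<bar>?d w\<bar>} \<le> prob ({w \<in> space P. True \<and> x\<^sup>2 * m / 4 < x / 2 * ?d w - (x / 2)\<^sup>2 * ?c w} \<union>
      {w \<in> space P. True \<and> x\<^sup>2 * m / 4 < - (x / 2) * ?d w - (- (x / 2))\<^sup>2 * ?c w})"
  proof (rule finite_measure_mono)
    show "{w \<in> space P. m \<le> ?c w \<and> x * ?c w < \<bar>?d w\<bar>} \<subseteq> {w \<in> space P. True \<and> x\<^sup>2 * m / 4 < x / 2 * ?d w - (x / 2)\<^sup>2 * ?c w} \<union>
      {w \<in> space P. True \<and> x\<^sup>2 * m / 4 < - (x / 2) * ?d w - (- (x / 2))\<^sup>2 * ?c w}"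
    proof
      fix w assume w: "w \<in> {w \<in> space P. m \<le> ?c w \<and> x * ?c w < \<bar>?d w\<bar>}"
      then have "x / 2 * (x * ?c w) < x / 2 * \<bar>?d w\<bar>" using x by (intro mult_strict_left_mono) auto
      moreover have "x\<^sup>2 * m \<le> x\<^sup>2 * ?c w" using w by (intro mult_left_mono) auto
      ultimately have "x\<^sup>2 * m / 4 < x / 2 * \<bar>?d w\<bar> - (x / 2)\<^sup>2 * ?c w" by (simp add: power2_eq_square field_simps)
      then show "w \<in> {w \<in> space P. True \<and> x\<^sup>2 * m / 4 < x / 2 * ?d w - (x / 2)\<^sup>2 * ?c w} \<union>
      {w \<in> space P. True \<and> x\<^sup>2 * m / 4 < - (x / 2) * ?d w - (- (x / 2))\<^sup>2 * ?c w}"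
        using w by (cases "0 \<le> ?d w") (auto simp: abs_if)
    qed
  qed (intro sets.Un ev)
  also have "\<dots> \<le> prob {w \<in> space P. True \<and> x\<^sup>2 * m / 4 < x / 2 * ?d w - (x / 2)\<^sup>2 * ?c w} +
      prob {w \<in> space P. True \<and> x\<^sup>2 * m / 4 < - (x / 2) * ?d w - (- (x / 2))\<^sup>2 * ?c w}"
    by (rule measure_Un_le; rule ev)
  also have "\<dots> \<le> exp (- (x\<^sup>2 * m / 4)) + exp (- (x\<^sup>2 * m / 4))"
    using x by (intro add_mono one) auto
  finally show ?thesis by simp
qed

definition chi :: "real \<Rightarrow> nat \<Rightarrow> nat \<Rightarrow> 'w \<Rightarrow> real" where
  "chi \<epsilon> u a w = (if \<bar>\<theta> a w - \<theta> u w\<bar> \<le> \<epsilon> then 1 else 0)"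

definition close_count :: "real \<Rightarrow> nat \<Rightarrow> 'w \<Rightarrow> real" where
  "close_count \<epsilon> u w = (\<Sum>a\<in>V. chi \<epsilon> u a w)"

definition count3 :: "real \<Rightarrow> nat \<Rightarrow> nat \<Rightarrow> (nat \<times> nat \<Rightarrow> mark) \<Rightarrow> 'w \<Rightarrow> real" where
  "count3 \<epsilon> u v \<mu> w = (\<Sum>e\<in>edges3 n \<mu>. chi \<epsilon> u (fst e) w * chi \<epsilon> v (snd e) w)"

lemma chi_info: "u \<in> V \<Longrightarrow> a \<in> V \<Longrightarrow> chi \<epsilon> u a \<in> borel_measurable (info R)"
  unfolding chi_def[abs_def] using theta_info[of u R] theta_info[of a R] by measurable

lemma bdd_chi: "bdd (chi \<epsilon> u a)"
  by (rule bddI[of _ 1]) (simp add: chi_def)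

lemma count3_info: "u \<in> V \<Longrightarrow> v \<in> V \<Longrightarrow> count3 \<epsilon> u v \<mu> \<in> borel_measurable (info (V \<times> V))"
  unfolding count3_def[abs_def] using edges3_sub[of \<mu>]
  by (intro borel_measurable_sum borel_measurable_times chi_info) auto

lemma close_count_info: "u \<in> V \<Longrightarrow> close_count \<epsilon> u \<in> borel_measurable (info R)"
  unfolding close_count_def[abs_def] by (intro borel_measurable_sum chi_info) auto

text \<open>Given the latent variables, the count is a sum of independent indicators of probability
  \<open>p / 2\<close>, one for each of at least \<open>q\<close> close pairs. Its exponential
  moment at -1 is at most \<open>exp (- (p * q / 4))\<close>, and Markov's inequality yields the
  lower tail.\<close>

lemma count_tail:
  assumes u: "u \<in> V" and v: "v \<in> V"
  shows "prob {w \<in> space P. q \<le> close_count \<epsilon> u w * close_count \<epsilon> v w \<and> count3 \<epsilon> u v (mk w) w < m} \<le> exp (m - p * q / 4)"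
proof -
  let ?Q = "\<lambda>w. q \<le> close_count \<epsilon> u w * close_count \<epsilon> v w"
  let ?\<Phi> = "\<lambda>\<mu> (\<tau> :: nat \<Rightarrow> (nat \<times> nat) set) w. if ?Q w then exp (- count3 \<epsilon> u v \<mu> w) else 0"
  have bc: "bdd (count3 \<epsilon> u v \<mu>)" for \<mu> unfolding count3_def[abs_def] by (intro bdd_sum bdd_mult bdd_chi)
  have "(\<integral>w. ?\<Phi> (mk w) (tr w) w \<partial>P) \<le> exp (- (p * q / 4))"
  proof (rule expectation_mk_tr_le[where \<Psi> = ?\<Phi>])
    fix \<mu> :: "nat \<times> nat \<Rightarrow> mark" and \<tau> :: "nat \<Rightarrow> (nat \<times> nat) set"
    show "?\<Phi> \<mu> \<tau> \<in> borel_measurable (info (V \<times> V))"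
      using count3_info[OF u v, of \<epsilon> \<mu>] close_count_info[OF u, of \<epsilon> "V \<times> V"] close_count_info[OF v, of \<epsilon> "V \<times> V"] by measurable
    then show "?\<Phi> \<mu> \<tau> \<in> borel_measurable (info (V \<times> V))" .
    have "bdd (\<lambda>w. exp (- count3 \<epsilon> u v \<mu> w))" by (intro bdd_exp bdd_uminus bc)
    then obtain K where K: "\<And>w. w \<in> space P \<Longrightarrow> exp (- count3 \<epsilon> u v \<mu> w) \<le> K" unfolding bdd_def by auto
    show "bdd (?\<Phi> \<mu> \<tau>)"
    proof (rule bddI[of _ K])
      fix w assume "w \<in> space P"
      from K[OF this] show "\<bar>?\<Phi> \<mu> \<tau> w\<bar> \<le> K" using order_trans[OF exp_ge_zero K[OF \<open>w \<in> space P\<close>]] by simp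
    qed
    then show "bdd (?\<Phi> \<mu> \<tau>)" .
  next
    fix w assume w: "w \<in> space P"
    show "pexp (marks_pmf n p) (\<lambda>\<mu>. pexp (trees_pmf n (edges1 n \<mu>)) (\<lambda>\<tau>. ?\<Phi> \<mu> \<tau> w)) \<le> exp (- (p * q / 4))"
    proof (cases "?Q w")
      case True
      let ?c = "\<lambda>e. chi \<epsilon> u (fst e) w * chi \<epsilon> v (snd e) w"
      have c01: "?c e = 0 \<or> ?c e = 1" for e by (auto simp: chi_def)
      have "pexp (marks_pmf n p) (\<lambda>\<mu>. pexp (trees_pmf n (edges1 n \<mu>)) (\<lambda>\<tau>. ?\<Phi> \<mu> \<tau> w)) = pexp (marks_pmf n p) (\<lambda>\<mu>. \<Prod>e\<in>V \<times> V. if \<mu> e = Part3 then exp (- ?c e) else 1)"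
      proof (rule pexp_cong)
        fix \<mu>
        have "exp (- count3 \<epsilon> u v \<mu> w) = (\<Prod>e\<in>edges3 n \<mu>. exp (- ?c e))"
          unfolding count3_def sum_negf[symmetric] by (rule exp_sum, rule finite_subset[OF edges3_sub]) simp
        also have "\<dots> = (\<Prod>e\<in>V \<times> V. if \<mu> e = Part3 then exp (- ?c e) else 1)"
          by (rule prod.mono_neutral_cong_left) (auto simp: edges3_def)
        finally show "pexp (trees_pmf n (edges1 n \<mu>)) (\<lambda>\<tau>. ?\<Phi> \<mu> \<tau> w) = (\<Prod>e\<in>V \<times> V. if \<mu> e = Part3 then exp (- ?c e) else 1)"
          using True by simp
      qed
      also have "\<dots> = (\<Prod>e\<in>V \<times> V. pexp (mark_pmf p) (\<lambda>m. if m = Part3 then exp (- ?c e) else 1))"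
        unfolding marks_pmf_def by (intro expectation_prod_Pi_pmf) (auto simp: integrable_measure_pmf_finite)
      also have "\<dots> \<le> (\<Prod>e\<in>V \<times> V. exp (- (p / 4 * ?c e)))"
      proof (intro prod_mono conjI)
        fix e
        show "0 \<le> pexp (mark_pmf p) (\<lambda>m. if m = Part3 then exp (- ?c e) else 1)" by (intro Bochner_Integration.integral_nonneg) auto
        \<comment> \<open>Since \<open>1 - exp (- 1) \<ge> 1/2\<close>, half of the observation
          probability \<open>p / 2\<close> survives in the exponent.\<close>
        have half: "exp (- 1) \<le> (1/2 :: real)" using exp_ge_add_one_self[of "1::real"] by (simp add: exp_minus field_simps)
        have eq: "pexp (mark_pmf p) (\<lambda>m. if m = Part3 then exp (- ?c e) else 1) = 1 - p / 2 * (1 - exp (- ?c e))"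
          by (subst pexp_mark[OF p4(3) p_le_1]) (simp add: algebra_simps)
        have "p / 4 * ?c e \<le> p / 2 * (1 - exp (- ?c e))"
          using c01[of e] half p_pos by auto
        then show "pexp (mark_pmf p) (\<lambda>m. if m = Part3 then exp (- ?c e) else 1) \<le> exp (- (p / 4 * ?c e))"
          unfolding eq using exp_ge_add_one_self[of "- (p / 4 * ?c e)"] by linarith
      qed
      also have "\<dots> = exp (- (p / 4 * (\<Sum>e\<in>V \<times> V. ?c e)))"
        by (simp add: exp_sum[symmetric] sum_negf sum_distrib_left)
      also have "(\<Sum>e\<in>V \<times> V. ?c e) = close_count \<epsilon> u w * close_count \<epsilon> v w"
        unfolding close_count_def sum_product by (simp add: sum.cartesian_product case_prod_unfold)
      also have "exp (- (p / 4 * \<dots>)) \<le> exp (- (p * q / 4))"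
        using True p_pos by (simp add: mult_left_mono)
      finally show ?thesis .
    qed simp
  qed simp
  moreover have "prob {w \<in> space P. ?Q w \<and> - m < - count3 \<epsilon> u v (mk w) w}
      \<le> exp (- (1 * - m)) * (\<integral>w. (if ?Q w then exp (1 * - count3 \<epsilon> u v (mk w) w) else 0) \<partial>P)"
  proof (rule markov_exp)
    show "(\<lambda>w. - count3 \<epsilon> u v (mk w) w) \<in> borel_measurable P"
      using mk_tr_measurable[of "\<lambda>\<mu> \<tau> w. - count3 \<epsilon> u v \<mu> w"] measurable_info[OF order.refl count3_info[OF u v]] by simp
    show "bdd (\<lambda>w. - count3 \<epsilon> u v (mk w) w)"
      using mk_tr_bdd[of "\<lambda>\<mu> \<tau> w. - count3 \<epsilon> u v \<mu> w"] bc by auto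
    show "{w \<in> space P. ?Q w} \<in> sets P"
      using measurable_info[OF order.refl close_count_info[OF u, of \<epsilon>]] measurable_info[OF order.refl close_count_info[OF v, of \<epsilon>]] by measurable
  qed simp
  ultimately have "prob {w \<in> space P. ?Q w \<and> - m < - count3 \<epsilon> u v (mk w) w} \<le> exp (- (1 * - m)) * exp (- (p * q / 4))"
    using mult_left_mono[of _ "exp (- (p * q / 4))" "exp (- (1 * - m))"] by (simp only: mult_1) (erule order_trans, simp)
  then show ?thesis by (simp add: exp_add[symmetric])
qed

end

section \<open>Eigenfunctions and uniform latent variables\<close>

text \<open>Reconciles the two uniform laws in play: completed Lebesgue measure in the rank
  decomposition and a Borel measure in the model.\<close>

lemma integral_lebesgue_on_unit:
  fixes g :: "real \<Rightarrow> real"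
  assumes [measurable]: "g \<in> borel_measurable borel"
  shows "integral\<^sup>L (lebesgue_on {0..1}) g = integral\<^sup>L (uniform_measure lborel {0..1}) g"
proof -
  have "integral\<^sup>L (lebesgue_on {0..1}) g = (\<integral>x. indicator {0..1} x *\<^sub>R g x \<partial>lebesgue)"
    by (rule integral_restrict_space) simp
  also have "\<dots> = (\<integral>x. indicator {0..1} x *\<^sub>R g x \<partial>lborel)"
    by (rule integral_completion) simp
  also have "\<dots> = integral\<^sup>L (uniform_measure lborel {0..1}) g"
  proof -
    have "uniform_measure lborel {0..1} = density lborel (\<lambda>x. ennreal (indicator {0..1::real} x))"
      unfolding uniform_measure_def by (rule density_cong) (auto simp: indicator_def)
    then have "integral\<^sup>L (uniform_measure lborel {0..1}) g = (\<integral>x. indicator {0..1} x *\<^sub>R g x \<partial>lborel)"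
      by (simp only:) (rule integral_density, auto)
    then show ?thesis ..
  qed
  finally show ?thesis .
qed

text \<open>A retraction of the line onto the unit interval with Lipschitz constant 1. Composing
  with it extends \<open>f\<close> and the \<open>q k\<close> to continuous, hence Borel, functions
  defined everywhere.\<close>

definition clamp01 :: "real \<Rightarrow> real" where "clamp01 x = max 0 (min 1 x)"

lemma clamp01_range: "clamp01 x \<in> {0..1}" by (auto simp: clamp01_def)

lemma clamp01_id: "x \<in> {0..1} \<Longrightarrow> clamp01 x = x" by (auto simp: clamp01_def)

lemma clamp01_lipschitz: "\<bar>clamp01 x - clamp01 y\<bar> \<le> \<bar>x - y\<bar>" by (auto simp: clamp01_def)

text \<open>The eigenfunctions inherit Lipschitz continuity from \<open>f\<close>, being
  \<open>q\<^sub>k(x) = (\<integral> f(x, y) q\<^sub>k(y) dy) / \<lambda>\<^sub>k\<close>. In particular they are Borel measurable on the unit interval.\<close>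

lemma rank_decomposition_lipschitz:
  assumes rd: "rank_decomposition f r lam q" and lip: "L-lipschitz_on ({0..1} \<times> {0..1}) (\<lambda>(x, y). f x y)"
  obtains B K where "1 \<le> B" "0 \<le> K"
    "\<And>k x. k \<in> {1..r} \<Longrightarrow> x \<in> {0..1} \<Longrightarrow> \<bar>q k x\<bar> \<le> B"
    "\<And>k x x'. k \<in> {1..r} \<Longrightarrow> x \<in> {0..1} \<Longrightarrow> x' \<in> {0..1} \<Longrightarrow> \<bar>q k x - q k x'\<bar> \<le> K * \<bar>x - x'\<bar>"
proof -
  let ?M = "lebesgue_on {0..1::real}"
  have r: "1 \<le> r" and f: "\<And>x y. x \<in> {0..1} \<Longrightarrow> y \<in> {0..1} \<Longrightarrow> f x y = (\<Sum>k=1..r. lam k * q k x * q k y)"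
    and lamr: "\<bar>lam r\<bar> > 0" and ord: "\<And>k. k \<in> {1..r} \<Longrightarrow> \<bar>lam r\<bar> \<le> \<bar>lam k\<bar>"
    and m: "\<And>k. k \<in> {1..r} \<Longrightarrow> q k \<in> borel_measurable ?M"
    and orth: "\<And>j k. j \<in> {1..r} \<Longrightarrow> k \<in> {1..r} \<Longrightarrow> integral\<^sup>L ?M (\<lambda>x. q j x * q k x) = (if j = k then 1 else 0)"
    using rd unfolding rank_decomposition_def by auto
  obtain B0 where B0: "\<And>k y. k \<in> {1..r} \<Longrightarrow> y \<in> {0..1} \<Longrightarrow> \<bar>q k y\<bar> \<le> B0"
    using rd unfolding rank_decomposition_def by blast
  define B where "B = max 1 B0"
  have B: "\<bar>q k y\<bar> \<le> B" if "k \<in> {1..r}" "y \<in> {0..1}" for k y using B0[OF that] by (simp add: B_def)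
  have L: "0 \<le> L" using lip by (rule lipschitz_on_nonneg)
  interpret M: finite_measure ?M
    by (rule finite_measureI) (simp add: emeasure_restrict_space space_restrict_space)
  have mM: "measure ?M (space ?M) = 1" by (simp add: measure_restrict_space space_restrict_space)
  have int: "integrable ?M (\<lambda>y. q j y * q k y)" if "j \<in> {1..r}" "k \<in> {1..r}" for j k
  proof (rule M.integrable_const_bound[of _ "B * B"])
    show "AE y in ?M. norm (q j y * q k y) \<le> B * B"
    proof (rule AE_I2)
      fix y assume "y \<in> space ?M"
      then have y: "y \<in> {0..1}" by (simp add: space_restrict_space)
      have "\<bar>q j y\<bar> * \<bar>q k y\<bar> \<le> B * B"
        using B[OF that(1) y] B[OF that(2) y] by (intro mult_mono) (auto simp: B_def)
      then show "norm (q j y * q k y) \<le> B * B" by (simp add: abs_mult)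
    qed
  qed (use m that in auto)
  have lipq: "\<bar>q k x - q k x'\<bar> \<le> L * B / \<bar>lam r\<bar> * \<bar>x - x'\<bar>"
    if k: "k \<in> {1..r}" and x: "x \<in> {0..1}" and x': "x' \<in> {0..1}" for k x x'
  proof -
    \<comment> \<open>On the unit interval this is \<open>(f x y - f x' y) * q k y\<close>. By
      orthonormality its integral isolates the \<open>k\<close>-th coefficient, while the Lipschitz
      bound of \<open>f\<close> controls its size.\<close>
    let ?g = "\<lambda>y. \<Sum>j=1..r. lam j * (q j x - q j x') * (q j y * q k y)"
    have gi: "integrable ?M ?g" using int k by (intro Bochner_Integration.integrable_sum) auto
    have "integral\<^sup>L ?M ?g = (\<Sum>j=1..r. lam j * (q j x - q j x') * (if j = k then 1 else 0))"
      using int k orth by (subst Bochner_Integration.integral_sum) auto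
    also have "\<dots> = lam k * (q k x - q k x')" using k by (simp add: sum.delta if_distrib cong: if_cong)
    finally have eq: "integral\<^sup>L ?M ?g = lam k * (q k x - q k x')" .
    have "\<bar>integral\<^sup>L ?M ?g\<bar> \<le> (\<integral>y. \<bar>?g y\<bar> \<partial>?M)" using integral_norm_bound[of ?M ?g] by simp
    also have "\<dots> \<le> (\<integral>y. L * \<bar>x - x'\<bar> * B \<partial>?M)"
    proof (rule integral_mono)
      show "integrable ?M (\<lambda>y. \<bar>?g y\<bar>)" using gi by simp
      show "integrable ?M (\<lambda>y. L * \<bar>x - x'\<bar> * B)" by (rule M.integrable_const)
      fix y assume "y \<in> space ?M"
      then have y: "y \<in> {0..1}" by (simp add: space_restrict_space)
      have "f x y - f x' y = (\<Sum>j=1..r. lam j * (q j x - q j x') * q j y)"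
        unfolding f[OF x y] f[OF x' y] sum_subtractf[symmetric] by (rule sum.cong[OF refl]) (simp add: algebra_simps)
      then have "?g y = (f x y - f x' y) * q k y"
        by (simp only: sum_distrib_right) (rule sum.cong[OF refl], simp add: mult_ac)
      moreover have "\<bar>f x y - f x' y\<bar> \<le> L * \<bar>x - x'\<bar>"
        using lipschitz_onD[OF lip, of "(x, y)" "(x', y)"] x x' y by (simp add: dist_Pair_Pair dist_real_def)
      ultimately show "\<bar>?g y\<bar> \<le> L * \<bar>x - x'\<bar> * B"
        using B[OF k y] L by (simp add: abs_mult mult_mono)
    qed
    also have "\<dots> = L * \<bar>x - x'\<bar> * B" using mM by simp
    finally have *: "\<bar>lam k\<bar> * \<bar>q k x - q k x'\<bar> \<le> L * \<bar>x - x'\<bar> * B" unfolding eq by (simp add: abs_mult)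
    have "\<bar>lam r\<bar> * \<bar>q k x - q k x'\<bar> \<le> L * \<bar>x - x'\<bar> * B"
      using mult_right_mono[OF ord[OF k], of "\<bar>q k x - q k x'\<bar>"] * by linarith
    then show ?thesis using lamr by (simp add: field_simps)
  qed
  have "0 \<le> L * B / \<bar>lam r\<bar>" "1 \<le> B" using L by (auto simp: B_def intro!: divide_nonneg_nonneg mult_nonneg_nonneg)
  with B lipq that show thesis by blast
qed

context sample_model
begin

lemma theta_expectation:
  fixes g :: "real \<Rightarrow> real"
  assumes g: "g \<in> borel_measurable borel" and i: "i \<in> V"
  shows "expectation (\<lambda>w. g (\<theta> i w)) = integral\<^sup>L (lebesgue_on {0..1}) g"
proof -
  have "expectation (\<lambda>w. g (\<theta> i w)) = integral\<^sup>L (distr P borel (\<theta> i)) g"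
    by (rule integral_distr[symmetric]) (use theta_measurable[OF i] g in auto)
  then show ?thesis using theta_uniform[OF i] integral_lebesgue_on_unit[OF g] by simp
qed

lemma theta_hoeffding:
  fixes g :: "real \<Rightarrow> real" and c \<epsilon> :: real
  assumes g: "g \<in> borel_measurable borel" "\<And>x. x \<in> {0..1} \<Longrightarrow> \<bar>g x\<bar> \<le> c" and c: "0 < c" and \<epsilon>: "0 \<le> \<epsilon>"
  shows "prob {w \<in> space P. \<epsilon> \<le> \<bar>(\<Sum>i\<in>V. g (\<theta> i w)) - n * integral\<^sup>L (lebesgue_on {0..1}) g\<bar>} \<le> 2 * exp (- \<epsilon>\<^sup>2 / (2 * real n * c\<^sup>2))"
proof -
  interpret H: Hoeffding_ineq P V "\<lambda>i w. g (\<theta> i w)" "\<lambda>_. - c" "\<lambda>_. c" "\<Sum>i\<in>V. expectation (\<lambda>w. g (\<theta> i w))"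
  proof unfold_locales
    show "indep_vars (\<lambda>_. borel) (\<lambda>i w. g (\<theta> i w)) V"
      using indep_vars_compose2[OF theta_indep, of "\<lambda>_. g" "\<lambda>_. borel"] g(1) by simp
    fix i assume i: "i \<in> V"
    show "AE w in P. g (\<theta> i w) \<in> {- c..c}"
    proof (rule AE_I2)
      fix w assume "w \<in> space P"
      from g(2)[OF theta_range[OF i this]] have "- c \<le> g (\<theta> i w)" "g (\<theta> i w) \<le> c" by linarith+
      then show "g (\<theta> i w) \<in> {- c..c}" by simp
    qed
  qed auto
  have mu: "(\<Sum>i\<in>V. expectation (\<lambda>w. g (\<theta> i w))) = n * integral\<^sup>L (lebesgue_on {0..1}) g"
    using theta_expectation[OF g(1)] by simp
  have s: "(\<Sum>i\<in>V. (c - - c)\<^sup>2) = 4 * n * c\<^sup>2" by (simp add: power2_eq_square)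
  have "prob {w \<in> space P. \<epsilon> \<le> \<bar>(\<Sum>i\<in>V. g (\<theta> i w)) - n * integral\<^sup>L (lebesgue_on {0..1}) g\<bar>}
      \<le> 2 * exp (- 2 * \<epsilon>\<^sup>2 / (\<Sum>i\<in>V. (c - - c)\<^sup>2))"
    using H.Hoeffding_ineq_abs_ge[OF \<epsilon>] c n_pos unfolding mu s by simp
  also have "- 2 * \<epsilon>\<^sup>2 / (\<Sum>i\<in>V. (c - - c)\<^sup>2) = - \<epsilon>\<^sup>2 / (2 * real n * c\<^sup>2)"
    unfolding s using c n_pos by (simp add: field_simps)
  finally show ?thesis .
qed

text \<open>Two points of one cell of the grid of width \<open>1/k\<close> are close, and every cell is well populated.\<close>

lemma grid_count:
  assumes k: "0 < k"
  shows "prob {w \<in> space P. \<exists>j<k. (\<Sum>i\<in>V. indicator {real j / k..(real j + 1) / k} (\<theta> i w)) \<le> real n / real (2 * k)}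
    \<le> k * (2 * exp (- (n / (8 * (real k)\<^sup>2))))"
proof -
  let ?g = "\<lambda>j x. indicator {real j / k..(real j + 1) / k} x :: real"
  have gm: "?g j \<in> borel_measurable borel" for j by simp
  have int: "integral\<^sup>L (lebesgue_on {0..1}) (?g j) = 1 / k" if "j < k" for j
  proof -
    have "real j + 1 \<le> real k" using that by linarith
    then have "(real j + 1) / k \<le> 1" using k by simp
    moreover have "0 \<le> real j / k" by simp
    ultimately have sub: "{real j / k..(real j + 1) / k} \<subseteq> {0..1}"
    proof (intro subsetI)
      fix x assume "(real j + 1) / k \<le> 1" "0 \<le> real j / k" "x \<in> {real j / k..(real j + 1) / k}"
      then have "0 \<le> x" "x \<le> 1" unfolding atLeastAtMost_iff by linarith+
      then show "x \<in> {0..1}" by simp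
    qed
    have "integral\<^sup>L (lebesgue_on {0..1}) (?g j) = measure (lebesgue_on {0..1}) ({real j / k..(real j + 1) / k} \<inter> space (lebesgue_on {0..1}))"
      by simp
    also have "\<dots> = measure lebesgue {real j / k..(real j + 1) / k}"
    proof -
      have "space (lebesgue_on {0..1::real}) = {0..1}" by (simp add: space_restrict_space)
      moreover have "{real j / k..(real j + 1) / k} \<inter> {0..1} = {real j / k..(real j + 1) / k}"
        by (rule Int_absorb2[OF sub])
      moreover have "measure (lebesgue_on {0..1}) {real j / k..(real j + 1) / k} = measure lebesgue {real j / k..(real j + 1) / k}"
        by (rule measure_restrict_space[OF _ sub]) simp
      ultimately show ?thesis by (simp only:)
    qed
    also have "\<dots> = (real j + 1) / k - real j / k"
      using k by (simp add: divide_right_mono)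
    also have "\<dots> = 1 / k" by (simp add: diff_divide_distrib[symmetric])
    finally show ?thesis .
  qed
  have gP: "(\<lambda>w. \<Sum>i\<in>V. ?g j (\<theta> i w)) \<in> borel_measurable P" for j
    using theta_measurable by (intro borel_measurable_sum) (measurable, auto)
  have ev: "{w \<in> space P. (\<Sum>i\<in>V. ?g j (\<theta> i w)) \<le> c} \<in> sets P" for j c
    using gP[of j] by measurable
  have one: "prob {w \<in> space P. (\<Sum>i\<in>V. ?g j (\<theta> i w)) \<le> real n / real (2 * k)} \<le> 2 * exp (- (n / (8 * (real k)\<^sup>2)))" if j: "j < k" for j
  proof -
    \<comment> \<open>A cell has mean occupation \<open>n / k\<close>, so falling to half of it is a
      deviation of \<open>n / (2 * k)\<close>.\<close>
    have "prob {w \<in> space P. (\<Sum>i\<in>V. ?g j (\<theta> i w)) \<le> real n / real (2 * k)} \<le>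
      prob {w \<in> space P. real n / real (2 * k) \<le> \<bar>(\<Sum>i\<in>V. ?g j (\<theta> i w)) - n * integral\<^sup>L (lebesgue_on {0..1}) (?g j)\<bar>}"
    proof (rule finite_measure_mono)
      have "real n / real (2 * k) = n * (1 / k) - real n / real (2 * k)" using k by (simp add: field_simps)
      then show "{w \<in> space P. (\<Sum>i\<in>V. ?g j (\<theta> i w)) \<le> real n / real (2 * k)} \<subseteq>
          {w \<in> space P. real n / real (2 * k) \<le> \<bar>(\<Sum>i\<in>V. ?g j (\<theta> i w)) - n * integral\<^sup>L (lebesgue_on {0..1}) (?g j)\<bar>}"
        unfolding int[OF j] by auto
      show "{w \<in> space P. real n / real (2 * k) \<le> \<bar>(\<Sum>i\<in>V. ?g j (\<theta> i w)) - n * integral\<^sup>L (lebesgue_on {0..1}) (?g j)\<bar>} \<in> sets P"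
        using gP[of j] by measurable
    qed
    also have "\<dots> \<le> 2 * exp (- (real n / real (2 * k))\<^sup>2 / (2 * real n * 1\<^sup>2))"
      by (rule theta_hoeffding[of "?g j" 1 "real n / real (2 * k)"]) (auto simp: indicator_def)
    also have "- (real n / real (2 * k))\<^sup>2 / (2 * real n * 1\<^sup>2) = - (n / (8 * (real k)\<^sup>2))"
      using n_pos k by (simp add: power2_eq_square field_simps)
    finally show ?thesis .
  qed
  let ?B = "\<lambda>j. {w \<in> space P. (\<Sum>i\<in>V. ?g j (\<theta> i w)) \<le> real n / real (2 * k)}"
  have "{w \<in> space P. \<exists>j<k. (\<Sum>i\<in>V. ?g j (\<theta> i w)) \<le> real n / real (2 * k)} = (\<Union>j\<in>{..<k}. ?B j)"
    by blast
  moreover have "prob (\<Union>j\<in>{..<k}. ?B j) \<le> (\<Sum>j\<in>{..<k}. prob (?B j))"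
    by (rule measure_UNION_le[OF finite_lessThan ev])
  moreover have "(\<Sum>j\<in>{..<k}. prob (?B j)) \<le> (\<Sum>j\<in>{..<k}. 2 * exp (- (n / (8 * (real k)\<^sup>2))))"
    by (rule sum_mono, rule one) (simp only: lessThan_iff)
  moreover have "(\<Sum>j\<in>{..<k}. 2 * exp (- (n / (8 * (real k)\<^sup>2)))) = k * (2 * exp (- (n / (8 * (real k)\<^sup>2))))"
    by (simp only: sum_constant card_lessThan)
  ultimately show ?thesis by (simp only:)
qed

end

section \<open>Deterministic error analysis at a good outcome\<close>

locale rank_model = sample_model P n f p \<theta> Z mrk T f'
  for P :: "'w measure" and n :: nat and f :: "real \<Rightarrow> real \<Rightarrow> real" and p :: real
    and \<theta> :: "nat \<Rightarrow> 'w \<Rightarrow> real" and Z :: "nat \<times> nat \<Rightarrow> 'w \<Rightarrow> real"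
    and mrk :: "nat \<times> nat \<Rightarrow> 'w \<Rightarrow> mark" and T :: "nat \<Rightarrow> 'w \<Rightarrow> (nat \<times> nat) set"
    and f' :: "real \<times> real \<Rightarrow> real" +
  fixes r :: nat and lam :: "nat \<Rightarrow> real" and q :: "nat \<Rightarrow> real \<Rightarrow> real" and B K \<Lambda> l :: real
  assumes f_rank: "x \<in> {0..1} \<Longrightarrow> y \<in> {0..1} \<Longrightarrow> f x y = (\<Sum>k=1..r. lam k * q k x * q k y)"
    and q_bound: "k \<in> {1..r} \<Longrightarrow> x \<in> {0..1} \<Longrightarrow> \<bar>q k x\<bar> \<le> B"
    and q_lip: "k \<in> {1..r} \<Longrightarrow> x \<in> {0..1} \<Longrightarrow> y \<in> {0..1} \<Longrightarrow> \<bar>q k x - q k y\<bar> \<le> K * \<bar>x - y\<bar>"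
    and B1: "1 \<le> B" and K0: "0 \<le> K"
    and q_orth: "j \<in> {1..r} \<Longrightarrow> k \<in> {1..r} \<Longrightarrow>
      integral\<^sup>L (lebesgue_on {0..1}) (\<lambda>x. q j x * q k x) = (if j = k then 1 else 0)"
    and lam_le: "k \<in> {1..r} \<Longrightarrow> \<bar>lam k\<bar> \<le> \<Lambda>" and L1: "1 \<le> \<Lambda>"
    and lam_ge: "k \<in> {1..r} \<Longrightarrow> l \<le> \<bar>lam k\<bar>" and l0: "0 < l"
begin

definition qq :: "nat \<Rightarrow> nat \<Rightarrow> 'w \<Rightarrow> real" where
  "qq k i w = (if i \<in> V then q k (\<theta> i w) else 0)"

lemma qq_bound: "k \<in> {1..r} \<Longrightarrow> w \<in> space P \<Longrightarrow> \<bar>qq k i w\<bar> \<le> B"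
  using q_bound[of k "\<theta> i w"] theta_range[of i w] B1 by (auto simp: qq_def simp del: atLeastAtMost_iff)

lemma ff_eq: "w \<in> space P \<Longrightarrow> a \<in> V \<Longrightarrow> b \<in> V \<Longrightarrow> ff w a b = (\<Sum>k=1..r. lam k * qq k a w * qq k b w)"
  using f_rank[OF theta_range theta_range] by (simp add: ff_def mean_def qq_def)

text \<open>Error constants per unit of \<open>\<epsilon>\<close>: \<open>C2\<close> for one level,
  \<open>C3\<close> accumulated over \<open>t + 1\<close> levels, \<open>C4\<close> for the form
  given by \<open>F\<close> between two levels, \<open>C5\<close> for the distance estimate, which
  combines four forms. \<open>C6\<close> converts a distance threshold into an error of the mean.
  None of them involves \<open>n\<close>.\<close>

definition C2 :: real where "C2 = 2 * ((1 + real r * \<Lambda> * B * B + B) + 2 * \<Lambda> * B)"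
definition C3 :: "nat \<Rightarrow> real" where "C3 t = C2 * (t + 1) * \<Lambda> ^ (t + 1)"
definition C4 :: "nat \<Rightarrow> real" where "C4 t = r * \<Lambda> * (C3 t * B + \<Lambda> ^ t * B * C3 t)"
definition C5 :: "nat \<Rightarrow> real" where "C5 t = 4 * (2 + C4 t)"
definition C6 :: "nat \<Rightarrow> real" where "C6 t = r * \<Lambda> * B * 2 * (2 / l ^ (t + 1))"

end

text \<open>All randomness is condensed into assumptions about one outcome \<open>w\<close>; what
  follows from them is deterministic. \<open>D\<close> is the expected out-degree in the first
  sample and \<open>\<zeta> s\<close> the noise allowed at level \<open>s\<close>. Size and level
  bounds are assumed only where level \<open>s\<close> has at most \<open>(2 * D) ^ s\<close>
  vertices, as the truncated tail bounds provide them.\<close>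

locale good_sample = rank_model P n f p \<theta> Z mrk T f' r lam q B K \<Lambda> l
  for P :: "'w measure" and n f p \<theta> Z mrk T f' r lam q B K \<Lambda> l +
  fixes w :: 'w and t :: nat and D \<epsilon> \<eta> x0 m0 :: real and \<zeta> :: "nat \<Rightarrow> real" and kk :: nat
  assumes w: "w \<in> space P"
    and tree0: "u \<in> V \<Longrightarrow> tr w u \<in> bfs_trees (edges1 n (mk w)) u"
    and D: "D = n * p / 4" "0 < D"
    and eps: "0 \<le> \<epsilon>" "\<epsilon> \<le> 1/4"
    and sizes: "u \<in> V \<Longrightarrow> s \<le> t \<Longrightarrow> real (card (sphere_at (edges1 n (mk w)) u s)) \<le> (2 * D) ^ s \<Longrightarrow>
      \<bar>size_dev u s (edges1 n (mk w))\<bar> \<le> \<zeta> s"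
    and levels: "u \<in> V \<Longrightarrow> s \<le> t \<Longrightarrow> k \<in> {1..r} \<Longrightarrow> real (card (sphere_at (edges1 n (mk w)) u s)) \<le> (2 * D) ^ s \<Longrightarrow>
      \<bar>level_dev u s (qq k) (edges1 n (mk w)) (tr w u) w\<bar> \<le> \<zeta> s"
    and orth: "j \<in> {1..r} \<Longrightarrow> k \<in> {1..r} \<Longrightarrow>
      \<bar>(\<Sum>i\<in>V. q j (\<theta> i w) * q k (\<theta> i w)) - real n * (if j = k then 1 else 0)\<bar> \<le> \<epsilon> * n"
    and bil: "u \<in> V \<Longrightarrow> v \<in> V \<Longrightarrow> (D / 4) ^ t * (D / 4) ^ (t + 1) \<le>
        real (card (sphere_at (edges1 n (mk w)) u t) * card (sphere_at (edges1 n (mk w)) v (t + 1))) \<Longrightarrow>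
      \<bar>bil_dev u t v (t + 1) (mk w) (tr w) w\<bar> \<le> \<epsilon>"
    and near: "u \<in> V \<Longrightarrow> v \<in> V \<Longrightarrow> m0 \<le> near_count t \<eta> u v (mk w) (tr w) w \<Longrightarrow>
      \<bar>near_dev t \<eta> u v (mk w) (tr w) w\<bar> \<le> x0 * near_count t \<eta> u v (mk w) (tr w) w"
    and count: "u \<in> V \<Longrightarrow> v \<in> V \<Longrightarrow> (real n / real (2 * kk))\<^sup>2 \<le> close_count (1 / kk) u w * close_count (1 / kk) v w \<Longrightarrow>
      m0 \<le> count3 (1 / kk) u v (mk w) w"
    and grid: "j < kk \<Longrightarrow> real n / real (2 * kk) \<le> (\<Sum>i\<in>V. indicator {real j / kk..(real j + 1) / kk} (\<theta> i w))"
    and zeta_le: "s \<le> t \<Longrightarrow> \<zeta> s \<le> \<epsilon> * ((D / 4) ^ s * D / 2)"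
    and hi_p: "s \<le> t \<Longrightarrow> (2 * D) ^ s * (p / 4) \<le> 1"
    and ball_le: "(\<Sum>j\<le>t. (2 * D) ^ j) \<le> \<epsilon> * n"
    and deg_le: "(2 * D + 1) / (D / 4) ^ (t + 1) \<le> \<epsilon>"
    and eta: "0 < \<eta>" "\<epsilon> * C5 t \<le> \<eta> / 2"
    and kk: "0 < kk" "r * \<Lambda> ^ (2 * t + 2) * K\<^sup>2 / (real kk)\<^sup>2 \<le> \<eta> / 4"
    and m0: "0 < m0"
begin

abbreviation "E \<equiv> edges1 n (mk w)"
abbreviation "S u s \<equiv> sphere_at E u s"
abbreviation "N u s a \<equiv> Nn E (tr w u) u s a w"

definition y :: "nat \<Rightarrow> nat \<Rightarrow> nat \<Rightarrow> real" where
  "y k u s = (\<Sum>a\<in>V. qq k a w * N u s a)"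

lemma SV: "u \<in> V \<Longrightarrow> S u s \<subseteq> V" by (rule sphere_at_subset[OF edges1_subset])

lemma finS: "u \<in> V \<Longrightarrow> finite (S u s)" by (rule finite_subset[OF SV]) auto

lemma N_nonneg: "0 \<le> N u s a" by (rule Nn_nonneg[OF w])

lemma N_sum: "u \<in> V \<Longrightarrow> (\<Sum>a\<in>V. N u s a) \<le> 1" by (rule Nn_sum_le[OF w _ SV]) auto

text \<open>The normalized vector is nonnegative and has total mass at most 1.\<close>

lemma weighted_bound:
  assumes u: "u \<in> V" and g: "\<And>a. a \<in> V \<Longrightarrow> \<bar>g a\<bar> \<le> c" and c: "0 \<le> c"
  shows "\<bar>\<Sum>a\<in>V. g a * N u s a\<bar> \<le> c"
proof -
  have "\<bar>\<Sum>a\<in>V. g a * N u s a\<bar> \<le> (\<Sum>a\<in>V. \<bar>g a * N u s a\<bar>)" by (rule sum_abs)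
  also have "\<dots> \<le> (\<Sum>a\<in>V. c * N u s a)"
    by (rule sum_mono) (use g N_nonneg in \<open>simp add: abs_mult mult_right_mono\<close>)
  also have "\<dots> = c * (\<Sum>a\<in>V. N u s a)" by (simp add: sum_distrib_left)
  also have "\<dots> \<le> c * 1" using N_sum[OF u] c by (intro mult_left_mono) auto
  finally show ?thesis by simp
qed

lemma y_bound: "u \<in> V \<Longrightarrow> k \<in> {1..r} \<Longrightarrow> \<bar>y k u s\<bar> \<le> B"
  unfolding y_def using B1 by (intro weighted_bound qq_bound w) auto

lemma N_outside: "a \<notin> S u s \<Longrightarrow> N u s a = 0" by (simp add: Nn_def nv_outside)

lemma sum_S: "u \<in> V \<Longrightarrow> (\<Sum>a\<in>S u s. g a * N u s a) = (\<Sum>a\<in>V. g a * N u s a)"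
  by (rule sum.mono_neutral_left) (use SV N_outside in auto)

lemma level_mean:
  assumes u: "u \<in> V" and i: "i \<in> V"
  shows "(\<Sum>a\<in>S u s. nv E (tr w u) u s a w * ff w a i) / card (S u s) = (\<Sum>k=1..r. lam k * y k u s * qq k i w)"
proof -
  have "(\<Sum>a\<in>S u s. nv E (tr w u) u s a w * ff w a i) / card (S u s) = (\<Sum>a\<in>S u s. ff w a i * N u s a)"
    unfolding Nn_def sum_divide_distrib by (simp add: mult.commute)
  also have "\<dots> = (\<Sum>a\<in>V. ff w a i * N u s a)" by (rule sum_S[OF u])
  also have "\<dots> = (\<Sum>a\<in>V. \<Sum>k=1..r. lam k * qq k i w * (qq k a w * N u s a))"
    by (rule sum.cong[OF refl]) (simp add: ff_eq[OF w _ i] sum_distrib_left mult_ac)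
  also have "\<dots> = (\<Sum>k=1..r. lam k * y k u s * qq k i w)"
    by (subst sum.swap) (simp add: y_def sum_distrib_left mult_ac)
  finally show ?thesis .
qed

lemma C2_nonneg: "0 \<le> C2" unfolding C2_def using B1 L1 by (intro mult_nonneg_nonneg add_nonneg_nonneg) auto

text \<open>The next level has about \<open>M = hit_prob * n\<close> vertices, and its expected
  vector is \<open>F\<close> applied to the current one, which multiplies the \<open>k\<close>-th
  coordinate by \<open>lam k\<close>. The errors are of order \<open>\<epsilon> * M\<close>:
  martingale noise, the vertices of the ball that are already used, and the defect in empirical
  orthogonality of the eigenfunctions.\<close>

lemma level_step:
  assumes u: "u \<in> V" and s: "s \<le> t" and c: "(D / 4) ^ s \<le> card (S u s)" "card (S u s) \<le> (2 * D) ^ s"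
    and ball: "real (card (ball E u s)) \<le> (\<Sum>j\<le>s. (2 * D) ^ j)"
  shows "(D / 4) ^ Suc s \<le> card (S u (Suc s))" "card (S u (Suc s)) \<le> (2 * D) ^ Suc s"
    "k \<in> {1..r} \<Longrightarrow> \<bar>y k u (Suc s) - lam k * y k u s\<bar> \<le> \<epsilon> * C2"
proof -
  let ?\<phi> = "hit_prob E u s" and ?c = "real (card (S u s))" and ?c' = "real (card (S u (Suc s)))"
  have cpos: "0 < ?c" using c(1) zero_less_power[of "D / 4" s] D(2) by linarith
  have cw: "?c * (p / 4) \<le> 1" using hi_p[OF s] c(2) p_pos by (meson mult_right_mono order_trans p4(1))
  have phi_up: "?\<phi> \<le> ?c * (p / 4)"
  proof -
    have "1 + ?c * (- (p / 4)) \<le> (1 + - (p / 4)) ^ card (S u s)" by (rule Bernoulli_inequality) (use p4 in auto)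
    then show ?thesis by (simp add: hit_prob_def)
  qed
  \<comment> \<open>For \<open>0 \<le> x \<le> 1\<close> one has
    \<open>x / 2 \<le> 1 - exp (- x)\<close>. The upper bound on \<open>x\<close> is
    \<open>cw\<close>; it is where the sparsity of the levels is used.\<close>
  have phi_lo: "?c * (p / 4) / 2 \<le> ?\<phi>"
  proof -
    let ?x = "?c * (p / 4)"
    have x0: "0 \<le> ?x" using p4 by simp
    have "(1 - p / 4) ^ card (S u s) \<le> exp (- (p / 4)) ^ card (S u s)"
      using p4 exp_ge_add_one_self[of "- (p / 4)"] by (intro power_mono) auto
    also have "\<dots> = exp (- ?x)" by (simp add: exp_of_nat_mult[symmetric])
    also have "\<dots> \<le> 1 - ?x / 2"
    proof -
      have "1 + ?x \<le> exp ?x" by (rule exp_ge_add_one_self)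
      then have "exp (- ?x) \<le> 1 / (1 + ?x)" using x0 by (simp add: exp_minus field_simps)
      also have "\<dots> \<le> 1 - ?x / 2" using x0 cw mult_left_mono[OF cw x0] by (simp add: field_simps)
      finally show ?thesis .
    qed
    finally show ?thesis by (simp add: hit_prob_def)
  qed
  define M where "M = ?\<phi> * n"
  have np: "n * (p / 4) = D" using D by simp
  have M_up: "M \<le> ?c * D" using mult_right_mono[OF phi_up, of "real n"] by (simp add: M_def np[symmetric] mult_ac)
  have M_lo: "?c * D / 2 \<le> M" using mult_right_mono[OF phi_lo, of "real n"] by (simp add: M_def np[symmetric] mult_ac)
  have Mpos: "0 < M" using M_lo cpos D by (meson half_gt_zero less_le_trans mult_pos_pos)
  have phi0: "0 \<le> ?\<phi>" using phi_lo p4 by (meson divide_nonneg_nonneg mult_nonneg_nonneg of_nat_0_le_iff order_trans zero_le_numeral)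
  have zM: "\<zeta> s \<le> \<epsilon> * M"
  proof -
    have "(D / 4) ^ s * D / 2 \<le> ?c * D / 2" using c(1) D(2) by (simp add: mult_right_mono)
    then have "\<epsilon> * ((D / 4) ^ s * D / 2) \<le> \<epsilon> * M" using M_lo eps by (intro mult_left_mono) auto
    then show ?thesis using zeta_le[OF s] by linarith
  qed
  have ball_n: "real (card (ball E u s)) \<le> \<epsilon> * n"
  proof -
    have "(\<Sum>j\<le>s. (2 * D) ^ j) \<le> (\<Sum>j\<le>t. (2 * D) ^ j)" using s D(2) by (intro sum_mono2) auto
    then show ?thesis using ball ball_le by linarith
  qed
  have ballV: "ball E u s \<subseteq> V" unfolding ball_def using SV[OF u] by auto
  have finb: "finite (ball E u s)" using finite_subset[OF ballV] by simp
  have phib: "?\<phi> * card (ball E u s) \<le> \<epsilon> * M"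
    using mult_left_mono[OF ball_n phi0] by (simp add: M_def mult_ac)
  have cardU: "real (card (V - ball E u s)) = real n - real (card (ball E u s))"
    using card_Diff_subset[OF finb ballV] card_mono[OF _ ballV] by (simp add: of_nat_diff)
  have sz: "\<bar>?c' - M\<bar> \<le> 2 * \<epsilon> * M"
  proof -
    have "?c' - M = size_dev u s E - ?\<phi> * card (ball E u s)"
      unfolding size_dev_def cardU M_def by (simp add: algebra_simps)
    moreover have "\<bar>size_dev u s E\<bar> \<le> \<epsilon> * M" using sizes[OF u s c(2)] zM by linarith
    moreover have "0 \<le> ?\<phi> * card (ball E u s)" using phi0 by simp
    ultimately show ?thesis using phib by linarith
  qed
  \<comment> \<open>With \<open>\<epsilon> \<le> 1/4\<close> the new size lies between
    \<open>M / 2\<close> and \<open>3 / 2 * M\<close>. Together with the two bounds on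
    \<open>hit_prob\<close> this is the origin of the growth factors \<open>D / 4\<close> and
    \<open>2 * D\<close>.\<close>
  have eM: "2 * \<epsilon> * M \<le> M / 2" using eps Mpos mult_right_mono[of "2 * \<epsilon>" "1/2" M] by simp
  have c'lo: "M / 2 \<le> ?c'" and c'up: "?c' \<le> 3 / 2 * M" using sz eM by linarith+
  show "(D / 4) ^ Suc s \<le> card (S u (Suc s))"
  proof -
    have "(D / 4) ^ Suc s \<le> D / 4 * ?c" using c(1) D(2) by (simp add: mult_left_mono)
    also have "\<dots> \<le> M / 2" using M_lo by (simp add: field_simps)
    finally show ?thesis using c'lo by linarith
  qed
  show "card (S u (Suc s)) \<le> (2 * D) ^ Suc s"
  proof -
    have cD: "0 \<le> ?c * D" using cpos D(2) by simp
    have "?c' \<le> 2 * (?c * D)" using c'up M_up cD by linarith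
    also have "\<dots> \<le> 2 * ((2 * D) ^ s * D)" using c(2) D(2) by (intro mult_left_mono mult_right_mono) auto
    finally show ?thesis by (simp add: mult_ac)
  qed
  assume k: "k \<in> {1..r}"
  let ?m = "\<lambda>i. \<Sum>j=1..r. lam j * y j u s * qq j i w"
  have X: "(\<Sum>i\<in>S u (Suc s). qq k i w * nv E (tr w u) u (Suc s) i w) = ?c' * y k u (Suc s)"
  proof -
    have c'0: "?c' \<noteq> 0" using c'lo Mpos by linarith
    have "(\<Sum>i\<in>S u (Suc s). qq k i w * nv E (tr w u) u (Suc s) i w) = ?c' * (\<Sum>i\<in>S u (Suc s). qq k i w * N u (Suc s) i)"
      unfolding sum_distrib_left using c'0 by (intro sum.cong refl) (simp add: Nn_def)
    then show ?thesis unfolding y_def sum_S[OF u] .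
  qed
  have m_le: "\<bar>?m i\<bar> \<le> 1" if i: "i \<in> V" for i
  proof -
    have "?m i = (\<Sum>a\<in>S u s. nv E (tr w u) u s a w * ff w a i) / card (S u s)" by (rule level_mean[OF u i, symmetric])
    also have "\<dots> = (\<Sum>a\<in>S u s. ff w a i * N u s a)"
      unfolding Nn_def sum_divide_distrib by (simp add: mult.commute)
    also have "\<dots> = (\<Sum>a\<in>V. ff w a i * N u s a)" by (rule sum_S[OF u])
    finally have "?m i = (\<Sum>a\<in>V. ff w a i * N u s a)" .
    moreover have "\<bar>\<Sum>a\<in>V. ff w a i * N u s a\<bar> \<le> 1"
      by (rule weighted_bound[OF u]) (use ff_unit[OF w] in auto)
    ultimately show ?thesis by simp
  qed
  have lev: "level_dev u s (qq k) E (tr w u) w = ?c' * y k u (Suc s) - (\<Sum>i\<in>V - ball E u s. qq k i w * (?\<phi> * ?m i))"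
    unfolding level_dev_def X using level_mean[OF u] by (intro arg_cong2[where f = "(-)"] refl sum.cong) auto
  have split: "(\<Sum>i\<in>V - ball E u s. qq k i w * (?\<phi> * ?m i)) = ?\<phi> * ((\<Sum>i\<in>V. qq k i w * ?m i) - (\<Sum>i\<in>ball E u s. qq k i w * ?m i))"
    by (subst sum_diff[OF _ ballV, symmetric], simp) (simp add: sum_distrib_left mult_ac)
  have b1: "\<bar>\<Sum>i\<in>ball E u s. qq k i w * ?m i\<bar> \<le> B * card (ball E u s)"
  proof -
    have "\<bar>\<Sum>i\<in>ball E u s. qq k i w * ?m i\<bar> \<le> (\<Sum>i\<in>ball E u s. B)"
    proof (rule order_trans[OF sum_abs sum_mono])
      fix i assume "i \<in> ball E u s"
      then have "i \<in> V" using ballV by blast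
      have "\<bar>qq k i w\<bar> * \<bar>?m i\<bar> \<le> B * 1" using B1 by (intro mult_mono qq_bound[OF k w] m_le[OF \<open>i \<in> V\<close>]) auto
      then show "\<bar>qq k i w * ?m i\<bar> \<le> B" by (simp only: abs_mult mult_1_right)
    qed
    then show ?thesis by (simp add: mult.commute)
  qed
  have e1: "\<bar>(\<Sum>i\<in>V. qq k i w * ?m i) - n * (lam k * y k u s)\<bar> \<le> r * \<Lambda> * B * (\<epsilon> * n)"
  proof -
    have "(\<Sum>i\<in>V. qq k i w * ?m i) = (\<Sum>j=1..r. lam j * y j u s * (\<Sum>i\<in>V. q j (\<theta> i w) * q k (\<theta> i w)))"
      unfolding sum_distrib_left by (subst sum.swap) (auto intro!: sum.cong simp: qq_def mult_ac)
    moreover have "n * (lam k * y k u s) = (\<Sum>j=1..r. lam j * y j u s * (real n * (if j = k then 1 else 0)))"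
    proof -
      have "(\<Sum>j=1..r. lam j * y j u s * (real n * (if j = k then 1 else 0))) = (\<Sum>j=1..r. if j = k then n * (lam j * y j u s) else 0)"
        by (rule sum.cong) auto
      then show ?thesis using k by (simp add: sum.delta)
    qed
    ultimately have "(\<Sum>i\<in>V. qq k i w * ?m i) - n * (lam k * y k u s) =
        (\<Sum>j=1..r. lam j * y j u s * ((\<Sum>i\<in>V. q j (\<theta> i w) * q k (\<theta> i w)) - real n * (if j = k then 1 else 0)))"
      by (simp only: right_diff_distrib sum_subtractf)
    also have "\<bar>\<dots>\<bar> \<le> (\<Sum>j=1..r. \<Lambda> * B * (\<epsilon> * n))"
    proof (rule order_trans[OF sum_abs sum_mono])
      fix j assume j: "j \<in> {1..r}"
      have "\<bar>lam j\<bar> * \<bar>y j u s\<bar> \<le> \<Lambda> * B" using L1 by (intro mult_mono lam_le[OF j] y_bound[OF u j]) auto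
      note ly = this
      have "\<bar>lam j\<bar> * \<bar>y j u s\<bar> * \<bar>(\<Sum>i\<in>V. q j (\<theta> i w) * q k (\<theta> i w)) - real n * (if j = k then 1 else 0)\<bar> \<le> \<Lambda> * B * (\<epsilon> * n)"
        by (rule mult_mono[OF ly orth[OF j k]]) (use L1 B1 in auto)
      then show "\<bar>lam j * y j u s * ((\<Sum>i\<in>V. q j (\<theta> i w) * q k (\<theta> i w)) - real n * (if j = k then 1 else 0))\<bar> \<le> \<Lambda> * B * (\<epsilon> * n)"
        by (simp only: abs_mult)
    qed
    finally show ?thesis by (simp add: mult.assoc)
  qed
  \<comment> \<open>\<open>lv\<close> is the noise, \<open>sb\<close> the orthogonality defect, and
    \<open>sc\<close> the part of the mean lost to the ball.\<close>
  define lv where "lv = level_dev u s (qq k) E (tr w u) w"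
  define sb where "sb = (\<Sum>i\<in>V. qq k i w * ?m i) - n * (lam k * y k u s)"
  define sc where "sc = (\<Sum>i\<in>ball E u s. qq k i w * ?m i)"
  have main: "\<bar>?c' * y k u (Suc s) - M * (lam k * y k u s)\<bar> \<le> (1 + r * \<Lambda> * B + B) * (\<epsilon> * M)"
  proof -
    have "?c' * y k u (Suc s) - M * (lam k * y k u s) = lv + ?\<phi> * sb - ?\<phi> * sc"
      unfolding lv_def lev split M_def sb_def sc_def by (simp only: right_diff_distrib mult_ac)
    moreover have "\<bar>lv\<bar> \<le> \<epsilon> * M" unfolding lv_def by (rule order_trans[OF levels[OF u s k c(2)] zM])
    moreover have "\<bar>?\<phi> * sb\<bar> \<le> r * \<Lambda> * B * (\<epsilon> * M)"
    proof -
      have "\<bar>?\<phi> * sb\<bar> \<le> ?\<phi> * (r * \<Lambda> * B * (\<epsilon> * n))"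
        unfolding abs_mult abs_of_nonneg[OF phi0] sb_def by (rule mult_left_mono[OF e1 phi0])
      then show ?thesis by (simp add: M_def mult_ac)
    qed
    moreover have "\<bar>?\<phi> * sc\<bar> \<le> B * (\<epsilon> * M)"
    proof -
      have "\<bar>?\<phi> * sc\<bar> \<le> ?\<phi> * (B * card (ball E u s))"
        unfolding abs_mult abs_of_nonneg[OF phi0] sc_def by (rule mult_left_mono[OF b1 phi0])
      also have "\<dots> = B * (?\<phi> * card (ball E u s))" by (simp only: mult_ac)
      also have "\<dots> \<le> B * (\<epsilon> * M)" using B1 by (intro mult_left_mono phib) auto
      finally show ?thesis .
    qed
    moreover have "(1 + r * \<Lambda> * B + B) * (\<epsilon> * M) = \<epsilon> * M + r * \<Lambda> * B * (\<epsilon> * M) + B * (\<epsilon> * M)" by (simp only: distrib_right mult_1)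
    ultimately show ?thesis by linarith
  qed
  \<comment> \<open>Passing from the nominal size \<open>M\<close> to the actual size costs the
    relative size error \<open>2 * \<epsilon>\<close>. Dividing by the actual size, which is at
    least \<open>M / 2\<close>, produces the leading factor 2 of \<open>C2\<close>.\<close>
  have "\<bar>?c' * (y k u (Suc s) - lam k * y k u s)\<bar> \<le> (1 + r * \<Lambda> * B + B) * (\<epsilon> * M) + \<Lambda> * B * (2 * \<epsilon> * M)"
  proof -
    have "?c' * (y k u (Suc s) - lam k * y k u s) = (?c' * y k u (Suc s) - M * (lam k * y k u s)) - (lam k * y k u s) * (?c' - M)"
      by (simp add: algebra_simps)
    moreover have "\<bar>(lam k * y k u s) * (?c' - M)\<bar> \<le> (\<Lambda> * B) * (2 * \<epsilon> * M)"
      unfolding abs_mult by (intro mult_mono lam_le[OF k] y_bound[OF u k] sz) (use L1 B1 in auto)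
    ultimately show ?thesis using main by linarith
  qed
  also have "\<dots> \<le> \<epsilon> * C2 * (M / 2)"
  proof -
    have "r * \<Lambda> * B * 1 \<le> r * \<Lambda> * B * B" using B1 L1 by (intro mult_left_mono) auto
    then have "(1 + r * \<Lambda> * B + B) * (\<epsilon> * M) \<le> (1 + r * \<Lambda> * B * B + B) * (\<epsilon> * M)"
      using eps(1) Mpos by (intro mult_right_mono) auto
    then show ?thesis unfolding C2_def by (simp add: algebra_simps)
  qed
  also have "\<dots> \<le> \<epsilon> * C2 * ?c'"
    using c'lo by (intro mult_left_mono mult_nonneg_nonneg eps(1) C2_nonneg)
  finally have "?c' * \<bar>y k u (Suc s) - lam k * y k u s\<bar> \<le> ?c' * (\<epsilon> * C2)" by (simp add: abs_mult mult.commute)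
  moreover have "0 < ?c'" using c'lo Mpos by linarith
  ultimately show "\<bar>y k u (Suc s) - lam k * y k u s\<bar> \<le> \<epsilon> * C2" by (simp only: mult_le_cancel_left_pos)
qed

text \<open>The errors satisfy \<open>e (Suc s) \<le> \<epsilon> * C2 + \<Lambda> * e s\<close>, and
  since \<open>\<Lambda> \<ge> 1\<close> the bound
  \<open>\<epsilon> * (C2 * s * \<Lambda> ^ s)\<close> absorbs the recursion. Each step produces the
  next level, so assumptions on levels up to \<open>t\<close> reach level
  \<open>t + 1\<close>.\<close>

lemma levels_all:
  assumes u: "u \<in> V"
  shows "s \<le> t + 1 \<Longrightarrow> (D / 4) ^ s \<le> card (S u s) \<and> card (S u s) \<le> (2 * D) ^ s \<and>
    real (card (ball E u s)) \<le> (\<Sum>j\<le>s. (2 * D) ^ j) \<and>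
    (\<forall>k\<in>{1..r}. \<bar>y k u s - lam k ^ s * qq k u w\<bar> \<le> \<epsilon> * (C2 * s * \<Lambda> ^ s))"
proof (induction s)
  case 0
  have "N u 0 a = (if a = u then 1 else 0)" for a
  proof (cases "a = u")
    case True
    have "tr w u = T u w" using u by (simp add: tr_def)
    have "nv E (tr w u) u 0 u w = 1" using tree0[OF u] unfolding nv_def by (rule nbr_vec_0[THEN trans]) simp
    then show ?thesis using True by (simp add: Nn_def)
  qed (simp add: Nn_def nv_outside)
  then have N0: "\<And>a. N u 0 a = (if a = u then 1 else 0)" by blast
  have "y k u 0 = qq k u w" for k
  proof -
    have "y k u 0 = (\<Sum>a\<in>V. if a = u then qq k a w else 0)"
      unfolding y_def by (rule sum.cong) (auto simp only: N0 if_True if_False mult_1_right mult_zero_right split: if_split)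
    then show ?thesis using u by (simp add: sum.delta)
  qed
  then show ?case by (simp add: ball_def)
next
  case (Suc s)
  then have s: "s \<le> t" and IH: "(D / 4) ^ s \<le> card (S u s)" "card (S u s) \<le> (2 * D) ^ s"
    "real (card (ball E u s)) \<le> (\<Sum>j\<le>s. (2 * D) ^ j)"
    "\<And>k. k \<in> {1..r} \<Longrightarrow> \<bar>y k u s - lam k ^ s * qq k u w\<bar> \<le> \<epsilon> * (C2 * s * \<Lambda> ^ s)" by auto
  note st = level_step[OF u s IH(1-3)]
  have "ball E u (Suc s) = ball E u s \<union> S u (Suc s)" unfolding ball_def by (auto simp: le_Suc_eq)
  then have "card (ball E u (Suc s)) \<le> card (ball E u s) + card (S u (Suc s))" by (simp add: card_Un_le)
  then have b: "real (card (ball E u (Suc s))) \<le> (\<Sum>j\<le>Suc s. (2 * D) ^ j)"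
    using IH(3) st(2) by (simp only: sum.atMost_Suc)
  have "\<bar>y k u (Suc s) - lam k ^ Suc s * qq k u w\<bar> \<le> \<epsilon> * (C2 * Suc s * \<Lambda> ^ Suc s)" if k: "k \<in> {1..r}" for k
  proof -
    have "y k u (Suc s) - lam k ^ Suc s * qq k u w = (y k u (Suc s) - lam k * y k u s) + lam k * (y k u s - lam k ^ s * qq k u w)"
      by (simp add: algebra_simps)
    moreover have "\<bar>lam k * (y k u s - lam k ^ s * qq k u w)\<bar> \<le> \<Lambda> * (\<epsilon> * (C2 * s * \<Lambda> ^ s))"
      unfolding abs_mult using L1 by (intro mult_mono lam_le[OF k] IH(4)[OF k]) auto
    moreover have "\<epsilon> * C2 * 1 \<le> \<epsilon> * C2 * \<Lambda> ^ Suc s"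
      using L1 eps C2_nonneg by (intro mult_left_mono one_le_power) auto
    moreover have "\<epsilon> * (C2 * Suc s * \<Lambda> ^ Suc s) = \<epsilon> * C2 * \<Lambda> ^ Suc s + \<Lambda> * (\<epsilon> * (C2 * s * \<Lambda> ^ s))"
      by (simp add: algebra_simps)
    ultimately show ?thesis using st(3)[OF k] by linarith
  qed
  then show ?case using st(1,2) b by blast
qed

text \<open>Out-neighbours of \<open>a\<close> form the first sphere, apart from a possible loop at
  \<open>a\<close>, which accounts for the added 1.\<close>

lemma out_degree: "a \<in> V \<Longrightarrow> real (card {b \<in> V. (a, b) \<in> E}) \<le> 2 * D + 1"
proof -
  assume a: "a \<in> V"
  have "{b \<in> V. (a, b) \<in> E} \<subseteq> insert a (S a 1)" by (auto simp: sphere_at_Suc)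
  then have "card {b \<in> V. (a, b) \<in> E} \<le> card (insert a (S a 1))" by (rule card_mono[rotated]) (simp add: finS[OF a])
  also have "\<dots> \<le> card (S a 1) + 1" by (simp add: card_insert_if finS[OF a])
  finally have "real (card {b \<in> V. (a, b) \<in> E}) \<le> real (card (S a 1)) + 1" by linarith
  moreover have "real (card (S a 1)) \<le> (2 * D) ^ 1" using levels_all[OF a, of 1] by simp
  ultimately show ?thesis by simp
qed

text \<open>The two matrices differ only on edges of the first sample. Each \<open>a\<close> has at
  most \<open>2 * D + 1\<close> of them, each weighted by at most the reciprocal size of level
  \<open>t + 1\<close>; \<open>deg_le\<close> makes the quotient small.\<close>

lemma gg_ff:
  assumes u: "u \<in> V" and v: "v \<in> V"
  shows "\<bar>\<Sum>a\<in>V. (\<Sum>b\<in>V. N v (t + 1) b * (gg E w a b - ff w a b)) * N u t a\<bar> \<le> \<epsilon>"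
proof (rule weighted_bound[OF u _ eps(1)])
  fix a assume a: "a \<in> V"
  let ?c = "real (card (S v (t + 1)))"
  have c: "(D / 4) ^ (t + 1) \<le> ?c" using levels_all[OF v, of "t + 1"] by blast
  have d: "0 < (D / 4) ^ (t + 1)" using D(2) by simp
  have "\<bar>\<Sum>b\<in>V. N v (t + 1) b * (gg E w a b - ff w a b)\<bar> \<le> (\<Sum>b\<in>V. \<bar>N v (t + 1) b * (gg E w a b - ff w a b)\<bar>)" by (rule sum_abs)
  also have "\<dots> \<le> (\<Sum>b\<in>V. if (a, b) \<in> E then 1 / ?c else 0)"
  proof (rule sum_mono)
    fix b assume "b \<in> V"
    show "\<bar>N v (t + 1) b * (gg E w a b - ff w a b)\<bar> \<le> (if (a, b) \<in> E then 1 / ?c else 0)"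
    proof (cases "(a, b) \<in> E")
      case True
      have "\<bar>zz w a b - ff w a b\<bar> \<le> 1" using zz_unit[OF w, of a b] ff_unit[OF w, of a b] by auto
      then have "\<bar>N v (t + 1) b\<bar> * \<bar>zz w a b - ff w a b\<bar> \<le> 1 / ?c * 1"
        using N_nonneg[of v "t + 1" b] Nn_le[OF w, of E "tr w v" v "t + 1" b] by (intro mult_mono) auto
      then show ?thesis using True by (simp add: gg_def abs_mult)
    qed (simp add: gg_def)
  qed
  also have "\<dots> = (\<Sum>b\<in>{b \<in> V. (a, b) \<in> E}. 1 / ?c)" by (rule sum.inter_filter[symmetric]) simp
  also have "\<dots> = real (card {b \<in> V. (a, b) \<in> E}) / ?c" by simp
  also have "\<dots> \<le> (2 * D + 1) / (D / 4) ^ (t + 1)"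
    using out_degree[OF a] c d D(2) by (intro frac_le) auto
  also have "\<dots> \<le> \<epsilon>" by (rule deg_le)
  finally show "\<bar>\<Sum>b\<in>V. N v (t + 1) b * (gg E w a b - ff w a b)\<bar> \<le> \<epsilon>" .
qed

text \<open>The value approximated by the bilinear form: \<open>t\<close> powers of the eigenvalue
  come from the vector of \<open>u\<close>, \<open>t + 1\<close> from that of \<open>v\<close>, and
  one from \<open>F\<close> in between.\<close>

definition G :: "nat \<Rightarrow> nat \<Rightarrow> real" where
  "G u v = (\<Sum>k=1..r. lam k ^ (2 * t + 2) * (qq k u w * qq k v w))"

lemma ff_G:
  assumes u: "u \<in> V" and v: "v \<in> V"
  shows "\<bar>(\<Sum>a\<in>V. (\<Sum>b\<in>V. N v (t + 1) b * ff w a b) * N u t a) - G u v\<bar> \<le> \<epsilon> * C4 t"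
proof -
  have pw: "x ^ (2 * t + 2) = x * x ^ t * x ^ (t + 1)" for x :: real by (simp add: mult_2 power_add)
  have C3: "0 \<le> C3 t" unfolding C3_def using C2_nonneg L1 by simp
  have "(\<Sum>b\<in>V. N v (t + 1) b * ff w a b) = (\<Sum>k=1..r. lam k * qq k a w * y k v (t + 1))" if a: "a \<in> V" for a
  proof -
    have "(\<Sum>b\<in>V. N v (t + 1) b * ff w a b) = (\<Sum>b\<in>V. \<Sum>k=1..r. lam k * qq k a w * (qq k b w * N v (t + 1) b))"
      by (rule sum.cong[OF refl]) (simp add: ff_eq[OF w a] sum_distrib_left mult_ac)
    then show ?thesis by (subst (asm) sum.swap) (simp add: y_def sum_distrib_left)
  qed
  then have "(\<Sum>a\<in>V. (\<Sum>b\<in>V. N v (t + 1) b * ff w a b) * N u t a) = (\<Sum>a\<in>V. \<Sum>k=1..r. lam k * y k v (t + 1) * (qq k a w * N u t a))"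
    by (intro sum.cong refl) (simp add: sum_distrib_left sum_distrib_right mult_ac)
  also have "\<dots> = (\<Sum>k=1..r. lam k * y k v (t + 1) * y k u t)"
    by (subst sum.swap) (simp add: y_def sum_distrib_left)
  finally have eq: "(\<Sum>a\<in>V. (\<Sum>b\<in>V. N v (t + 1) b * ff w a b) * N u t a) - G u v =
      (\<Sum>k=1..r. lam k * ((y k u t - lam k ^ t * qq k u w) * y k v (t + 1) + lam k ^ t * qq k u w * (y k v (t + 1) - lam k ^ (t + 1) * qq k v w)))"
    unfolding G_def by (simp only: sum_subtractf[symmetric]) (intro sum.cong refl, simp only: pw, simp add: algebra_simps)
  have "\<bar>(\<Sum>a\<in>V. (\<Sum>b\<in>V. N v (t + 1) b * ff w a b) * N u t a) - G u v\<bar> \<le> (\<Sum>k=1..r. \<Lambda> * (\<epsilon> * C3 t * B + \<Lambda> ^ t * B * (\<epsilon> * C3 t)))"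
    unfolding eq
  proof (rule order_trans[OF sum_abs sum_mono])
    fix k assume k: "k \<in> {1..r}"
    have "C2 * t * \<Lambda> ^ t \<le> C2 * (t + 1) * \<Lambda> ^ (t + 1)"
      using L1 C2_nonneg by (intro mult_mono power_increasing) auto
    then have e1: "\<epsilon> * (C2 * t * \<Lambda> ^ t) \<le> \<epsilon> * C3 t"
      unfolding C3_def using eps(1) by (intro mult_left_mono) auto
    have l1: "\<bar>y k u t - lam k ^ t * qq k u w\<bar> \<le> \<epsilon> * C3 t"
      using levels_all[OF u, of t] k e1 by (meson le_add1 order_trans)
    have "\<bar>y k v (t + 1) - lam k ^ (t + 1) * qq k v w\<bar> \<le> \<epsilon> * (C2 * real (t + 1) * \<Lambda> ^ (t + 1))"
      using levels_all[OF v order.refl] k by blast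
    then have l2: "\<bar>y k v (t + 1) - lam k ^ (t + 1) * qq k v w\<bar> \<le> \<epsilon> * C3 t" by (simp only: C3_def of_nat_add of_nat_1)
    have lt: "\<bar>lam k ^ t * qq k u w\<bar> \<le> \<Lambda> ^ t * B"
      unfolding abs_mult power_abs using lam_le[OF k] L1 by (intro mult_mono power_mono qq_bound[OF k w]) auto
    have eC: "0 \<le> \<epsilon> * C3 t" using eps(1) C3 by simp
    have "\<bar>(y k u t - lam k ^ t * qq k u w) * y k v (t + 1)\<bar> \<le> \<epsilon> * C3 t * B"
      unfolding abs_mult[of "y k u t - lam k ^ t * qq k u w"] using eC by (intro mult_mono l1 y_bound[OF v k]) auto
    moreover have "\<bar>lam k ^ t * qq k u w * (y k v (t + 1) - lam k ^ (t + 1) * qq k v w)\<bar> \<le> \<Lambda> ^ t * B * (\<epsilon> * C3 t)"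
      unfolding abs_mult[of "lam k ^ t * qq k u w"] using L1 B1 by (intro mult_mono lt l2) auto
    ultimately have "\<bar>(y k u t - lam k ^ t * qq k u w) * y k v (t + 1) + lam k ^ t * qq k u w * (y k v (t + 1) - lam k ^ (t + 1) * qq k v w)\<bar>
        \<le> \<epsilon> * C3 t * B + \<Lambda> ^ t * B * (\<epsilon> * C3 t)" by linarith
    then show "\<bar>lam k * ((y k u t - lam k ^ t * qq k u w) * y k v (t + 1) + lam k ^ t * qq k u w * (y k v (t + 1) - lam k ^ (t + 1) * qq k v w))\<bar>
        \<le> \<Lambda> * (\<epsilon> * C3 t * B + \<Lambda> ^ t * B * (\<epsilon> * C3 t))"
      unfolding abs_mult[of "lam k"] using L1 by (intro mult_mono lam_le[OF k]) auto
  qed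
  also have "\<dots> = \<epsilon> * C4 t" by (simp add: C4_def algebra_simps)
  finally show ?thesis .
qed

definition Q :: "nat \<Rightarrow> nat \<Rightarrow> real" where
  "Q u v = 1 / p' * (\<Sum>a\<in>V. \<Sum>b\<in>V. N u t a * aa (mk w) w a b * N v (t + 1) b)"

text \<open>Noise of the fresh sample and the revealed entries cost \<open>\<epsilon>\<close> each;
  the spectral approximation costs \<open>\<epsilon> * C4 t\<close>.\<close>

lemma Q_G:
  assumes u: "u \<in> V" and v: "v \<in> V"
  shows "\<bar>Q u v - G u v\<bar> \<le> \<epsilon> * (2 + C4 t)"
proof -
  let ?gg = "\<Sum>a\<in>V. \<Sum>b\<in>V. N u t a * N v (t + 1) b * gg E w a b"
  have "bil_dev u t v (t + 1) (mk w) (tr w) w = (\<Sum>a\<in>V. \<Sum>b\<in>V. N u t a * N v (t + 1) b * (aa (mk w) w a b / p' - gg E w a b))"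
    unfolding bil_dev_def by (simp only: sum.cartesian_product case_prod_unfold)
  also have "\<dots> = Q u v - ?gg"
    unfolding Q_def sum_distrib_left sum_subtractf[symmetric] by (intro sum.cong refl) (simp add: algebra_simps)
  finally have bd: "bil_dev u t v (t + 1) (mk w) (tr w) w = Q u v - ?gg" .
  have eq: "?gg = (\<Sum>a\<in>V. (\<Sum>b\<in>V. N v (t + 1) b * (gg E w a b - ff w a b)) * N u t a) + (\<Sum>a\<in>V. (\<Sum>b\<in>V. N v (t + 1) b * ff w a b) * N u t a)"
    unfolding sum_distrib_right sum.distrib[symmetric] by (intro sum.cong refl) (simp add: algebra_simps)
  have "(D / 4) ^ t * (D / 4) ^ (t + 1) \<le> real (card (S u t)) * real (card (S v (t + 1)))"
    using levels_all[OF u, of t] levels_all[OF v, of "t + 1"] D(2) by (intro mult_mono) auto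
  then have "\<bar>Q u v - ?gg\<bar> \<le> \<epsilon>" unfolding bd[symmetric] by (intro bil[OF u v]) simp
  moreover have "\<epsilon> * (2 + C4 t) = \<epsilon> + \<epsilon> + \<epsilon> * C4 t" by (simp add: algebra_simps)
  ultimately show ?thesis using gg_ff[OF u v] ff_G[OF u v] eq by linarith
qed

text \<open>The value approximated by the distance estimate. Pairing levels \<open>t\<close> and
  \<open>t + 1\<close> makes the exponent even, so every term is nonnegative whatever the signs of
  the eigenvalues.\<close>

definition dist2 :: "nat \<Rightarrow> nat \<Rightarrow> real" where
  "dist2 u v = (\<Sum>k=1..r. lam k ^ (2 * t + 2) * (qq k u w - qq k v w)\<^sup>2)"

abbreviation "d u v \<equiv> dh t (mk w) (tr w) u v w"

lemma dh_dist2: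
  assumes u: "u \<in> V" and v: "v \<in> V"
  shows "\<bar>d u v - dist2 u v\<bar> \<le> \<eta> / 2"
proof -
  have "d u v = Q u u - Q u v - Q v u + Q v v"
    unfolding dh_eq Q_def sum_distrib_left sum_subtractf[symmetric] sum.distrib[symmetric]
    by (intro sum.cong refl) (simp add: algebra_simps)
  moreover have "dist2 u v = G u u - G u v - G v u + G v v"
    unfolding dist2_def G_def sum_subtractf[symmetric] sum.distrib[symmetric]
    by (intro sum.cong refl) (simp add: algebra_simps power2_eq_square)
  moreover have "\<epsilon> * C5 t = \<epsilon> * (2 + C4 t) + \<epsilon> * (2 + C4 t) + \<epsilon> * (2 + C4 t) + \<epsilon> * (2 + C4 t)"
    by (simp add: C5_def algebra_simps)
  ultimately show ?thesis
    using Q_G[OF u u] Q_G[OF u v] Q_G[OF v u] Q_G[OF v v] eta(2) by linarith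
qed

text \<open>Latent variables within \<open>1 / kk\<close> have \<open>dist2\<close> at most
  \<open>\<eta> / 4\<close> by the choice of \<open>kk\<close>, and the estimate is off by at most
  \<open>\<eta> / 2\<close>.\<close>

lemma close_dh:
  assumes u: "u \<in> V" and a: "a \<in> V" and c: "\<bar>\<theta> a w - \<theta> u w\<bar> \<le> 1 / kk"
  shows "d u a < \<eta>"
proof -
  have "dist2 u a \<le> (\<Sum>k=1..r. \<Lambda> ^ (2 * t + 2) * (K * (1 / kk))\<^sup>2)"
    unfolding dist2_def
  proof (intro sum_mono mult_mono)
    fix k assume k: "k \<in> {1..r}"
    have "lam k ^ (2 * t + 2) \<le> \<bar>lam k\<bar> ^ (2 * t + 2)" using abs_ge_self[of "lam k ^ (2 * t + 2)"] by (simp only: power_abs)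
    also have "\<dots> \<le> \<Lambda> ^ (2 * t + 2)" by (rule power_mono[OF lam_le[OF k]]) simp
    finally show "lam k ^ (2 * t + 2) \<le> \<Lambda> ^ (2 * t + 2)" .
    have "\<bar>q k (\<theta> u w) - q k (\<theta> a w)\<bar> \<le> K * \<bar>\<theta> u w - \<theta> a w\<bar>" by (rule q_lip[OF k theta_range[OF u w] theta_range[OF a w]])
    also have "\<dots> \<le> K * (1 / kk)" using c K0 by (intro mult_left_mono) auto
    finally have "\<bar>qq k u w - qq k a w\<bar> \<le> K * (1 / kk)" using u a by (simp add: qq_def)
    from power_mono[OF this, of 2] show "(qq k u w - qq k a w)\<^sup>2 \<le> (K * (1 / kk))\<^sup>2" by simp
  qed (use L1 in auto)
  also have "\<dots> = r * \<Lambda> ^ (2 * t + 2) * K\<^sup>2 / (real kk)\<^sup>2" by (simp add: power_mult_distrib power_divide)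
  also have "\<dots> \<le> \<eta> / 4" by (rule kk(2))
  finally show ?thesis using dh_dist2[OF u a] eta(1) by linarith
qed

lemma close_count_ge:
  assumes u: "u \<in> V" shows "real n / real (2 * kk) \<le> close_count (1 / kk) u w"
proof -
  let ?x = "\<theta> u w"
  have x: "0 \<le> ?x" "?x \<le> 1" using theta_range[OF u w] by auto
  have kp: "0 < real kk" using kk(1) by simp
  obtain j where j: "j < kk" "real j \<le> ?x * kk" "?x * kk \<le> real j + 1"
  \<comment> \<open>The right endpoint 1 would fall into a cell beyond the grid and is assigned to
    the last one.\<close>
  proof (cases "?x = 1")
    case True
    have "real (kk - 1) = real kk - 1" using kk(1) by (simp add: of_nat_diff)
    then show ?thesis using that[of "kk - 1"] True kk(1) by simp
  next
    case False
    let ?j = "nat \<lfloor>?x * kk\<rfloor>"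
    have x0: "0 \<le> ?x * kk" using x by simp
    then have j: "real ?j \<le> ?x * kk" "?x * kk \<le> real ?j + 1" by linarith+
    have "?x * real kk < 1 * real kk" by (rule mult_strict_right_mono[OF _ kp]) (use False x in linarith)
    then have "?j < kk" using j(1) by linarith
    then show ?thesis using that j by blast
  qed
  have "real n / real (2 * kk) \<le> (\<Sum>i\<in>V. indicator {real j / kk..(real j + 1) / kk} (\<theta> i w))" by (rule grid[OF j(1)])
  also have "\<dots> \<le> close_count (1 / kk) u w"
    unfolding close_count_def
  proof (rule sum_mono)
    fix i
    have xu: "real j / kk \<le> ?x" "?x \<le> (real j + 1) / kk" using j kp by (auto simp: field_simps)
    show "indicator {real j / kk..(real j + 1) / kk} (\<theta> i w) \<le> chi (1 / kk) u i w"
    proof (cases "\<theta> i w \<in> {real j / kk..(real j + 1) / kk}")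
      case True
      then have "real j / kk \<le> \<theta> i w" "\<theta> i w \<le> (real j + 1) / kk" by auto
      moreover have "(real j + 1) / kk = real j / kk + 1 / kk" by (rule add_divide_distrib)
      ultimately have "\<bar>\<theta> i w - ?x\<bar> \<le> 1 / kk" using xu by linarith
      then show ?thesis by (simp add: chi_def indicator_def)
    qed (simp add: chi_def)
  qed
  finally show ?thesis .
qed

lemma near_count_ge:
  assumes u: "u \<in> V" and v: "v \<in> V"
  shows "m0 \<le> near_count t \<eta> u v (mk w) (tr w) w"
proof -
  have "(real n / real (2 * kk))\<^sup>2 \<le> close_count (1 / kk) u w * close_count (1 / kk) v w"
    unfolding power2_eq_square using close_count_ge[OF u] close_count_ge[OF v]
    by (intro mult_mono) (auto intro: order_trans[rotated])
  then have "m0 \<le> count3 (1 / kk) u v (mk w) w" by (rule count[OF u v])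
  also have "\<dots> \<le> near_count t \<eta> u v (mk w) (tr w) w"
    unfolding count3_def near_count_def
  proof (rule sum_mono)
    fix e assume "e \<in> edges3 n (mk w)"
    then have "e \<in> V \<times> V" using edges3_sub by blast
    then have e: "fst e \<in> V" "snd e \<in> V" by (simp_all only: mem_Times_iff)
    show "chi (1 / kk) u (fst e) w * chi (1 / kk) v (snd e) w \<le> near_ind t \<eta> u v (mk w) (tr w) e w"
      using close_dh[OF u e(1)] close_dh[OF v e(2)] unfolding chi_def near_ind_def by auto
  qed
  finally show ?thesis .
qed

text \<open>Each term of \<open>dist2\<close> is at most the whole sum, which is at most
  \<open>3 / 2 * \<eta>\<close> for an accepted pair. It is relaxed to \<open>4 * \<eta>\<close>,
  the square of \<open>2 * sqrt \<eta>\<close>. Dividing by \<open>l ^ (t + 1)\<close> is the price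
  of small eigenvalues.\<close>

lemma near_qq:
  assumes u: "u \<in> V" and a: "a \<in> V" and d: "d u a < \<eta>" and k: "k \<in> {1..r}"
  shows "\<bar>qq k u w - qq k a w\<bar> \<le> 2 / l ^ (t + 1) * sqrt \<eta>"
proof -
  let ?x = "\<bar>qq k u w - qq k a w\<bar>"
  have nn: "0 \<le> lam j ^ (2 * t + 2) * (qq j u w - qq j a w)\<^sup>2" for j
    by (intro mult_nonneg_nonneg zero_le_even_power) auto
  have "(l ^ (t + 1) * ?x)\<^sup>2 = (l ^ (t + 1))\<^sup>2 * ?x\<^sup>2" by (rule power_mult_distrib)
  also have "\<dots> \<le> (\<bar>lam k\<bar> ^ (t + 1))\<^sup>2 * ?x\<^sup>2"
    using l0 by (intro mult_right_mono power_mono lam_ge[OF k]) auto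
  also have "\<dots> = lam k ^ (2 * t + 2) * (qq k u w - qq k a w)\<^sup>2"
  proof -
    have "(\<bar>lam k\<bar> ^ (t + 1))\<^sup>2 = (\<bar>lam k\<bar>\<^sup>2) ^ (t + 1)" by (simp only: power_mult[symmetric] mult.commute)
    also have "\<dots> = lam k ^ (2 * t + 2)" by (simp add: power_mult[symmetric] power2_abs del: power_Suc)
    finally show ?thesis by simp
  qed
  also have "\<dots> \<le> dist2 u a" unfolding dist2_def by (rule member_le_sum[OF k]) (use nn in auto)
  also have "\<dots> \<le> 4 * \<eta>" using dh_dist2[OF u a] d eta(1) by linarith
  also have "\<dots> = (2 * sqrt \<eta>)\<^sup>2" using eta(1) by (simp add: power_mult_distrib)
  finally have "l ^ (t + 1) * ?x \<le> 2 * sqrt \<eta>" by (rule power2_le_imp_le) (use eta(1) in simp)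
  then show ?thesis using l0 by (simp add: field_simps)
qed

lemma near_mean:
  assumes u: "u \<in> V" and v: "v \<in> V" and a: "a \<in> V" and b: "b \<in> V" and d: "d u a < \<eta>" "d v b < \<eta>"
  shows "\<bar>mean (a, b) w - mean (u, v) w\<bar> \<le> C6 t * sqrt \<eta>"
proof -
  let ?x = "2 / l ^ (t + 1) * sqrt \<eta>"
  have x0: "0 \<le> ?x" using l0 eta(1) by simp
  have m: "mean (i, j) w = (\<Sum>k=1..r. lam k * qq k i w * qq k j w)" if "i \<in> V" "j \<in> V" for i j
    using ff_eq[OF w that] that by (simp add: ff_def)
  have eq: "mean (a, b) w - mean (u, v) w = (\<Sum>k=1..r. lam k * ((qq k a w - qq k u w) * qq k b w + qq k u w * (qq k b w - qq k v w)))"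
    unfolding m[OF a b] m[OF u v] sum_subtractf[symmetric] by (intro sum.cong refl) (simp add: algebra_simps)
  have "\<bar>mean (a, b) w - mean (u, v) w\<bar> \<le> (\<Sum>k=1..r. \<Lambda> * (?x * B + B * ?x))"
    unfolding eq
  proof (rule order_trans[OF sum_abs sum_mono])
    fix k assume k: "k \<in> {1..r}"
    have "\<bar>(qq k a w - qq k u w) * qq k b w\<bar> \<le> ?x * B"
      unfolding abs_mult using near_qq[OF u a d(1) k] x0 by (intro mult_mono qq_bound[OF k w]) (simp_all add: abs_minus_commute)
    moreover have "\<bar>qq k u w * (qq k b w - qq k v w)\<bar> \<le> B * ?x"
      unfolding abs_mult using near_qq[OF v b d(2) k] B1 by (intro mult_mono qq_bound[OF k w]) (simp_all add: abs_minus_commute)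
    ultimately have "\<bar>(qq k a w - qq k u w) * qq k b w + qq k u w * (qq k b w - qq k v w)\<bar> \<le> ?x * B + B * ?x" by linarith
    then show "\<bar>lam k * ((qq k a w - qq k u w) * qq k b w + qq k u w * (qq k b w - qq k v w))\<bar> \<le> \<Lambda> * (?x * B + B * ?x)"
      unfolding abs_mult[of "lam k"] using L1 by (intro mult_mono lam_le[OF k]) auto
  qed
  also have "\<dots> = C6 t * sqrt \<eta>" by (simp add: C6_def)
  finally show ?thesis .
qed

text \<open>The error splits into the noise of the averaged entries, at most \<open>x0\<close> per
  near pair, and the bias of the accepted pairs. Near pairs exist because their number is at least
  \<open>m0 > 0\<close>, so the arbitrary value \<open>c\<close> does not occur.\<close>

theorem estimate_error:
  assumes u: "u \<in> V" and v: "v \<in> V"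
  shows "\<bar>nn_estimate n (mk w) (\<lambda>e. Z e w) d \<eta> c u v - mean (u, v) w\<bar> \<le> x0 + C6 t * sqrt \<eta>"
proof -
  define A where "A = {(a, b) \<in> edges3 n (mk w). d u a < \<eta> \<and> d v b < \<eta>}"
  have A3: "A \<subseteq> edges3 n (mk w)" unfolding A_def by auto
  have f3: "finite (edges3 n (mk w))" by (rule finite_subset[OF edges3_sub]) simp
  have fA: "finite A" by (rule finite_subset[OF A3 f3])
  have sumA: "(\<Sum>e\<in>edges3 n (mk w). near_ind t \<eta> u v (mk w) (tr w) e w * h e) = sum h A" for h :: "nat \<times> nat \<Rightarrow> real"
    by (rule sum.mono_neutral_cong_right[OF f3 A3]) (auto simp: A_def near_ind_def)
  have cnt: "near_count t \<eta> u v (mk w) (tr w) w = card A"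
    using sumA[of "\<lambda>_. 1"] by (simp add: near_count_def)
  have dev: "near_dev t \<eta> u v (mk w) (tr w) w = (\<Sum>e\<in>A. Z e w - mean e w)"
    using sumA by (simp add: near_dev_def)
  have cA: "0 < real (card A)" using near_count_ge[OF u v] m0 by (simp only: cnt)
  then have ne: "A \<noteq> {}" by auto
  have "restrict_matrix (edges3 n (mk w)) (data_matrix n (mk w) (\<lambda>e. Z e w)) a b = Z (a, b) w" if "(a, b) \<in> A" for a b
    using that A3 by (auto simp: restrict_matrix_def data_matrix_def edges_obs_def edges3_def)
  then have "nn_estimate n (mk w) (\<lambda>e. Z e w) d \<eta> c u v = 1 / card A * (\<Sum>(a, b)\<in>A. Z (a, b) w)"
    using ne unfolding nn_estimate_def Let_def A_def[symmetric] by (simp cong: sum.cong_simp) (intro disjI2 sum.cong, auto)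
  also have "(\<Sum>(a, b)\<in>A. Z (a, b) w) = (\<Sum>e\<in>A. Z e w)" by (simp add: case_prod_unfold)
  finally have nn: "nn_estimate n (mk w) (\<lambda>e. Z e w) d \<eta> c u v = 1 / card A * (\<Sum>e\<in>A. Z e w)" .
  have eq: "card A * (nn_estimate n (mk w) (\<lambda>e. Z e w) d \<eta> c u v - mean (u, v) w) =
      near_dev t \<eta> u v (mk w) (tr w) w + (\<Sum>e\<in>A. mean e w - mean (u, v) w)"
    unfolding nn dev using cA by (simp add: right_diff_distrib sum_subtractf)
  have "\<bar>\<Sum>e\<in>A. mean e w - mean (u, v) w\<bar> \<le> (\<Sum>e\<in>A. C6 t * sqrt \<eta>)"
  proof (rule order_trans[OF sum_abs sum_mono])
    fix e assume e: "e \<in> A"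
    then have "e \<in> V \<times> V" using A3 edges3_sub by blast
    moreover have "d u (fst e) < \<eta>" "d v (snd e) < \<eta>" using e by (auto simp: A_def)
    ultimately have "fst e \<in> V" "snd e \<in> V" "d u (fst e) < \<eta>" "d v (snd e) < \<eta>" by (simp_all only: mem_Times_iff)
    from near_mean[OF u v this] show "\<bar>mean e w - mean (u, v) w\<bar> \<le> C6 t * sqrt \<eta>" by simp
  qed
  then have "\<bar>near_dev t \<eta> u v (mk w) (tr w) w + (\<Sum>e\<in>A. mean e w - mean (u, v) w)\<bar> \<le> x0 * card A + card A * (C6 t * sqrt \<eta>)"
    using near[OF u v near_count_ge[OF u v]] unfolding cnt by simp
  then have "card A * \<bar>nn_estimate n (mk w) (\<lambda>e. Z e w) d \<eta> c u v - mean (u, v) w\<bar> \<le> card A * (x0 + C6 t * sqrt \<eta>)"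
    unfolding eq[symmetric] abs_mult by (simp add: algebra_simps)
  then show ?thesis using cA by (simp only: mult_le_cancel_left_pos)
qed

end

section \<open>Measurability of the estimate; from a tail bound to both claims\<close>

context sample_model
begin

lemma trees_AE:
  defines "A \<equiv> {w \<in> space P. \<not> (\<forall>u\<in>V. tr w u \<in> bfs_trees (edges1 n (mk w)) u)}"
  shows "A \<in> sets P" "prob A = 0"
proof -
  let ?\<Phi> = "\<lambda>\<mu> \<tau> (w :: 'w). if (\<forall>u\<in>V. \<tau> u \<in> bfs_trees (edges1 n \<mu>) u) then 0 else 1 :: real"
  have m: "(\<lambda>w. ?\<Phi> (mk w) (tr w) w) \<in> borel_measurable P"
    by (rule mk_tr_measurable[of ?\<Phi>]) simp
  have A: "A = {w \<in> space P. 1 / 2 < ?\<Phi> (mk w) (tr w) w}" unfolding A_def by auto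
  show s: "A \<in> sets P" unfolding A using borel_measurable_less[OF borel_measurable_const m, of "1 / 2"] by simp
  have "(\<integral>w. ?\<Phi> (mk w) (tr w) w \<partial>P) \<le> 0"
  proof (rule expectation_mk_tr_le[where \<Phi> = ?\<Phi> and \<Psi> = "\<lambda>_ _ _. 0"])
    fix \<mu> :: "nat \<times> nat \<Rightarrow> mark" and \<tau> :: "nat \<Rightarrow> (nat \<times> nat) set"
    show "?\<Phi> \<mu> \<tau> \<in> borel_measurable (info (V \<times> V))" by (rule borel_measurable_const)
    show "bdd (?\<Phi> \<mu> \<tau>)" by (rule bddI[of _ 1]) simp
    show "(\<lambda>_. 0 :: real) \<in> borel_measurable (info (V \<times> V))" by (rule borel_measurable_const)
    show "bdd (\<lambda>_. 0)" by (rule bddI[of _ 1]) simp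
    show "(\<integral>w. ?\<Phi> \<mu> \<tau> w \<partial>P) \<le> (\<integral>w. 0 \<partial>P)" if "\<And>u. u \<in> V \<Longrightarrow> \<tau> u \<in> bfs_trees (edges1 n \<mu>) u"
    proof -
      have all: "\<forall>u\<in>V. \<tau> u \<in> bfs_trees (edges1 n \<mu>) u" using that by blast
      show ?thesis unfolding if_P[OF all] by (rule order.refl)
    qed
  next
    fix w
    show "pexp (marks_pmf n p) (\<lambda>\<mu>. pexp (trees_pmf n (edges1 n \<mu>)) (\<lambda>\<tau>. 0)) \<le> 0"
      by (simp only: Bochner_Integration.integral_zero order.refl)
  qed
  moreover have "(\<integral>w. ?\<Phi> (mk w) (tr w) w \<partial>P) = (\<integral>w. indicator A w \<partial>P)"
    by (rule Bochner_Integration.integral_cong) (auto simp: A_def indicator_def)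
  moreover have "(\<integral>w. indicator A w \<partial>P) = prob A" using s sets.sets_into_space[OF s] by (simp add: Int_absorb2)
  ultimately show "prob A = 0" using measure_nonneg[of P A] by linarith
qed

lemma union_bound:
  fixes c :: real
  assumes I: "finite I" and R: "\<And>i. i \<in> I \<Longrightarrow> {w \<in> space P. R i w} \<in> sets P" "\<And>i. i \<in> I \<Longrightarrow> prob {w \<in> space P. R i w} \<le> c"
  shows "{w \<in> space P. \<exists>i\<in>I. R i w} \<in> sets P \<and> prob {w \<in> space P. \<exists>i\<in>I. R i w} \<le> real (card I) * c"
proof
  have eq: "{w \<in> space P. \<exists>i\<in>I. R i w} = (\<Union>i\<in>I. {w \<in> space P. R i w})" by blast
  show "{w \<in> space P. \<exists>i\<in>I. R i w} \<in> sets P" unfolding eq by (rule sets.finite_UN[OF I R(1)])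
  have "prob (\<Union>i\<in>I. {w \<in> space P. R i w}) \<le> (\<Sum>i\<in>I. prob {w \<in> space P. R i w})" by (rule measure_UNION_le[OF I R(1)])
  also have "\<dots> \<le> real (card I) * c" by (rule sum_bounded_above[OF R(2)])
  finally show "prob {w \<in> space P. \<exists>i\<in>I. R i w} \<le> real (card I) * c" unfolding eq .
qed

lemma mk_fun: "(\<lambda>w. h (mk w) :: real) \<in> borel_measurable P"
  by (rule mk_tr_measurable[of "\<lambda>\<mu> \<tau> w. h \<mu>"]) simp

lemma
  fixes a a' b :: "'w \<Rightarrow> real"
  assumes [measurable]: "a \<in> borel_measurable P" "a' \<in> borel_measurable P" "b \<in> borel_measurable P"
  shows ev_le_less: "{w \<in> space P. a w \<le> m \<and> z < \<bar>b w\<bar>} \<in> sets P"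
    and ev_ge_less: "{w \<in> space P. m \<le> a w \<and> z < \<bar>b w\<bar>} \<in> sets P"
    and ev_near: "{w \<in> space P. m \<le> a w \<and> z * a w < \<bar>b w\<bar>} \<in> sets P"
    and ev_count: "{w \<in> space P. m \<le> a w * a' w \<and> b w < z} \<in> sets P"
  by measurable

definition near_sum :: "nat \<Rightarrow> real \<Rightarrow> nat \<Rightarrow> nat \<Rightarrow> (nat \<times> nat \<Rightarrow> mark) \<Rightarrow> (nat \<Rightarrow> (nat \<times> nat) set) \<Rightarrow> 'w \<Rightarrow> real" where
  "near_sum t \<eta> u v \<mu> \<tau> w = (\<Sum>e\<in>edges3 n \<mu>. near_ind t \<eta> u v \<mu> \<tau> e w * Z e w)"

definition nn :: "nat \<Rightarrow> real \<Rightarrow> (nat \<Rightarrow> nat \<Rightarrow> real) \<Rightarrow> nat \<Rightarrow> nat \<Rightarrow> 'w \<Rightarrow> real" where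
  "nn t \<eta> c u v w = nn_estimate n (mk w) (\<lambda>e. Z e w) (\<lambda>u v. dh t (mk w) (tr w) u v w) \<eta> c u v"

text \<open>As a quotient of sums over the whole third sample the estimate is visibly measurable,
  and a mean of values in the unit interval.\<close>

lemma nn_eq:
  "nn t \<eta> c u v w = (if near_count t \<eta> u v (mk w) (tr w) w = 0 then c u v
    else near_sum t \<eta> u v (mk w) (tr w) w / near_count t \<eta> u v (mk w) (tr w) w)"
proof -
  define A where "A = {(a, b) \<in> edges3 n (mk w). dh t (mk w) (tr w) u a w < \<eta> \<and> dh t (mk w) (tr w) v b w < \<eta>}"
  have A3: "A \<subseteq> edges3 n (mk w)" unfolding A_def by auto
  have f3: "finite (edges3 n (mk w))" by (rule finite_subset[OF edges3_sub]) simp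
  have fA: "finite A" by (rule finite_subset[OF A3 f3])
  have sumA: "(\<Sum>e\<in>edges3 n (mk w). near_ind t \<eta> u v (mk w) (tr w) e w * h e) = sum h A" for h :: "nat \<times> nat \<Rightarrow> real"
    by (rule sum.mono_neutral_cong_right[OF f3 A3]) (auto simp: A_def near_ind_def)
  have cnt: "near_count t \<eta> u v (mk w) (tr w) w = card A"
    using sumA[of "\<lambda>_. 1"] by (simp add: near_count_def)
  have sm: "near_sum t \<eta> u v (mk w) (tr w) w = (\<Sum>e\<in>A. Z e w)"
    using sumA by (simp add: near_sum_def)
  have M3: "restrict_matrix (edges3 n (mk w)) (data_matrix n (mk w) (\<lambda>e. Z e w)) a b = Z (a, b) w" if "(a, b) \<in> A" for a b
    using that A3 by (auto simp: restrict_matrix_def data_matrix_def edges_obs_def edges3_def)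
  have "(\<Sum>(a, b)\<in>A. restrict_matrix (edges3 n (mk w)) (data_matrix n (mk w) (\<lambda>e. Z e w)) a b) = (\<Sum>e\<in>A. Z e w)"
    by (rule sum.cong) (auto simp: M3)
  then show ?thesis
    unfolding nn_def nn_estimate_def Let_def A_def[symmetric] cnt sm using fA by simp
qed

lemma nn_measurable:
  assumes c: "(\<lambda>w. c w u v) \<in> borel_measurable P"
  shows "(\<lambda>w. nn t \<eta> (c w) u v w) \<in> borel_measurable P"
proof -
  have ni: "near_ind t \<eta> u v \<mu> \<tau> e \<in> borel_measurable P" for \<mu> \<tau> e
    by (rule measurable_info[OF order.refl measurable_info_mono[OF Diff_subset near_ind_info]])
  have "(\<lambda>w. near_sum t \<eta> u v (mk w) (tr w) w) \<in> borel_measurable P"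
  proof (rule mk_tr_measurable)
    show "near_sum t \<eta> u v \<mu> \<tau> \<in> borel_measurable P" for \<mu> \<tau>
      unfolding near_sum_def[abs_def] using edges3_sub[of \<mu>]
      by (intro borel_measurable_sum borel_measurable_times ni Z_measurable) auto
  qed
  then show ?thesis unfolding nn_eq using near_P(2)[of t \<eta> u v] c by measurable
qed

lemma nn_range:
  assumes w: "w \<in> space P" and c: "c u v \<in> {0..1}"
  shows "nn t \<eta> c u v w \<in> {0..1}"
proof -
  have "0 \<le> near_ind t \<eta> u v \<mu> \<tau> e w * Z e w \<and> near_ind t \<eta> u v \<mu> \<tau> e w * Z e w \<le> near_ind t \<eta> u v \<mu> \<tau> e w" if "e \<in> edges3 n \<mu>" for e \<mu> \<tau>
    using Z_range[OF subsetD[OF edges3_sub that] w] by (auto simp: near_ind_def)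
  then have "0 \<le> near_sum t \<eta> u v (mk w) (tr w) w" "near_sum t \<eta> u v (mk w) (tr w) w \<le> near_count t \<eta> u v (mk w) (tr w) w"
    unfolding near_sum_def near_count_def by (auto intro!: sum_nonneg sum_mono)
  then show ?thesis unfolding nn_eq using c by (auto simp: divide_le_eq)
qed

text \<open>The estimate reads marks and trees only on the index set, where they agree with
  \<open>mk\<close> and \<open>tr\<close>.\<close>

lemma nn_estimate_mk_tr:
  assumes u: "u \<in> V" and v: "v \<in> V"
  shows "nn_estimate n (\<lambda>e. mrk e w) (\<lambda>e. Z e w)
      (\<lambda>u v. dist_estimate n p t (\<lambda>e. mrk e w) (\<lambda>e. Z e w) (\<lambda>u. T u w) u v) \<eta> c u v = nn t \<eta> c u v w"
proof -
  have e: "edges1 n (mk w) = edges1 n (\<lambda>e. mrk e w)" "edges1_ind n (mk w) = edges1_ind n (\<lambda>e. mrk e w)"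
    "edges2 n (mk w) = edges2 n (\<lambda>e. mrk e w)" "edges3 n (mk w) = edges3 n (\<lambda>e. mrk e w)" "edges_obs n (mk w) = edges_obs n (\<lambda>e. mrk e w)"
    unfolding edges1_def edges1_ind_def edges2_def edges3_def edges_obs_def mk_def by auto
  have dm: "data_matrix n (mk w) = data_matrix n (\<lambda>e. mrk e w)"
    unfolding data_matrix_def[abs_def] e ..
  have d: "dist_estimate n p t (\<lambda>e. mrk e w) (\<lambda>e. Z e w) (\<lambda>u. T u w) a b = dh t (mk w) (tr w) a b w"
    if "a \<in> V" "b \<in> V" for a b
  proof -
    have "tr w a = T a w" "tr w b = T b w" using that by (simp_all add: tr_def)
    then show ?thesis unfolding dh_def dist_estimate_def Let_def e dm by (simp only:)
  qed
  have A: "((a, b) \<in> edges3 n (\<lambda>e. mrk e w) \<and> dist_estimate n p t (\<lambda>e. mrk e w) (\<lambda>e. Z e w) (\<lambda>u. T u w) u a < \<eta> \<and>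
        dist_estimate n p t (\<lambda>e. mrk e w) (\<lambda>e. Z e w) (\<lambda>u. T u w) v b < \<eta>) =
      ((a, b) \<in> edges3 n (\<lambda>e. mrk e w) \<and> dh t (mk w) (tr w) u a w < \<eta> \<and> dh t (mk w) (tr w) v b w < \<eta>)" for a b
  proof (rule conj_cong[OF refl])
    assume "(a, b) \<in> edges3 n (\<lambda>e. mrk e w)"
    then have ab: "(a, b) \<in> V \<times> V" by (rule subsetD[OF edges3_sub])
    have "a \<in> V" by (rule SigmaD1[OF ab])
    moreover have "b \<in> V" by (rule SigmaD2[OF ab])
    ultimately show "(dist_estimate n p t (\<lambda>e. mrk e w) (\<lambda>e. Z e w) (\<lambda>u. T u w) u a < \<eta> \<and>
        dist_estimate n p t (\<lambda>e. mrk e w) (\<lambda>e. Z e w) (\<lambda>u. T u w) v b < \<eta>) =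
      (dh t (mk w) (tr w) u a w < \<eta> \<and> dh t (mk w) (tr w) v b w < \<eta>)"
      by (simp only: d[OF u] d[OF v])
  qed
  show ?thesis unfolding nn_def nn_estimate_def Let_def e dm A ..
qed

text \<open>Off the good event the squared error is still at most 1, as both values lie in the unit
  interval. So the exceptional probability \<open>\<delta>\<close> is simply added to the mean
  squared error.\<close>

lemma error_consequences:
  fixes Fh Fm :: "nat \<Rightarrow> nat \<Rightarrow> 'w \<Rightarrow> real" and b0 b \<delta> :: real
  assumes arb: "\<And>u v. u \<in> V \<Longrightarrow> v \<in> V \<Longrightarrow> arb u v \<in> borel_measurable P"
      "\<And>u v w. u \<in> V \<Longrightarrow> v \<in> V \<Longrightarrow> w \<in> space P \<Longrightarrow> arb u v w \<in> {0..1}"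
    and Fh: "\<And>u v w. u \<in> V \<Longrightarrow> v \<in> V \<Longrightarrow> Fh u v w = nn t \<eta> (\<lambda>u v. arb u v w) u v w"
    and Fm: "\<And>u v w. u \<in> V \<Longrightarrow> v \<in> V \<Longrightarrow> Fm u v w = mean (u, v) w"
    and tail: "prob {w \<in> space P. \<not> (\<forall>u\<in>V. \<forall>v\<in>V. \<bar>nn t \<eta> (\<lambda>u v. arb u v w) u v w - mean (u, v) w\<bar> \<le> b0)} \<le> \<delta>"
    and b: "b0 \<le> b"
  shows "1 - \<delta> \<le> prob {w \<in> space P. (MAX (u, v)\<in>V \<times> V. \<bar>Fh u v w - Fm u v w\<bar>) \<le> b}"
    and "mean_squared_error P n Fh Fm \<le> b\<^sup>2 + \<delta>" "0 \<le> mean_squared_error P n Fh Fm"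
proof -
  define G where "G = {w \<in> space P. \<forall>u\<in>V. \<forall>v\<in>V. \<bar>Fh u v w - Fm u v w\<bar> \<le> b}"
  have FhM: "Fh u v \<in> borel_measurable P" if "u \<in> V" "v \<in> V" for u v
    using nn_measurable[of "\<lambda>w u v. arb u v w" u v t \<eta>, OF arb(1)[OF that]] Fh[OF that] by (simp cong: measurable_cong)
  have "mean (u, v) \<in> borel_measurable P" if "u \<in> V" "v \<in> V" for u v
    by (rule measurable_info[OF empty_subsetI mean_info]) (use that in blast)
  then have FmM: "Fm u v \<in> borel_measurable P" if "u \<in> V" "v \<in> V" for u v
    using that Fm[OF that] by (simp cong: measurable_cong)
  have dM: "(\<lambda>w. \<bar>Fh u v w - Fm u v w\<bar>) \<in> borel_measurable P" if "u \<in> V" "v \<in> V" for u v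
    by (intro borel_measurable_abs borel_measurable_diff FhM FmM that)
  have GP: "{w \<in> space P. \<forall>u\<in>V. \<forall>v\<in>V. \<bar>Fh u v w - Fm u v w\<bar> \<le> a} \<in> sets P" for a
    by (intro sets.sets_Collect_finite_All finite_atLeastAtMost borel_measurable_le dM borel_measurable_const)
  note GP' = GP[of b, folded G_def]
  let ?G0 = "{w \<in> space P. \<forall>u\<in>V. \<forall>v\<in>V. \<bar>Fh u v w - Fm u v w\<bar> \<le> b0}"
  have cG: "space P - ?G0 = {w \<in> space P. \<not> (\<forall>u\<in>V. \<forall>v\<in>V. \<bar>nn t \<eta> (\<lambda>u v. arb u v w) u v w - mean (u, v) w\<bar> \<le> b0)}"
  proof -
    have "(\<forall>u\<in>V. \<forall>v\<in>V. \<bar>Fh u v w - Fm u v w\<bar> \<le> b0) = (\<forall>u\<in>V. \<forall>v\<in>V. \<bar>nn t \<eta> (\<lambda>u v. arb u v w) u v w - mean (u, v) w\<bar> \<le> b0)" for w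
      by (intro ball_cong refl) (simp only: Fh Fm)
    then show ?thesis by blast
  qed
  have "?G0 \<subseteq> G" unfolding G_def using b by (blast intro: order_trans)
  then have "prob (space P - G) \<le> prob (space P - ?G0)"
    by (intro finite_measure_mono sets.Diff sets.top GP) blast
  then have pG: "prob (space P - G) \<le> \<delta>" using tail unfolding cG by (rule order_trans)
  have "{w \<in> space P. (MAX (u, v)\<in>V \<times> V. \<bar>Fh u v w - Fm u v w\<bar>) \<le> b} = G"
    unfolding G_def
  proof (rule Collect_cong, rule conj_cong[OF refl])
    fix w
    have ball_pair: "(\<forall>x\<in>(\<lambda>(u, v). g u v) ` (V \<times> V). x \<le> b) = (\<forall>u\<in>V. \<forall>v\<in>V. g u v \<le> b)" for g :: "nat \<Rightarrow> nat \<Rightarrow> real"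
      by auto
    have "V \<times> V \<noteq> {}" using n_pos by auto
    then have "((MAX (u, v)\<in>V \<times> V. \<bar>Fh u v w - Fm u v w\<bar>) \<le> b) = (\<forall>x\<in>(\<lambda>(u, v). \<bar>Fh u v w - Fm u v w\<bar>) ` (V \<times> V). x \<le> b)"
      by (intro Max_le_iff finite_imageI finite_cartesian_product finite_atLeastAtMost) blast
    then show "((MAX (u, v)\<in>V \<times> V. \<bar>Fh u v w - Fm u v w\<bar>) \<le> b) = (\<forall>u\<in>V. \<forall>v\<in>V. \<bar>Fh u v w - Fm u v w\<bar> \<le> b)"
      by (simp only: ball_pair)
  qed
  then show "1 - \<delta> \<le> prob {w \<in> space P. (MAX (u, v)\<in>V \<times> V. \<bar>Fh u v w - Fm u v w\<bar>) \<le> b}"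
    using pG prob_compl[OF GP'] by simp
  let ?h = "\<lambda>w. \<Sum>u=1..n. \<Sum>v=1..n. (Fh u v w - Fm u v w)\<^sup>2"
  let ?k = "\<lambda>w. (real n)\<^sup>2 * (b\<^sup>2 + indicator (space P - G) w)"
  have one: "\<bar>Fh u v w - Fm u v w\<bar> \<le> 1" if uv: "u \<in> V" "v \<in> V" and w: "w \<in> space P" for u v w
  proof -
    have "Fh u v w \<in> {0..1}" unfolding Fh[OF uv] by (rule nn_range[where c = "\<lambda>u v. arb u v w", OF w arb(2)[OF uv w]])
    moreover have "Fm u v w \<in> {0..1}" unfolding Fm[OF uv] by (rule mean_range[OF _ w]) (use uv in blast)
    ultimately show ?thesis by (simp add: abs_le_iff)
  qed
  have hk: "?h w \<le> ?k w" if w: "w \<in> space P" for w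
  proof -
    have "?h w \<le> (\<Sum>u=1..n. \<Sum>v=1..n. b\<^sup>2 + indicator (space P - G) w)"
    proof (intro sum_mono)
      fix u v assume uv: "u \<in> V" "v \<in> V"
      show "(Fh u v w - Fm u v w)\<^sup>2 \<le> b\<^sup>2 + indicator (space P - G) w"
      proof (cases "w \<in> G")
        case True
        then have "\<bar>Fh u v w - Fm u v w\<bar> \<le> b" using uv unfolding G_def by blast
        from power_mono[OF this, of 2] show ?thesis by (simp add: add_increasing2)
      next
        case False
        have "(Fh u v w - Fm u v w)\<^sup>2 \<le> 1" using power_mono[OF one[OF uv w], of 2] by simp
        then show ?thesis using False w by (simp add: add_increasing)
      qed
    qed
    then show ?thesis by (simp add: power2_eq_square)
  qed
  have hM: "?h \<in> borel_measurable P"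
    by (intro borel_measurable_sum borel_measurable_power borel_measurable_diff FhM FmM) auto
  have h0: "0 \<le> ?h w" for w by (intro sum_nonneg) auto
  have i: "integrable P (indicator (space P - G) :: 'w \<Rightarrow> real)"
    by (rule integrable_bounded[of _ 1]) (use GP' in \<open>auto simp: indicator_def[abs_def]\<close>)
  have kM: "integrable P ?k"
    by (intro integrable_mult_right Bochner_Integration.integrable_add i) simp
  have hI: "integrable P ?h"
  proof (rule Bochner_Integration.integrable_bound[OF kM hM], rule AE_I2)
    fix w assume "w \<in> space P"
    from hk[OF this] h0[of w] show "norm (?h w) \<le> norm (?k w)" unfolding real_norm_def by linarith
  qed
  have "(\<integral>w. ?h w \<partial>P) \<le> (\<integral>w. ?k w \<partial>P)" by (rule integral_mono[OF hI kM hk])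
  also have "\<dots> = (real n)\<^sup>2 * (b\<^sup>2 + prob (space P - G))"
  proof -
    have "(\<integral>w. indicator (space P - G) w \<partial>P) = prob (space P - G)" by (simp add: Int_absorb2)
    then show ?thesis using i by (simp add: prob_space)
  qed
  also have "\<dots> \<le> (real n)\<^sup>2 * (b\<^sup>2 + \<delta>)" using pG by (intro mult_left_mono) auto
  finally have "(\<integral>w. ?h w \<partial>P) \<le> (real n)\<^sup>2 * (b\<^sup>2 + \<delta>)" .
  then show "mean_squared_error P n Fh Fm \<le> b\<^sup>2 + \<delta>"
    unfolding mean_squared_error_def using n_pos mult_left_mono[of _ _ "1 / (real n)\<^sup>2"] by fastforce
  show "0 \<le> mean_squared_error P n Fh Fm"
    unfolding mean_squared_error_def using Bochner_Integration.integral_nonneg[of P ?h, OF h0] by simp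
qed

end

section \<open>Probability of the exceptional event\<close>

context rank_model
begin

lemma q_clamp_measurable: "k \<in> {1..r} \<Longrightarrow> (\<lambda>x. q k (clamp01 x)) \<in> borel_measurable borel"
proof -
  assume k: "k \<in> {1..r}"
  have "K-lipschitz_on UNIV (\<lambda>x. q k (clamp01 x))"
  proof (rule lipschitz_onI)
    fix x y
    have "\<bar>q k (clamp01 x) - q k (clamp01 y)\<bar> \<le> K * \<bar>clamp01 x - clamp01 y\<bar>" by (rule q_lip[OF k clamp01_range clamp01_range])
    also have "\<dots> \<le> K * \<bar>x - y\<bar>" by (intro mult_left_mono clamp01_lipschitz K0)
    finally show "dist (q k (clamp01 x)) (q k (clamp01 y)) \<le> K * dist x y" by (simp add: dist_real_def)
  qed (rule K0)
  then show ?thesis by (intro borel_measurable_continuous_onI lipschitz_on_continuous_on)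
qed

lemma qq_info: "k \<in> {1..r} \<Longrightarrow> qq k i \<in> borel_measurable (info {})"
proof (cases "i \<in> V")
  case True
  assume k: "k \<in> {1..r}"
  have "(\<lambda>w. q k (clamp01 (\<theta> i w))) \<in> borel_measurable (info {})"
    by (rule measurable_compose[OF theta_info[OF True] q_clamp_measurable[OF k]])
  moreover have "q k (clamp01 (\<theta> i w)) = qq k i w" if "w \<in> space (info {})" for w
    using True clamp01_id[OF theta_range[OF True]] that by (simp add: qq_def)
  ultimately show ?thesis using measurable_cong[of "info {}" "\<lambda>w. q k (clamp01 (\<theta> i w))" "qq k i" borel] by blast
next
  case False
  then have "qq k i = (\<lambda>_. 0)" by (auto simp: qq_def fun_eq_iff)
  then show ?thesis by simp
qed

lemma orth_tail:
  fixes \<epsilon> :: real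
  assumes j: "j \<in> {1..r}" and k: "k \<in> {1..r}" and \<epsilon>: "0 \<le> \<epsilon>"
  defines "A \<equiv> {w \<in> space P. \<epsilon> * n < \<bar>(\<Sum>i\<in>V. q j (\<theta> i w) * q k (\<theta> i w)) - real n * (if j = k then 1 else 0)\<bar>}"
  shows "A \<in> sets P" "prob A \<le> 2 * exp (- (\<epsilon>\<^sup>2 * n / (2 * B ^ 4)))"
proof -
  let ?g = "\<lambda>x. q j (clamp01 x) * q k (clamp01 x)"
  have gm: "?g \<in> borel_measurable borel" using q_clamp_measurable[OF j] q_clamp_measurable[OF k] by measurable
  have gi: "integral\<^sup>L (lebesgue_on {0..1}) ?g = (if j = k then 1 else 0)"
    unfolding q_orth[OF j k, symmetric]
    by (rule Bochner_Integration.integral_cong) (auto simp: space_restrict_space clamp01_id)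
  have th: "(\<Sum>i\<in>V. ?g (\<theta> i w)) = (\<Sum>i\<in>V. q j (\<theta> i w) * q k (\<theta> i w))" if "w \<in> space P" for w
    by (rule sum.cong[OF refl]) (simp only: clamp01_id[OF theta_range[OF _ that]])
  let ?A = "{w \<in> space P. \<epsilon> * n \<le> \<bar>(\<Sum>i\<in>V. ?g (\<theta> i w)) - n * integral\<^sup>L (lebesgue_on {0..1}) ?g\<bar>}"
  have gP: "(\<lambda>w. \<Sum>i\<in>V. ?g (\<theta> i w)) \<in> borel_measurable P"
    by (intro borel_measurable_sum measurable_compose[OF theta_measurable gm])
  have A: "A = {w \<in> space P. \<epsilon> * n < \<bar>(\<Sum>i\<in>V. ?g (\<theta> i w)) - real n * (if j = k then 1 else 0)\<bar>}"
    unfolding A_def by (rule Collect_cong, rule conj_cong[OF refl]) (simp only: th)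
  show "A \<in> sets P" unfolding A using gP by measurable
  have "prob A \<le> prob ?A" unfolding A gi using gP by (intro finite_measure_mono) (auto, measurable)
  also have "\<dots> \<le> 2 * exp (- (\<epsilon> * n)\<^sup>2 / (2 * real n * (B * B)\<^sup>2))"
  proof (rule theta_hoeffding[OF gm])
    fix x :: real
    have "\<bar>q j (clamp01 x)\<bar> * \<bar>q k (clamp01 x)\<bar> \<le> B * B"
      by (intro mult_mono q_bound[OF j clamp01_range] q_bound[OF k clamp01_range]) (use B1 in auto)
    then show "\<bar>?g x\<bar> \<le> B * B" by (simp only: abs_mult)
  qed (use B1 \<epsilon> in auto)
  also have "- (\<epsilon> * n)\<^sup>2 / (2 * real n * (B * B)\<^sup>2) = - (\<epsilon>\<^sup>2 * n / (2 * B ^ 4))"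
    using n_pos B1 by (simp add: power2_eq_square power4_eq_xxxx field_simps)
  finally show "prob A \<le> 2 * exp (- (\<epsilon>\<^sup>2 * n / (2 * B ^ 4)))" .
qed

text \<open>A union bound over eight kinds of failure, with the parameters tuned so that each single
  failure has probability at most \<open>6 * exp (- L)\<close>. The factor
  \<open>(real n)\<^sup>2\<close> comes from the pairs of vertices.\<close>

lemma error_tail:
  fixes L D \<epsilon> \<eta> x0 :: real and t kk :: nat and arb :: "nat \<Rightarrow> nat \<Rightarrow> 'w \<Rightarrow> real"
  defines "m0 \<equiv> p * (real n / real (2 * kk))\<^sup>2 / 8" and "R \<equiv> p' * ((D / 4) ^ t * (D / 4) ^ (t + 1))"
  assumes D: "D = n * p / 4" "1 \<le> D" and eps: "0 \<le> \<epsilon>" "\<epsilon> \<le> 1/4"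
    and zeta: "\<And>s. s \<le> t \<Longrightarrow> L * B * sqrt (D * (2 * D) ^ s) \<le> \<epsilon> * ((D / 4) ^ s * D / 2)"
    and hi_p: "\<And>s. s \<le> t \<Longrightarrow> (2 * D) ^ s * (p / 4) \<le> 1"
    and ball_le: "(\<Sum>j\<le>t. (2 * D) ^ j) \<le> \<epsilon> * n"
    and deg_le: "(2 * D + 1) / (D / 4) ^ (t + 1) \<le> \<epsilon>"
    and eta: "0 < \<eta>" "\<epsilon> * C5 t \<le> \<eta> / 2"
    and kk: "0 < kk" "kk \<le> n" "r * \<Lambda> ^ (2 * t + 2) * K\<^sup>2 / (real kk)\<^sup>2 \<le> \<eta> / 4"
    and R: "1 \<le> R" "L \<le> \<epsilon> * sqrt R" and L0: "0 \<le> L"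
    and orthL: "L \<le> \<epsilon>\<^sup>2 * n / (2 * B ^ 4)" and gridL: "L \<le> n / (8 * (real kk)\<^sup>2)"
    and x0: "0 < x0" "x0 \<le> 2" and nearL: "L \<le> x0\<^sup>2 * m0 / 4"
  shows "prob {w \<in> space P. \<not> (\<forall>u\<in>V. \<forall>v\<in>V. \<bar>nn t \<eta> (\<lambda>u v. arb u v w) u v w - mean (u, v) w\<bar> \<le> x0 + C6 t * sqrt \<eta>)}
    \<le> (6 * real (t + 1) * real (r + 1) + 2 * (real r)\<^sup>2 + 11) * (real n)\<^sup>2 * exp (- L)"
proof -
  \<comment> \<open>\<open>D * (2 * D) ^ s\<close> bounds the variance of a level sum up to the
    factor \<open>B\<^sup>2\<close>, so \<open>\<zeta> s\<close> allows \<open>L\<close> standard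
    deviations. The Chernoff parameter for level sums is one over the standard deviation, which
    leaves \<open>exp 1 * exp (- L)\<close>.\<close>
  define \<zeta> where "\<zeta> = (\<lambda>s. L * B * sqrt (D * (2 * D) ^ s))"
  \<comment> \<open>The reciprocal of the guaranteed product of level sizes. Then
    \<open>R = p' / c\<close> is the expected number of observed entries between two levels of these
    sizes.\<close>
  define c where "c = 1 / ((D / 4) ^ t * (D / 4) ^ (t + 1))"
  let ?e = "exp (- L)"
  have e1: "exp (1::real) \<le> 3" by (rule exp_le)
  have e0: "0 < ?e" by simp
  have Dp: "0 < D" using D(2) by simp
  have npD: "n * (p / 4 * m) = D * m" for m by (simp add: D(1))
  have p'0: "0 < p'" by (rule p'_pos)
  have np1: "1 \<le> real n" using n_pos by simp
  have lo0: "0 < (D / 4) ^ t * (D / 4) ^ (t + 1)" using Dp by simp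
  have c0: "0 < c" using lo0 by (simp add: c_def)
  have m0: "0 < m0" unfolding m0_def using p_pos np1 kk(1) by simp
  have X: "1 \<le> D * (2 * D) ^ s" for s
  proof -
    have "1 * 1 \<le> D * (2 * D) ^ s" using D(2) by (intro mult_mono one_le_power) auto
    then show ?thesis by simp
  qed
  have sX: "1 \<le> sqrt (D * (2 * D) ^ s)" for s using X[of s] by simp
  have inv: "Y * (1 / sqrt Y)\<^sup>2 = 1" if "1 \<le> Y" for Y :: real using that by (simp add: power_divide)
  have tail1: "n * (p / 4 * (2 * D) ^ s) * (1 / sqrt (D * (2 * D) ^ s))\<^sup>2 = 1" for s
    by (simp only: npD inv[OF X])
  have canc: "1 / y * (L * B * y) = L * B" "1 / (B * y) * (L * B * y) = L" "1 / (B * y) * B = 1 / y" if "1 \<le> y" for y :: real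
    using that B1 by auto
  have Rc: "R = p' / c" by (simp add: R_def c_def)
  let ?S = "\<lambda>u s w. sphere_at (edges1 n (mk w)) u s"
  \<comment> \<open>The failures in order: not a breadth-first tree, level size, level sum, bilinear
    form, empirical orthogonality, grid occupation, number of close observed pairs, noise over near
    pairs.\<close>
  define B0 where "B0 = {w \<in> space P. \<not> (\<forall>u\<in>V. tr w u \<in> bfs_trees (edges1 n (mk w)) u)}"
  define B1 where "B1 = {w \<in> space P. \<exists>x\<in>V \<times> {..t}. real (card (?S (fst x) (snd x) w)) \<le> (2 * D) ^ snd x \<and>
    \<zeta> (snd x) < \<bar>size_dev (fst x) (snd x) (edges1 n (mk w))\<bar>}"
  define B2 where "B2 = {w \<in> space P. \<exists>x\<in>V \<times> {..t} \<times> {1..r}. real (card (?S (fst x) (fst (snd x)) w)) \<le> (2 * D) ^ fst (snd x) \<and>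
    \<zeta> (fst (snd x)) < \<bar>level_dev (fst x) (fst (snd x)) (qq (snd (snd x))) (edges1 n (mk w)) (tr w (fst x)) w\<bar>}"
  define B3 where "B3 = {w \<in> space P. \<exists>x\<in>V \<times> V. 1 \<le> c * (card (?S (fst x) t w) * card (?S (snd x) (t + 1) w)) \<and>
    \<epsilon> < \<bar>bil_dev (fst x) t (snd x) (t + 1) (mk w) (tr w) w\<bar>}"
  define B4 where "B4 = {w \<in> space P. \<exists>x\<in>{1..r} \<times> {1..r}. \<epsilon> * n < \<bar>(\<Sum>i\<in>V. q (fst x) (\<theta> i w) * q (snd x) (\<theta> i w)) - real n * (if fst x = snd x then 1 else 0)\<bar>}"
  define B5 where "B5 = {w \<in> space P. \<exists>j<kk. (\<Sum>i\<in>V. indicator {real j / kk..(real j + 1) / kk} (\<theta> i w)) \<le> real n / real (2 * kk)}"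
  define B6 where "B6 = {w \<in> space P. \<exists>x\<in>V \<times> V. (real n / real (2 * kk))\<^sup>2 \<le> close_count (1 / kk) (fst x) w * close_count (1 / kk) (snd x) w \<and>
    count3 (1 / kk) (fst x) (snd x) (mk w) w < m0}"
  define B7 where "B7 = {w \<in> space P. \<exists>x\<in>V \<times> V. m0 \<le> near_count t \<eta> (fst x) (snd x) (mk w) (tr w) w \<and>
    x0 * near_count t \<eta> (fst x) (snd x) (mk w) (tr w) w < \<bar>near_dev t \<eta> (fst x) (snd x) (mk w) (tr w) w\<bar>}"
  have b0: "B0 \<in> sets P" "prob B0 = 0" unfolding B0_def by (rule trees_AE)+
  have b1': "B1 \<in> sets P \<and> prob B1 \<le> real (card (V \<times> {..t})) * (6 * ?e)"
    unfolding B1_def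
  proof (rule union_bound)
    fix x assume "x \<in> V \<times> {..t}"
    then have u: "fst x \<in> V" by auto
    let ?X = "D * (2 * D) ^ snd x"
    show "{w \<in> space P. real (card (?S (fst x) (snd x) w)) \<le> (2 * D) ^ snd x \<and> \<zeta> (snd x) < \<bar>size_dev (fst x) (snd x) (edges1 n (mk w))\<bar>} \<in> sets P"
      by (rule ev_le_less[OF mk_fun[of "\<lambda>\<mu>. real (card (sphere_at (edges1 n \<mu>) (fst x) (snd x)))"] borel_measurable_const mk_fun[of "\<lambda>\<mu>. size_dev (fst x) (snd x) (edges1 n \<mu>)"]])
    have "prob {w \<in> space P. real (card (?S (fst x) (snd x) w)) \<le> (2 * D) ^ snd x \<and> \<zeta> (snd x) < \<bar>size_dev (fst x) (snd x) (edges1 n (mk w))\<bar>}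
      \<le> 2 * exp (n * (p / 4 * (2 * D) ^ snd x) * (1 / sqrt ?X)\<^sup>2) * exp (- (1 / sqrt ?X * \<zeta> (snd x)))"
      by (rule size_tail[OF u]) (use sX[of "snd x"] in \<open>auto simp: divide_le_eq\<close>)
    also have "\<dots> = 2 * exp 1 * exp (- (L * B))"
      by (simp only: tail1 \<zeta>_def canc[OF sX])
    also have "\<dots> \<le> 2 * 3 * ?e"
      using e1 mult_left_mono[OF B1 L0] by (intro mult_mono) auto
    finally show "prob {w \<in> space P. real (card (?S (fst x) (snd x) w)) \<le> (2 * D) ^ snd x \<and> \<zeta> (snd x) < \<bar>size_dev (fst x) (snd x) (edges1 n (mk w))\<bar>} \<le> 6 * ?e" by simp
  qed auto
  note b1 = conjunct1[OF b1'] conjunct2[OF b1']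
  have b2': "B2 \<in> sets P \<and> prob B2 \<le> real (card (V \<times> {..t} \<times> {1..r})) * (6 * ?e)"
    unfolding B2_def
  proof (rule union_bound)
    fix x assume "x \<in> V \<times> {..t} \<times> {1..r}"
    then have u: "fst x \<in> V" and k: "snd (snd x) \<in> {1..r}" by auto
    let ?s = "fst (snd x)"
    let ?X = "D * (2 * D) ^ ?s"
    have qb: "bdd (qq (snd (snd x)) i)" for i by (rule bddI[OF qq_bound[OF k]])
    show "{w \<in> space P. real (card (?S (fst x) ?s w)) \<le> (2 * D) ^ ?s \<and> \<zeta> ?s < \<bar>level_dev (fst x) ?s (qq (snd (snd x))) (edges1 n (mk w)) (tr w (fst x)) w\<bar>} \<in> sets P"
      by (rule ev_le_less[OF mk_fun[of "\<lambda>\<mu>. real (card (sphere_at (edges1 n \<mu>) (fst x) ?s))"] borel_measurable_const level_dev_P(1)[OF qq_info[OF k] qb]])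
    have "prob {w \<in> space P. real (card (?S (fst x) ?s w)) \<le> (2 * D) ^ ?s \<and> \<zeta> ?s < \<bar>level_dev (fst x) ?s (qq (snd (snd x))) (edges1 n (mk w)) (tr w (fst x)) w\<bar>}
      \<le> 2 * exp (n * (p / 4 * (2 * D) ^ ?s) * (1 / (B * sqrt ?X) * B)\<^sup>2) * exp (- (1 / (B * sqrt ?X) * \<zeta> ?s))"
      by (rule level_tail[OF u qq_info[OF k] qq_bound[OF k]]) (use sX[of ?s] B1 in \<open>auto simp: divide_le_eq\<close>)
    also have "\<dots> = 2 * exp 1 * ?e"
      by (simp only: tail1 \<zeta>_def canc[OF sX])
    also have "\<dots> \<le> 2 * 3 * ?e" using e1 by (intro mult_mono) auto
    finally show "prob {w \<in> space P. real (card (?S (fst x) ?s w)) \<le> (2 * D) ^ ?s \<and> \<zeta> ?s < \<bar>level_dev (fst x) ?s (qq (snd (snd x))) (edges1 n (mk w)) (tr w (fst x)) w\<bar>} \<le> 6 * ?e" by simp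
  qed auto
  note b2 = conjunct1[OF b2'] conjunct2[OF b2']
  have bilP: "(\<lambda>w. bil_dev u t v (t + 1) (mk w) (tr w) w) \<in> borel_measurable P" for u v
    by (rule mk_tr_measurable[of "\<lambda>\<mu> \<tau>. bil_dev u t v (t + 1) \<mu> \<tau>"], rule measurable_info[OF order.refl bil_dev_info])
  have b3': "B3 \<in> sets P \<and> prob B3 \<le> real (card (V \<times> V)) * (6 * ?e)"
    unfolding B3_def
  proof (rule union_bound)
    fix x assume "x \<in> V \<times> V"
    then have u: "fst x \<in> V" and v: "snd x \<in> V" by auto
    show "{w \<in> space P. 1 \<le> c * (card (?S (fst x) t w) * card (?S (snd x) (t + 1) w)) \<and> \<epsilon> < \<bar>bil_dev (fst x) t (snd x) (t + 1) (mk w) (tr w) w\<bar>} \<in> sets P"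
      by (rule ev_ge_less[OF mk_fun[of "\<lambda>\<mu>. c * (card (sphere_at (edges1 n \<mu>) (fst x) t) * card (sphere_at (edges1 n \<mu>) (snd x) (t + 1)))"] borel_measurable_const bilP])
    have cp: "c \<le> p'" using R(1) c0 by (simp add: Rc le_divide_eq)
    have sc: "sqrt R * c \<le> p'"
    proof -
      have "sqrt R * c \<le> R * c" using R(1) c0 by (intro mult_right_mono) (auto simp: real_sqrt_le_iff intro!: real_le_lsqrt self_le_power)
      then show ?thesis using c0 by (simp add: Rc)
    qed
    \<comment> \<open>With \<open>\<sigma> = sqrt R\<close> the variance term is exactly 1, and the
      tail is governed by \<open>sqrt R * \<epsilon> \<ge> L\<close>.\<close>
    have "prob {w \<in> space P. 1 \<le> c * (card (?S (fst x) t w) * card (?S (snd x) (t + 1) w)) \<and> \<epsilon> < \<bar>bil_dev (fst x) t (snd x) (t + 1) (mk w) (tr w) w\<bar>}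
      \<le> 2 * exp ((sqrt R)\<^sup>2 * c / p') * exp (- (sqrt R * \<epsilon>))"
      by (rule bil_tail[OF u v _ _ sc]) (use c0 R(1) in auto)
    also have "(sqrt R)\<^sup>2 * c / p' = 1" using R(1) c0 p'0 by (simp add: Rc)
    also have "2 * exp 1 * exp (- (sqrt R * \<epsilon>)) \<le> 2 * 3 * ?e" using e1 R(2) by (intro mult_mono) (auto simp: mult.commute)
    finally show "prob {w \<in> space P. 1 \<le> c * (card (?S (fst x) t w) * card (?S (snd x) (t + 1) w)) \<and> \<epsilon> < \<bar>bil_dev (fst x) t (snd x) (t + 1) (mk w) (tr w) w\<bar>} \<le> 6 * ?e" by simp
  qed auto
  note b3 = conjunct1[OF b3'] conjunct2[OF b3']
  have b4': "B4 \<in> sets P \<and> prob B4 \<le> real (card ({1..r} \<times> {1..r})) * (2 * ?e)"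
    unfolding B4_def
  proof (rule union_bound)
    fix x assume "x \<in> {1..r} \<times> {1..r}"
    then have j: "fst x \<in> {1..r}" and k: "snd x \<in> {1..r}" by auto
    show "{w \<in> space P. \<epsilon> * n < \<bar>(\<Sum>i\<in>V. q (fst x) (\<theta> i w) * q (snd x) (\<theta> i w)) - real n * (if fst x = snd x then 1 else 0)\<bar>} \<in> sets P"
      by (rule orth_tail(1)[OF j k eps(1)])
    have "2 * exp (- (\<epsilon>\<^sup>2 * n / (2 * B ^ 4))) \<le> 2 * ?e" using orthL by simp
    then show "prob {w \<in> space P. \<epsilon> * n < \<bar>(\<Sum>i\<in>V. q (fst x) (\<theta> i w) * q (snd x) (\<theta> i w)) - real n * (if fst x = snd x then 1 else 0)\<bar>} \<le> 2 * ?e"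
      by (rule order_trans[OF orth_tail(2)[OF j k eps(1)]])
  qed auto
  note b4 = conjunct1[OF b4'] conjunct2[OF b4']
  have b5: "B5 \<in> sets P" "prob B5 \<le> real kk * (2 * ?e)"
  proof -
    have "(\<lambda>w. \<Sum>i\<in>V. indicator {real j / kk..(real j + 1) / kk} (\<theta> i w) :: real) \<in> borel_measurable P" for j
      by (intro borel_measurable_sum measurable_compose[OF theta_measurable] borel_measurable_indicator) auto
    then show "B5 \<in> sets P" unfolding B5_def by measurable
    have "prob B5 \<le> real kk * (2 * exp (- (n / (8 * (real kk)\<^sup>2))))" unfolding B5_def by (rule grid_count[OF kk(1)])
    also have "\<dots> \<le> real kk * (2 * ?e)" using gridL by (intro mult_left_mono) auto
    finally show "prob B5 \<le> real kk * (2 * ?e)" .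
  qed
  \<comment> \<open>\<open>m0\<close> is half of the exponent \<open>p * q / 4\<close> in
    \<open>count_tail\<close>, so the tail there is \<open>exp (- m0)\<close>. The bound on
    \<open>L\<close> follows from the near condition because
    \<open>x0\<^sup>2 / 4 \<le> 1\<close>.\<close>
  have Lm0: "L \<le> m0"
  proof -
    have "x0\<^sup>2 \<le> 2\<^sup>2" using x0 by (intro power_mono) auto
    then have "x0\<^sup>2 * m0 \<le> 2\<^sup>2 * m0" using m0 by (intro mult_right_mono) auto
    then show ?thesis using nearL by simp
  qed
  have b6': "B6 \<in> sets P \<and> prob B6 \<le> real (card (V \<times> V)) * (1 * ?e)"
    unfolding B6_def
  proof (rule union_bound)
    fix x assume "x \<in> V \<times> V"
    then have u: "fst x \<in> V" and v: "snd x \<in> V" by auto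
    have c3: "(\<lambda>w. count3 (1 / kk) (fst x) (snd x) (mk w) w) \<in> borel_measurable P"
      by (rule mk_tr_measurable[of "\<lambda>\<mu> \<tau>. count3 (1 / kk) (fst x) (snd x) \<mu>"], rule measurable_info[OF order.refl count3_info[OF u v]])
    show "{w \<in> space P. (real n / real (2 * kk))\<^sup>2 \<le> close_count (1 / kk) (fst x) w * close_count (1 / kk) (snd x) w \<and> count3 (1 / kk) (fst x) (snd x) (mk w) w < m0} \<in> sets P"
      by (rule ev_count[OF measurable_info[OF empty_subsetI close_count_info[OF u]] measurable_info[OF empty_subsetI close_count_info[OF v]] c3])
    have "m0 - p * (real n / real (2 * kk))\<^sup>2 / 4 \<le> - L" using Lm0 by (simp add: m0_def)
    then have "exp (m0 - p * (real n / real (2 * kk))\<^sup>2 / 4) \<le> 1 * ?e" by simp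
    then show "prob {w \<in> space P. (real n / real (2 * kk))\<^sup>2 \<le> close_count (1 / kk) (fst x) w * close_count (1 / kk) (snd x) w \<and> count3 (1 / kk) (fst x) (snd x) (mk w) w < m0} \<le> 1 * ?e"
      by (rule order_trans[OF count_tail[OF u v]])
  qed auto
  note b6 = conjunct1[OF b6'] conjunct2[OF b6']
  have b7': "B7 \<in> sets P \<and> prob B7 \<le> real (card (V \<times> V)) * (2 * ?e)"
    unfolding B7_def
  proof (rule union_bound)
    fix x
    show "{w \<in> space P. m0 \<le> near_count t \<eta> (fst x) (snd x) (mk w) (tr w) w \<and> x0 * near_count t \<eta> (fst x) (snd x) (mk w) (tr w) w < \<bar>near_dev t \<eta> (fst x) (snd x) (mk w) (tr w) w\<bar>} \<in> sets P"
      by (rule ev_near[OF near_P(2) borel_measurable_const near_P(1)])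
    have "2 * exp (- (x0\<^sup>2 * m0 / 4)) \<le> 2 * ?e" using nearL by simp
    then show "prob {w \<in> space P. m0 \<le> near_count t \<eta> (fst x) (snd x) (mk w) (tr w) w \<and> x0 * near_count t \<eta> (fst x) (snd x) (mk w) (tr w) w < \<bar>near_dev t \<eta> (fst x) (snd x) (mk w) (tr w) w\<bar>} \<le> 2 * ?e"
      by (rule order_trans[OF near_tail[OF x0]])
  qed auto
  note b7 = conjunct1[OF b7'] conjunct2[OF b7']
  let ?Bad = "B0 \<union> B1 \<union> B2 \<union> B3 \<union> B4 \<union> B5 \<union> B6 \<union> B7"
  \<comment> \<open>At an outcome outside all failures the assumptions of \<open>good_sample\<close>
    hold, so \<open>estimate_error\<close> excludes an error above the bound.\<close>
  have sub: "{w \<in> space P. \<not> (\<forall>u\<in>V. \<forall>v\<in>V. \<bar>nn t \<eta> (\<lambda>u v. arb u v w) u v w - mean (u, v) w\<bar> \<le> x0 + C6 t * sqrt \<eta>)} \<subseteq> ?Bad"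
  proof (rule subsetI, rule ccontr)
    fix w assume "w \<in> {w \<in> space P. \<not> (\<forall>u\<in>V. \<forall>v\<in>V. \<bar>nn t \<eta> (\<lambda>u v. arb u v w) u v w - mean (u, v) w\<bar> \<le> x0 + C6 t * sqrt \<eta>)}"
      and nb: "w \<notin> ?Bad"
    then have w: "w \<in> space P" and bad: "\<not> (\<forall>u\<in>V. \<forall>v\<in>V. \<bar>nn t \<eta> (\<lambda>u v. arb u v w) u v w - mean (u, v) w\<bar> \<le> x0 + C6 t * sqrt \<eta>)" by blast+
    have n: "w \<notin> B0" "w \<notin> B1" "w \<notin> B2" "w \<notin> B3" "w \<notin> B4" "w \<notin> B5" "w \<notin> B6" "w \<notin> B7" using nb by blast+
    have "good_sample P n f p \<theta> Z mrk T f' r lam q B K \<Lambda> l w t D \<epsilon> \<eta> x0 m0 \<zeta> kk"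
    proof unfold_locales
      show "w \<in> space P" by (rule w)
      show "u \<in> V \<Longrightarrow> tr w u \<in> bfs_trees (edges1 n (mk w)) u" for u using n(1) w unfolding B0_def by blast
      show "\<bar>size_dev u s (edges1 n (mk w))\<bar> \<le> \<zeta> s" if "u \<in> V" "s \<le> t" "real (card (?S u s w)) \<le> (2 * D) ^ s" for u s
      proof -
        have "(u, s) \<in> V \<times> {..t}" using that by blast
        then have "\<not> (real (card (?S (fst (u, s)) (snd (u, s)) w)) \<le> (2 * D) ^ snd (u, s) \<and> \<zeta> (snd (u, s)) < \<bar>size_dev (fst (u, s)) (snd (u, s)) (edges1 n (mk w))\<bar>)"
          using n(2) w unfolding B1_def by blast
        then show ?thesis using that(3) by (simp only: fst_conv snd_conv not_less de_Morgan_conj) blast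
      qed
      show "\<bar>level_dev u s (qq k) (edges1 n (mk w)) (tr w u) w\<bar> \<le> \<zeta> s" if "u \<in> V" "s \<le> t" "k \<in> {1..r}" "real (card (?S u s w)) \<le> (2 * D) ^ s" for u s k
      proof -
        have "(u, s, k) \<in> V \<times> {..t} \<times> {1..r}" using that by blast
        then have "\<not> (real (card (?S (fst (u, s, k)) (fst (snd (u, s, k))) w)) \<le> (2 * D) ^ fst (snd (u, s, k)) \<and>
            \<zeta> (fst (snd (u, s, k))) < \<bar>level_dev (fst (u, s, k)) (fst (snd (u, s, k))) (qq (snd (snd (u, s, k)))) (edges1 n (mk w)) (tr w (fst (u, s, k))) w\<bar>)"
          using n(3) w unfolding B2_def by blast
        then show ?thesis using that(4) by (simp only: fst_conv snd_conv not_less de_Morgan_conj) blast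
      qed
      show "\<bar>(\<Sum>i\<in>V. q j (\<theta> i w) * q k (\<theta> i w)) - real n * (if j = k then 1 else 0)\<bar> \<le> \<epsilon> * n" if "j \<in> {1..r}" "k \<in> {1..r}" for j k
      proof -
        have "(j, k) \<in> {1..r} \<times> {1..r}" using that by blast
        then have "\<not> \<epsilon> * n < \<bar>(\<Sum>i\<in>V. q (fst (j, k)) (\<theta> i w) * q (snd (j, k)) (\<theta> i w)) - real n * (if fst (j, k) = snd (j, k) then 1 else 0)\<bar>"
          using n(5) w unfolding B4_def by blast
        then show ?thesis by (simp only: fst_conv snd_conv not_less)
      qed
      show "\<bar>bil_dev u t v (t + 1) (mk w) (tr w) w\<bar> \<le> \<epsilon>"
        if "u \<in> V" "v \<in> V" "(D / 4) ^ t * (D / 4) ^ (t + 1) \<le> real (card (?S u t w) * card (?S v (t + 1) w))" for u v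
      proof -
        have "(u, v) \<in> V \<times> V" using that by blast
        then have "\<not> (1 \<le> c * (card (?S (fst (u, v)) t w) * card (?S (snd (u, v)) (t + 1) w)) \<and> \<epsilon> < \<bar>bil_dev (fst (u, v)) t (snd (u, v)) (t + 1) (mk w) (tr w) w\<bar>)"
          using n(4) w unfolding B3_def by blast
        moreover have "1 \<le> c * (card (?S u t w) * card (?S v (t + 1) w))" using that(3) lo0 by (simp add: c_def le_divide_eq)
        ultimately show ?thesis by (simp only: fst_conv snd_conv not_less de_Morgan_conj) blast
      qed
      show "\<bar>near_dev t \<eta> u v (mk w) (tr w) w\<bar> \<le> x0 * near_count t \<eta> u v (mk w) (tr w) w"
        if "u \<in> V" "v \<in> V" "m0 \<le> near_count t \<eta> u v (mk w) (tr w) w" for u v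
      proof -
        have "(u, v) \<in> V \<times> V" using that by blast
        then have "\<not> (m0 \<le> near_count t \<eta> (fst (u, v)) (snd (u, v)) (mk w) (tr w) w \<and>
            x0 * near_count t \<eta> (fst (u, v)) (snd (u, v)) (mk w) (tr w) w < \<bar>near_dev t \<eta> (fst (u, v)) (snd (u, v)) (mk w) (tr w) w\<bar>)"
          using n(8) w unfolding B7_def by blast
        then show ?thesis using that(3) by (simp only: fst_conv snd_conv not_less de_Morgan_conj) blast
      qed
      show "m0 \<le> count3 (1 / kk) u v (mk w) w"
        if "u \<in> V" "v \<in> V" "(real n / real (2 * kk))\<^sup>2 \<le> close_count (1 / kk) u w * close_count (1 / kk) v w" for u v
      proof -
        have "(u, v) \<in> V \<times> V" using that by blast
        then have "\<not> ((real n / real (2 * kk))\<^sup>2 \<le> close_count (1 / kk) (fst (u, v)) w * close_count (1 / kk) (snd (u, v)) w \<and>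
            count3 (1 / kk) (fst (u, v)) (snd (u, v)) (mk w) w < m0)"
          using n(7) w unfolding B6_def by blast
        then show ?thesis using that(3) by (simp only: fst_conv snd_conv not_less de_Morgan_conj) blast
      qed
      show "real n / real (2 * kk) \<le> (\<Sum>i\<in>V. indicator {real j / kk..(real j + 1) / kk} (\<theta> i w))" if "j < kk" for j
      proof (rule ccontr)
        assume "\<not> real n / real (2 * kk) \<le> (\<Sum>i\<in>V. indicator {real j / kk..(real j + 1) / kk} (\<theta> i w))"
        then have le: "(\<Sum>i\<in>V. indicator {real j / kk..(real j + 1) / kk} (\<theta> i w)) \<le> real n / real (2 * kk)" by (rule less_imp_le[OF not_le_imp_less])
        have "w \<in> B5" unfolding B5_def by (rule CollectI, rule conjI[OF w], rule exI[of _ j], rule conjI[OF that le])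
        with n(6) show False by (rule notE)
      qed
    qed (unfold \<zeta>_def, (rule D(1) Dp eps(1) eps(2) ball_le deg_le eta(1) eta(2) kk(1) kk(3) m0 | (rule zeta hi_p, assumption))+)
    then interpret g: good_sample P n f p \<theta> Z mrk T f' r lam q B K \<Lambda> l w t D \<epsilon> \<eta> x0 m0 \<zeta> kk .
    show False using bad g.estimate_error unfolding nn_def by blast
  qed
  have "prob {w \<in> space P. \<not> (\<forall>u\<in>V. \<forall>v\<in>V. \<bar>nn t \<eta> (\<lambda>u v. arb u v w) u v w - mean (u, v) w\<bar> \<le> x0 + C6 t * sqrt \<eta>)} \<le> prob ?Bad"
    by (rule finite_measure_mono[OF sub]) (intro sets.Un b0 b1 b2 b3 b4 b5 b6 b7)
  also have "\<dots> \<le> prob B0 + prob B1 + prob B2 + prob B3 + prob B4 + prob B5 + prob B6 + prob B7"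
    by (intro order_trans[OF measure_Un_le] add_mono order.refl sets.Un b0(1) b1(1) b2(1) b3(1) b4(1) b5(1) b6(1) b7(1))
  also have "\<dots> \<le> 0 + real (card (V \<times> {..t})) * (6 * ?e) + real (card (V \<times> {..t} \<times> {1..r})) * (6 * ?e) + real (card (V \<times> V)) * (6 * ?e)
      + real (card ({1..r} \<times> {1..r})) * (2 * ?e) + real kk * (2 * ?e) + real (card (V \<times> V)) * (1 * ?e) + real (card (V \<times> V)) * (2 * ?e)"
    using b0(2) b1(2) b2(2) b3(2) b4(2) b5(2) b6(2) b7(2) by linarith
  also have "\<dots> = (6 * real (t + 1) * real (r + 1) * real n + 2 * (real r)\<^sup>2 * 1 + 2 * real kk + 9 * (real n)\<^sup>2) * ?e"
    by (simp add: card_cartesian_product power2_eq_square algebra_simps)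
  also have "\<dots> \<le> (6 * real (t + 1) * real (r + 1) * (real n)\<^sup>2 + 2 * (real r)\<^sup>2 * (real n)\<^sup>2 + 2 * (real n)\<^sup>2 + 9 * (real n)\<^sup>2) * ?e"
  proof -
    have n2: "real n \<le> (real n)\<^sup>2" "1 \<le> (real n)\<^sup>2" using np1 by (auto intro: self_le_power)
    have "real kk \<le> (real n)\<^sup>2" using kk(2) n2 by linarith
    then show ?thesis using n2 by (intro mult_right_mono add_mono mult_left_mono) auto
  qed
  also have "\<dots> = (6 * real (t + 1) * real (r + 1) + 2 * (real r)\<^sup>2 + 11) * (real n)\<^sup>2 * exp (- L)" by (simp add: algebra_simps)
  finally show ?thesis .
qed

end

section \<open>Choice of the parameters\<close>

lemma eventually_small:
  fixes a c e :: real
  assumes "0 < e" "0 < c" shows "eventually (\<lambda>n. a * real n powr (- e) \<le> c) sequentially"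
proof -
  have "(\<lambda>n. a * real n powr (- e)) \<longlonglongrightarrow> 0" using assms(1) by real_asymp
  from order_tendstoD(2)[OF this assms(2)] show ?thesis by (rule eventually_mono) simp
qed

lemma eventually_large:
  fixes a c e :: real
  assumes "0 < e" "0 < c" shows "eventually (\<lambda>n. a \<le> c * real n powr e) sequentially"
proof -
  have "filterlim (\<lambda>n. c * real n powr e) at_top sequentially" using assms by real_asymp
  then show ?thesis by (simp add: filterlim_at_top)
qed

lemma eventually_tail:
  fixes C a b :: real
  assumes "0 < a" "0 < b"
  shows "eventually (\<lambda>n. C * (real n)\<^sup>2 * exp (- (real n powr a)) \<le> real n powr (- b)) sequentially"
proof -
  have "(\<lambda>n. C * (real n)\<^sup>2 * exp (- (real n powr a)) * real n powr b) \<longlonglongrightarrow> 0" using assms by real_asymp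
  from order_tendstoD(2)[OF this zero_less_one] eventually_ge_at_top[of 1] show ?thesis
  proof eventually_elim
    case (elim n)
    then have "C * (real n)\<^sup>2 * exp (- (real n powr a)) < 1 / real n powr b" by (simp add: less_divide_eq)
    then show ?case by (simp add: powr_minus_divide)
  qed
qed

text \<open>The hypotheses of \<open>error_tail\<close>, with \<open>C\<close> for
  \<open>C5 t\<close> and \<open>A\<close> for
  \<open>r * \<Lambda> ^ (2 * t + 2) * K\<^sup>2\<close>. The quantities \<open>D\<close>,
  \<open>\<epsilon>\<close> and \<open>kk\<close>, internal to the proof, are hidden by the
  quantifier.\<close>

definition parameters_ok :: "nat \<Rightarrow> real \<Rightarrow> real \<Rightarrow> real \<Rightarrow> nat \<Rightarrow> real \<Rightarrow> real \<Rightarrow> real \<Rightarrow> real \<Rightarrow> real \<Rightarrow> bool" where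
  "parameters_ok t B C A n \<eta> p p' L x0 \<longleftrightarrow> (\<exists>D \<epsilon> kk. D = n * p / 4 \<and> 1 \<le> D \<and> 0 \<le> \<epsilon> \<and> \<epsilon> \<le> 1/4 \<and>
      (\<forall>s\<le>t. L * B * sqrt (D * (2 * D) ^ s) \<le> \<epsilon> * ((D / 4) ^ s * D / 2)) \<and>
      (\<forall>s\<le>t. (2 * D) ^ s * (p / 4) \<le> 1) \<and>
      (\<Sum>j\<le>t. (2 * D) ^ j) \<le> \<epsilon> * n \<and>
      (2 * D + 1) / (D / 4) ^ (t + 1) \<le> \<epsilon> \<and>
      0 < \<eta> \<and> \<epsilon> * C \<le> \<eta> / 2 \<and>
      0 < kk \<and> kk \<le> n \<and> A / (real kk)\<^sup>2 \<le> \<eta> / 4 \<and>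
      1 \<le> p' * ((D / 4) ^ t * (D / 4) ^ (t + 1)) \<and> L \<le> \<epsilon> * sqrt (p' * ((D / 4) ^ t * (D / 4) ^ (t + 1))) \<and>
      L \<le> \<epsilon>\<^sup>2 * n / (2 * B ^ 4) \<and> L \<le> n / (8 * (real kk)\<^sup>2) \<and>
      0 \<le> L \<and> 0 < x0 \<and> x0 \<le> 2 \<and>
      L \<le> x0\<^sup>2 * (p * (real n / real (2 * kk))\<^sup>2 / 8) / 4)"

text \<open>The orders are n^kappa for \<open>D\<close>, n^(-delta) with delta = kappa/2 - rho/4 for
  \<open>\<epsilon>\<close>, and n^(kappa/4) for \<open>kk\<close>. The exponent delta is dictated
  by noise: \<open>\<epsilon> * sqrt D\<close> must be of order \<open>L\<close>. Then
  \<open>\<epsilon>\<close> is smaller than \<open>\<eta>\<close> by a factor of order n^(-rho/4),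
  which beats any constant, and the squared cell width n^(-kappa/2) is also negligible against
  \<open>\<eta>\<close>.\<close>

lemma eventually_parameters:
  fixes \<kappa> \<rho> c1 B A C :: real and t :: nat
  assumes \<kappa>: "0 < \<rho>" "\<rho> < \<kappa>" "\<kappa> < 1/2" and t: "1 \<le> t" "\<kappa> * (t + 1) \<le> 1" "1 \<le> \<kappa> * (2 * t + 1)"
    and B: "1 \<le> B" and c1: "0 < c1" and A: "0 \<le> A"
  shows "eventually (\<lambda>n. \<forall>\<eta> p p' L x0 :: real. p = real n powr (-1 + \<kappa>) \<longrightarrow> p / 4 \<le> p' \<longrightarrow> c1 * real n powr (-(1/2) * (\<kappa> - \<rho>)) \<le> \<eta> \<longrightarrow>
    L = real n powr (\<rho> / 4) \<longrightarrow> x0 = real n powr (-(1/4) * (\<kappa> - \<rho>)) \<longrightarrow>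
    parameters_ok t B C A n \<eta> p p' L x0) sequentially"
proof -
  define \<delta> where "\<delta> = \<kappa> / 2 - \<rho> / 4"
  \<comment> \<open>Two demands on the constant of \<open>\<epsilon>\<close>: the ratio
    \<open>8 ^ t\<close> of the upper to the lower size bound in \<open>zeta\<close>, and the powers
    of 4 lost in \<open>LR\<close>.\<close>
  define c where "c = 4 * B * 8 ^ t + 2 * 4 ^ (2 * t + 1)"
  have c0: "0 < c" "4 * B * 8 ^ t \<le> c" "2 * 4 ^ (2 * t + 1) \<le> c" using B by (simp_all add: c_def add_pos_pos)
  have \<delta>0: "0 < \<delta>" "0 < \<kappa> - \<delta>" using \<kappa> by (simp_all add: \<delta>_def)
  have k0: "0 < \<kappa>" using \<kappa> by simp
  \<comment> \<open>Each of these limits compares two powers of \<open>n\<close>. Their exponents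
    are positive because 0 < rho < kappa < 1/2.\<close>
  have ev0: "eventually (\<lambda>n. 1 \<le> 1/4 * real n powr (\<kappa>)) sequentially"
    by (rule eventually_large) (use \<kappa> \<delta>0 c0 c1 B in \<open>simp_all add: zero_less_divide_iff zero_less_mult_iff\<close>)
  have ev1: "eventually (\<lambda>n. (c) * real n powr (- (\<delta>)) \<le> 1/4) sequentially"
    by (rule eventually_small) (use \<kappa> \<delta>0 c0 c1 B in \<open>simp_all add: zero_less_divide_iff zero_less_mult_iff\<close>)
  have ev2: "eventually (\<lambda>n. (real t + 1) * real n powr (- (\<kappa> - \<delta>)) \<le> c) sequentially"
    by (rule eventually_small) (use \<kappa> \<delta>0 c0 c1 B in \<open>simp_all add: zero_less_divide_iff zero_less_mult_iff\<close>)
  have ev3: "eventually (\<lambda>n. (12 * 4 ^ (t + 1)) * real n powr (- (\<kappa> - \<delta>)) \<le> c) sequentially"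
    by (rule eventually_small) (use \<kappa> \<delta>0 c0 c1 B in \<open>simp_all add: zero_less_divide_iff zero_less_mult_iff\<close>)
  have ev4: "eventually (\<lambda>n. (c * C) * real n powr (- (\<rho> / 4)) \<le> c1 / 2) sequentially"
    by (rule eventually_small) (use \<kappa> \<delta>0 c0 c1 B in \<open>simp_all add: zero_less_divide_iff zero_less_mult_iff\<close>)
  have ev5: "eventually (\<lambda>n. (A) * real n powr (- (\<rho> / 2)) \<le> c1 / 4) sequentially"
    by (rule eventually_small) (use \<kappa> \<delta>0 c0 c1 B in \<open>simp_all add: zero_less_divide_iff zero_less_mult_iff\<close>)
  have ev6: "eventually (\<lambda>n. (2) * real n powr (- (1 - \<kappa> / 4)) \<le> 1) sequentially"
    by (rule eventually_small) (use \<kappa> \<delta>0 c0 c1 B in \<open>simp_all add: zero_less_divide_iff zero_less_mult_iff\<close>)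
  have ev7: "eventually (\<lambda>n. 1 \<le> 1 / (4 * 16 ^ (2 * t + 1)) * real n powr (\<kappa>)) sequentially"
    by (rule eventually_large) (use \<kappa> \<delta>0 c0 c1 B in \<open>simp_all add: zero_less_divide_iff zero_less_mult_iff\<close>)
  have ev8: "eventually (\<lambda>n. 1 \<le> c\<^sup>2 / (2 * B ^ 4) * real n powr (1 - \<kappa> + \<rho> / 4)) sequentially"
    by (rule eventually_large) (use \<kappa> \<delta>0 c0 c1 B in \<open>simp_all add: zero_less_divide_iff zero_less_mult_iff\<close>)
  have ev9: "eventually (\<lambda>n. 1 \<le> 1 / 32 * real n powr (1 - \<kappa> / 2 - \<rho> / 4)) sequentially"
    by (rule eventually_large) (use \<kappa> \<delta>0 c0 c1 B in \<open>simp_all add: zero_less_divide_iff zero_less_mult_iff\<close>)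
  have ev10: "eventually (\<lambda>n. 1 \<le> 1 / 512 * real n powr (1 + \<rho> / 4)) sequentially"
    by (rule eventually_large) (use \<kappa> \<delta>0 c0 c1 B in \<open>simp_all add: zero_less_divide_iff zero_less_mult_iff\<close>)
  show ?thesis
    using eventually_ge_at_top[of "1::nat"] ev0 ev1 ev2 ev3 ev4 ev5 ev6 ev7 ev8 ev9 ev10
  proof eventually_elim
    case (elim n)
    let ?x = "real n"
    have x1: "1 \<le> ?x" and x0: "0 < ?x" and n0 [simp]: "0 < n" using elim(1) by simp_all
    have pw: "?x powr a * ?x powr b = ?x powr (a + b)" for a b by (simp add: powr_add)
    have pn: "?x * ?x powr a = ?x powr (1 + a)" for a using x0 by (simp add: powr_add)
    have mono: "?x powr a \<le> ?x powr b" if "a \<le> b" for a b using x1 that by (rule powr_mono[rotated])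
    have pos: "0 < ?x powr a" for a using x0 by simp
    have scale: "a * ?x powr e' \<le> b * ?x powr f" if "a * ?x powr (- e) \<le> b" "e' = f - e" for a b e e' f
    proof -
      have "a * ?x powr (- e) * ?x powr f \<le> b * ?x powr f" using that(1) pos by (intro mult_right_mono) (auto intro: less_imp_le)
      then show ?thesis unfolding that(2) by (simp add: mult.assoc pw)
    qed
    have scale': "?x powr f \<le> b * ?x powr e'" if "1 \<le> b * ?x powr e" "e' = f + e" for b e e' f
    proof -
      have "1 * ?x powr f \<le> b * ?x powr e * ?x powr f" using that(1) pos by (intro mult_right_mono) (auto intro: less_imp_le)
      then show ?thesis unfolding that(2) by (simp add: mult.assoc pw add.commute)
    qed
    have "parameters_ok t B C A n \<eta> p p' L y"
      if p: "p = ?x powr (-1 + \<kappa>)" and p': "p / 4 \<le> p'" and \<eta>: "c1 * ?x powr (-(1/2) * (\<kappa> - \<rho>)) \<le> \<eta>"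
        and L: "L = ?x powr (\<rho> / 4)" and y: "y = ?x powr (-(1/4) * (\<kappa> - \<rho>))"
      for \<eta> p p' L y :: real
    proof -
      define D where "D = ?x powr \<kappa> / 4"
      define \<epsilon> where "\<epsilon> = c * ?x powr (- \<delta>)"
      define kk where "kk = nat \<lceil>?x powr (\<kappa> / 4)\<rceil>"
      have D1: "1 \<le> D" using elim(2) by (simp add: D_def)
      have Dn: "D = n * p / 4" by (simp add: D_def p pn)
      have e0: "0 < \<epsilon>" using c0(1) pos by (simp add: \<epsilon>_def)
      have sD: "sqrt D = ?x powr (\<kappa> / 2) / 2"
        by (simp add: D_def real_sqrt_divide powr_half_sqrt[symmetric] powr_powr)
      have esD: "\<epsilon> * sqrt D = c * L / 2"
        by (simp add: \<epsilon>_def sD L mult.assoc pw \<delta>_def)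
      have L0: "0 < L" by (simp add: L pos)
      have sqrt_le: "sqrt z \<le> z" if "1 \<le> z" for z :: real
      proof -
        have "z * 1 \<le> z * z" using that by (intro mult_left_mono) auto
        then have "sqrt z \<le> sqrt (z * z)" by (simp only: real_sqrt_le_iff mult_1_right)
        also have "sqrt (z * z) = z" using that by simp
        finally show ?thesis .
      qed
      \<comment> \<open>The root of \<open>(2 * D) ^ s\<close> is at most the power itself, and
        \<open>(2 * D) ^ s = 8 ^ s * (D / 4) ^ s\<close>. What remains is
        \<open>esD\<close>.\<close>
      have zeta: "L * B * sqrt (D * (2 * D) ^ s) \<le> \<epsilon> * ((D / 4) ^ s * D / 2)" if s: "s \<le> t" for s
      proof -
        have "1 \<le> (2 * D) ^ s" using D1 by (intro one_le_power) simp
        then have "sqrt ((2 * D) ^ s) \<le> (2 * D) ^ s" by (rule sqrt_le)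
        moreover have "(2 * D) ^ s = 8 ^ s * (D / 4) ^ s" by (simp only: power_mult_distrib[symmetric]) simp
        moreover have "(8 :: real) ^ s * (D / 4) ^ s \<le> 8 ^ t * (D / 4) ^ s" using s D1 by (intro mult_right_mono power_increasing) auto
        ultimately have "sqrt ((2 * D) ^ s) \<le> 8 ^ t * (D / 4) ^ s" by linarith
        then have "L * B * (sqrt D * sqrt ((2 * D) ^ s)) \<le> L * B * (sqrt D * (8 ^ t * (D / 4) ^ s))"
          using L0 B D1 by (intro mult_left_mono) auto
        also have "\<dots> = (4 * B * 8 ^ t) * (L * (sqrt D * (D / 4) ^ s) / 4)" by (simp add: algebra_simps)
        also have "\<dots> \<le> c * (L * (sqrt D * (D / 4) ^ s) / 4)" using c0(2) L0 D1 by (intro mult_right_mono) auto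
        also have "\<dots> = (c * L / 2) * (sqrt D * (D / 4) ^ s / 2)" by simp
        also have "\<dots> = \<epsilon> * ((D / 4) ^ s * (sqrt D * sqrt D) / 2)" unfolding esD[symmetric] by (simp add: algebra_simps)
        also have "sqrt D * sqrt D = D" using D1 by simp
        finally show ?thesis by (simp add: real_sqrt_mult)
      qed
      have D2: "(2 * D) ^ s \<le> ?x powr (\<kappa> * t)" if "s \<le> t" for s
      proof -
        have "(2 * D) ^ s \<le> (2 * D) ^ t" using that D1 by (intro power_increasing) auto
        also have "\<dots> \<le> (?x powr \<kappa>) ^ t" using pos by (intro power_mono) (auto simp: D_def intro: less_imp_le)
        also have "\<dots> = ?x powr (\<kappa> * t)" using x0 by (simp add: powr_realpow[symmetric] powr_powr)
        finally show ?thesis .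
      qed
      have hi_p: "(2 * D) ^ s * (p / 4) \<le> 1" if s: "s \<le> t" for s
      proof -
        have "(2 * D) ^ s * p \<le> ?x powr (\<kappa> * t) * ?x powr (-1 + \<kappa>)"
          unfolding p using D2[OF s] pos by (intro mult_right_mono) (auto intro: less_imp_le)
        also have "\<dots> = ?x powr (\<kappa> * (t + 1) - 1)" by (simp add: pw algebra_simps)
        also have "\<dots> \<le> ?x powr 0" using t(2) by (intro mono) simp
        finally show ?thesis using x0 by simp
      qed
      \<comment> \<open>The condition \<open>\<kappa> * (t + 1) \<le> 1\<close> bounds the ball by a
        multiple of n^(1 - kappa), which is below n^(1 - delta) as delta < kappa.\<close>
      have ball: "(\<Sum>j\<le>t. (2 * D) ^ j) \<le> \<epsilon> * n"
      proof -
        have "(\<Sum>j\<le>t. (2 * D) ^ j) \<le> (\<Sum>j\<le>t. ?x powr (\<kappa> * t))" by (intro sum_mono D2) simp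
        also have "\<dots> = (real t + 1) * ?x powr (\<kappa> * t)" by simp
        also have "\<dots> \<le> (real t + 1) * ?x powr (1 - \<kappa>)" using t(2) by (intro mult_left_mono mono) (auto simp: algebra_simps)
        also have "\<dots> \<le> c * ?x powr (1 - \<delta>)" by (rule scale[OF elim(4)]) simp
        also have "\<dots> = \<epsilon> * n" using pn[of "- \<delta>"] by (simp add: \<epsilon>_def mult_ac)
        finally show ?thesis .
      qed
      \<comment> \<open>As \<open>t \<ge> 1\<close>, the denominator holds at least two powers of
        \<open>D\<close>, so the quotient is at most of order n^(-kappa).\<close>
      have deg: "(2 * D + 1) / (D / 4) ^ (t + 1) \<le> \<epsilon>"
      proof -
        have "D ^ 2 \<le> D ^ (t + 1)" using D1 t(1) by (intro power_increasing) auto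
        then have "(2 * D + 1) / (D / 4) ^ (t + 1) \<le> 3 * D / (D ^ 2 / 4 ^ (t + 1))"
          using D1 by (intro frac_le) (auto simp: power_divide divide_right_mono)
        also have "\<dots> = 12 * 4 ^ (t + 1) / ?x powr \<kappa>" using D1 pos[of \<kappa>] by (simp add: D_def power2_eq_square)
        also have "\<dots> = 12 * 4 ^ (t + 1) * ?x powr (- \<kappa>)" by (simp add: powr_minus_divide)
        also have "\<dots> \<le> \<epsilon>" unfolding \<epsilon>_def by (rule scale[OF elim(5)]) simp
        finally show ?thesis .
      qed
      have eta0: "0 < \<eta>" using \<eta> c1 pos by (meson less_le_trans mult_pos_pos)
      have eta1: "\<epsilon> * C \<le> \<eta> / 2"
      proof -
        have "c * C * ?x powr (- \<delta>) \<le> c1 / 2 * ?x powr (-(1/2) * (\<kappa> - \<rho>))"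
          by (rule scale[OF elim(6)]) (use \<kappa> c1 in \<open>simp_all add: \<delta>_def field_simps\<close>)
        then show ?thesis using \<eta> by (simp add: \<epsilon>_def mult_ac)
      qed
      have kg: "?x powr (\<kappa> / 4) \<le> kk" unfolding kk_def by linarith
      have k1: "1 \<le> ?x powr (\<kappa> / 4)" using mono[of 0 "\<kappa> / 4"] k0 x0 by simp
      have kl: "real kk \<le> 2 * ?x powr (\<kappa> / 4)" unfolding kk_def using k1 by linarith
      have kp: "0 < real kk" using kg k1 by linarith
      have kp': "0 < kk" using kp by (simp only: of_nat_0_less_iff)
      have kn: "kk \<le> n"
      proof -
        have "2 * ?x powr (\<kappa> / 4) \<le> 1 * ?x powr 1" by (rule scale[OF elim(8)]) (use \<kappa> in auto)
        then have "real kk \<le> real n" using kl x0 by simp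
        then show ?thesis by simp
      qed
      have kg2: "?x powr (\<kappa> / 2) \<le> (real kk)\<^sup>2"
        using power_mono[OF kg, of 2] pos[of "\<kappa> / 4"] by (simp add: power2_eq_square pw)
      have kl2: "(real kk)\<^sup>2 \<le> 4 * ?x powr (\<kappa> / 2)"
        using power_mono[OF kl, of 2] by (simp add: power2_eq_square pw)
      have grid: "A / (real kk)\<^sup>2 \<le> \<eta> / 4"
      proof -
        have "A / (real kk)\<^sup>2 \<le> A / ?x powr (\<kappa> / 2)" using kg2 A pos kp by (intro divide_left_mono mult_pos_pos) auto
        also have "\<dots> = A * ?x powr (- (\<kappa> / 2))" by (simp add: powr_minus_divide)
        also have "\<dots> \<le> c1 / 4 * ?x powr (-(1/2) * (\<kappa> - \<rho>))"
          by (rule scale[OF elim(7)]) (use \<kappa> c1 in \<open>simp_all add: field_simps\<close>)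
        finally show ?thesis using \<eta> by simp
      qed
      let ?R = "p' * ((D / 4) ^ t * (D / 4) ^ (t + 1))"
      \<comment> \<open>Here \<open>1 \<le> \<kappa> * (2 * t + 1)\<close> enters: the exponent of
        \<open>p * D ^ (2 * t + 1)\<close> is
        \<open>- 1 + \<kappa> + \<kappa> * (2 * t + 1)\<close>, hence at least
        \<open>\<kappa>\<close>. So \<open>sqrt ?R\<close> is at least of the order of
        \<open>sqrt D\<close>, and the bilinear form is no noisier than a level.\<close>
      have R: "1 / (4 * 16 ^ (2 * t + 1)) * ?x powr \<kappa> \<le> ?R"
      proof -
        have "?x powr \<kappa> \<le> ?x powr (-1 + \<kappa> + \<kappa> * (2 * t + 1))" using t(3) by (intro mono) simp
        also have "\<dots> = ?x powr (-1 + \<kappa>) * (?x powr \<kappa>) ^ (2 * t + 1)"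
        proof -
          have "(?x powr \<kappa>) ^ (2 * t + 1) = ?x powr (\<kappa> * real (2 * t + 1))" using pos[of \<kappa>] by (simp only: powr_realpow[symmetric] powr_powr)
          then show ?thesis by (simp only: pw)
        qed
        finally have "?x powr \<kappa> * (1 / (4 * 16 ^ (2 * t + 1))) \<le> ?x powr (-1 + \<kappa>) * (?x powr \<kappa>) ^ (2 * t + 1) * (1 / (4 * 16 ^ (2 * t + 1)))"
          by (rule mult_right_mono) simp
        also have "\<dots> = p / 4 * (D / 4) ^ (2 * t + 1)" by (simp add: p D_def power_divide)
        also have "\<dots> \<le> p' * (D / 4) ^ (2 * t + 1)" using p' D1 by (intro mult_right_mono) auto
        also have "(D / 4) ^ (2 * t + 1) = (D / 4) ^ t * (D / 4) ^ (t + 1)" by (simp add: power_add mult_2)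
        finally show ?thesis by (simp only: mult.commute)
      qed
      have R1: "1 \<le> ?R" using R elim(9) by linarith
      have sq4: "((4 :: real) ^ m)\<^sup>2 = 16 ^ m" for m :: nat
      proof -
        have "(4 :: real) ^ m * 4 ^ m = (4 * 4) ^ m" by (rule power_mult_distrib[symmetric])
        then show ?thesis by (simp only: power2_eq_square) simp
      qed
      have LR: "L \<le> \<epsilon> * sqrt ?R"
      proof -
        have "1 / (2 * 4 ^ (2 * t + 1)) * ?x powr (\<kappa> / 2) \<le> sqrt ?R"
        proof (rule real_le_rsqrt)
          have "(1 / (2 * 4 ^ (2 * t + 1)) * ?x powr (\<kappa> / 2))\<^sup>2 = 1 / (4 * (4 ^ (2 * t + 1))\<^sup>2) * (?x powr (\<kappa> / 2))\<^sup>2"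
            by (simp add: power_mult_distrib power_divide)
          also have "((4 :: real) ^ (2 * t + 1))\<^sup>2 = 16 ^ (2 * t + 1)" by (rule sq4)
          also have "(?x powr (\<kappa> / 2))\<^sup>2 = ?x powr \<kappa>" by (simp add: power2_eq_square pw)
          finally show "(1 / (2 * 4 ^ (2 * t + 1)) * ?x powr (\<kappa> / 2))\<^sup>2 \<le> ?R" using R by simp
        qed
        then have "\<epsilon> * (1 / (2 * 4 ^ (2 * t + 1)) * ?x powr (\<kappa> / 2)) \<le> \<epsilon> * sqrt ?R" using e0 by (intro mult_left_mono) auto
        moreover have "\<epsilon> * (1 / (2 * 4 ^ (2 * t + 1)) * ?x powr (\<kappa> / 2)) = c / (2 * 4 ^ (2 * t + 1)) * L"
          using pw[of "- \<delta>" "\<kappa> / 2"] by (simp add: \<epsilon>_def L \<delta>_def)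
        moreover have "1 * L \<le> c / (2 * 4 ^ (2 * t + 1)) * L" using c0(3) L0 by (intro mult_right_mono) (auto simp: le_divide_eq)
        ultimately show ?thesis by linarith
      qed
      have orth: "L \<le> \<epsilon>\<^sup>2 * n / (2 * B ^ 4)"
      proof -
        have "L \<le> c\<^sup>2 / (2 * B ^ 4) * ?x powr (1 - 2 * \<delta>)"
          unfolding L by (rule scale'[OF elim(10)]) (use \<kappa> c0 B in \<open>simp_all add: \<delta>_def field_simps\<close>)
        moreover have "\<epsilon>\<^sup>2 * n = c\<^sup>2 * ?x powr (1 - 2 * \<delta>)"
        proof -
          have "\<epsilon>\<^sup>2 * n = c\<^sup>2 * (?x * (?x powr (- \<delta>) * ?x powr (- \<delta>)))" by (simp add: \<epsilon>_def power2_eq_square)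
          then show ?thesis by (simp only: pw pn) simp
        qed
        ultimately show ?thesis by simp
      qed
      have gridL: "L \<le> n / (8 * (real kk)\<^sup>2)"
      proof -
        have "L \<le> 1 / 32 * ?x powr (1 - \<kappa> / 2)" unfolding L by (rule scale'[OF elim(11)]) (use \<kappa> in auto)
        also have "\<dots> = ?x / (8 * (4 * ?x powr (\<kappa> / 2)))" using x0 by (simp add: powr_diff)
        also have "\<dots> \<le> ?x / (8 * (real kk)\<^sup>2)" using kl2 kp x0 by (intro divide_left_mono mult_pos_pos) auto
        finally show ?thesis .
      qed
      \<comment> \<open>About n^(1 + kappa/2) close pairs are observed. Multiplied by
        \<open>y\<^sup>2\<close> this is n^(1 + rho/2), far above \<open>L\<close>.\<close>
      have near: "L \<le> y\<^sup>2 * (p * (real n / real (2 * kk))\<^sup>2 / 8) / 4"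
      proof -
        have "L \<le> 1 / 512 * ?x powr (1 + \<rho> / 2)" unfolding L by (rule scale'[OF elim(12)]) (use \<kappa> in auto)
        also have "?x powr (1 + \<rho> / 2) = y\<^sup>2 * (p * (?x\<^sup>2 / ?x powr (\<kappa> / 2)))"
        proof -
          have y2: "y\<^sup>2 = ?x powr (-(1/2) * (\<kappa> - \<rho>))" by (simp add: y power2_eq_square pw)
          have x2: "?x\<^sup>2 / ?x powr (\<kappa> / 2) = ?x powr (2 - \<kappa> / 2)" using x0 by (simp add: powr_diff)
          show ?thesis unfolding y2 x2 p pw by (rule arg_cong[where f = "\<lambda>a. ?x powr a"]) (simp add: field_simps)
        qed
        also have "1 / 512 * (y\<^sup>2 * (p * (?x\<^sup>2 / ?x powr (\<kappa> / 2)))) = y\<^sup>2 * (p * (?x\<^sup>2 / (4 * (4 * ?x powr (\<kappa> / 2)))) / 8) / 4" by simp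
        also have "\<dots> \<le> y\<^sup>2 * (p * (?x\<^sup>2 / (4 * (real kk)\<^sup>2)) / 8) / 4"
          using kl2 kp x0 by (intro divide_right_mono mult_left_mono divide_left_mono mult_pos_pos) (auto simp: p)
        also have "?x\<^sup>2 / (4 * (real kk)\<^sup>2) = (real n / real (2 * kk))\<^sup>2" by (simp add: power_divide power_mult_distrib)
        finally show ?thesis .
      qed
      have y1: "0 < y" "y \<le> 2"
      proof -
        show "0 < y" by (simp add: y pos)
        have "y \<le> ?x powr 0" unfolding y using \<kappa> by (intro mono) simp
        then show "y \<le> 2" using x0 by simp
      qed
      have e4: "\<epsilon> \<le> 1/4" using elim(3) by (simp add: \<epsilon>_def)
      show ?thesis unfolding parameters_ok_def
        by (rule exI[of _ D], rule exI[of _ \<epsilon>], rule exI[of _ kk])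
          (intro conjI allI impI Dn D1 less_imp_le[OF e0] e4 zeta hi_p ball deg eta0 eta1 kp' kn grid R1 LR orth gridL less_imp_le[OF L0] y1 near; assumption)
    qed
    then show ?case by blast
  qed
qed

section \<open>Assembling the bounds for large \<open>n\<close>\<close>

theorem theorem4p1:
  fixes f :: "real \<Rightarrow> real \<Rightarrow> real" and r :: nat
    and lam :: "nat \<Rightarrow> real" and q :: "nat \<Rightarrow> real \<Rightarrow> real"
    and \<kappa> \<rho> C\<^sub>f :: real
    and p \<eta> :: "nat \<Rightarrow> real" and t :: "nat \<Rightarrow> nat"
    and P :: "nat \<Rightarrow> 'w measure"
    and \<theta> :: "nat \<Rightarrow> nat \<Rightarrow> 'w \<Rightarrow> real"
    and Z :: "nat \<Rightarrow> nat \<times> nat \<Rightarrow> 'w \<Rightarrow> real"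
    and mrk :: "nat \<Rightarrow> nat \<times> nat \<Rightarrow> 'w \<Rightarrow> mark"
    and T :: "nat \<Rightarrow> nat \<Rightarrow> 'w \<Rightarrow> (nat \<times> nat) set"
    and arb :: "nat \<Rightarrow> nat \<Rightarrow> nat \<Rightarrow> 'w \<Rightarrow> real"
    and F dhat Fhat :: "nat \<Rightarrow> nat \<Rightarrow> nat \<Rightarrow> 'w \<Rightarrow> real"
  assumes f_range: "\<And>x y. x \<in> {0..1} \<Longrightarrow> y \<in> {0..1} \<Longrightarrow> f x y \<in> {0..1}"
    and f_sym: "\<And>x y. x \<in> {0..1} \<Longrightarrow> y \<in> {0..1} \<Longrightarrow> f x y = f y x"
    and f_lipschitz: "\<exists>L. L-lipschitz_on ({0..1} \<times> {0..1}) (\<lambda>(x, y). f x y)"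
    and f_rank: "rank_decomposition f r lam q"
    and C\<^sub>f: "C\<^sub>f = \<bar>lam 1\<bar> / \<bar>lam r\<bar>"
    and kappa: "0 < \<kappa>" "\<kappa> < 1/2" "1/\<kappa> \<notin> \<int>"
    and rho: "0 < \<rho>" "\<rho> < \<kappa>"
    and p: "\<And>n. p n = real n powr (-1 + \<kappa>)"
    and t: "\<And>n. t n = nat \<lfloor>ln (1 / p n) / ln (real n * p n)\<rfloor>"
    and eta: "\<eta> \<in> \<Theta>(\<lambda>n. real n powr (-(1/2) * (\<kappa> - \<rho>)))"
    and eta_pos: "eventually (\<lambda>n. \<eta> n > 0) sequentially"
    and model: "\<And>n. n \<ge> 1 \<Longrightarrow> latent_model (P n) n f (p n) (\<theta> n) (Z n) (mrk n) (T n)"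
    and arb_measurable: "\<And>n u v. u \<in> {1..n} \<Longrightarrow> v \<in> {1..n} \<Longrightarrow> arb n u v \<in> borel_measurable (P n)"
    and arb_range: "\<And>n u v w. u \<in> {1..n} \<Longrightarrow> v \<in> {1..n} \<Longrightarrow> w \<in> space (P n) \<Longrightarrow> arb n u v w \<in> {0..1}"
    and F: "\<And>n u v w. F n u v w = f (\<theta> n u w) (\<theta> n v w)"
    and dhat: "\<And>n u v w. dhat n u v w =
      dist_estimate n (p n) (t n) (\<lambda>e. mrk n e w) (\<lambda>e. Z n e w) (\<lambda>u. T n u w) u v"
    and Fhat: "\<And>n u v w. Fhat n u v w =
      nn_estimate n (\<lambda>e. mrk n e w) (\<lambda>e. Z n e w) (\<lambda>u v. dhat n u v w) (\<eta> n)
        (\<lambda>u v. arb n u v w) u v"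
  shows "(\<exists>C. (\<lambda>n. measure (P n) {w \<in> space (P n).
            (MAX (u, v)\<in>{1..n} \<times> {1..n}. \<bar>Fhat n u v w - F n u v w\<bar>)
              \<le> C * (real r * C\<^sub>f powr (1/\<kappa>) * real n powr (-(1/4) * (\<kappa> - \<rho>)))}) \<longlonglongrightarrow> 1)
       \<and> (\<lambda>n. mean_squared_error (P n) n (Fhat n) (F n))
            \<in> O(\<lambda>n. (real r)\<^sup>2 * C\<^sub>f powr (2/\<kappa>) * real n powr (-(1/2) * (\<kappa> - \<rho>)))"
proof -
  \<comment> \<open>For \<open>n \<ge> 2\<close> the quotient of logarithms equals
    \<open>(1 - \<kappa>) / \<kappa>\<close>, so the depth of the neighbourhoods is the same for all
    these \<open>n\<close>.\<close>
  define t0 where "t0 = nat \<lfloor>(1 - \<kappa>) / \<kappa>\<rfloor>"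
  have k1: "1 < (1 - \<kappa>) / \<kappa>" using kappa by (simp add: less_divide_eq)
  have t0r: "real t0 \<le> (1 - \<kappa>) / \<kappa>" "(1 - \<kappa>) / \<kappa> < real t0 + 1" unfolding t0_def using k1 by linarith+
  have t1: "1 \<le> t0" using t0r(2) k1 by linarith
  have "real t0 * \<kappa> \<le> 1 - \<kappa>" using t0r(1) kappa(1) by (simp add: pos_le_divide_eq)
  then have tk1: "\<kappa> * (t0 + 1) \<le> 1" by (simp add: algebra_simps)
  have "1 - \<kappa> < (real t0 + 1) * \<kappa>" using t0r(2) kappa(1) by (simp add: pos_divide_less_eq)
  moreover have "1 * \<kappa> \<le> real t0 * \<kappa>" using t1 kappa(1) by (intro mult_right_mono) auto
  \<comment> \<open>Adding the two inequalities gives \<open>1 < (t0 + 2) * \<kappa>\<close> up to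
    rearrangement, and \<open>t0 + 2 \<le> 2 * t0 + 1\<close> since \<open>t0 \<ge> 1\<close>, which
    is where \<open>\<kappa> < 1/2\<close> is used.\<close>
  ultimately have tk2: "1 \<le> \<kappa> * (2 * t0 + 1)" by (simp add: algebra_simps)
  have t_eq: "t n = t0" if n: "2 \<le> n" for n
  proof -
    have n0: "0 < real n" and l: "0 < ln (real n)" using n by simp_all
    have "1 / p n = real n powr (1 - \<kappa>)" unfolding p using powr_minus_divide[of "real n" "-1 + \<kappa>"] by simp
    then have a: "ln (1 / p n) = (1 - \<kappa>) * ln (real n)" using n0 by (simp add: ln_powr)
    have "real n * p n = real n powr \<kappa>" unfolding p using n0 powr_add[of "real n" 1 "-1 + \<kappa>"] by simp
    then have b: "ln (real n * p n) = \<kappa> * ln (real n)" using n0 by (simp add: ln_powr)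
    have "ln (1 / p n) / ln (real n * p n) = (1 - \<kappa>) / \<kappa>" unfolding a b using l by simp
    then show ?thesis by (simp only: t t0_def)
  qed
  from f_lipschitz obtain L where lip: "L-lipschitz_on ({0..1} \<times> {0..1}) (\<lambda>(x, y). f x y)" by blast
  from rank_decomposition_lipschitz[OF f_rank lip] obtain B K where B: "1 \<le> B" and K: "0 \<le> K"
    and qB: "\<And>k x. k \<in> {1..r} \<Longrightarrow> x \<in> {0..1} \<Longrightarrow> \<bar>q k x\<bar> \<le> B"
    and qK: "\<And>k x x'. k \<in> {1..r} \<Longrightarrow> x \<in> {0..1} \<Longrightarrow> x' \<in> {0..1} \<Longrightarrow> \<bar>q k x - q k x'\<bar> \<le> K * \<bar>x - x'\<bar>" by blast
  \<comment> \<open>The maximum with 1 makes the powers of \<open>\<Lambda>\<close> increase with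
    the level.\<close>
  define \<Lambda> where "\<Lambda> = max 1 \<bar>lam 1\<bar>"
  define l where "l = \<bar>lam r\<bar>"
  have r1: "1 \<le> r" and l0: "0 < l"
    and dec: "\<And>j k. j \<in> {1..r} \<Longrightarrow> k \<in> {1..r} \<Longrightarrow> j \<le> k \<Longrightarrow> \<bar>lam k\<bar> \<le> \<bar>lam j\<bar>"
    and fq: "\<And>x y. x \<in> {0..1} \<Longrightarrow> y \<in> {0..1} \<Longrightarrow> f x y = (\<Sum>k=1..r. lam k * q k x * q k y)"
    and qo: "\<And>j k. j \<in> {1..r} \<Longrightarrow> k \<in> {1..r} \<Longrightarrow>
        integral\<^sup>L (lebesgue_on {0..1}) (\<lambda>x. q j x * q k x) = (if j = k then 1 else 0)"
    using f_rank unfolding rank_decomposition_def l_def by blast+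
  define f' where "f' = (\<lambda>z. f (clamp01 (fst z)) (clamp01 (snd z)))"
  have f'M: "f' \<in> borel_measurable borel"
  proof (rule borel_measurable_continuous_onI)
    have "continuous_on UNIV (\<lambda>z. (clamp01 (fst z), clamp01 (snd z)))"
      unfolding clamp01_def by (intro continuous_intros)
    from continuous_on_compose2[OF lipschitz_on_continuous_on[OF lip] this]
    show "continuous_on UNIV f'" unfolding f'_def using clamp01_range by (simp add: image_subset_iff)
  qed
  have RM: "rank_model (P n) n f (p n) (\<theta> n) (Z n) (mrk n) (T n) f' r lam q B K \<Lambda> l" if n: "1 \<le> n" for n
  proof (intro rank_model.intro sample_model.intro sample_model_axioms.intro rank_model_axioms.intro)
    show "latent_model (P n) n f (p n) (\<theta> n) (Z n) (mrk n) (T n)" by (rule model[OF n])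
    show "0 < p n" unfolding p using n by simp
    have "real n powr (-1 + \<kappa>) \<le> real n powr 0" using n kappa by (intro powr_mono) auto
    then show "p n \<le> 1" unfolding p using n by simp
    show "f' (x, y) = f x y" if "x \<in> {0..1}" "y \<in> {0..1}" for x y
      using that by (simp add: f'_def clamp01_id)
    show "\<bar>lam k\<bar> \<le> \<Lambda>" if "k \<in> {1..r}" for k
    proof -
      have "\<bar>lam k\<bar> \<le> \<bar>lam 1\<bar>" using that r1 by (intro dec) auto
      then show ?thesis by (simp add: \<Lambda>_def)
    qed
    show "l \<le> \<bar>lam k\<bar>" if "k \<in> {1..r}" for k
      unfolding l_def using that r1 by (intro dec) auto
    show "1 \<le> \<Lambda>" by (simp add: \<Lambda>_def)
  qed (fact n f_range f'M fq qB qK B K qo l0)+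
  \<comment> \<open>The constants \<open>C5\<close> and \<open>C6\<close> depend only on the bounds
    for \<open>f\<close> and on the depth, so the instance \<open>n = 1\<close> names their values
    for all \<open>n\<close>.\<close>
  interpret M1: rank_model "P 1" 1 f "p 1" "\<theta> 1" "Z 1" "mrk 1" "T 1" f' r lam q B K \<Lambda> l by (rule RM) simp
  let ?X = "\<lambda>n. real n powr (-(1/4) * (\<kappa> - \<rho>))" and ?Y = "\<lambda>n. real n powr (-(1/2) * (\<kappa> - \<rho>))"
  let ?A = "real r * \<Lambda> ^ (2 * t0 + 2) * K\<^sup>2"
  let ?Cp = "6 * real (t0 + 1) * real (r + 1) + 2 * (real r)\<^sup>2 + 11"
  obtain c2 where c2: "0 < c2" "eventually (\<lambda>n. norm (\<eta> n) \<le> c2 * norm (?Y n)) sequentially"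
    using landau_o.bigE[OF bigthetaD1[OF eta]] by blast
  obtain c1 where c1: "0 < c1" "eventually (\<lambda>n. norm (\<eta> n) \<ge> c1 * norm (?Y n)) sequentially"
    using landau_omega.bigE[OF bigthetaD2[OF eta]] by blast
  \<comment> \<open>The 1 pays for the noise threshold \<open>x0 = ?X n\<close>, the rest for the
    bias \<open>C6 * sqrt \<eta>\<close>. Both are of the same order because \<open>?X n\<close> is
    the root of \<open>?Y n\<close>.\<close>
  define C0 where "C0 = 1 + \<bar>M1.C6 t0\<bar> * sqrt c2"
  have Ysq: "?Y n = (?X n)\<^sup>2" for n by (simp add: power2_eq_square powr_add[symmetric])
  define e where "e = (1/2) * (\<kappa> - \<rho>)"
  have e0: "0 < e" using rho by (simp add: e_def)
  have A0: "0 \<le> ?A" by (simp add: \<Lambda>_def)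
  \<comment> \<open>The exceptional probability only has to fall below the rate of the mean squared
    error, to which it is added.\<close>
  have ev_tail: "eventually (\<lambda>n. ?Cp * (real n)\<^sup>2 * exp (- (real n powr (\<rho> / 4))) \<le> real n powr (- e)) sequentially"
    by (rule eventually_tail[OF _ e0]) (use rho(1) in simp)
  have main: "eventually (\<lambda>n. 1 \<le> n \<and>
      1 - ?Y n \<le> measure (P n) {w \<in> space (P n). (MAX (u, v)\<in>{1..n} \<times> {1..n}. \<bar>Fhat n u v w - F n u v w\<bar>) \<le> C0 * ?X n} \<and>
      mean_squared_error (P n) n (Fhat n) (F n) \<le> (C0\<^sup>2 + 1) * ?Y n \<and> 0 \<le> mean_squared_error (P n) n (Fhat n) (F n)) sequentially"
    using eventually_ge_at_top[of "2::nat"] c1(2) c2(2) eta_pos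
      eventually_parameters[where C = "M1.C5 t0" and A = ?A, OF rho kappa(2) t1 tk1 tk2 B c1(1) A0]
      ev_tail
  proof eventually_elim
    case (elim n)
    have n1: "1 \<le> n" using elim(1) by simp
    interpret M: rank_model "P n" n f "p n" "\<theta> n" "Z n" "mrk n" "T n" f' r lam q B K \<Lambda> l by (rule RM[OF n1])
    have Y0: "0 < ?Y n" and X0: "0 < ?X n" using n1 by simp_all
    have et: "c1 * ?Y n \<le> \<eta> n" "\<eta> n \<le> c2 * ?Y n" using elim(2-4) by simp_all
    have p4: "p n / 4 \<le> M.p'"
      unfolding M.p'_def subsample_prob_def using M.p_pos M.p_le_1 by (intro divide_left_mono) auto
    have "parameters_ok t0 B (M1.C5 t0) ?A n (\<eta> n) (p n) M.p' (real n powr (\<rho> / 4)) (?X n)"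
      by (rule elim(5)[rule_format, OF p p4 et(1) refl refl])
    then obtain D \<epsilon> :: real and kk :: nat where o1: "D = n * p n / 4"
      and o2: "1 \<le> D"
      and o3: "0 \<le> \<epsilon>"
      and o4: "\<epsilon> \<le> 1/4"
      and o5: "\<forall>s\<le>t0. real n powr (\<rho> / 4) * B * sqrt (D * (2 * D) ^ s) \<le> \<epsilon> * ((D / 4) ^ s * D / 2)"
      and o6: "\<forall>s\<le>t0. (2 * D) ^ s * (p n / 4) \<le> 1"
      and o7: "(\<Sum>j\<le>t0. (2 * D) ^ j) \<le> \<epsilon> * n"
      and o8: "(2 * D + 1) / (D / 4) ^ (t0 + 1) \<le> \<epsilon>"
      and o9: "0 < \<eta> n"
      and o10: "\<epsilon> * M1.C5 t0 \<le> \<eta> n / 2"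
      and o11: "0 < kk"
      and o12: "kk \<le> n"
      and o13: "?A / (real kk)\<^sup>2 \<le> \<eta> n / 4"
      and o14: "1 \<le> M.p' * ((D / 4) ^ t0 * (D / 4) ^ (t0 + 1))"
      and o15: "real n powr (\<rho> / 4) \<le> \<epsilon> * sqrt (M.p' * ((D / 4) ^ t0 * (D / 4) ^ (t0 + 1)))"
      and o16: "real n powr (\<rho> / 4) \<le> \<epsilon>\<^sup>2 * n / (2 * B ^ 4)"
      and o17: "real n powr (\<rho> / 4) \<le> n / (8 * (real kk)\<^sup>2)"
      and o18: "0 \<le> real n powr (\<rho> / 4)"
      and o19: "0 < ?X n"
      and o20: "?X n \<le> 2"
      and o21: "real n powr (\<rho> / 4) \<le> (?X n)\<^sup>2 * (p n * (real n / real (2 * kk))\<^sup>2 / 8) / 4"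
      unfolding parameters_ok_def by (elim exE conjE) (rule that; assumption)
    have "M.prob {w \<in> space (P n). \<not> (\<forall>u\<in>{1..n}. \<forall>v\<in>{1..n}. \<bar>M.nn t0 (\<eta> n) (\<lambda>u v. arb n u v w) u v w - M.mean (u, v) w\<bar> \<le> ?X n + M.C6 t0 * sqrt (\<eta> n))}
        \<le> ?Cp * (real n)\<^sup>2 * exp (- (real n powr (\<rho> / 4)))"
      by (rule M.error_tail[where D = D and \<epsilon> = \<epsilon> and kk = kk and t = t0 and L = "real n powr (\<rho> / 4)" and \<eta> = "\<eta> n" and ?x0.0 = "?X n" and arb = "arb n"])
        (rule o1 o2 o3 o4 o7 o8 o9 o10 o11 o12 o13 o14 o15 o16 o17 o18 o19 o20 o21 | (rule o5[rule_format] o6[rule_format], assumption))+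
    also have "\<dots> \<le> ?Y n"
    proof -
      have "?Y n = real n powr (- e)" by (simp add: e_def)
      then show ?thesis using elim(6) by (simp only:)
    qed
    finally have tail: "M.prob {w \<in> space (P n). \<not> (\<forall>u\<in>{1..n}. \<forall>v\<in>{1..n}. \<bar>M.nn t0 (\<eta> n) (\<lambda>u v. arb n u v w) u v w - M.mean (u, v) w\<bar> \<le> ?X n + M.C6 t0 * sqrt (\<eta> n))} \<le> ?Y n" .
    have b: "?X n + M.C6 t0 * sqrt (\<eta> n) \<le> C0 * ?X n"
    proof -
      have "sqrt (\<eta> n) \<le> sqrt (c2 * (?X n)\<^sup>2)" using et(2) unfolding Ysq by (simp only: real_sqrt_le_iff)
      also have "\<dots> = sqrt c2 * ?X n" using X0 by (simp add: real_sqrt_mult)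
      finally have "\<bar>M.C6 t0\<bar> * sqrt (\<eta> n) \<le> \<bar>M.C6 t0\<bar> * (sqrt c2 * ?X n)" by (intro mult_left_mono) auto
      moreover have "M.C6 t0 * sqrt (\<eta> n) \<le> \<bar>M.C6 t0\<bar> * sqrt (\<eta> n)" using less_imp_le[OF o9] by (intro mult_right_mono) auto
      ultimately show ?thesis by (simp add: C0_def algebra_simps)
    qed
    have Fh: "Fhat n u v w = M.nn t0 (\<eta> n) (\<lambda>u v. arb n u v w) u v w" if "u \<in> {1..n}" "v \<in> {1..n}" for u v w
      unfolding Fhat dhat t_eq[OF elim(1)] by (rule M.nn_estimate_mk_tr[OF that])
    have Fm: "F n u v w = M.mean (u, v) w" for u v w by (simp add: F M.mean_def)
    note cons = M.error_consequences[where Fh = "Fhat n" and Fm = "F n" and arb = "arb n" and b = "C0 * ?X n", OF _ _ _ _ tail b]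
    have "1 - ?Y n \<le> M.prob {w \<in> space (P n). (MAX (u, v)\<in>{1..n} \<times> {1..n}. \<bar>Fhat n u v w - F n u v w\<bar>) \<le> C0 * ?X n}"
      by (rule cons(1)) (rule arb_measurable arb_range Fh Fm; assumption)+
    moreover have "mean_squared_error (P n) n (Fhat n) (F n) \<le> (C0 * ?X n)\<^sup>2 + ?Y n"
      by (rule cons(2)) (rule arb_measurable arb_range Fh Fm; assumption)+
    moreover have "0 \<le> mean_squared_error (P n) n (Fhat n) (F n)"
      by (rule cons(3)) (rule arb_measurable arb_range Fh Fm; assumption)+
    moreover have "(C0 * ?X n)\<^sup>2 + ?Y n = (C0\<^sup>2 + 1) * ?Y n" unfolding Ysq by (simp add: power_mult_distrib algebra_simps)
    ultimately show ?case using n1 by (simp only: simp_thms)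
  qed
  have Cf: "0 < C\<^sub>f"
  proof -
    have "\<bar>lam r\<bar> \<le> \<bar>lam 1\<bar>" using r1 by (intro dec) auto
    then show ?thesis unfolding C\<^sub>f using l0 by (simp add: l_def)
  qed
  let ?k = "real r * C\<^sub>f powr (1/\<kappa>)" and ?k2 = "(real r)\<^sup>2 * C\<^sub>f powr (2/\<kappa>)"
  have k0: "0 < ?k" "0 < ?k2" using r1 Cf by simp_all
  have cancel: "a / k * (k * x) = a * x" if "0 < k" for a k x :: real using that by simp
  note scale = cancel[OF k0(1)]
  show ?thesis
  \<comment> \<open>Neither \<open>r\<close> nor \<open>C\<^sub>f\<close> varies with
    \<open>n\<close>, and both are positive, so the constant is divided by the factor that the
    stated bound contains.\<close>
  proof (intro conjI exI[of _ "C0 / ?k"])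
    have lim: "(\<lambda>n. 1 - ?Y n) \<longlonglongrightarrow> 1"
    proof -
      have "(\<lambda>n. 1 - real n powr (- e)) \<longlonglongrightarrow> 1" using e0 by real_asymp
      then show ?thesis by (simp add: e_def)
    qed
    show "(\<lambda>n. measure (P n) {w \<in> space (P n). (MAX (u, v)\<in>{1..n} \<times> {1..n}. \<bar>Fhat n u v w - F n u v w\<bar>)
        \<le> C0 / ?k * (?k * ?X n)}) \<longlonglongrightarrow> 1"
      unfolding scale
    proof (rule tendsto_sandwich[OF _ _ lim tendsto_const])
      show "eventually (\<lambda>n. 1 - ?Y n \<le> measure (P n) {w \<in> space (P n). (MAX (u, v)\<in>{1..n} \<times> {1..n}. \<bar>Fhat n u v w - F n u v w\<bar>) \<le> C0 * ?X n}) sequentially"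
        using main by (rule eventually_mono) blast
      show "eventually (\<lambda>n. measure (P n) {w \<in> space (P n). (MAX (u, v)\<in>{1..n} \<times> {1..n}. \<bar>Fhat n u v w - F n u v w\<bar>) \<le> C0 * ?X n} \<le> 1) sequentially"
        using eventually_ge_at_top[of 1]
      proof eventually_elim
        case (elim n)
        interpret M: rank_model "P n" n f "p n" "\<theta> n" "Z n" "mrk n" "T n" f' r lam q B K \<Lambda> l by (rule RM[OF elim])
        show ?case by (rule M.prob_le_1)
      qed
    qed
    show "(\<lambda>n. mean_squared_error (P n) n (Fhat n) (F n)) \<in> O(\<lambda>n. ?k2 * ?Y n)"
    proof (rule bigoI[where c = "(C0\<^sup>2 + 1) / ?k2"], rule eventually_mono[OF main])
      fix n
      assume m: "1 \<le> n \<and>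
        1 - ?Y n \<le> measure (P n) {w \<in> space (P n). (MAX (u, v)\<in>{1..n} \<times> {1..n}. \<bar>Fhat n u v w - F n u v w\<bar>) \<le> C0 * ?X n} \<and>
        mean_squared_error (P n) n (Fhat n) (F n) \<le> (C0\<^sup>2 + 1) * ?Y n \<and> 0 \<le> mean_squared_error (P n) n (Fhat n) (F n)"
      have "0 \<le> ?k2 * ?Y n" using k0(2) by (intro mult_nonneg_nonneg) auto
      then have "norm (?k2 * ?Y n) = ?k2 * ?Y n" by (simp only: real_norm_def abs_of_nonneg)
      moreover have "(C0\<^sup>2 + 1) / ?k2 * (?k2 * ?Y n) = (C0\<^sup>2 + 1) * ?Y n" by (rule cancel[OF k0(2)])
      ultimately show "norm (mean_squared_error (P n) n (Fhat n) (F n)) \<le> (C0\<^sup>2 + 1) / ?k2 * norm (?k2 * ?Y n)"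
        using m by (simp only: real_norm_def abs_of_nonneg)
    qed
  qed
qed

end
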